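(* Let $K$ be a multi-quadratic number field. The following are equivalent: (1) There exists an elliptic curve over $K$ whose Mordell-Weil group $E(K)$ contains a subgroup isomorphic to $\mathbb{Z}/2 \times \mathbb{Z}/10$. (2) There exist infinitely many such elliptic curves (up to $K$-isomorphism). (3) $\operatorname{rank} J_1(2,10)(K) \ge 1$.
   Context: A multi-quadratic number field is a number field (including $\mathbb{Q}$ itself) which is a compositum of quadratic number fields. For positive integers $M,N$, $X_1(M,MN)$ is the modular curve (coarse moduli space) attached to the level structure $\Gamma_1(M,MN) = \{\begin{pmatrix}1&b\\0&d\end{pmatrix} \in \mathrm{GL}_2(\mathbb{Z}/MN) : b \equiv 0,\ d\equiv 1 \bmod M\}$; it is defined over $\mathbb{Q}(\zeta_M)$ and its non-cuspidal points correspond to elliptic curves equipped with a level structure of type $\mathbb{Z}/M\times\mathbb{Z}/MN$. $J_1(M,MN)$ denotes its Jacobian. Here $X_1(2,10)$ is defined over $\mathbb{Q}$ and has genus one (Cremona label 20a2). $\operatorname{rank}$ is the rank of the group of $K$-rational points. Elliptic curves over $K$ are counted up to $K$-isomorphism. *)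

theory Defs
  imports
    "HOL-Algebra.Algebraic_Closure_Type"
    "HOL-Algebra.Free_Abelian_Groups"
    "HOL-Algebra.Elementary_Groups"
    "HOL-Algebra.Generated_Fields"
    "HOL-Analysis.Determinants"
    "HOL-Number_Theory.Cong"
    "HOL-Library.Extended_Nat"
    "HOL-Computational_Algebra.Fraction_Field"
    "HOL-Computational_Algebra.Normalized_Fraction"
begin

unbundle no fps_syntax

section \<open>Multi-quadratic number fields\<close>

definition quadratic_subfield :: "'k::field_char_0 set \<Rightarrow> bool" where
  "quadratic_subfield L \<longleftrightarrow>
     subfield L ring_of_type_algebra \<and>
     vector_space.dim (\<lambda>(q::rat) (x::'k). of_rat q * x) L = 2"

text \<open>The empty compositum is allowed and gives the field of rational numbers.\<close>

definition multi_quadratic_field :: "'k::field_char_0 itself \<Rightarrow> bool" where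
  "multi_quadratic_field _ \<longleftrightarrow>
     (\<exists>Ls :: 'k set set. finite Ls \<and> (\<forall>L\<in>Ls. quadratic_subfield L) \<and>
        generate_field ring_of_type_algebra (\<Union>Ls) = UNIV)"

section \<open>Elliptic curves\<close>

text \<open>\<open>Weierstrass a1 a2 a3 a4 a6\<close> stands for the projective curve
  \<open>y\<^sup>2 + a1 x y + a3 y = x\<^sup>3 + a2 x\<^sup>2 + a4 x + a6\<close>.\<close>

datatype 'a weierstrass =
  Weierstrass (wa1: 'a) (wa2: 'a) (wa3: 'a) (wa4: 'a) (wa6: 'a)

definition wb2 :: "'a::field weierstrass \<Rightarrow> 'a" where
  "wb2 E = wa1 E ^ 2 + 4 * wa2 E"

definition wb4 :: "'a::field weierstrass \<Rightarrow> 'a" where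
  "wb4 E = 2 * wa4 E + wa1 E * wa3 E"

definition wb6 :: "'a::field weierstrass \<Rightarrow> 'a" where
  "wb6 E = wa3 E ^ 2 + 4 * wa6 E"

definition wb8 :: "'a::field weierstrass \<Rightarrow> 'a" where
  "wb8 E = wa1 E ^ 2 * wa6 E + 4 * wa2 E * wa6 E - wa1 E * wa3 E * wa4 E
           + wa2 E * wa3 E ^ 2 - wa4 E ^ 2"

definition wdisc :: "'a::field weierstrass \<Rightarrow> 'a" where
  "wdisc E = - (wb2 E ^ 2 * wb8 E) - 8 * wb4 E ^ 3 - 27 * wb6 E ^ 2 + 9 * wb2 E * wb4 E * wb6 E"

definition elliptic :: "'a::field weierstrass \<Rightarrow> bool" where
  "elliptic E \<longleftrightarrow> wdisc E \<noteq> 0"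

definition j_invariant :: "'a::field weierstrass \<Rightarrow> 'a" where
  "j_invariant E = (wb2 E ^ 2 - 24 * wb4 E) ^ 3 / wdisc E"

text \<open>Isomorphism over the base field: an admissible change of variables
  \<open>x = u\<^sup>2 x' + r\<close>, \<open>y = u\<^sup>3 y' + s u\<^sup>2 x' + t\<close> turns \<open>E\<close> into \<open>E'\<close>.\<close>

definition weierstrass_iso :: "'a::field weierstrass \<Rightarrow> 'a weierstrass \<Rightarrow> bool" where
  "weierstrass_iso E E' \<longleftrightarrow> (\<exists>u r s t. u \<noteq> 0 \<and>
     u * wa1 E' = wa1 E + 2 * s \<and>
     u ^ 2 * wa2 E' = wa2 E - s * wa1 E + 3 * r - s ^ 2 \<and>
     u ^ 3 * wa3 E' = wa3 E + r * wa1 E + 2 * t \<and>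
     u ^ 4 * wa4 E' = wa4 E - s * wa3 E + 2 * r * wa2 E - (t + r * s) * wa1 E
                      + 3 * r ^ 2 - 2 * s * t \<and>
     u ^ 6 * wa6 E' = wa6 E + r * wa4 E + r ^ 2 * wa2 E + r ^ 3 - t * wa3 E - t ^ 2
                      - r * t * wa1 E)"

datatype 'a ec_point = Infinity | Affine 'a 'a

fun on_curve :: "'a::field weierstrass \<Rightarrow> 'a ec_point \<Rightarrow> bool" where
  "on_curve E Infinity \<longleftrightarrow> True"
| "on_curve E (Affine x y) \<longleftrightarrow>
     y ^ 2 + wa1 E * x * y + wa3 E * y = x ^ 3 + wa2 E * x ^ 2 + wa4 E * x + wa6 E"

text \<open>The chord-and-tangent law: \<open>l\<close> and \<open>y1 - l * x1\<close> are the slope and the intercept of the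
  line through the two points (the tangent line if they agree).\<close>

fun ec_add :: "'a::field weierstrass \<Rightarrow> 'a ec_point \<Rightarrow> 'a ec_point \<Rightarrow> 'a ec_point" where
  "ec_add E Infinity Q = Q"
| "ec_add E (Affine x1 y1) Infinity = Affine x1 y1"
| "ec_add E (Affine x1 y1) (Affine x2 y2) =
     (if x1 = x2 \<and> y1 + y2 + wa1 E * x2 + wa3 E = 0 then Infinity
      else
        let l = (if x1 = x2
                 then (3 * x1 ^ 2 + 2 * wa2 E * x1 + wa4 E - wa1 E * y1) /
                      (2 * y1 + wa1 E * x1 + wa3 E)
                 else (y2 - y1) / (x2 - x1));
            x3 = l ^ 2 + wa1 E * l - wa2 E - x1 - x2
        in Affine x3 (- (l + wa1 E) * x3 - (y1 - l * x1) - wa3 E))"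

definition mordell_weil :: "'a::field weierstrass \<Rightarrow> 'a ec_point monoid" where
  "mordell_weil E = \<lparr>carrier = {P. on_curve E P}, monoid.mult = ec_add E, one = Infinity\<rparr>"

definition contains_Z2_Z10 :: "'a::field weierstrass \<Rightarrow> bool" where
  "contains_Z2_Z10 E \<longleftrightarrow> (\<exists>H. subgroup H (mordell_weil E) \<and>
     (mordell_weil E)\<lparr>carrier := H\<rparr> \<cong> integer_mod_group 2 \<times>\<times> integer_mod_group 10)"

section \<open>Rank of an abelian group\<close>

definition independent_in :: "('a, 'b) monoid_scheme \<Rightarrow> 'a set \<Rightarrow> bool" where
  "independent_in G S \<longleftrightarrow> finite S \<and> S \<subseteq> carrier G \<and>
     (\<forall>c :: 'a \<Rightarrow> int. finprod G (\<lambda>x. x [^]\<^bsub>G\<^esub> c x) S = \<one>\<^bsub>G\<^esub> \<longrightarrow> (\<forall>x\<in>S. c x = 0))"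

definition abelian_rank :: "('a, 'b) monoid_scheme \<Rightarrow> enat" where
  "abelian_rank G = (SUP S\<in>{S. independent_in G S}. enat (card S))"

section \<open>Degree zero divisor classes of a function field\<close>

text \<open>A smooth projective curve over \<open>'k\<close> is given by its function field, which is a subfield
  \<open>F\<close> of the algebraic closure of the rational function field \<open>'k(t)\<close>. Its closed points are the
  valuation rings of \<open>F\<close> over \<open>'k\<close>.\<close>

type_synonym 'k funs = "'k poly fract alg_closure"

definition const_fun :: "'k::field \<Rightarrow> 'k funs" where
  "const_fun c = to_ac (to_fract [:c:])"

definition places :: "'k::field funs set \<Rightarrow> 'k funs set set" where
  "places F = {V. subring V ring_of_type_algebra \<and> range const_fun \<subseteq> V \<and> V \<subset> F \<and>
     (\<forall>f\<in>F. f \<in> V \<or> inverse f \<in> V)}"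

definition place_units :: "'k::field funs set \<Rightarrow> 'k funs set" where
  "place_units V = {f \<in> V. f \<noteq> 0 \<and> inverse f \<in> V}"

definition place_ideal :: "'k::field funs set \<Rightarrow> 'k funs set" where
  "place_ideal V = V - place_units V"

definition uniformizer :: "'k::field funs set \<Rightarrow> 'k funs \<Rightarrow> bool" where
  "uniformizer V p \<longleftrightarrow> place_ideal V = (\<lambda>f. p * f) ` V"

definition place_ord :: "'k::field funs set \<Rightarrow> 'k funs \<Rightarrow> int" where
  "place_ord V f = (THE n. \<exists>p u. uniformizer V p \<and> u \<in> place_units V \<and> f = u * p powi n)"

text \<open>The degree of a place is the dimension of its residue field over \<open>'k\<close>; \<open>B\<close> is a set of
  representatives of a basis.\<close>

definition place_degree :: "'k::field funs set \<Rightarrow> nat" where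
  "place_degree V = (THE d. \<exists>B. finite B \<and> B \<subseteq> V \<and> card B = d \<and>
     (\<forall>f\<in>V. \<exists>!c. c \<in> (B \<rightarrow>\<^sub>E UNIV) \<and> f - (\<Sum>b\<in>B. const_fun (c b) * b) \<in> place_ideal V))"

definition divisor_group :: "'k::field funs set \<Rightarrow> ('k funs set \<Rightarrow>\<^sub>0 int) monoid" where
  "divisor_group F = free_Abelian_group (places F)"

definition divisor_degree :: "('k::field funs set \<Rightarrow>\<^sub>0 int) \<Rightarrow> int" where
  "divisor_degree D =
     (\<Sum>V\<in>Poly_Mapping.keys D. Poly_Mapping.lookup D V * int (place_degree V))"

definition principal_divisors :: "'k::field funs set \<Rightarrow> ('k funs set \<Rightarrow>\<^sub>0 int) set" where
  "principal_divisors F = {D \<in> carrier (divisor_group F).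
     \<exists>f\<in>F. f \<noteq> 0 \<and> (\<forall>V\<in>places F. Poly_Mapping.lookup D V = place_ord V f)}"

text \<open>For a curve over \<open>'k\<close> with a \<open>'k\<close>-rational point (for instance a rational cusp of a
  modular curve), this is the group of \<open>'k\<close>-rational points of the Jacobian.\<close>

definition Pic0 :: "'k::field funs set \<Rightarrow> ('k funs set \<Rightarrow>\<^sub>0 int) set monoid" where
  "Pic0 F = ((divisor_group F)
       \<lparr>carrier := {D \<in> carrier (divisor_group F). divisor_degree D = 0}\<rparr>)
     Mod principal_divisors F"

section \<open>The modular curves \<open>X\<^sub>1(m,n)\<close>, where \<open>m\<close> divides \<open>n\<close>\<close>

text \<open>Integral matrices whose reduction modulo \<open>n\<close> lies in the level structure group in \<open>GL\<^sub>2(Z/n)\<close>.\<close>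

definition Gamma1 :: "nat \<Rightarrow> nat \<Rightarrow> (int^2^2) set" where
  "Gamma1 m n = {A. coprime (det A) (int n) \<and>
     [A $ 1 $ 1 = 1] (mod int n) \<and> [A $ 2 $ 1 = 0] (mod int n) \<and>
     [A $ 1 $ 2 = 0] (mod int m) \<and> [A $ 2 $ 2 = 1] (mod int m)}"

definition galois_group :: "('k::field funs \<Rightarrow> 'k funs) set" where
  "galois_group = {\<sigma> \<in> ring_iso ring_of_type_algebra ring_of_type_algebra.
     \<forall>z. \<sigma> (to_ac z) = to_ac z}"

definition torsion_basis :: "'a::field weierstrass \<Rightarrow> nat \<Rightarrow> 'a ec_point \<Rightarrow> 'a ec_point \<Rightarrow> bool" where
  "torsion_basis E n P Q \<longleftrightarrow>
     (let G = mordell_weil E in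
       bij_betw (\<lambda>(a, b). (P [^]\<^bsub>G\<^esub> a) \<otimes>\<^bsub>G\<^esub> (Q [^]\<^bsub>G\<^esub> b)) ({..<n} \<times> {..<n})
         {R \<in> carrier G. R [^]\<^bsub>G\<^esub> n = \<one>\<^bsub>G\<^esub>} \<and>
       {P, Q} \<subseteq> {R \<in> carrier G. R [^]\<^bsub>G\<^esub> n = \<one>\<^bsub>G\<^esub>})"

text \<open>\<open>\<sigma>\<close> acts on the torsion basis \<open>P\<close>, \<open>Q\<close> through the matrix \<open>A\<close>, whose columns are the
  coordinates of the images of \<open>P\<close> and \<open>Q\<close>.\<close>

definition acts_by ::
  "'a::field weierstrass \<Rightarrow> 'a ec_point \<Rightarrow> 'a ec_point \<Rightarrow> ('a \<Rightarrow> 'a) \<Rightarrow> int^2^2 \<Rightarrow> bool" where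
  "acts_by E P Q \<sigma> A \<longleftrightarrow>
     (let G = mordell_weil E in
       map_ec_point \<sigma> P = (P [^]\<^bsub>G\<^esub> (A $ 1 $ 1)) \<otimes>\<^bsub>G\<^esub> (Q [^]\<^bsub>G\<^esub> (A $ 2 $ 1)) \<and>
       map_ec_point \<sigma> Q = (P [^]\<^bsub>G\<^esub> (A $ 1 $ 2)) \<otimes>\<^bsub>G\<^esub> (Q [^]\<^bsub>G\<^esub> (A $ 2 $ 2)))"

text \<open>\<open>F\<close> is the function field over \<open>'k\<close> of the coarse moduli space for the level structure
  \<open>Gamma1 m n\<close>: for an elliptic curve \<open>E\<close> over \<open>'k(t)\<close> with \<open>j\<close>-invariant \<open>t\<close> and a basis
  \<open>P\<close>, \<open>Q\<close> of its \<open>n\<close>-torsion, \<open>F\<close> is the subfield of the algebraic closure of \<open>'k(t)\<close> fixed by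
  the Galois automorphisms that act on the \<open>n\<close>-torsion through \<open>Gamma1 m n\<close> up to sign.
  Since the sign is disregarded, \<open>F\<close> does not change when \<open>E\<close> is replaced by a twist;
  the points \<open>P\<close> and \<open>(n / m) Q\<close> form the level structure of type \<open>Z/n \<times> Z/m\<close>.
  If \<open>'k\<close> contains the \<open>m\<close>-th roots of unity, then the field of constants of \<open>F\<close> is \<open>'k\<close>.\<close>

definition is_X1_function_field :: "nat \<Rightarrow> nat \<Rightarrow> 'k::field_char_0 funs set \<Rightarrow> bool" where
  "is_X1_function_field m n F \<longleftrightarrow>
     (\<exists>(E :: 'k poly fract weierstrass) P Q.
        elliptic E \<and> j_invariant E = to_fract [:0, 1:] \<and>
        torsion_basis (map_weierstrass to_ac E) n P Q \<and>
        F = {z. \<forall>\<sigma>\<in>galois_group.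
               (\<exists>A\<in>Gamma1 m n. acts_by (map_weierstrass to_ac E) P Q \<sigma> A \<or>
                              acts_by (map_weierstrass to_ac E) P Q \<sigma> (- A))
               \<longrightarrow> \<sigma> z = z})"

end

(* Let P be a point of order 10 on an elliptic curve E and R a 2-torsion point different from 5P.
   Moving P to (0,0) gives the Tate normal form, in which E depends on one parameter s, and the
   condition on R becomes that u = 2s - 1 is the abscissa of a point (u,w) on w^2 = u^3 + u^2 - u
   at which the discriminant does not vanish. Over the algebraic closure of k(t) this identifies the
   function field of X_1(2,10) with k(u,w).

   The degree zero divisor class group of k(u,w) is computed by hand: every class is (P) - (O) for
   a unique rational point P. Hence its rank is positive iff there is a rational point of infinite
   order. A curve E over K containing Z/2 x Z/10 gives a point (u,w) that is not a cusp. To see that it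
   has infinite order, let P be a torsion point and apply P + sigma P and P - sigma P repeatedly for
   the involutions sigma that generate the Galois group of K: a multiple 2^k P is a sum of torsion
   points with rational abscissa, and these are found by a height estimate. Finally, if 2Q is a
   cusp, then so is Q, since otherwise -1 or 5 would be the norm of a square from a quadratic field. *)

theory Submission
  imports Defs
begin

unbundle no fps_syntax

text \<open>Divisor classes serve two ends. Besides the Jacobian they yield the group law: lines
  show that sending \<open>P\<close> to \<open>(P) - (O)\<close> is additive, the parity of pole
  orders at infinity shows that it is injective, and so associativity is inherited from divisors. A
  change of variables extends this to every elliptic curve in characteristic 0, also to the generic
  curve over the closure of \<open>k(t)\<close> that defines the modular curve.

  Over that closure the sign ambiguity of the level structure is absorbed by the scaling factor of
  the normal form, because \<open>j = t\<close> is neither 0 nor 1728. Thus the automorphisms that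
  count are exactly those that fix \<open>u\<close> and \<open>w\<close>.

  Positive rank yields infinitely many points because finite groups are torsion, and infinitely many
  curves because only finitely many parameters share a j-invariant. In the other direction powers of
  2 decide: if \<open>P\<close> were torsion, some \<open>2^k P\<close> would lie in the subgroup
  \<open>{O, (1, 1), (1, - 1)}\<close>, whose affine points are cusps, whereas doubling over
  \<open>K\<close> never leads from a non-cusp to a cusp.\<close>

section \<open>Polynomials, constant functions and subfields\<close>

instance fract :: ("{idom, ring_char_0}") ring_char_0
proof
  have "(of_nat n :: 'a fract) = to_fract (of_nat n)" for n
    by (induction n) auto
  then show "inj (of_nat :: nat \<Rightarrow> 'a fract)"
    by (auto intro!: injI)
qed

text \<open>A nonzero combination of \<open>a\<close> and \<open>g\<close> of least degree divides
  every combination, in particular \<open>a\<close> and \<open>g\<close>. As \<open>g\<close> is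
  irreducible and does not divide \<open>a\<close>, it is a unit.\<close>

lemma irreducible_bezout:
  fixes g :: "'a::field poly"
  assumes "irreducible g" "\<not> g dvd a"
  obtains x y where "x * a + y * g = 1"
proof -
  let ?S = "\<lambda>d. d \<noteq> 0 \<and> (\<exists>x y. d = x * a + y * g)"
  have "?S g"
    using assms(1) by (metis add_0 comm_semiring_1_class.irreducible_def mult_zero_left mult_1)
  then obtain d where d: "?S d" and min: "\<And>d'. ?S d' \<Longrightarrow> degree d \<le> degree d'"
    using ex_has_least_nat[of ?S g degree] by blast
  from d obtain x y where xy: "d = x * a + y * g" by blast
  have dvd: "d dvd x' * a + y' * g" for x' y'
  proof (rule ccontr)
    let ?z = "x' * a + y' * g"
    assume "\<not> d dvd ?z"
    then have nz: "?z mod d \<noteq> 0" by (simp add: dvd_eq_mod_eq_0)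
    define q where "q = ?z div d"
    have "?z mod d = ?z - q * d" by (simp add: minus_div_mult_eq_mod q_def)
    also have "\<dots> = ?z - q * (x * a + y * g)" by (simp only: xy[symmetric])
    also have "\<dots> = (x' - q * x) * a + (y' - q * y) * g" by (simp add: algebra_simps)
    finally have "?S (?z mod d)" using nz by blast
    then have "degree d \<le> degree (?z mod d)" by (rule min)
    moreover have "degree (?z mod d) < degree d"
      using degree_mod_less'[of d ?z] d nz by auto
    ultimately show False by simp
  qed
  have dg: "d dvd g" using dvd[of 0 1] by simp
  have da: "d dvd a" using dvd[of 1 0] by simp
  have "is_unit d \<or> g dvd d"
    using assms(1) dg by (meson irreducible_altdef)
  with da assms(2) have "is_unit d" by (meson dvd_trans)
  then obtain k where "1 = d * k" by (auto elim: dvdE)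
  then have "k * x * a + k * y * g = 1" using xy by (simp add: algebra_simps)
  then show ?thesis by (rule that)
qed

lemma const_fun_simps [simp]:
  "const_fun 0 = 0" "const_fun 1 = 1"
  "const_fun (a + b) = const_fun a + const_fun b"
  "const_fun (a - b) = const_fun a - const_fun b"
  "const_fun (- a) = - const_fun a"
  "const_fun (a * b) = const_fun a * const_fun b"
  "const_fun a = const_fun b \<longleftrightarrow> a = b"
  by (simp_all add: const_fun_def flip: to_ac_add to_fract_add to_ac_mult to_fract_mult
      to_ac_diff to_fract_diff to_ac_minus to_fract_uminus one_pCons)

lemma const_fun_eq_0_iff [simp]: "const_fun a = 0 \<longleftrightarrow> a = 0"
  using const_fun_simps(1,7) by metis

lemma const_fun_power [simp]: "const_fun (a ^ n) = const_fun a ^ n"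
  by (induction n) auto

lemma const_fun_inverse [simp]: "const_fun (inverse a) = inverse (const_fun a)"
proof (cases "a = 0")
  case False
  then have "const_fun a * const_fun (inverse a) = 1"
    by (simp flip: const_fun_simps(6))
  then show ?thesis by (metis inverse_unique)
qed simp

lemma const_fun_divide [simp]: "const_fun (a / b) = const_fun a / const_fun b"
  by (simp add: field_class.field_divide_inverse)

definition evf :: "'k::field_char_0 funs \<Rightarrow> 'k poly \<Rightarrow> 'k funs" where
  "evf u p = poly (map_poly const_fun p) u"

lemma evf_simps [simp]:
  "evf u 0 = 0" "evf u 1 = 1" "evf u (pCons a p) = const_fun a + u * evf u p"
  by (simp_all add: evf_def map_poly_pCons)

lemma evf_add [simp]: "evf u (p + q) = evf u p + evf u q"
  by (induction p q rule: poly_induct2) (simp_all add: algebra_simps)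

lemma evf_smult [simp]: "evf u (smult c p) = const_fun c * evf u p"
  by (induction p) (simp_all add: algebra_simps)

lemma evf_minus [simp]: "evf u (- p) = - evf u p"
  by (metis add.inverse_unique add.right_inverse evf_add evf_simps(1))

lemma evf_diff [simp]: "evf u (p - q) = evf u p - evf u q"
  by (metis diff_conv_add_uminus evf_add evf_minus)

lemma evf_mult [simp]: "evf u (p * q) = evf u p * evf u q"
  by (induction p) (simp_all add: algebra_simps)

lemma evf_power [simp]: "evf u (p ^ n) = evf u p ^ n"
  by (induction n) simp_all

lemma evf_sum: "evf u (sum h A) = (\<Sum>x\<in>A. evf u (h x))"
  by (induction A rule: infinite_finite_induct) simp_all

lemma evf_monom: "evf u (monom c n) = const_fun c * u ^ n"
  by (induction n) (simp_all add: monom_0 monom_Suc algebra_simps)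

text \<open>A subfield as a set with closure rules, which then serve as introduction rules. The
  convention \<open>inverse 0 = 0\<close> spares a side condition.\<close>

definition field_set :: "'a::field set \<Rightarrow> bool" where
  "field_set F \<longleftrightarrow> 1 \<in> F \<and> (\<forall>x\<in>F. \<forall>y\<in>F. x + y \<in> F \<and> x * y \<in> F) \<and> (\<forall>x\<in>F. - x \<in> F \<and> inverse x \<in> F)"

lemma field_setD:
  assumes "field_set F"
  shows "1 \<in> F" "0 \<in> F" "x \<in> F \<Longrightarrow> y \<in> F \<Longrightarrow> x + y \<in> F" "x \<in> F \<Longrightarrow> y \<in> F \<Longrightarrow> x * y \<in> F"
    "x \<in> F \<Longrightarrow> - x \<in> F" "x \<in> F \<Longrightarrow> inverse x \<in> F"
    "x \<in> F \<Longrightarrow> y \<in> F \<Longrightarrow> x - y \<in> F" "x \<in> F \<Longrightarrow> y \<in> F \<Longrightarrow> x / y \<in> F"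
proof -
  show 1: "1 \<in> F" and 2: "x \<in> F \<Longrightarrow> y \<in> F \<Longrightarrow> x + y \<in> F" "x \<in> F \<Longrightarrow> y \<in> F \<Longrightarrow> x * y \<in> F"
    "x \<in> F \<Longrightarrow> - x \<in> F" "x \<in> F \<Longrightarrow> inverse x \<in> F" for x y
    using assms by (auto simp: field_set_def)
  show "0 \<in> F" using 1 2 by (metis add.right_inverse)
  show "x \<in> F \<Longrightarrow> y \<in> F \<Longrightarrow> x - y \<in> F" using 2 by (metis diff_conv_add_uminus)
  show "x \<in> F \<Longrightarrow> y \<in> F \<Longrightarrow> x / y \<in> F" using 2 by (metis field_class.field_divide_inverse)
qed

lemma field_set_power: "field_set F \<Longrightarrow> x \<in> F \<Longrightarrow> x ^ n \<in> F"
  by (induction n) (auto intro: field_setD)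

lemma field_set_powi: "field_set F \<Longrightarrow> x \<in> F \<Longrightarrow> x powi n \<in> F"
  by (auto simp: power_int_def intro: field_setD field_set_power)

section \<open>Places, their maximal ideals and their degrees\<close>

lemma subring_type_iff:
  "subring V ring_of_type_algebra \<longleftrightarrow>
     1 \<in> V \<and> (\<forall>x\<in>V. \<forall>y\<in>V. x + y \<in> V \<and> x * y \<in> V) \<and> (\<forall>x\<in>V. - x \<in> (V :: 'a::field set))"
proof -
  interpret ring "ring_of_type_algebra :: 'a ring" by (rule ring_from_type_algebra)
  have neg: "\<ominus>\<^bsub>ring_of_type_algebra\<^esub> x = - x" for x :: 'a
    by (rule minus_equality) (simp_all add: ring_of_type_algebra_def)
  show ?thesis
  proof
    assume "subring V ring_of_type_algebra"
    then interpret subring V "ring_of_type_algebra :: 'a ring" .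
    show "1 \<in> V \<and> (\<forall>x\<in>V. \<forall>y\<in>V. x + y \<in> V \<and> x * y \<in> V) \<and> (\<forall>x\<in>V. - x \<in> V)"
      using one_closed m_closed a_inv_closed a_closed neg
      by (simp add: ring_of_type_algebra_def subring_axioms subringE) 
        (metis neg subringE(5,6,7) subring_axioms ring_of_type_algebra_def monoid.simps(1) ring_record_simps(12))
  next
    assume "1 \<in> V \<and> (\<forall>x\<in>V. \<forall>y\<in>V. x + y \<in> V \<and> x * y \<in> V) \<and> (\<forall>x\<in>V. - x \<in> V)"
    then show "subring V ring_of_type_algebra"
      by (intro subringI) (auto simp: neg, auto simp: ring_of_type_algebra_def)
  qed
qed

lemma places_iff:
  "V \<in> places F \<longleftrightarrow> 1 \<in> V \<and> (\<forall>x\<in>V. \<forall>y\<in>V. x + y \<in> V \<and> x * y \<in> V) \<and> (\<forall>x\<in>V. - x \<in> V) \<and>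
     range const_fun \<subseteq> V \<and> V \<subset> F \<and> (\<forall>f\<in>F. f \<in> V \<or> inverse f \<in> V)"
  unfolding places_def subring_type_iff by auto

lemma placeD:
  assumes "V \<in> places F"
  shows "1 \<in> V" "0 \<in> V" "x \<in> V \<Longrightarrow> y \<in> V \<Longrightarrow> x + y \<in> V" "x \<in> V \<Longrightarrow> y \<in> V \<Longrightarrow> x * y \<in> V"
    "x \<in> V \<Longrightarrow> - x \<in> V" "const_fun c \<in> V" "V \<subseteq> F" "V \<noteq> F" "x \<in> F \<Longrightarrow> x \<notin> V \<Longrightarrow> inverse x \<in> V"
    "x \<in> V \<Longrightarrow> y \<in> V \<Longrightarrow> x - y \<in> V" "x \<in> V \<Longrightarrow> x ^ n \<in> V"
proof -
  show 1: "1 \<in> V" "x \<in> V \<Longrightarrow> y \<in> V \<Longrightarrow> x + y \<in> V" "x \<in> V \<Longrightarrow> y \<in> V \<Longrightarrow> x * y \<in> V"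
    "x \<in> V \<Longrightarrow> - x \<in> V" "const_fun c \<in> V" "V \<subseteq> F" "V \<noteq> F" "x \<in> F \<Longrightarrow> x \<notin> V \<Longrightarrow> inverse x \<in> V"
    for x y
    using assms unfolding places_iff by blast+
  show "0 \<in> V" using 1(1,2,4) by (metis add.right_inverse)
  show "x \<in> V \<Longrightarrow> y \<in> V \<Longrightarrow> x - y \<in> V" using 1(2,4) by (metis diff_conv_add_uminus)
  show "x \<in> V \<Longrightarrow> x ^ n \<in> V" by (induction n) (auto intro: 1)
qed

lemma place_sum:
  assumes "V \<in> places F" "\<And>b. b \<in> B \<Longrightarrow> h b \<in> V"
  shows "sum h B \<in> V"
  using assms(2) by (induction B rule: infinite_finite_induct) (auto intro: placeD[OF assms(1)])

lemma place_ideal_iff: "x \<in> place_ideal V \<longleftrightarrow> x \<in> V \<and> (x = 0 \<or> inverse x \<notin> V)"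
  by (auto simp: place_ideal_def place_units_def)

lemma place_ideal_mult:
  assumes "V \<in> places F" "x \<in> V" "y \<in> place_ideal V"
  shows "x * y \<in> place_ideal V"
proof (rule ccontr)
  assume "x * y \<notin> place_ideal V"
  then have *: "inverse (x * y) \<in> V" "x * y \<noteq> 0"
    using assms placeD(4)[OF assms(1)] by (auto simp: place_ideal_iff)
  then have "inverse y = x * inverse (x * y)" by simp
  with * assms(2) placeD(4)[OF assms(1)] have "inverse y \<in> V" by metis
  with assms(3) * show False by (auto simp: place_ideal_iff)
qed

text \<open>Of two nonzero elements one divides the other in the valuation ring, so the sum is a
  multiple of one of them.\<close>

lemma place_ideal_add:
  assumes F: "field_set F" and V: "V \<in> places F" and xy: "x \<in> place_ideal V" "y \<in> place_ideal V"
  shows "x + y \<in> place_ideal V"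
proof (cases "x = 0 \<or> y = 0")
  case True
  with xy show ?thesis by auto
next
  case False
  have in_F: "x \<in> F" "y \<in> F" using xy V by (auto simp: place_ideal_iff dest: placeD)
  have *: "a + b \<in> place_ideal V" if "a \<in> place_ideal V" "b / a \<in> V" "a \<noteq> 0" for a b
  proof -
    have "(1 + b / a) * a \<in> place_ideal V"
      using that by (intro place_ideal_mult[OF V] placeD[OF V])
    then show ?thesis using that by (simp add: field_simps)
  qed
  show ?thesis
  proof (cases "y / x \<in> V")
    case True
    then show ?thesis using * xy False by blast
  next
    case yx: False
    have "inverse (y / x) \<in> V" by (rule placeD(9)[OF V]) (use in_F yx in \<open>auto intro: field_setD F\<close>)
    then have "x / y \<in> V" by simp
    then have "y + x \<in> place_ideal V" using * xy False by blast
    then show ?thesis by (simp add: add.commute)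
  qed
qed

lemma place_ideal_uminus: "V \<in> places F \<Longrightarrow> x \<in> place_ideal V \<Longrightarrow> - x \<in> place_ideal V"
  using place_ideal_mult[of V F "- 1" x] placeD(1,5) by force

lemma place_ideal_diff:
  "field_set F \<Longrightarrow> V \<in> places F \<Longrightarrow> x \<in> place_ideal V \<Longrightarrow> y \<in> place_ideal V \<Longrightarrow> x - y \<in> place_ideal V"
  using place_ideal_add[of F V x "- y"] place_ideal_uminus by fastforce

lemma place_ideal_sum:
  assumes "field_set F" "V \<in> places F" "\<And>b. b \<in> B \<Longrightarrow> h b \<in> place_ideal V"
  shows "sum h B \<in> place_ideal V"
  using assms(3) placeD(2)[OF assms(2)]
  by (induction B rule: infinite_finite_induct)
     (auto intro: place_ideal_add[OF assms(1,2)] simp: place_ideal_iff[of 0])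

lemma place_ideal_prime:
  "V \<in> places F \<Longrightarrow> x \<in> V \<Longrightarrow> y \<in> V \<Longrightarrow> x * y \<in> place_ideal V \<Longrightarrow> x \<in> place_ideal V \<or> y \<in> place_ideal V"
  by (auto simp: place_ideal_iff placeD)

lemma one_notin_place_ideal: "V \<in> places F \<Longrightarrow> 1 \<notin> place_ideal V"
  by (auto simp: place_ideal_iff placeD)

lemma const_notin_place_ideal: "V \<in> places F \<Longrightarrow> c \<noteq> 0 \<Longrightarrow> const_fun c \<notin> place_ideal V"
  by (auto simp: place_ideal_iff placeD simp flip: const_fun_inverse)

text \<open>Independence and generation in the residue field, stated for representatives. The
  definition of \<open>place_degree\<close> expresses the same by unique coefficients.\<close>

definition residue_basis :: "'k::field_char_0 funs set \<Rightarrow> 'k funs set \<Rightarrow> bool" where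
  "residue_basis V B \<longleftrightarrow> finite B \<and> B \<subseteq> V \<and>
     (\<forall>c. (\<Sum>b\<in>B. const_fun (c b) * b) \<in> place_ideal V \<longrightarrow> (\<forall>b\<in>B. c b = 0)) \<and>
     (\<forall>f\<in>V. \<exists>c. f - (\<Sum>b\<in>B. const_fun (c b) * b) \<in> place_ideal V)"

lemma residue_basisD:
  assumes "residue_basis V B" "(\<Sum>b\<in>B. const_fun (c b) * b) \<in> place_ideal V" "b \<in> B"
  shows "c b = 0"
  using assms unfolding residue_basis_def by (elim conjE allE[of _ c]) auto

lemma residue_basis_iff:
  assumes F: "field_set F" and V: "V \<in> places F"
  shows "residue_basis V B \<longleftrightarrow> finite B \<and> B \<subseteq> V \<and>
     (\<forall>f\<in>V. \<exists>!c. c \<in> (B \<rightarrow>\<^sub>E UNIV) \<and> f - (\<Sum>b\<in>B. const_fun (c b) * b) \<in> place_ideal V)"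
    (is "_ \<longleftrightarrow> ?R")
proof
  assume B: "residue_basis V B"
  have "\<exists>!c. c \<in> (B \<rightarrow>\<^sub>E UNIV) \<and> f - (\<Sum>b\<in>B. const_fun (c b) * b) \<in> place_ideal V" if f: "f \<in> V" for f
  proof (rule ex_ex1I)
    obtain c where "f - (\<Sum>b\<in>B. const_fun (c b) * b) \<in> place_ideal V"
      using B f unfolding residue_basis_def by blast
    moreover have "(\<Sum>b\<in>B. const_fun (restrict c B b) * b) = (\<Sum>b\<in>B. const_fun (c b) * b)"
      by (intro sum.cong) auto
    ultimately show "\<exists>c. c \<in> (B \<rightarrow>\<^sub>E UNIV) \<and> f - (\<Sum>b\<in>B. const_fun (c b) * b) \<in> place_ideal V"
      by (intro exI[of _ "restrict c B"]) auto
  next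
    fix c d
    assume c: "c \<in> (B \<rightarrow>\<^sub>E UNIV) \<and> f - (\<Sum>b\<in>B. const_fun (c b) * b) \<in> place_ideal V"
      and d: "d \<in> (B \<rightarrow>\<^sub>E UNIV) \<and> f - (\<Sum>b\<in>B. const_fun (d b) * b) \<in> place_ideal V"
    have "(\<Sum>b\<in>B. const_fun (d b - c b) * b) =
        (f - (\<Sum>b\<in>B. const_fun (c b) * b)) - (f - (\<Sum>b\<in>B. const_fun (d b) * b))"
      by (simp add: algebra_simps sum_subtractf)
    also have "\<dots> \<in> place_ideal V" using c d by (blast intro: place_ideal_diff[OF F V])
    finally have "\<forall>b\<in>B. d b - c b = 0"
      using residue_basisD[OF B, of "\<lambda>b. d b - c b"] by blast
    with c d show "c = d" by (intro PiE_ext[of c B "\<lambda>_. UNIV" d]) auto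
  qed
  with B show ?R unfolding residue_basis_def by blast
next
  assume R: ?R
  have "\<forall>b\<in>B. c b = 0" if c: "(\<Sum>b\<in>B. const_fun (c b) * b) \<in> place_ideal V" for c
  proof -
    have zero: "0 \<in> V" by (rule placeD(2)[OF V])
    have "- (\<Sum>b\<in>B. const_fun (c b) * b) \<in> place_ideal V"
      by (rule place_ideal_uminus[OF V c])
    moreover have "(\<Sum>b\<in>B. const_fun (restrict c B b) * b) = (\<Sum>b\<in>B. const_fun (c b) * b)"
      by (intro sum.cong) auto
    moreover have "(\<Sum>b\<in>B. const_fun (restrict (\<lambda>_. 0) B b) * b) = 0"
      by (intro sum.neutral) auto
    moreover have "0 \<in> place_ideal V" using zero by (simp add: place_ideal_iff)
    ultimately have *: "restrict c B \<in> (B \<rightarrow>\<^sub>E UNIV) \<and> 0 - (\<Sum>b\<in>B. const_fun (restrict c B b) * b) \<in> place_ideal V"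
      "restrict (\<lambda>_. 0) B \<in> (B \<rightarrow>\<^sub>E UNIV) \<and> 0 - (\<Sum>b\<in>B. const_fun (restrict (\<lambda>_. 0) B b) * b) \<in> place_ideal V"
      by simp_all
    have "\<exists>!c. c \<in> (B \<rightarrow>\<^sub>E UNIV) \<and> 0 - (\<Sum>b\<in>B. const_fun (c b) * b) \<in> place_ideal V"
      by (rule bspec[OF conjunct2[OF conjunct2[OF R]] zero])
    then have "restrict c B = restrict (\<lambda>_. 0) B"
      by (rule ex1E) (rule trans[OF _ sym], (drule spec, erule mp, rule *)+)
    then show ?thesis by (metis restrict_apply')
  qed
  with R show "residue_basis V B" unfolding residue_basis_def by blast
qed

interpretation funs: vector_space "\<lambda>(c::'k::field_char_0) (x::'k funs). const_fun c * x"
  by unfold_locales (simp_all add: algebra_simps)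

text \<open>Each \<open>b\<close> in \<open>B\<close> is congruent to a combination
  \<open>\<psi> b\<close> of \<open>B'\<close>. These combinations stay independent over the
  constants, even as functions, so the bound on independent sets in the span of \<open>B'\<close>
  applies to them.\<close>

lemma residue_basis_card_le:
  assumes F: "field_set F" and V: "V \<in> places F" and B: "residue_basis V B" and B': "residue_basis V B'"
  shows "card B \<le> card B'"
proof -
  have fin: "finite B" "finite B'" and sub: "B \<subseteq> V" "B' \<subseteq> V"
    using B B' by (auto simp: residue_basis_def)
  have "\<forall>b\<in>B. \<exists>c. b - (\<Sum>b\<in>B'. const_fun (c b) * b) \<in> place_ideal V"
    using B' sub unfolding residue_basis_def by blast
  then have "\<exists>co. \<forall>b\<in>B. b - (\<Sum>b'\<in>B'. const_fun (co b b') * b') \<in> place_ideal V"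
    by (rule bchoice)
  then obtain co where co: "\<forall>b\<in>B. b - (\<Sum>b'\<in>B'. const_fun (co b b') * b') \<in> place_ideal V" ..
  define \<psi> where "\<psi> b = (\<Sum>b'\<in>B'. const_fun (co b b') * b')" for b
  have diff: "b - \<psi> b \<in> place_ideal V" if "b \<in> B" for b
    using bspec[OF co that] by (simp add: \<psi>_def)
  have ind: "\<forall>b\<in>B. c b = 0" if "(\<Sum>b\<in>B. const_fun (c b) * \<psi> b) = 0" for c
  proof -
    have "(\<Sum>b\<in>B. const_fun (c b) * (b - \<psi> b)) \<in> place_ideal V"
      by (intro place_ideal_sum[OF F V] place_ideal_mult[OF V] diff placeD[OF V])
    also have "(\<Sum>b\<in>B. const_fun (c b) * (b - \<psi> b)) = (\<Sum>b\<in>B. const_fun (c b) * b)"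
      using that by (simp add: algebra_simps sum_subtractf)
    finally show ?thesis using residue_basisD[OF B, of c] by blast
  qed
  have inj: "inj_on \<psi> B"
  proof (rule inj_onI, rule ccontr)
    fix a b assume ab: "a \<in> B" "b \<in> B" "\<psi> a = \<psi> b" "a \<noteq> b"
    let ?c = "\<lambda>x. if x = a then 1 else if x = b then - 1 else 0"
    have "(\<Sum>x\<in>B. const_fun (?c x) * \<psi> x) = (\<Sum>x\<in>{a, b}. const_fun (?c x) * \<psi> x)"
      using ab fin by (intro sum.mono_neutral_right) auto
    also have "\<dots> = 0" using ab by simp
    finally have z: "(\<Sum>x\<in>B. const_fun (?c x) * \<psi> x) = 0" .
    from bspec[OF ind[OF z] ab(1)] show False by simp
  qed
  have "funs.independent (\<psi> ` B)"
  proof (rule funs.independent_if_scalars_zero)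
    show "finite (\<psi> ` B)" using fin by simp
    fix c x assume s: "(\<Sum>x\<in>\<psi> ` B. const_fun (c x) * x) = 0" and x: "x \<in> \<psi> ` B"
    from s have "(\<Sum>b\<in>B. const_fun (c (\<psi> b)) * \<psi> b) = 0"
      by (simp add: sum.reindex[OF inj])
    from ind[OF this] x show "c x = 0" by auto
  qed
  moreover have "\<psi> ` B \<subseteq> funs.span B'"
    unfolding \<psi>_def by (rule image_subsetI, intro funs.span_sum funs.span_scale, rule funs.span_base)
  ultimately have "card (\<psi> ` B) \<le> card B'"
    using funs.independent_span_bound[of B' "\<psi> ` B"] fin by auto
  then show ?thesis by (simp add: card_image[OF inj])
qed

lemma place_degree_eq:
  assumes F: "field_set F" and V: "V \<in> places F" and B: "residue_basis V B"
  shows "place_degree V = card B"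
  unfolding place_degree_def
proof (rule the_equality)
  show "\<exists>B'. finite B' \<and> B' \<subseteq> V \<and> card B' = card B \<and> (\<forall>f\<in>V. \<exists>!c. c \<in> (B' \<rightarrow>\<^sub>E UNIV) \<and>
      f - (\<Sum>b\<in>B'. const_fun (c b) * b) \<in> place_ideal V)"
    using B unfolding residue_basis_iff[OF F V] by blast
next
  fix d
  assume "\<exists>B'. finite B' \<and> B' \<subseteq> V \<and> card B' = d \<and> (\<forall>f\<in>V. \<exists>!c. c \<in> (B' \<rightarrow>\<^sub>E UNIV) \<and>
      f - (\<Sum>b\<in>B'. const_fun (c b) * b) \<in> place_ideal V)"
  then obtain B' where "residue_basis V B'" "card B' = d"
    unfolding residue_basis_iff[OF F V] by blast
  then show "d = card B"
    using residue_basis_card_le[OF F V] B by (metis le_antisym)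
qed

section \<open>Discrete valuation rings as localizations\<close>

text \<open>A prime \<open>p\<close> of a ring \<open>R\<close> such that every nonzero function is
  a power of \<open>\<pi>\<close> times a quotient of elements of \<open>R - p\<close>. Then the
  localization at \<open>p\<close> is a discrete valuation ring with uniformizer
  \<open>\<pi>\<close>. The instances take for \<open>R\<close> the coordinate ring of an affine
  chart of the curve.\<close>

locale dvr_center =
  fixes F R p :: "'k::field_char_0 funs set" and \<pi> :: "'k funs"
  assumes F: "field_set F"
    and R_sub: "R \<subseteq> F" and R_const: "const_fun c \<in> R"
    and R_add: "x \<in> R \<Longrightarrow> y \<in> R \<Longrightarrow> x + y \<in> R" and R_mult: "x \<in> R \<Longrightarrow> y \<in> R \<Longrightarrow> x * y \<in> R"
    and p_sub: "p \<subseteq> R"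
    and p_mult: "x \<in> R \<Longrightarrow> y \<in> p \<Longrightarrow> x * y \<in> p"
    and one_notin: "1 \<notin> p"
    and prime: "x \<in> R - p \<Longrightarrow> y \<in> R - p \<Longrightarrow> x * y \<notin> p"
    and pi_in: "\<pi> \<in> p" and pi_nz: "\<pi> \<noteq> 0"
    and factor: "x \<in> F \<Longrightarrow> x \<noteq> 0 \<Longrightarrow> \<exists>n. \<exists>s\<in>R - p. \<exists>s'\<in>R - p. x = \<pi> powi n * (s / s')"
begin

definition V :: "'k funs set" where "V = {a / b |a b. a \<in> R \<and> b \<in> R - p}"

definition U :: "'k funs set" where "U = {a / b |a b. a \<in> R - p \<and> b \<in> R - p}"

lemma zero_in: "0 \<in> p"
  using p_mult[OF _ pi_in, of 0] R_const[of 0] by simp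

lemma one_R: "1 \<in> R" using R_const[of 1] by simp

lemma compl_mult: "x \<in> R - p \<Longrightarrow> y \<in> R - p \<Longrightarrow> x * y \<in> R - p"
  using prime R_mult by auto

lemma compl_nz: "x \<in> R - p \<Longrightarrow> x \<noteq> 0" using zero_in by auto

lemma R_uminus: "x \<in> R \<Longrightarrow> - x \<in> R"
  using R_mult[of "const_fun (- 1)" x] R_const[of "- 1"] by simp

lemma VI: "a \<in> R \<Longrightarrow> b \<in> R - p \<Longrightarrow> a / b \<in> V" by (auto simp: V_def)

lemma UI: "a \<in> R - p \<Longrightarrow> b \<in> R - p \<Longrightarrow> a / b \<in> U" unfolding U_def by blast

lemma R_V: "R \<subseteq> V"
proof
  fix x assume "x \<in> R"
  then have "x / 1 \<in> V" using one_R one_notin by (intro VI) auto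
  then show "x \<in> V" by simp
qed

lemma V_add: "x \<in> V \<Longrightarrow> y \<in> V \<Longrightarrow> x + y \<in> V"
proof -
  assume "x \<in> V" "y \<in> V"
  then obtain a b c d where *: "x = a / b" "y = c / d" "a \<in> R" "c \<in> R" "b \<in> R - p" "d \<in> R - p"
    by (auto simp: V_def)
  then have "x + y = (a * d + c * b) / (b * d)"
    using compl_nz by (simp add: add_frac_eq)
  moreover have "(a * d + c * b) / (b * d) \<in> V"
    using * by (intro VI compl_mult R_add R_mult) auto
  ultimately show ?thesis by simp
qed

lemma V_mult: "x \<in> V \<Longrightarrow> y \<in> V \<Longrightarrow> x * y \<in> V"
proof -
  assume "x \<in> V" "y \<in> V"
  then obtain a b c d where *: "x = a / b" "y = c / d" "a \<in> R" "c \<in> R" "b \<in> R - p" "d \<in> R - p"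
    by (auto simp: V_def)
  have "(a * c) / (b * d) \<in> V"
    using * by (intro VI compl_mult R_add R_mult) auto
  with * show ?thesis by simp
qed

lemma V_uminus: "x \<in> V \<Longrightarrow> - x \<in> V"
  using V_mult[of "- 1" x] R_V R_uminus one_R by auto

lemma V_sub_F: "V \<subseteq> F"
  using R_sub by (auto simp: V_def intro!: field_setD(8)[OF F])

lemma U_inverse: "y \<in> U \<Longrightarrow> inverse y \<in> U"
  using UI by (force simp: U_def)

lemma U_mult: "x \<in> U \<Longrightarrow> y \<in> U \<Longrightarrow> x * y \<in> U"
proof -
  assume "x \<in> U" "y \<in> U"
  then obtain a b c d where *: "x = a / b" "y = c / d" "a \<in> R - p" "c \<in> R - p" "b \<in> R - p" "d \<in> R - p"
    unfolding U_def by blast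
  have "(a * c) / (b * d) \<in> U"
    using * by (intro UI compl_mult) auto
  with * show ?thesis by simp
qed

lemma U_V: "U \<subseteq> V" unfolding U_def V_def by blast

lemma U_nz: "y \<in> U \<Longrightarrow> y \<noteq> 0" unfolding U_def using compl_nz by auto

lemma one_U: "1 \<in> U" using UI[of 1 1] one_R one_notin by simp

lemma compl_U: "x \<in> R - p \<Longrightarrow> x \<in> U" using UI[of x 1] one_R one_notin by simp

lemma factor_U: "x \<in> F \<Longrightarrow> x \<noteq> 0 \<Longrightarrow> \<exists>n. \<exists>y\<in>U. x = \<pi> powi n * y"
  using factor UI by metis

lemma pi_V: "\<pi> \<in> V" using pi_in p_sub R_V by blast

lemma V_power: "x \<in> V \<Longrightarrow> x ^ n \<in> V"
  using one_R R_V by (induction n) (auto intro: V_mult)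

lemma inv_pi: "inverse \<pi> \<notin> V"
proof
  assume "inverse \<pi> \<in> V"
  then obtain a b where ab: "inverse \<pi> = a / b" "a \<in> R" "b \<in> R - p" by (auto simp: V_def)
  then have "b = a * \<pi>" using pi_nz compl_nz by (simp add: field_simps)
  then have "b \<in> p" using p_mult[OF ab(2) pi_in] by simp
  with ab show False by simp
qed

lemma powi_in_V_iff:
  assumes y: "y \<in> U"
  shows "\<pi> powi n * y \<in> V \<longleftrightarrow> n \<ge> 0"
proof
  assume "n \<ge> 0"
  then have "\<pi> powi n = \<pi> ^ nat n" by (simp add: power_int_def)
  then show "\<pi> powi n * y \<in> V" using y U_V V_mult[OF V_power[OF pi_V]] by auto
next
  assume V: "\<pi> powi n * y \<in> V"
  show "n \<ge> 0"
  proof (rule ccontr)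
    assume n: "\<not> n \<ge> 0"
    \<comment> \<open>Cancelling the unit and all but one factor of the negative power leaves
      \<open>inverse \<pi>\<close>, which is not in \<open>V\<close>.\<close>
    have "\<pi> ^ nat (- n - 1) * (\<pi> powi n * y) * inverse y \<in> V"
      using V_mult[OF V_mult[OF V_power[OF pi_V] V]] U_inverse[OF y] U_V by blast
    also have "\<pi> ^ nat (- n - 1) * (\<pi> powi n * y) * inverse y = \<pi> powi (- n - 1) * \<pi> powi n"
      using n U_nz[OF y] by (simp add: power_int_def)
    also have "\<dots> = \<pi> powi (- 1)" using pi_nz by (simp flip: power_int_add)
    finally show False using inv_pi by (simp add: power_int_minus)
  qed
qed

lemma V_place: "V \<in> places F"
  unfolding places_iff
proof (intro conjI ballI impI)
  show "1 \<in> V" using one_R R_V by blast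
  show "range const_fun \<subseteq> V" using R_const R_V by blast
  have "inverse \<pi> \<in> F" using pi_V V_sub_F by (intro field_setD(6)[OF F]) auto
  with inv_pi V_sub_F show "V \<subset> F" by blast
  fix f assume f: "f \<in> F"
  show "f \<in> V \<or> inverse f \<in> V"
  proof (cases "f = 0")
    case True
    then show ?thesis using R_const[of 0] R_V by auto
  next
    case False
    then obtain n y where y: "y \<in> U" "f = \<pi> powi n * y" using factor_U[OF f] by blast
    have "inverse f = \<pi> powi (- n) * inverse y" using y by (simp add: power_int_minus)
    then show ?thesis
      using y powi_in_V_iff[OF y(1), of n] powi_in_V_iff[OF U_inverse[OF y(1)], of "- n"] by auto
  qed
qed (auto intro: V_add V_mult V_uminus)

lemma units_eq: "place_units V = U"
proof
  show "U \<subseteq> place_units V"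
    using U_V U_inverse U_nz by (auto simp: place_units_def)
  show "place_units V \<subseteq> U"
  proof
    fix x assume "x \<in> place_units V"
    then have x: "x \<in> V" "inverse x \<in> V" "x \<noteq> 0" by (auto simp: place_units_def)
    then obtain n y where y: "y \<in> U" "x = \<pi> powi n * y" using factor_U V_sub_F by blast
    have "inverse x = \<pi> powi (- n) * inverse y" using y by (simp add: power_int_minus)
    then have "n = 0"
      using x y powi_in_V_iff[OF y(1), of n] powi_in_V_iff[OF U_inverse[OF y(1)], of "- n"] by auto
    with y show "x \<in> U" by simp
  qed
qed

lemma center: "R \<inter> place_ideal V = p"
proof -
  have "x \<notin> U" if "x \<in> p" for x
  proof
    assume "x \<in> U"
    then obtain a b where ab: "x = a / b" "a \<in> R - p" "b \<in> R - p" unfolding U_def by blast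
    have "a = b * x" unfolding ab(1) using compl_nz[OF ab(3)] by simp
    with p_mult[OF _ that, of b] ab(2,3) show False by auto
  qed
  with compl_U R_V p_sub show ?thesis by (auto simp: place_ideal_def units_eq)
qed

text \<open>A place with the same centre contains the localization. It cannot be larger, since a
  further element would bring in \<open>inverse \<pi>\<close>, although \<open>\<pi>\<close> lies in
  the maximal ideal of \<open>W\<close>.\<close>

lemma unique:
  assumes W: "W \<in> places F" "R \<subseteq> W" "R \<inter> place_ideal W = p"
  shows "W = V"
proof
  have inv: "inverse b \<in> W" if "b \<in> R - p" for b
    using that W compl_nz[OF that] by (auto simp: place_ideal_iff)
  have UW: "y \<in> W" if "y \<in> U" for y
  proof -
    from that obtain a b where "y = a * inverse b" "a \<in> R - p" "b \<in> R - p"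
      unfolding U_def by (auto simp: divide_inverse)
    then show ?thesis using inv W by (auto intro!: placeD(4)[OF W(1)])
  qed
  show "V \<subseteq> W"
    using W inv by (auto simp: V_def divide_inverse intro!: placeD(4)[OF W(1)])
  show "W \<subseteq> V"
  proof
    fix x assume x: "x \<in> W"
    show "x \<in> V"
    proof (cases "x = 0")
      case True
      then show ?thesis using placeD(2)[OF V_place] by simp
    next
      case False
      then obtain n y where y: "y \<in> U" "x = \<pi> powi n * y"
        using factor_U x placeD(7)[OF W(1)] by blast
      have "n \<ge> 0"
      proof (rule ccontr)
        assume n: "\<not> n \<ge> 0"
        have "\<pi> ^ nat (- n - 1) * x * inverse y \<in> W"
          using x UW[OF U_inverse[OF y(1)]] pi_in p_sub W(2)
          by (intro placeD(4,11)[OF W(1)]) auto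
        also have "\<pi> ^ nat (- n - 1) * x * inverse y = \<pi> powi (- n - 1) * \<pi> powi n"
          using n U_nz[OF y(1)] y by (simp add: power_int_def)
        also have "\<dots> = \<pi> powi (- 1)" using pi_nz by (simp flip: power_int_add)
        finally have "inverse \<pi> \<in> W" by (simp add: power_int_minus)
        with W(3) pi_in pi_nz show False by (auto simp: place_ideal_iff)
      qed
      then show ?thesis using powi_in_V_iff[OF y(1)] y by simp
    qed
  qed
qed

lemma ideal_eq: "place_ideal V = (\<lambda>f. \<pi> * f) ` V"
proof
  show "(\<lambda>f. \<pi> * f) ` V \<subseteq> place_ideal V"
    using center pi_in place_ideal_mult[OF V_place] by (auto simp: mult.commute[of \<pi>])
  show "place_ideal V \<subseteq> (\<lambda>f. \<pi> * f) ` V"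
  proof
    fix x assume x: "x \<in> place_ideal V"
    show "x \<in> (\<lambda>f. \<pi> * f) ` V"
    proof (cases "x = 0")
      case True
      then show ?thesis using placeD(2)[OF V_place] by force
    next
      case False
      moreover have "x \<in> F" using x V_sub_F by (auto simp: place_ideal_iff)
      ultimately obtain n y where y: "y \<in> U" "x = \<pi> powi n * y"
        using factor_U by blast
      have "n \<ge> 0" "n \<noteq> 0"
        using x y powi_in_V_iff[OF y(1)] units_eq by (auto simp: place_ideal_def)
      then have "n - 1 \<ge> 0" by simp
      then have "\<pi> powi (n - 1) * y \<in> V" using powi_in_V_iff[OF y(1)] by blast
      moreover have "x = \<pi> * (\<pi> powi (n - 1) * y)"
        using y pi_nz by (simp add: power_int_diff)
      ultimately show ?thesis by blast
    qed
  qed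
qed

lemma powi_U_imp_0: "\<pi> powi n \<in> U \<Longrightarrow> n = 0"
  using powi_in_V_iff[OF one_U, of n] powi_in_V_iff[OF one_U, of "- n"] U_V U_inverse[of "\<pi> powi n"]
  by (auto simp: power_int_minus)

lemma U_powi: "y \<in> U \<Longrightarrow> y powi n \<in> U"
proof -
  have "y ^ k \<in> U" if "y \<in> U" for y k
    using that one_U by (induction k) (auto intro: U_mult)
  then show "y \<in> U \<Longrightarrow> y powi n \<in> U" using U_inverse by (auto simp: power_int_def)
qed

text \<open>The definition of \<open>place_ord\<close> allows any uniformizer; two of them differ by
  a unit, so the exponent does not depend on the choice.\<close>

lemma ord_eq:
  assumes y: "y \<in> U"
  shows "place_ord V (\<pi> powi n * y) = n"
  unfolding place_ord_def
proof (rule the_equality)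
  show "\<exists>p u. uniformizer V p \<and> u \<in> place_units V \<and> \<pi> powi n * y = u * p powi n"
    using ideal_eq y units_eq by (intro exI[of _ \<pi>] exI[of _ y]) (auto simp: uniformizer_def)
next
  fix n' assume "\<exists>p u. uniformizer V p \<and> u \<in> place_units V \<and> \<pi> powi n * y = u * p powi n'"
  then obtain q u where q: "uniformizer V q" and u: "u \<in> U" "\<pi> powi n * y = u * q powi n'"
    using units_eq by blast
  have eq: "(\<lambda>f. \<pi> * f) ` V = (\<lambda>f. q * f) ` V" using q ideal_eq by (simp add: uniformizer_def)
  have 1: "1 \<in> V" by (rule placeD(1)[OF V_place])
  have "\<pi> * 1 \<in> (\<lambda>f. q * f) ` V" using 1 eq by blast
  then obtain b where b: "b \<in> V" "\<pi> = q * b" by auto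
  have "q * 1 \<in> (\<lambda>f. \<pi> * f) ` V" using 1 eq by blast
  then obtain a where a: "a \<in> V" "q = \<pi> * a" by auto
  have "a * b = 1" using a b pi_nz by (metis mult.assoc mult_cancel_left mult.right_neutral)
  then have "inverse a = b" "a \<noteq> 0" by (auto intro: inverse_unique)
  then have "a \<in> U" using a b by (simp flip: units_eq add: place_units_def)
  have eq': "\<pi> powi n * y = u * a powi n' * \<pi> powi n'"
    unfolding u(2) a(2) power_int_mult_distrib by (simp only: mult_ac)
  have "\<pi> powi (n - n') = (\<pi> powi n * y) * inverse y * inverse (\<pi> powi n')"
    using pi_nz U_nz[OF y] by (simp add: power_int_diff divide_inverse)
  also have "\<dots> = u * a powi n' * inverse y"
    unfolding eq' using pi_nz by simp
  finally have "\<pi> powi (n - n') = u * a powi n' * inverse y" .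
  moreover have "u * a powi n' * inverse y \<in> U"
    using u \<open>a \<in> U\<close> y by (intro U_mult U_powi U_inverse)
  ultimately have "\<pi> powi (n - n') \<in> U" by metis
  from powi_U_imp_0[OF this] show "n' = n" by simp
qed

abbreviation ord where "ord \<equiv> place_ord V"

lemma ord_decomp:
  assumes "x \<in> F" "x \<noteq> 0"
  obtains y where "y \<in> U" "x = \<pi> powi ord x * y"
proof -
  from factor_U[OF assms] obtain n y where y: "y \<in> U" "x = \<pi> powi n * y" by blast
  have "ord x = n" unfolding y(2) by (rule ord_eq[OF y(1)])
  then have "x = \<pi> powi ord x * y" using y(2) by (simp only:)
  with y(1) show ?thesis by (rule that)
qed

lemma ord_pi: "ord \<pi> = 1" using ord_eq[OF one_U, of 1] by simp

lemma ord_U: "y \<in> U \<Longrightarrow> ord y = 0" using ord_eq[of y 0] by simp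

lemma ord_mult: "x \<in> F \<Longrightarrow> x \<noteq> 0 \<Longrightarrow> y \<in> F \<Longrightarrow> y \<noteq> 0 \<Longrightarrow> ord (x * y) = ord x + ord y"
proof -
  assume x: "x \<in> F" "x \<noteq> 0" and y: "y \<in> F" "y \<noteq> 0"
  obtain a where a: "a \<in> U" "x = \<pi> powi ord x * a" by (rule ord_decomp[OF x])
  obtain b where b: "b \<in> U" "y = \<pi> powi ord y * b" by (rule ord_decomp[OF y])
  have "x * y = (\<pi> powi ord x * a) * (\<pi> powi ord y * b)" by (simp only: a(2)[symmetric] b(2)[symmetric])
  also have "\<dots> = \<pi> powi (ord x + ord y) * (a * b)"
    using power_int_add[of \<pi> "ord x" "ord y"] pi_nz by (simp only: mult_ac simp_thms)
  finally have e: "x * y = \<pi> powi (ord x + ord y) * (a * b)" .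
  show ?thesis unfolding e by (rule ord_eq[OF U_mult[OF a(1) b(1)]])
qed

lemma in_V_iff: "x \<in> F \<Longrightarrow> x \<noteq> 0 \<Longrightarrow> x \<in> V \<longleftrightarrow> ord x \<ge> 0"
proof -
  assume x: "x \<in> F" "x \<noteq> 0"
  obtain y where y: "y \<in> U" "x = \<pi> powi ord x * y" by (rule ord_decomp[OF x])
  show ?thesis using powi_in_V_iff[OF y(1), of "ord x"] unfolding y(2)[symmetric] .
qed

lemma ord_eq_0_iff: "x \<in> F \<Longrightarrow> x \<noteq> 0 \<Longrightarrow> ord x = 0 \<longleftrightarrow> x \<in> U"
proof
  assume x: "x \<in> F" "x \<noteq> 0" and "ord x = 0"
  obtain y where y: "y \<in> U" "x = \<pi> powi ord x * y" by (rule ord_decomp[OF x])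
  have "x = y" using y(2) unfolding \<open>ord x = 0\<close> power_int_0_right mult_1 .
  with y(1) show "x \<in> U" by simp
qed (rule ord_U)

lemma ord_R: "x \<in> R \<Longrightarrow> x \<noteq> 0 \<Longrightarrow> ord x \<ge> 0"
  using in_V_iff R_V R_sub by blast

lemma ord_compl: "x \<in> R - p \<Longrightarrow> ord x = 0"
  using ord_U compl_U by blast

lemma ord_p: "x \<in> p \<Longrightarrow> x \<noteq> 0 \<Longrightarrow> ord x > 0"
proof -
  assume x: "x \<in> p" "x \<noteq> 0"
  then have "x \<in> F" using p_sub R_sub by blast
  have "x \<in> place_ideal V" using x(1) center by blast
  then have "x \<notin> U" by (simp add: place_ideal_def units_eq)
  then have "ord x \<noteq> 0" using ord_eq_0_iff[OF \<open>x \<in> F\<close> x(2)] by blast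
  moreover have "ord x \<ge> 0" using x p_sub by (intro ord_R) auto
  ultimately show ?thesis by simp
qed

lemma ord_inverse: "x \<in> F \<Longrightarrow> x \<noteq> 0 \<Longrightarrow> ord (inverse x) = - ord x"
  using ord_mult[of x "inverse x"] field_setD(6)[OF F] ord_U[OF one_U] by simp

lemma ord_divide: "x \<in> F \<Longrightarrow> x \<noteq> 0 \<Longrightarrow> y \<in> F \<Longrightarrow> y \<noteq> 0 \<Longrightarrow> ord (x / y) = ord x - ord y"
  by (simp add: divide_inverse ord_mult ord_inverse field_setD(6)[OF F])

lemma ord_power: "x \<in> F \<Longrightarrow> x \<noteq> 0 \<Longrightarrow> ord (x ^ n) = int n * ord x"
  by (induction n) (simp_all add: ord_U[OF one_U] ord_mult field_set_power[OF F] algebra_simps)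

lemma ord_add_ge:
  assumes "x \<in> F" "x \<noteq> 0" "y \<in> F" "x + y \<noteq> 0" "y = 0 \<or> ord x \<le> ord y"
  shows "ord (x + y) \<ge> ord x"
proof -
  have "y / x \<in> V"
  proof (cases "y = 0")
    case True
    then show ?thesis using placeD(2)[OF V_place] by simp
  next
    case False
    then show ?thesis using assms ord_divide[of y x] field_setD(8)[OF F] in_V_iff[of "y / x"] by simp
  qed
  then have V: "1 + y / x \<in> V" by (intro placeD[OF V_place])
  have eq: "x + y = x * (1 + y / x)" using assms by (simp add: field_simps)
  then have nz: "1 + y / x \<noteq> 0" using assms(4) by auto
  have "ord (x + y) = ord x + ord (1 + y / x)"
    unfolding eq using assms nz V V_sub_F by (intro ord_mult) auto
  moreover have "ord (1 + y / x) \<ge> 0" using V nz V_sub_F in_V_iff by blast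
  ultimately show ?thesis by simp
qed

lemma ord_add_eq:
  assumes "x \<in> F" "x \<noteq> 0" "y \<in> F" "y = 0 \<or> ord x < ord y"
  shows "x + y \<noteq> 0" "ord (x + y) = ord x"
proof -
  have m: "ord (- z) = ord z" if "z \<in> F" "z \<noteq> 0" for z
  proof -
    have "const_fun (- 1) \<in> U"
      using placeD(6)[OF V_place, of "- 1"] by (simp flip: units_eq add: place_units_def)
    then show ?thesis
      using ord_mult[of "const_fun (- 1)" z] that ord_U[of "const_fun (- 1)"] U_V V_sub_F
      by (auto dest: U_nz)
  qed
  show nz: "x + y \<noteq> 0"
  proof
    assume "x + y = 0"
    then have "y = - x" by (simp add: eq_neg_iff_add_eq_0 add.commute)
    with m[OF assms(1,2)] assms show False by auto
  qed
  show "ord (x + y) = ord x"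
  proof (cases "y = 0")
    case False
    have F': "x + y \<in> F" using assms by (intro field_setD(3)[OF F]) auto
    have "ord (x + y) \<le> ord x"
    proof (rule ccontr)
      assume "\<not> ?thesis"
      then have lt: "ord x < ord (x + y)" by simp
      show False
      proof (cases "ord y \<le> ord (x + y)")
        case True
        have "ord (- y + (x + y)) \<ge> ord (- y)"
          using True assms False F' m[of y] by (intro ord_add_ge) (auto intro: field_setD(5)[OF F])
        with assms False m[of y] show False by simp
      next
        case f2: False
        have "ord ((x + y) + - y) \<ge> ord (x + y)"
          using f2 assms False F' m[of y] nz by (intro ord_add_ge) (auto intro: field_setD(5)[OF F])
        with lt show False by simp
      qed
    qed
    moreover have "ord (x + y) \<ge> ord x"
      using assms nz by (intro ord_add_ge) auto
    ultimately show ?thesis by simp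
  qed simp
qed

end

section \<open>Irreducible polynomials over a field\<close>

lemma irreducible_poly_dvd_mult_iff:
  fixes g :: "'a::field poly"
  assumes "irreducible g"
  shows "g dvd a * b \<longleftrightarrow> g dvd a \<or> g dvd b"
  using field_poly_irreducible_imp_prime[OF assms] by (rule prime_elem_dvd_mult_iff)

lemma irreducible_poly_degree:
  fixes g :: "'a::field poly"
  assumes "irreducible g"
  shows "degree g > 0" "g \<noteq> 0"
proof -
  show nz: "g \<noteq> 0" using assms by (auto simp: comm_semiring_1_class.irreducible_def)
  have "\<not> is_unit g" using assms by (auto simp: comm_semiring_1_class.irreducible_def)
  then show "degree g > 0" using nz is_unit_iff_degree by blast
qed

lemma irreducible_not_dvd_const:
  fixes g :: "'a::field poly"
  assumes "irreducible g" "c \<noteq> 0"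
  shows "\<not> g dvd [:c:]"
  using irreducible_poly_degree[OF assms(1)] dvd_imp_degree_le[of g "[:c:]"] assms(2) by auto

text \<open>A divisor of least positive degree is irreducible.\<close>

lemma poly_irreducible_factor:
  fixes N :: "'a::field poly"
  assumes "degree N > 0"
  obtains g where "irreducible g" "g dvd N"
proof -
  let ?P = "\<lambda>d. degree d > 0 \<and> d dvd N"
  obtain g where g: "?P g" and min: "\<And>d. ?P d \<Longrightarrow> degree g \<le> degree d"
    using ex_has_least_nat[of ?P N degree] assms by auto
  have N: "N \<noteq> 0" using assms by auto
  have "irreducible g"
  proof (rule comm_semiring_1_class.irreducibleI)
    show "g \<noteq> 0" using g by auto
    show "\<not> g dvd 1" using g is_unit_iff_degree[of g] by (cases "g = 0") auto
    fix a b assume ab: "g = a * b"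
    have nz: "a \<noteq> 0" "b \<noteq> 0" using ab g by auto
    show "a dvd 1 \<or> b dvd 1"
    proof (cases "degree a = 0")
      case True
      then show ?thesis using nz is_unit_iff_degree by blast
    next
      case False
      then have "?P a" using g ab by (auto intro: dvd_trans[of a g])
      then have "degree g \<le> degree a" by (rule min)
      then have "degree b = 0" using ab nz by (simp add: degree_mult_eq)
      then show ?thesis using nz is_unit_iff_degree by blast
    qed
  qed
  with g that show ?thesis by blast
qed

text \<open>Stated for a pair in order to make an element \<open>a + b w\<close> primitive at
  \<open>g\<close>; for a single polynomial the pair repeats it.\<close>

lemma poly_extract_power:
  fixes g :: "'a::field poly"
  assumes g: "degree g > 0" and nz: "a \<noteq> 0 \<or> b \<noteq> 0"
  obtains n a' b' where "a = g ^ n * a'" "b = g ^ n * b'" "\<not> (g dvd a' \<and> g dvd b')"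
  using nz
proof (induction "degree a + degree b" arbitrary: a b thesis rule: less_induct)
  case less
  show ?case
  proof (cases "g dvd a \<and> g dvd b")
    case False
    then show ?thesis using less.prems(1)[of 0 a b] by simp
  next
    case True
    then obtain a1 b1 where ab: "a = g * a1" "b = g * b1" by (auto elim!: dvdE)
    have g0: "g \<noteq> 0" using g by auto
    have "degree a1 \<le> degree a" "degree b1 \<le> degree b"
      using ab g0 by (cases "a1 = 0"; cases "b1 = 0"; simp add: degree_mult_eq)+
    moreover have "degree a1 < degree a \<or> degree b1 < degree b"
      using ab g g0 less.prems(2) by (cases "a1 = 0"; cases "b1 = 0"; simp add: degree_mult_eq)
    ultimately have lt: "degree a1 + degree b1 < degree a + degree b" by linarith
    have nz1: "a1 \<noteq> 0 \<or> b1 \<noteq> 0" using ab less.prems(2) by auto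
    obtain n a' b' where "a1 = g ^ n * a'" "b1 = g ^ n * b'" "\<not> (g dvd a' \<and> g dvd b')"
      using less.hyps[OF lt _ nz1] by blast
    then show ?thesis using less.prems(1)[of "Suc n" a' b'] ab by simp
  qed
qed

section \<open>Quadratic extensions of a rational function field and their finite places\<close>

text \<open>The field \<open>k(u, w)\<close> with \<open>w^2 = f(u)\<close>; by
  \<open>w_notin\<close> the function \<open>w\<close> is not rational in \<open>u\<close>. As
  \<open>f\<close> is squarefree, \<open>k[u, w]\<close> is integrally closed, so that its primes
  carry discrete valuations. The locale is used twice: for the cubic, and for the quartic that
  describes the neighbourhood of infinity.\<close>

locale quad =
  fixes u w :: "'k::field_char_0 funs" and f :: "'k poly"
  assumes trans: "evf u q = 0 \<Longrightarrow> q = 0"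
    and w2: "w * w = evf u f"
    and sqfree: "irreducible g \<Longrightarrow> \<not> g * g dvd f"
    and w_notin: "evf u c * w = evf u a \<Longrightarrow> c = 0"
begin

lemma evf_eq_iff [simp]: "evf u p = evf u q \<longleftrightarrow> p = q"
  using trans[of "p - q"] by auto

lemma evf_eq_0_iff [simp]: "evf u p = 0 \<longleftrightarrow> p = 0"
  using trans[of p] by auto

definition el :: "'k poly \<Rightarrow> 'k poly \<Rightarrow> 'k funs" where "el a b = evf u a + evf u b * w"

definition nrm :: "'k poly \<Rightarrow> 'k poly \<Rightarrow> 'k poly" where "nrm a b = a * a - b * b * f"

definition R :: "'k funs set" where "R = {el a b |a b. True}"

definition FF :: "'k funs set" where "FF = {el a b / evf u c |a b c. c \<noteq> 0}"

lemma el_eq_iff [simp]: "el a b = el a' b' \<longleftrightarrow> a = a' \<and> b = b'"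
proof
  assume "el a b = el a' b'"
  then have "evf u (b - b') * w = evf u (a' - a)" by (simp add: el_def algebra_simps)
  then have "b - b' = 0" by (rule w_notin)
  with \<open>el a b = el a' b'\<close> show "a = a' \<and> b = b'" by (simp add: el_def)
qed simp

lemma el_0: "el 0 0 = 0" and el_1: "el 1 0 = 1" and el_poly: "el a 0 = evf u a" and el_w: "el 0 1 = w"
  by (simp_all add: el_def)

lemma el_eq_0_iff [simp]: "el a b = 0 \<longleftrightarrow> a = 0 \<and> b = 0"
  using el_eq_iff[of a b 0 0] by (simp add: el_0)

lemma el_add: "el a b + el a' b' = el (a + a') (b + b')"
  by (simp add: el_def algebra_simps)

lemma el_uminus: "- el a b = el (- a) (- b)"
  by (simp add: el_def algebra_simps)

lemma el_mult: "el a b * el a' b' = el (a * a' + b * b' * f) (a * b' + a' * b)"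
proof -
  have "el a b * el a' b' = evf u a * evf u a' + evf u b * evf u b' * (w * w)
      + (evf u a * evf u b' + evf u a' * evf u b) * w"
    by (simp add: el_def algebra_simps)
  then show ?thesis unfolding w2 by (simp add: el_def algebra_simps)
qed

lemma el_smult: "evf u c * el a b = el (c * a) (c * b)"
  by (simp add: el_def algebra_simps)

lemma el_conj: "el a b * el a (- b) = evf u (nrm a b)"
  unfolding el_mult nrm_def el_poly[symmetric] by simp

lemma nrm_eq_0_iff [simp]: "nrm a b = 0 \<longleftrightarrow> a = 0 \<and> b = 0"
proof
  assume "nrm a b = 0"
  then have "el a b * el a (- b) = 0" by (simp add: el_conj)
  then show "a = 0 \<and> b = 0" by auto
qed (simp add: nrm_def)

lemma nrm_uminus: "nrm a (- b) = nrm a b"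
  by (simp add: nrm_def)

lemma FFI: "c \<noteq> 0 \<Longrightarrow> el a b / evf u c \<in> FF" by (auto simp: FF_def)

lemma FFE:
  assumes "x \<in> FF" obtains a b c where "c \<noteq> 0" "x = el a b / evf u c"
  using assms by (auto simp: FF_def)

lemma R_FF: "R \<subseteq> FF"
  unfolding R_def using FFI[of 1] by auto

lemma el_R [simp]: "el a b \<in> R" by (auto simp: R_def)

lemma evf_R [simp]: "evf u a \<in> R" using el_R[of a 0] by (simp only: el_poly)

lemma w_R [simp]: "w \<in> R" using el_R[of 0 1] by (simp only: el_w)

lemma w_nz: "w \<noteq> 0" using el_eq_0_iff[of 0 1] by (simp add: el_w)

lemma f_nz: "f \<noteq> 0" using w2 w_nz by auto

lemma FF_field: "field_set FF"
  unfolding field_set_def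
proof (intro conjI ballI)
  show "1 \<in> FF" using FFI[of 1 1 0] by (simp add: el_1)
  fix x assume x: "x \<in> FF"
  then obtain a b c where abc: "c \<noteq> 0" "x = el a b / evf u c" by (rule FFE)
  show "- x \<in> FF" using FFI[OF abc(1), of "- a" "- b"] abc by (simp add: el_uminus[symmetric])
  show "inverse x \<in> FF"
  proof (cases "x = 0")
    case True
    then show ?thesis using FFI[of 1 0 0] by (simp add: el_0)
  next
    case False
    then have nz: "el a b \<noteq> 0" "el a (- b) \<noteq> 0" using abc by auto
    have "inverse x = evf u c * el a (- b) / (el a b * el a (- b))"
      unfolding abc(2) using nz abc(1) by simp
    also have "\<dots> = el (c * a) (c * - b) / evf u (nrm a b)"
      by (simp only: el_conj el_smult)
    also have "\<dots> \<in> FF" using nz by (intro FFI) auto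
    finally show ?thesis .
  qed
  fix y assume y: "y \<in> FF"
  then obtain a' b' c' where abc': "c' \<noteq> 0" "y = el a' b' / evf u c'" by (rule FFE)
  have "x + y = el (c' * a + c * a') (c' * b + c * b') / evf u (c * c')"
    unfolding abc(2) abc'(2) using abc(1) abc'(1) by (simp add: el_def field_simps)
  also have "\<dots> \<in> FF" using abc abc' by (intro FFI) auto
  finally show "x + y \<in> FF" .
  have "x * y = (el a b * el a' b') / evf u (c * c')" unfolding abc(2) abc'(2) by simp
  also have "\<dots> \<in> FF" unfolding el_mult using abc abc' by (intro FFI) auto
  finally show "x * y \<in> FF" .
qed

lemma R_ring:
  "const_fun c \<in> R" "x \<in> R \<Longrightarrow> y \<in> R \<Longrightarrow> x + y \<in> R" "x \<in> R \<Longrightarrow> y \<in> R \<Longrightarrow> x * y \<in> R"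
proof -
  show "const_fun c \<in> R" using evf_R[of "[:c:]"] by simp
  show "x \<in> R \<Longrightarrow> y \<in> R \<Longrightarrow> x + y \<in> R" by (auto simp: R_def el_add)
  show "x \<in> R \<Longrightarrow> y \<in> R \<Longrightarrow> x * y \<in> R" unfolding R_def using el_mult by blast
qed

text \<open>The kernel of the map from \<open>k[u, w]\<close> to \<open>k[u]/(g)\<close> that sends
  \<open>w\<close> to \<open>h\<close>, where \<open>h\<close> is a square root of \<open>f\<close>
  modulo \<open>g\<close>.\<close>

definition ph :: "'k poly \<Rightarrow> 'k poly \<Rightarrow> 'k funs set" where "ph g h = {el a b |a b. g dvd a + b * h}"

text \<open>The ideal generated by \<open>g\<close>, which is prime if \<open>f\<close> is not a
  square modulo \<open>g\<close>.\<close>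

definition pin :: "'k poly \<Rightarrow> 'k funs set" where "pin g = {el a b |a b. g dvd a \<and> g dvd b}"

lemma el_ph [simp]: "el a b \<in> ph g h \<longleftrightarrow> g dvd a + b * h"
  by (auto simp: ph_def)

lemma evf_ph [simp]: "evf u a \<in> ph g h \<longleftrightarrow> g dvd a"
  using el_ph[of a 0 g h] by (simp add: el_poly)

lemma w_ph [simp]: "w \<in> ph g h \<longleftrightarrow> g dvd h"
  using el_ph[of 0 1 g h] by (simp add: el_w)

lemma el_pin [simp]: "el a b \<in> pin g \<longleftrightarrow> g dvd a \<and> g dvd b"
  by (auto simp: pin_def)

lemma evf_pin [simp]: "evf u a \<in> pin g \<longleftrightarrow> g dvd a"
  using el_pin[of a 0 g] by (simp add: el_poly)

text \<open>The factorization demanded by \<open>dvr_center\<close>, as a property that passes to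
  products, inverses and powers.\<close>

definition fct :: "'k funs set \<Rightarrow> 'k funs \<Rightarrow> 'k funs \<Rightarrow> bool" where
  "fct p \<pi> x \<longleftrightarrow> (\<exists>n. \<exists>s\<in>R - p. \<exists>s'\<in>R - p. x = \<pi> powi n * (s / s'))"

context
  fixes p :: "'k funs set" and \<pi> :: "'k funs"
  assumes prime: "\<forall>x\<in>R - p. \<forall>y\<in>R - p. x * y \<in> R - p"
    and one: "1 \<notin> p" and pi: "\<pi> \<noteq> 0" and zero: "0 \<in> p"
begin

lemma fctI: "s \<in> R - p \<Longrightarrow> s' \<in> R - p \<Longrightarrow> x = \<pi> powi n * (s / s') \<Longrightarrow> fct p \<pi> x"
  unfolding fct_def by blast

lemma fct_unit: "s \<in> R - p \<Longrightarrow> fct p \<pi> s"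
  using fctI[of s 1 s 0] one evf_R[of 1] by simp

lemma fct_pi: "fct p \<pi> \<pi>"
  using fctI[of 1 1 \<pi> 1] one evf_R[of 1] by simp

lemma fct_mult: "fct p \<pi> x \<Longrightarrow> fct p \<pi> y \<Longrightarrow> fct p \<pi> (x * y)"
proof -
  assume "fct p \<pi> x" "fct p \<pi> y"
  then obtain n s s' m t t' where *: "s \<in> R - p" "s' \<in> R - p" "t \<in> R - p" "t' \<in> R - p"
    "x = \<pi> powi n * (s / s')" "y = \<pi> powi m * (t / t')"
    unfolding fct_def by blast
  have "\<pi> powi (n + m) = \<pi> powi n * \<pi> powi m" using pi by (intro power_int_add) auto
  then have "x * y = \<pi> powi (n + m) * ((s * t) / (s' * t'))"
    unfolding *(5,6) by simp
  with bspec[OF bspec[OF prime *(1)] *(3)] bspec[OF bspec[OF prime *(2)] *(4)] show ?thesis by (rule fctI)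
qed

lemma fct_inverse: "fct p \<pi> x \<Longrightarrow> fct p \<pi> (inverse x)"
proof -
  assume "fct p \<pi> x"
  then obtain n s s' where *: "s \<in> R - p" "s' \<in> R - p" "x = \<pi> powi n * (s / s')"
    unfolding fct_def by blast
  then have "inverse x = \<pi> powi (- n) * (s' / s)" by (simp add: power_int_minus divide_inverse mult_ac)
  with *(2,1) show ?thesis by (rule fctI)
qed

lemma fct_divide: "fct p \<pi> x \<Longrightarrow> fct p \<pi> y \<Longrightarrow> fct p \<pi> (x / y)"
  unfolding divide_inverse by (intro fct_mult fct_inverse)

lemma fct_power: "fct p \<pi> x \<Longrightarrow> fct p \<pi> (x ^ n)"
  using fct_unit[of 1] one evf_R[of 1] by (induction n) (auto intro: fct_mult)

text \<open>Once the common power of \<open>g\<close> is removed from \<open>a\<close> and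
  \<open>b\<close>, it suffices to factor \<open>g\<close> itself and the primitive
  elements.\<close>

lemma fct_all:
  assumes g: "degree g > 0" "fct p \<pi> (evf u g)"
    and prim: "\<And>a b. \<not> (g dvd a \<and> g dvd b) \<Longrightarrow> fct p \<pi> (el a b)"
    and x: "x \<in> FF" "x \<noteq> 0"
  shows "fct p \<pi> x"
proof -
  have *: "fct p \<pi> (el a b)" if nz: "a \<noteq> 0 \<or> b \<noteq> 0" for a b
  proof -
    obtain n a' b' where ab: "a = g ^ n * a'" "b = g ^ n * b'" "\<not> (g dvd a' \<and> g dvd b')"
      using poly_extract_power[OF g(1) nz] .
    then have "el a b = evf u g ^ n * el a' b'" by (simp add: el_smult flip: evf_power)
    with fct_mult[OF fct_power[OF g(2)] prim[OF ab(3)]] show ?thesis by simp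
  qed
  obtain a b c where abc: "c \<noteq> 0" "x = el a b / evf u c" using FFE[OF x(1)] .
  have "a \<noteq> 0 \<or> b \<noteq> 0" using abc x(2) by auto
  then have "fct p \<pi> (el a b)" "fct p \<pi> (evf u c)" using *[of c 0] *[of a b] abc(1) by (auto simp: el_poly)
  then show ?thesis unfolding abc(2) by (rule fct_divide)
qed

end

text \<open>Over a divisor \<open>g\<close> of \<open>f\<close> the extension is ramified:
  \<open>g\<close> has order two there and \<open>w\<close> has order one.\<close>

definition unif :: "'k poly \<Rightarrow> 'k funs" where "unif g = (if g dvd f then w else evf u g)"

definition root_mod :: "'k poly \<Rightarrow> 'k poly \<Rightarrow> bool" where
  "root_mod g h \<longleftrightarrow> irreducible g \<and> g dvd h * h - f"

lemma root_mod_uminus: "root_mod g h \<Longrightarrow> root_mod g (- h)"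
  by (simp add: root_mod_def)

lemma root_mod_dvd_iff:
  assumes "root_mod g h" shows "g dvd f \<longleftrightarrow> g dvd h"
proof -
  have g: "irreducible g" "g dvd h * h - f" using assms by (auto simp: root_mod_def)
  have "g dvd f \<longleftrightarrow> g dvd f + (h * h - f)" using g(2) by (simp only: dvd_add_left_iff)
  also have "f + (h * h - f) = h * h" by simp
  finally have "g dvd f \<longleftrightarrow> g dvd h * h" .
  then show ?thesis using irreducible_poly_dvd_mult_iff[OF g(1)] by blast
qed

lemma ph_hom:
  assumes "root_mod g h"
  shows "el a b * el a' b' \<in> ph g h \<longleftrightarrow> g dvd (a + b * h) * (a' + b' * h)"
proof -
  have "(a + b * h) * (a' + b' * h) = (a * a' + b * b' * f + (a * b' + a' * b) * h) + b * b' * (h * h - f)"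
    by (simp add: algebra_simps)
  moreover have "g dvd b * b' * (h * h - f)" using assms by (simp add: root_mod_def)
  ultimately show ?thesis by (simp add: el_mult dvd_add_left_iff)
qed

lemma two_unit: "irreducible (g :: 'k poly) \<Longrightarrow> g dvd 2 * a \<longleftrightarrow> g dvd a"
  using irreducible_not_dvd_const[of g 2] irreducible_poly_dvd_mult_iff[of g "[:2:]" a]
  by (simp add: numeral_poly)

text \<open>If \<open>f = g c\<close>, then \<open>c\<close> is prime to \<open>g\<close> since
  \<open>f\<close> is squarefree, so \<open>g = w^2 / c\<close>, and \<open>w\<close> can be split
  off from a primitive \<open>a + b w\<close> with \<open>g\<close> dividing \<open>a\<close>. If
  \<open>g\<close> does not divide \<open>f\<close>, a primitive element and its conjugate are not
  both in the ideal; the norm is a power of \<open>g\<close> times a unit, and dividing it by the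
  conjugate factors the element.\<close>

lemma center_ph:
  assumes gh: "root_mod g h"
  shows "dvr_center FF R (ph g h) (unif g)"
proof -
  have g: "irreducible g" "g dvd h * h - f" using gh by (auto simp: root_mod_def)
  have dg: "degree g > 0" "g \<noteq> 0" using irreducible_poly_degree[OF g(1)] by auto
  have ng1: "\<not> g dvd 1" using g(1) by (auto simp: comm_semiring_1_class.irreducible_def)
  have prime: "x * y \<in> R - ph g h" if "x \<in> R - ph g h" "y \<in> R - ph g h" for x y
  proof -
    from that obtain a b a' b' where "x = el a b" "y = el a' b'" by (auto simp: R_def)
    with that show ?thesis
      by (simp add: ph_hom[OF gh] irreducible_poly_dvd_mult_iff[OF g(1)] R_ring)
  qed
  then have prime': "\<forall>x\<in>R - ph g h. \<forall>y\<in>R - ph g h. x * y \<in> R - ph g h" by blast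
  have one: "1 \<notin> ph g h" using evf_ph[of 1 g h] ng1 by simp
  have zero: "0 \<in> ph g h" using evf_ph[of 0 g h] by simp
  have unz: "unif g \<noteq> 0" using dg w_nz by (simp add: unif_def)
  note fct = fct_unit[OF prime' one unz zero] fct_mult[OF prime' one unz zero] fct_divide[OF prime' one unz zero]
    fct_power[OF prime' one unz zero] fct_pi[OF prime' one unz zero] fct_all[OF prime' one unz zero]
  have fgp: "fct (ph g h) (unif g) (evf u g) \<and> (\<forall>a b. \<not> (g dvd a \<and> g dvd b) \<longrightarrow> fct (ph g h) (unif g) (el a b))"
  proof (cases "g dvd f")
    case True
    then have h: "g dvd h" using root_mod_dvd_iff[OF gh] by simp
    obtain c where c: "f = g * c" using True by (auto elim: dvdE)
    have nc: "\<not> g dvd c" using sqfree[OF g(1)] c by (auto simp: dvd_def)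
    then have c0: "c \<noteq> 0" by auto
    have fc: "fct (ph g h) (unif g) (evf u c)" using nc by (intro fct) auto
    have fw: "fct (ph g h) (unif g) w" using True fct(5) by (simp add: unif_def)
    have "evf u c \<noteq> 0" using c0 by simp
    then have eq: "evf u g = w * w / evf u c"
      unfolding w2 c(1) evf_mult by (rule nonzero_mult_div_cancel_right[symmetric])
    have 1: "fct (ph g h) (unif g) (evf u g)" unfolding eq by (rule fct(3)[OF fct(2)[OF fw fw] fc])
    moreover have "fct (ph g h) (unif g) (el a b)" if nd: "\<not> (g dvd a \<and> g dvd b)" for a b
    proof (cases "g dvd a")
      case False
      then show ?thesis using h by (intro fct(1)) (auto simp: dvd_add_left_iff)
    next
      case a: True
      then have nb: "\<not> g dvd b" using nd by blast
      obtain a' where a': "a = g * a'" using a by (auto elim: dvdE)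
      have "w * el (b * c) a' = el 0 1 * el (b * c) a'" by (simp add: el_w)
      also have "\<dots> = evf u c * el a b" by (simp add: el_mult el_smult a' c mult_ac)
      finally have eq: "el a b = w * el (b * c) a' / evf u c" using c0 by (simp add: eq_divide_eq mult.commute)
      have "fct (ph g h) (unif g) (el (b * c) a')"
        using h nb nc by (intro fct(1)) (auto simp: dvd_add_left_iff irreducible_poly_dvd_mult_iff[OF g(1)])
      then show ?thesis unfolding eq by (rule fct(3)[OF fct(2)[OF fw] fc])
    qed
    ultimately show ?thesis by blast
  next
    case nf: False
    then have nh: "\<not> g dvd h" using root_mod_dvd_iff[OF gh] by simp
    have 1: "fct (ph g h) (unif g) (evf u g)" using nf fct(5) by (simp add: unif_def)
    moreover have "fct (ph g h) (unif g) (el a b)" if nd: "\<not> (g dvd a \<and> g dvd b)" for a b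
    proof (cases "g dvd a + b * h")
      case False
      then show ?thesis by (intro fct(1)) auto
    next
      case T: True
      have nc: "\<not> g dvd a + (- b) * h"
      proof
        assume c: "g dvd a + (- b) * h"
        have "g dvd (a + b * h) - (a + (- b) * h)" using T c by (rule dvd_diff)
        then have "g dvd 2 * (b * h)" by (simp add: algebra_simps)
        then have "g dvd b * h" by (simp only: two_unit[OF g(1)])
        then have b: "g dvd b" using nh by (simp add: irreducible_poly_dvd_mult_iff[OF g(1)])
        then have "g dvd a" using T by (simp add: dvd_add_left_iff)
        with b nd show False by blast
      qed
      have ab: "a \<noteq> 0 \<or> b \<noteq> 0" using nd by auto
      then have N: "nrm a b \<noteq> 0" by auto
      obtain n c where c: "nrm a b = g ^ n * c" "\<not> g dvd c"
        using poly_extract_power[OF dg(1), of "nrm a b" "nrm a b"] N by (metis)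
      have eq: "el a b = evf u g ^ n * evf u c / el a (- b)"
      proof -
        have "el a b * el a (- b) = evf u g ^ n * evf u c" by (simp add: el_conj c(1))
        moreover have "el a (- b) \<noteq> 0" using ab by simp
        ultimately show ?thesis by (simp only: eq_divide_eq not_False_eq_True if_True)
      qed
      have "fct (ph g h) (unif g) (evf u c)" using c(2) by (intro fct(1)) auto
      moreover have "fct (ph g h) (unif g) (el a (- b))" using nc by (intro fct(1)) auto
      ultimately show ?thesis unfolding eq by (rule fct(3)[OF fct(2)[OF fct(4)[OF 1]]])
    qed
    ultimately show ?thesis by blast
  qed
  show ?thesis
  proof
    show "field_set FF" by (rule FF_field)
    show "ph g h \<subseteq> R" by (auto simp: ph_def)
    show "unif g \<in> ph g h" using root_mod_dvd_iff[OF gh] by (simp add: unif_def)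
    show "x * y \<in> ph g h" if "x \<in> R" "y \<in> ph g h" for x y
    proof -
      from that obtain a b a' b' where "x = el a b" "y = el a' b'" "g dvd a' + b' * h"
        by (auto simp: R_def ph_def)
      then show ?thesis by (simp add: ph_hom[OF gh])
    qed
    show "\<exists>n. \<exists>s\<in>R - ph g h. \<exists>s'\<in>R - ph g h. x = unif g powi n * (s / s')" if "x \<in> FF" "x \<noteq> 0" for x
      using fct(6)[OF dg(1) conjunct1[OF fgp] _ that] fgp unfolding fct_def by blast
  qed (use R_FF R_ring one prime unz in auto)
qed

text \<open>If \<open>g\<close> divides the norm but not \<open>b\<close>, then \<open>a / b\<close>
  modulo \<open>g\<close> is a square root of \<open>f\<close>.\<close>

lemma inert_nrm:
  assumes g: "irreducible g" and inert: "\<And>h. \<not> root_mod g h"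
  shows "g dvd nrm a b \<longleftrightarrow> g dvd a \<and> g dvd b"
proof
  assume N: "g dvd nrm a b"
  have b: "g dvd b"
  proof (rule ccontr)
    assume "\<not> g dvd b"
    with g obtain x y where xy: "x * b + y * g = 1" by (rule irreducible_bezout)
    have "x * a * (x * a) - f = x * x * nrm a b + (x * b * (x * b) - 1) * f"
      by (simp add: nrm_def algebra_simps)
    also have "x * b * (x * b) - 1 = - g * (y * (x * b + 1))"
    proof -
      have e: "x * b = 1 - y * g" using xy by (simp add: algebra_simps)
      show ?thesis unfolding e by (simp add: algebra_simps)
    qed
    finally have "g dvd x * a * (x * a) - f" using N by (simp add: mult.assoc)
    then have "root_mod g (x * a)" using g by (simp add: root_mod_def)
    with inert show False by blast
  qed
  have "g dvd nrm a b + b * b * f" using N b by simp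
  then have "g dvd a * a" by (simp add: nrm_def)
  with b show "g dvd a \<and> g dvd b" using irreducible_poly_dvd_mult_iff[OF g] by blast
qed (auto simp: nrm_def)

lemma nrm_mult:
  "nrm (a * a' + b * b' * f) (a * b' + a' * b) = nrm a b * nrm a' b'"
  by (simp add: nrm_def algebra_simps)

text \<open>The norm is multiplicative and detects membership in \<open>pin g\<close>, which makes
  the ideal prime. Primitive elements lie outside it, so \<open>g\<close> is a uniformizer.\<close>

lemma center_pin:
  assumes g: "irreducible g" and inert: "\<And>h. \<not> root_mod g h"
  shows "dvr_center FF R (pin g) (evf u g)"
proof -
  have dg: "degree g > 0" "g \<noteq> 0" using irreducible_poly_degree[OF g(1)] by auto
  have ng1: "\<not> g dvd 1" using g(1) by (auto simp: comm_semiring_1_class.irreducible_def)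
  have prime: "x * y \<in> R - pin g" if "x \<in> R - pin g" "y \<in> R - pin g" for x y
  proof -
    from that obtain a b a' b' where xy: "x = el a b" "y = el a' b'" by (auto simp: R_def)
    with that have "\<not> g dvd nrm a b" "\<not> g dvd nrm a' b'" using inert_nrm[OF g inert] by auto
    then have "\<not> g dvd nrm a b * nrm a' b'" by (simp add: irreducible_poly_dvd_mult_iff[OF g])
    then have "\<not> (g dvd a * a' + b * b' * f \<and> g dvd a * b' + a' * b)"
      unfolding nrm_mult[symmetric] using inert_nrm[OF g inert] by blast
    then show ?thesis unfolding xy el_mult by simp
  qed
  then have prime': "\<forall>x\<in>R - pin g. \<forall>y\<in>R - pin g. x * y \<in> R - pin g" by blast
  have one: "1 \<notin> pin g" using evf_pin[of 1 g] ng1 by simp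
  have zero: "0 \<in> pin g" using evf_pin[of 0 g] by simp
  have unz: "evf u g \<noteq> 0" using dg by simp
  show ?thesis
  proof
    show "field_set FF" by (rule FF_field)
    show "pin g \<subseteq> R" by (auto simp: pin_def)
    show "evf u g \<in> pin g" by simp
    show "x * y \<in> pin g" if "x \<in> R" "y \<in> pin g" for x y
    proof -
      from that obtain a b a' b' where "x = el a b" "y = el a' b'" "g dvd a'" "g dvd b'"
        by (auto simp: R_def pin_def)
      then show ?thesis by (simp add: el_mult)
    qed
    show "\<exists>n. \<exists>s\<in>R - pin g. \<exists>s'\<in>R - pin g. x = evf u g powi n * (s / s')" if "x \<in> FF" "x \<noteq> 0" for x
    proof -
      have "fct (pin g) (evf u g) x"
        using fct_all[OF prime' one unz zero dg(1) fct_pi[OF prime' one unz zero] _ that]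
          fct_unit[OF prime' one unz zero] by simp
      then show ?thesis unfolding fct_def .
    qed
  qed (use R_FF R_ring one prime unz in auto)
qed

definition VH :: "'k poly \<Rightarrow> 'k poly \<Rightarrow> 'k funs set" where "VH g h = dvr_center.V R (ph g h)"

definition VI :: "'k poly \<Rightarrow> 'k funs set" where "VI g = dvr_center.V R (pin g)"

text \<open>The function \<open>w\<close> is integral over \<open>k[u]\<close>: if it were missing
  from \<open>V\<close>, then \<open>V\<close> would contain \<open>1 / w\<close> and hence
  \<open>f(u) / w = w\<close>.\<close>

lemma R_sub_place:
  assumes V: "V \<in> places FF" and u: "u \<in> V"
  shows "R \<subseteq> V"
proof
  have e: "evf u p \<in> V" for p
    by (induction p) (auto intro!: placeD(2,3,4,6)[OF V] u)
  have "w \<in> V"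
  proof (rule ccontr)
    assume w: "w \<notin> V"
    then have "inverse w \<in> V" using placeD(9)[OF V] w_R R_FF by blast
    then have "evf u f * inverse w \<in> V" by (intro placeD(4)[OF V] e)
    moreover have "evf u f * inverse w = w" using w_nz by (simp add: w2[symmetric])
    ultimately show False using w by simp
  qed
  then show "x \<in> V" if "x \<in> R" for x
    using that by (auto simp: R_def el_def intro!: placeD(3,4)[OF V] e)
qed

lemma evf_ideal_iff:
  assumes V: "V \<in> places FF" and u: "u \<in> V" and g: "irreducible g" "evf u g \<in> place_ideal V"
  shows "evf u a \<in> place_ideal V \<longleftrightarrow> g dvd a"
proof
  have RV: "\<And>x. evf u x \<in> V" using R_sub_place[OF V u] by auto
  show "evf u a \<in> place_ideal V" if "g dvd a"
    using that place_ideal_mult[OF V RV g(2)] by (auto elim!: dvdE simp: mult.commute)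
  show "g dvd a" if a: "evf u a \<in> place_ideal V"
  proof (rule ccontr)
    assume "\<not> g dvd a"
    with g(1) obtain x y where "x * a + y * g = 1" by (rule irreducible_bezout)
    then have "evf u x * evf u a + evf u y * evf u g = 1" by (simp flip: evf_mult evf_add)
    moreover have "evf u x * evf u a + evf u y * evf u g \<in> place_ideal V"
      by (intro place_ideal_add[OF FF_field V] place_ideal_mult[OF V RV] a g(2))
    ultimately show False using one_notin_place_ideal[OF V] by simp
  qed
qed

text \<open>If no nonzero polynomial in \<open>u\<close> vanished at \<open>V\<close>, all
  denominators would be units and \<open>V\<close> would be the whole field. A polynomial that
  vanishes has an irreducible factor that does.\<close>

lemma place_over_irreducible:
  assumes V: "V \<in> places FF" and u: "u \<in> V"
  obtains g where "irreducible g" "evf u g \<in> place_ideal V"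
proof -
  have RV: "\<And>x. evf u x \<in> V" "R \<subseteq> V" using R_sub_place[OF V u] by auto
  have "\<exists>q. q \<noteq> 0 \<and> evf u q \<in> place_ideal V"
  proof (rule ccontr)
    assume "\<not> ?thesis"
    then have "inverse (evf u q) \<in> V" if "q \<noteq> 0" for q
      using that RV(1)[of q] by (auto simp: place_ideal_iff)
    then have "FF \<subseteq> V"
      using RV(2) by (auto simp: FF_def divide_inverse intro!: placeD(4)[OF V])
    with placeD(7,8)[OF V] show False by blast
  qed
  then obtain q where q: "q \<noteq> 0" "evf u q \<in> place_ideal V" by blast
  from q have "\<exists>g. irreducible g \<and> evf u g \<in> place_ideal V"
  proof (induction "degree q" arbitrary: q rule: less_induct)
    case less
    show ?case
    proof (cases "degree q = 0")
      case True
      then obtain c where "q = [:c:]" by (auto elim: degree_eq_zeroE)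
      with less.prems const_notin_place_ideal[OF V, of c] show ?thesis by auto
    next
      case False
      then obtain g where g: "irreducible g" "g dvd q" using poly_irreducible_factor by blast
      then obtain r where r: "q = g * r" by (auto elim: dvdE)
      have "evf u g * evf u r \<in> place_ideal V" using less.prems r by simp
      then have "evf u g \<in> place_ideal V \<or> evf u r \<in> place_ideal V"
        by (intro place_ideal_prime[OF V] RV)
      moreover have "degree r < degree q"
        using r less.prems irreducible_poly_degree[OF g(1)] by (auto simp: degree_mult_eq)
      ultimately show ?thesis using g(1) less.hyps[of r] less.prems r by auto
    qed
  qed
  with that show ?thesis by blast
qed

text \<open>Either \<open>w\<close> is congruent to some \<open>h(u)\<close> modulo the place, and
  then \<open>h\<close> is a root of \<open>f\<close> modulo \<open>g\<close>; or there is no such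
  root, because \<open>h^2 - w^2\<close> would split into two factors one of which vanishes at
  \<open>V\<close>. In both cases the centre on \<open>k[u, w]\<close> is known, and it determines
  the place.\<close>

lemma place_classify:
  assumes V: "V \<in> places FF" and u: "u \<in> V" and g: "irreducible g" "evf u g \<in> place_ideal V"
  shows "(\<exists>h. root_mod g h \<and> V = VH g h) \<or> ((\<forall>h. \<not> root_mod g h) \<and> V = VI g)"
proof -
  note RV = R_sub_place[OF V u]
  have RVe: "\<And>x. evf u x \<in> V" "\<And>a b. el a b \<in> V" using RV by auto
  note ev = evf_ideal_iff[OF V u g]
  show ?thesis
  proof (cases "\<exists>h. w - evf u h \<in> place_ideal V")
    case True
    then obtain h where h: "w - evf u h \<in> place_ideal V" by blast
    have "(w + evf u h) * (w - evf u h) \<in> place_ideal V"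
      by (intro place_ideal_mult[OF V _ h] placeD(3)[OF V] subsetD[OF RV] w_R evf_R)
    also have "(w + evf u h) * (w - evf u h) = evf u (f - h * h)" by (simp add: algebra_simps w2)
    finally have "g dvd f - h * h" using ev by blast
    then have gh: "root_mod g h" using g by (simp add: root_mod_def dvd_diff_commute)
    interpret dvr_center FF R "ph g h" "unif g" by (rule center_ph[OF gh])
    have "el a b \<in> place_ideal V \<longleftrightarrow> g dvd a + b * h" for a b
    proof -
      have i: "evf u b * (w - evf u h) \<in> place_ideal V" by (intro place_ideal_mult[OF V _ h] RVe)
      have e: "el a b = evf u (a + b * h) + evf u b * (w - evf u h)" by (simp add: el_def algebra_simps)
      show ?thesis
        using place_ideal_add[OF FF_field V _ i, of "evf u (a + b * h)"]
          place_ideal_diff[OF FF_field V _ i, of "el a b"] ev[of "a + b * h"] unfolding e by auto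
    qed
    then have "R \<inter> place_ideal V = ph g h" by (auto simp: R_def ph_def)
    then have "V = VH g h" unfolding VH_def using unique[OF V RV] by blast
    with gh show ?thesis by blast
  next
    case False
    have inert: "\<not> root_mod g h" for h
    proof
      assume "root_mod g h"
      then have "evf u (h * h - f) \<in> place_ideal V" unfolding root_mod_def using ev by blast
      also have "evf u (h * h - f) = (evf u h - w) * (evf u h + w)" by (simp add: algebra_simps w2)
      finally have "evf u h - w \<in> place_ideal V \<or> evf u h + w \<in> place_ideal V"
        by (intro place_ideal_prime[OF V] placeD(3,10)[OF V] subsetD[OF RV] w_R evf_R)
      then have "w - evf u h \<in> place_ideal V \<or> w - evf u (- h) \<in> place_ideal V"
        using place_ideal_uminus[OF V, of "evf u h - w"] by (auto simp: add.commute)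
      with False show False by blast
    qed
    interpret dvr_center FF R "pin g" "evf u g" by (rule center_pin[OF g(1) inert])
    have "el a b \<in> place_ideal V \<longleftrightarrow> g dvd a \<and> g dvd b" for a b
    proof
      assume i: "el a b \<in> place_ideal V"
      have b: "g dvd b"
      proof (rule ccontr)
        assume "\<not> g dvd b"
        with g(1) obtain x y where xy: "x * b + y * g = 1" by (rule irreducible_bezout)
        have "evf u x * el a b + evf u y * w * evf u g \<in> place_ideal V"
          using RV by (intro place_ideal_add[OF FF_field V] place_ideal_mult[OF V _ i]
              place_ideal_mult[OF V _ g(2)] placeD(4)[OF V]) auto
        also have "evf u x * el a b + evf u y * w * evf u g = evf u (x * a) + evf u (x * b + y * g) * w"
          by (simp add: el_def algebra_simps)
        also have "\<dots> = w - evf u (- (x * a))" unfolding xy by simp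
        finally show False using False by blast
      qed
      then have "w * evf u b \<in> place_ideal V" using RV ev by (intro place_ideal_mult[OF V]) auto
      from place_ideal_diff[OF FF_field V i this] have "evf u a \<in> place_ideal V"
        by (simp add: el_def mult.commute)
      with b ev show "g dvd a \<and> g dvd b" by blast
    next
      assume "g dvd a \<and> g dvd b"
      then show "el a b \<in> place_ideal V" unfolding el_def using RV ev
        by (subst mult.commute) (intro place_ideal_add[OF FF_field V] place_ideal_mult[OF V]; auto)
    qed
    then have "R \<inter> place_ideal V = pin g" by (auto simp: R_def pin_def)
    then have "V = VI g" unfolding VI_def using unique[OF V RV] by blast
    with inert show ?thesis by blast
  qed
qed

end

section \<open>Conjugation\<close>

context quad
begin

text \<open>The automorphism of \<open>FF\<close> with \<open>w \<mapsto> - w\<close>, read off from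
  a representation; it is meaningful only on \<open>FF\<close>. It serves to reduce the degree of a
  principal divisor to that of a norm, which is a polynomial in \<open>u\<close>.\<close>

definition cj :: "'k funs \<Rightarrow> 'k funs" where
  "cj x = (THE y. \<exists>a b c. c \<noteq> 0 \<and> x = el a b / evf u c \<and> y = el a (- b) / evf u c)"

lemma cj_el [simp]:
  assumes "c \<noteq> 0"
  shows "cj (el a b / evf u c) = el a (- b) / evf u c"
  unfolding cj_def
proof (rule the_equality)
  show "\<exists>a' b' c'. c' \<noteq> 0 \<and> el a b / evf u c = el a' b' / evf u c' \<and> el a (- b) / evf u c = el a' (- b') / evf u c'"
    using assms by blast
next
  fix y assume "\<exists>a' b' c'. c' \<noteq> 0 \<and> el a b / evf u c = el a' b' / evf u c' \<and> y = el a' (- b') / evf u c'"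
  then obtain a' b' c' where *: "c' \<noteq> 0" "el a b / evf u c = el a' b' / evf u c'" "y = el a' (- b') / evf u c'"
    by blast
  from *(1,2) assms have "el a b * evf u c' = el a' b' * evf u c" by (simp add: frac_eq_eq)
  then have "el (c' * a) (c' * b) = el (c * a') (c * b')"
    unfolding el_smult[symmetric] by (simp only: mult.commute[of _ "el a b"] mult.commute[of _ "el a' b'"])
  then have "c' * a = c * a'" "c' * b = c * b'" by simp_all
  then have "el (c' * a) (c' * - b) = el (c * a') (c * - b')" by simp
  then have "el a (- b) * evf u c' = el a' (- b') * evf u c"
    unfolding el_smult[symmetric] by (simp only: mult.commute[of _ "el a (- b)"] mult.commute[of _ "el a' (- b')"])
  then show "y = el a (- b) / evf u c" unfolding *(3) using *(1) assms by (simp add: frac_eq_eq)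
qed

lemma cj_el1 [simp]: "cj (el a b) = el a (- b)"
  using cj_el[of 1 a b] by simp

lemma cj_evf [simp]: "cj (evf u a) = evf u a"
  using cj_el1[of a 0] by (simp add: el_poly)

lemma cj_u [simp]: "cj u = u" using cj_evf[of "[:0, 1:]"] by simp

lemma cj_const [simp]: "cj (const_fun c) = const_fun c"
  using cj_evf[of "[:c:]"] by simp

lemma cj_0 [simp]: "cj 0 = 0" and cj_1 [simp]: "cj 1 = 1"
  using cj_const[of 0] cj_const[of 1] by simp_all

lemma cj_FF: "x \<in> FF \<Longrightarrow> cj x \<in> FF"
  by (erule FFE) (simp add: FFI)

lemma cj_cj: "x \<in> FF \<Longrightarrow> cj (cj x) = x"
  by (erule FFE) simp

lemma cj_add: assumes "x \<in> FF" "y \<in> FF" shows "cj (x + y) = cj x + cj y"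
proof -
  obtain a b c where x: "c \<noteq> 0" "x = el a b / evf u c" using FFE[OF assms(1)] .
  obtain a' b' c' where y: "c' \<noteq> 0" "y = el a' b' / evf u c'" using FFE[OF assms(2)] .
  have *: "el a b / evf u c + el a' b' / evf u c' = el (c' * a + c * a') (c' * b + c * b') / evf u (c * c')"
    for a b a' b' using x(1) y(1) by (simp add: el_def field_simps)
  have "cj (x + y) = el (c' * a + c * a') (- (c' * b + c * b')) / evf u (c * c')"
    unfolding x(2) y(2) * using x(1) y(1) by (intro cj_el) simp
  also have "\<dots> = el (c' * a + c * a') (c' * (- b) + c * (- b')) / evf u (c * c')" by simp
  also have "\<dots> = cj x + cj y" unfolding *[symmetric] x(2) y(2) using x(1) y(1) by simp
  finally show ?thesis .
qed

lemma cj_mult: assumes "x \<in> FF" "y \<in> FF" shows "cj (x * y) = cj x * cj y"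
proof -
  obtain a b c where x: "c \<noteq> 0" "x = el a b / evf u c" using FFE[OF assms(1)] .
  obtain a' b' c' where y: "c' \<noteq> 0" "y = el a' b' / evf u c'" using FFE[OF assms(2)] .
  have *: "el a b / evf u c * (el a' b' / evf u c') =
      el (a * a' + b * b' * f) (a * b' + a' * b) / evf u (c * c')" for a b a' b'
    by (simp only: times_divide_times_eq el_mult evf_mult)
  have "cj (x * y) = el (a * a' + b * b' * f) (- (a * b' + a' * b)) / evf u (c * c')"
    unfolding x(2) y(2) * using x(1) y(1) by (intro cj_el) simp
  also have "\<dots> = el (a * a' + (- b) * (- b') * f) (a * (- b') + a' * (- b)) / evf u (c * c')" by simp
  also have "\<dots> = cj x * cj y" unfolding *[symmetric] x(2) y(2) using x(1) y(1) by simp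
  finally show ?thesis .
qed

lemma cj_uminus: "x \<in> FF \<Longrightarrow> cj (- x) = - cj x"
  using cj_mult[of "const_fun (- 1)" x] cj_const[of "- 1"] R_ring(1)[of "- 1"] R_FF by auto

lemma cj_diff: "x \<in> FF \<Longrightarrow> y \<in> FF \<Longrightarrow> cj (x - y) = cj x - cj y"
  using cj_add[of x "- y"] field_setD(5)[OF FF_field] by (simp add: cj_uminus)

lemma cj_eq_0_iff: "x \<in> FF \<Longrightarrow> cj x = 0 \<longleftrightarrow> x = 0"
  using cj_cj[of x] by auto

lemma cj_inverse: assumes "x \<in> FF" shows "cj (inverse x) = inverse (cj x)"
proof (cases "x = 0")
  case False
  then have "cj x * cj (inverse x) = 1"
    using cj_mult[OF assms field_setD(6)[OF FF_field assms]] by simp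
  then show ?thesis by (rule inverse_unique[symmetric])
qed simp

lemma cj_power: "x \<in> FF \<Longrightarrow> cj (x ^ n) = cj x ^ n"
  by (induction n) (simp_all add: cj_mult field_set_power[OF FF_field])

lemma cj_powi: "x \<in> FF \<Longrightarrow> cj (x powi n) = cj x powi n"
  by (simp add: power_int_def cj_power cj_inverse field_setD(6)[OF FF_field])

lemma cj_sum: "(\<And>b. b \<in> B \<Longrightarrow> h b \<in> FF) \<Longrightarrow> cj (sum h B) = (\<Sum>b\<in>B. cj (h b)) \<and> sum h B \<in> FF"
  by (induction B rule: infinite_finite_induct)
     (auto simp: cj_add intro: field_setD[OF FF_field])

lemma cj_inj: "inj_on cj FF"
  by (rule inj_on_inverseI[of _ cj]) (rule cj_cj)

lemma cj_image_iff: "V \<subseteq> FF \<Longrightarrow> x \<in> FF \<Longrightarrow> x \<in> cj ` V \<longleftrightarrow> cj x \<in> V"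
  using cj_cj[of x] cj_cj by (auto intro!: rev_image_eqI)

lemma cj_image_FF: "cj ` FF = FF"
proof -
  have "x \<in> cj ` FF" if "x \<in> FF" for x
    using cj_image_iff[OF subset_refl that] cj_FF[OF that] by blast
  then show ?thesis using cj_FF by blast
qed

lemma cj_cj_image: "V \<subseteq> FF \<Longrightarrow> cj ` cj ` V = V"
proof -
  assume V: "V \<subseteq> FF"
  have "(\<lambda>x. cj (cj x)) ` V = (\<lambda>x. x) ` V" by (rule image_cong) (use V cj_cj in auto)
  then show ?thesis by (simp add: image_image)
qed

lemma cj_place:
  assumes V: "V \<in> places FF" shows "cj ` V \<in> places FF"
proof -
  have sub: "V \<subseteq> FF" by (rule placeD(7)[OF V])
  then have sub': "cj ` V \<subseteq> FF" by (auto intro: cj_FF)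
  show ?thesis
    unfolding places_iff
  proof (intro conjI ballI)
    show "1 \<in> cj ` V" using placeD(1)[OF V] by force
    show "range const_fun \<subseteq> cj ` V" using placeD(6)[OF V] by (force simp: image_iff)
    have "cj ` V \<noteq> FF"
      using cj_cj_image[OF sub] cj_image_FF placeD(8)[OF V] by auto
    with sub' show "cj ` V \<subset> FF" by blast
    show "x \<in> cj ` V \<or> inverse x \<in> cj ` V" if x: "x \<in> FF" for x
      using placeD(9)[OF V cj_FF[OF x]] x cj_inverse[OF x]
      by (auto simp: cj_image_iff[OF sub] field_setD(6)[OF FF_field])
    fix x assume x: "x \<in> cj ` V"
    then have xF: "x \<in> FF" and xV: "cj x \<in> V" using sub' cj_image_iff[OF sub] by auto
    show "- x \<in> cj ` V" using placeD(5)[OF V xV] xF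
      by (simp add: cj_image_iff[OF sub] field_setD[OF FF_field] cj_uminus)
    fix y assume y: "y \<in> cj ` V"
    then have yF: "y \<in> FF" and yV: "cj y \<in> V" using sub' cj_image_iff[OF sub] by auto
    show "x + y \<in> cj ` V" using placeD(3)[OF V xV yV] xF yF
      by (simp add: cj_image_iff[OF sub] field_setD[OF FF_field] cj_add)
    show "x * y \<in> cj ` V" using placeD(4)[OF V xV yV] xF yF
      by (simp add: cj_image_iff[OF sub] field_setD[OF FF_field] cj_mult)
  qed
qed

lemma cj_units:
  assumes "V \<subseteq> FF" shows "place_units (cj ` V) = cj ` place_units V"
proof -
  have iff: "x \<in> place_units (cj ` V) \<longleftrightarrow> cj x \<in> place_units V" if "x \<in> FF" for x
    using that assms cj_inverse[OF that]
    by (simp add: place_units_def cj_image_iff field_setD(6)[OF FF_field] cj_eq_0_iff)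
  have sub: "place_units V \<subseteq> FF" "place_units (cj ` V) \<subseteq> FF"
    using assms by (auto simp: place_units_def intro: cj_FF)
  show ?thesis
  proof (rule Set.set_eqI)
    fix x
    show "x \<in> place_units (cj ` V) \<longleftrightarrow> x \<in> cj ` place_units V"
    proof (cases "x \<in> FF")
      case True
      then show ?thesis using iff cj_image_iff[OF sub(1)] by simp
    next
      case False
      then show ?thesis using sub cj_FF by blast
    qed
  qed
qed

lemma cj_ideal:
  assumes "V \<subseteq> FF" shows "place_ideal (cj ` V) = cj ` place_ideal V"
  unfolding place_ideal_def cj_units[OF assms]
  by (rule inj_on_image_set_diff[OF cj_inj, symmetric]) (use assms in \<open>auto simp: place_units_def\<close>)

lemma cj_ord:
  assumes V: "V \<in> places FF" and x: "x \<in> FF"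
  shows "place_ord (cj ` V) (cj x) = place_ord V x"
proof -
  define P where "P V x n \<longleftrightarrow> (\<exists>p u. uniformizer V p \<and> u \<in> place_units V \<and> x = u * p powi n)"
    for V :: "'k funs set" and x :: "'k funs" and n :: int
  have imp: "P (cj ` V) (cj x) n" if V: "V \<in> places FF" and P: "P V x n" for V x n
  proof -
    obtain p u where pu: "uniformizer V p" "u \<in> place_units V" "x = u * p powi n"
      using P unfolding P_def by blast
    have sub: "V \<subseteq> FF" by (rule placeD(7)[OF V])
    have "p * 1 \<in> place_ideal V" using pu(1) placeD(1)[OF V] unfolding uniformizer_def by blast
    then have p: "p \<in> FF" using sub by (auto simp: place_ideal_def)
    have u: "u \<in> FF" using pu(2) sub by (auto simp: place_units_def)
    have "cj ` (\<lambda>f. p * f) ` V = (\<lambda>f. cj p * f) ` cj ` V"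
      unfolding image_image using sub p by (intro image_cong) (auto simp: cj_mult)
    then have "uniformizer (cj ` V) (cj p)"
      using pu(1) unfolding uniformizer_def cj_ideal[OF sub] by simp
    moreover have "cj u \<in> place_units (cj ` V)" using pu(2) by (simp add: cj_units[OF sub])
    moreover have "cj x = cj u * cj p powi n"
      unfolding pu(3) using u p by (simp add: cj_mult cj_powi field_set_powi[OF FF_field])
    ultimately show ?thesis unfolding P_def by blast
  qed
  have "P (cj ` V) (cj x) n \<longleftrightarrow> P V x n" for n
    using imp[OF V, of x n] imp[OF cj_place[OF V], of "cj x" n] cj_cj_image[OF placeD(7)[OF V]] cj_cj[OF x]
    by metis
  then show ?thesis unfolding place_ord_def P_def[symmetric] by simp
qed

lemma cj_residue_basis:
  assumes V: "V \<in> places FF" and B: "residue_basis V B"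
  shows "residue_basis (cj ` V) (cj ` B)"
proof -
  have sub: "V \<subseteq> FF" by (rule placeD(7)[OF V])
  have BV: "finite B" "B \<subseteq> V" using B by (auto simp: residue_basis_def)
  have BF: "B \<subseteq> FF" using BV sub by blast
  have idF: "place_ideal V \<subseteq> FF" using sub by (auto simp: place_ideal_def)
  have s: "(\<Sum>b\<in>cj ` B. const_fun (c b) * b) = cj (\<Sum>b\<in>B. const_fun (c (cj b)) * b)
      \<and> (\<Sum>b\<in>B. const_fun (c (cj b)) * b) \<in> FF" for c
  proof -
    have "(\<Sum>b\<in>cj ` B. const_fun (c b) * b) = (\<Sum>b\<in>B. const_fun (c (cj b)) * cj b)"
      by (simp add: sum.reindex[OF inj_on_subset[OF cj_inj BF]])
    moreover have F: "const_fun c \<in> FF" for c using R_ring(1) R_FF by blast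
    have "cj (\<Sum>b\<in>B. const_fun (c (cj b)) * b) = (\<Sum>b\<in>B. cj (const_fun (c (cj b)) * b))
       \<and> (\<Sum>b\<in>B. const_fun (c (cj b)) * b) \<in> FF"
      using BF F by (intro cj_sum field_setD(4)[OF FF_field]) auto
    moreover have "cj (const_fun c * b) = const_fun c * cj b" if "b \<in> B" for b c
      using BF F that by (subst cj_mult) auto
    ultimately show ?thesis by simp
  qed
  show ?thesis
    unfolding residue_basis_def cj_ideal[OF sub]
  proof (intro conjI allI impI ballI)
    show "finite (cj ` B)" "cj ` B \<subseteq> cj ` V" using BV by auto
    fix c b assume c: "(\<Sum>b\<in>cj ` B. const_fun (c b) * b) \<in> cj ` place_ideal V" and b: "b \<in> cj ` B"
    have "(\<Sum>b\<in>B. const_fun (c (cj b)) * b) \<in> place_ideal V"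
      using c s[of c] cj_image_iff[OF idF, of "cj (\<Sum>b\<in>B. const_fun (c (cj b)) * b)"]
      by (simp add: cj_cj cj_FF)
    then have "c (cj b') = 0" if "b' \<in> B" for b'
      using residue_basisD[OF B, of "\<lambda>b. c (cj b)"] that by blast
    with b show "c b = 0" by auto
  next
    fix x assume "x \<in> cj ` V"
    then obtain y where y: "y \<in> V" "x = cj y" by blast
    obtain c where c: "y - (\<Sum>b\<in>B. const_fun (c b) * b) \<in> place_ideal V"
      using B y(1) unfolding residue_basis_def by blast
    have eq: "(\<Sum>b\<in>B. const_fun (c (cj (cj b))) * b) = (\<Sum>b\<in>B. const_fun (c b) * b)"
      using BF by (intro sum.cong) (auto simp: cj_cj)
    have "x - (\<Sum>b\<in>cj ` B. const_fun (c (cj b)) * b) = cj (y - (\<Sum>b\<in>B. const_fun (c b) * b))"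
      using s[of "\<lambda>b. c (cj b)"] y sub unfolding eq by (subst cj_diff) auto
    with c show "\<exists>c. x - (\<Sum>b\<in>cj ` B. const_fun (c b) * b) \<in> cj ` place_ideal V"
      by (intro exI[of _ "\<lambda>b. c (cj b)"]) simp
  qed
qed

section \<open>Residue degrees of the finite places\<close>

definition monoms :: "nat \<Rightarrow> 'k funs set" where "monoms d = (\<lambda>i. u ^ i) ` {..<d}"

lemma u_power: "u ^ i = evf u (monom 1 i)" by (simp add: evf_monom)

lemma monoms_inj: "inj_on (\<lambda>i. u ^ i) A"
  by (rule inj_onI) (simp add: u_power monom_eq_iff')

lemma monoms_finite: "finite (monoms d)" and monoms_card: "card (monoms d) = d"
  by (auto simp: monoms_def card_image[OF monoms_inj])

lemma monoms_R: "monoms d \<subseteq> R" by (auto simp: monoms_def u_power)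

lemma monoms_sum: "(\<Sum>b\<in>monoms d. const_fun (c b) * b) = evf u (\<Sum>i<d. monom (c (u ^ i)) i)"
  by (simp add: monoms_def sum.reindex[OF monoms_inj] evf_sum evf_monom)

lemma monoms_span:
  assumes "degree r < d" obtains c where "(\<Sum>b\<in>monoms d. const_fun (c b) * b) = evf u r"
proof
  let ?c = "\<lambda>b. coeff r (the_inv_into UNIV (\<lambda>i. u ^ i) b)"
  have "(\<Sum>i<d. monom (?c (u ^ i)) i) = r"
    using assms by (intro poly_eqI)
      (auto simp: the_inv_into_f_f[OF monoms_inj] coeff_sum coeff_eq_0)
  then show "(\<Sum>b\<in>monoms d. const_fun (?c b) * b) = evf u r" by (simp only: monoms_sum)
qed

lemma monoms_small:
  fixes g :: "'k poly"
  assumes "g dvd (\<Sum>i<degree g. monom (c i) i)" "i < degree g"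
  shows "c i = 0"
proof -
  let ?r = "\<Sum>i<degree g. monom (c i) i"
  have co: "coeff ?r j = (if j < degree g then c j else 0)" for j
    by (simp add: coeff_sum)
  have "degree ?r < degree g" using assms(2) by (intro degree_lessI) (auto simp: co)
  then have "?r = 0" using assms(1) dvd_imp_degree_le[of g ?r] by auto
  then have "coeff ?r i = 0" by (simp only: coeff_0)
  then show ?thesis using assms(2) co[of i] by simp
qed

text \<open>The residue field is \<open>k[u]/(g)\<close>: modulo the place \<open>w\<close> becomes
  \<open>h\<close>, and a denominator, being prime to \<open>g\<close>, is inverted by a Bezout
  relation.\<close>

lemma VH_basis:
  assumes gh: "root_mod g h"
  shows "residue_basis (VH g h) (monoms (degree g))"
proof -
  interpret dvr_center FF R "ph g h" "unif g" by (rule center_ph[OF gh])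
  have g: "irreducible g" using gh by (simp add: root_mod_def)
  note dg = irreducible_poly_degree[OF g]
  have id: "x \<in> place_ideal V \<longleftrightarrow> x \<in> ph g h" if "x \<in> R" for x using center that by blast
  show ?thesis unfolding VH_def residue_basis_def
  proof (intro conjI allI impI ballI)
    show "finite (monoms (degree g))" by (rule monoms_finite)
    show "monoms (degree g) \<subseteq> V" using monoms_R R_V by blast
    fix c b assume "(\<Sum>b\<in>monoms (degree g). const_fun (c b) * b) \<in> place_ideal V"
    then have "g dvd (\<Sum>i<degree g. monom (c (u ^ i)) i)" unfolding monoms_sum by (simp only: id evf_R evf_ph)
    then have "c (u ^ i) = 0" if "i < degree g" for i
      using monoms_small[of g "\<lambda>i. c (u ^ i)"] that by blast
    moreover assume "b \<in> monoms (degree g)"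
    ultimately show "c b = 0" by (auto simp: monoms_def)
  next
    fix x assume "x \<in> V"
    then obtain y z where yz: "x = y / z" "y \<in> R" "z \<in> R - ph g h" by (auto simp: V_def)
    obtain a b where y: "y = el a b" using yz(2) by (auto simp: R_def)
    obtain a' b' where z: "z = el a' b'" using yz(3) by (auto simp: R_def)
    define \<alpha> \<beta> where "\<alpha> = a + b * h" and "\<beta> = a' + b' * h"
    have "\<not> g dvd \<beta>" using yz(3) by (simp add: z \<beta>_def)
    then obtain s t where st: "s * \<beta> + t * g = 1" using irreducible_bezout[OF g] by blast
    have m: "el a b - evf u (a + b * h) \<in> place_ideal V" for a b
    proof -
      have "el a b - evf u (a + b * h) = el (- (b * h)) b" by (simp add: el_def)
      then show ?thesis by (simp add: id)
    qed
    define q where "q = \<alpha> * s"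
    have "z * (x - evf u q) = y - z * evf u q" using yz compl_nz by (simp add: algebra_simps)
    also have "\<dots> = (y - evf u \<alpha>) - evf u q * (z - evf u \<beta>) + evf u (\<alpha> * (1 - s * \<beta>))"
      by (simp add: q_def algebra_simps)
    also have "\<alpha> * (1 - s * \<beta>) = g * (\<alpha> * t)" using st by (simp add: algebra_simps flip: st)
    also have "(y - evf u \<alpha>) - evf u q * (z - evf u \<beta>) + evf u (g * (\<alpha> * t)) \<in> place_ideal V"
      unfolding y z \<alpha>_def \<beta>_def
    proof (rule place_ideal_add[OF F V_place place_ideal_diff[OF F V_place m place_ideal_mult[OF V_place _ m]]])
      show "evf u q \<in> V" using R_V by auto
      show "evf u (g * ((a + b * h) * t)) \<in> place_ideal V" by (simp only: id evf_R evf_ph) simp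
    qed
    finally have "z * (x - evf u q) \<in> place_ideal V" .
    moreover have "z \<notin> place_ideal V" "z \<in> V" using yz(3) id R_V by auto
    moreover have "x - evf u q \<in> V" using \<open>x \<in> V\<close> R_V by (intro placeD(10)[OF V_place]) auto
    ultimately have 1: "x - evf u q \<in> place_ideal V" using place_ideal_prime[OF V_place] by blast
    have "degree (q mod g) < degree g" using degree_mod_less'[of g q] dg by (cases "q mod g = 0") auto
    then obtain c where c: "(\<Sum>b\<in>monoms (degree g). const_fun (c b) * b) = evf u (q mod g)"
      using monoms_span by blast
    have "evf u (q - q mod g) \<in> place_ideal V" by (simp only: id evf_R evf_ph) (simp add: minus_mod_eq_mult_div)
    from place_ideal_add[OF F V_place 1 this] have "x - evf u (q mod g) \<in> place_ideal V" by simp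
    then show "\<exists>c. x - (\<Sum>b\<in>monoms (degree g). const_fun (c b) * b) \<in> place_ideal V"
      unfolding c[symmetric] by (rule exI[of _ c])
  qed
qed

text \<open>The residue field is a quadratic extension of \<open>k[u]/(g)\<close> with the powers of
  \<open>u\<close> and their multiples by \<open>w\<close> as a basis. A denominator is inverted
  through its norm, which is prime to \<open>g\<close>.\<close>

lemma VI_basis:
  assumes g: "irreducible g" and inert: "\<And>h. \<not> root_mod g h"
  shows "\<exists>B. residue_basis (VI g) B \<and> card B = 2 * degree g"
proof -
  interpret dvr_center FF R "pin g" "evf u g" by (rule center_pin[OF g inert])
  note dg = irreducible_poly_degree[OF g]
  have id: "x \<in> place_ideal V \<longleftrightarrow> x \<in> pin g" if "x \<in> R" for x using center that by blast
  let ?M = "monoms (degree g)"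
  define B where "B = ?M \<union> (\<lambda>b. b * w) ` ?M"
  have injw: "inj_on (\<lambda>b. b * w) A" for A using w_nz by (auto simp: inj_on_def)
  have disj: "?M \<inter> (\<lambda>b. b * w) ` ?M = {}"
  proof -
    have "u ^ i \<noteq> u ^ j * w" for i j
    proof
      assume e: "u ^ i = u ^ j * w"
      then have "el (monom 1 i) 0 = el 0 (monom 1 j)" unfolding u_power el_def by simp
      then show False by simp
    qed
    then show ?thesis by (auto simp: monoms_def)
  qed
  have card: "card B = 2 * degree g"
    unfolding B_def using disj by (simp add: card_Un_disjoint monoms_finite card_image[OF injw] monoms_card)
  have s: "(\<Sum>b\<in>B. const_fun (c b) * b) =
     el (\<Sum>i<degree g. monom (c (u ^ i)) i) (\<Sum>i<degree g. monom (c (u ^ i * w)) i)" for c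
  proof -
    have "(\<Sum>b\<in>B. const_fun (c b) * b) = (\<Sum>b\<in>?M. const_fun (c b) * b) + (\<Sum>b\<in>?M. const_fun (c (b * w)) * b) * w"
      unfolding B_def using disj
      by (simp add: sum.union_disjoint monoms_finite sum.reindex[OF injw] sum_distrib_right mult.assoc)
    then show ?thesis by (simp only: monoms_sum el_def)
  qed
  have "residue_basis V B" unfolding residue_basis_def
  proof (intro conjI allI impI ballI)
    show "finite B" by (simp add: B_def monoms_finite)
    have "b * w \<in> R" if "b \<in> ?M" for b using that monoms_R by (intro R_ring(3)) auto
    then show "B \<subseteq> V" using monoms_R R_V by (auto simp: B_def)
    fix c b assume "(\<Sum>b\<in>B. const_fun (c b) * b) \<in> place_ideal V"
    then have "g dvd (\<Sum>i<degree g. monom (c (u ^ i)) i)" "g dvd (\<Sum>i<degree g. monom (c (u ^ i * w)) i)"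
      unfolding s by (simp_all only: id el_R el_pin)
    then have "c (u ^ i) = 0" "c (u ^ i * w) = 0" if "i < degree g" for i
      using monoms_small[of g "\<lambda>i. c (u ^ i)"] monoms_small[of g "\<lambda>i. c (u ^ i * w)"] that by blast+
    moreover assume "b \<in> B"
    ultimately show "c b = 0" by (auto simp: monoms_def B_def)
  next
    fix x assume "x \<in> V"
    then obtain y z where yz: "x = y / z" "y \<in> R" "z \<in> R - pin g" by (auto simp: V_def)
    obtain a b where z: "z = el a b" using yz(3) by (auto simp: R_def)
    have "\<not> g dvd nrm a b" using yz(3) inert_nrm[OF g inert] by (simp add: z)
    then obtain s' t where st: "s' * nrm a b + t * g = 1" using irreducible_bezout[OF g] by blast
    have "y * (el a (- b) * evf u s') \<in> R" using yz(2) by (intro R_ring(3)) auto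
    then obtain q r where qr: "y * (el a (- b) * evf u s') = el q r" by (auto simp: R_def)
    have "z * (x - el q r) = y - z * el q r" using yz compl_nz by (simp add: algebra_simps)
    also have "z * el q r = y * evf u s' * (el a b * el a (- b))" unfolding qr[symmetric] z by (simp add: mult_ac)
    also have "y - y * evf u s' * (el a b * el a (- b)) = y * evf u (1 - s' * nrm a b)"
      unfolding el_conj by (simp add: algebra_simps)
    also have "1 - s' * nrm a b = t * g" using st by (simp add: algebra_simps flip: st)
    also have "y * evf u (t * g) \<in> place_ideal V"
      using yz(2) R_V by (intro place_ideal_mult[OF V_place]) (auto simp: id simp del: evf_mult)
    finally have "z * (x - el q r) \<in> place_ideal V" .
    moreover have "z \<notin> place_ideal V" "z \<in> V" using yz(3) id R_V by auto
    moreover have "x - el q r \<in> V" using \<open>x \<in> V\<close> R_V by (intro placeD(10)[OF V_place]) auto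
    ultimately have 1: "x - el q r \<in> place_ideal V" using place_ideal_prime[OF V_place] by blast
    have md: "degree (q mod g) < degree g" for q using degree_mod_less'[of g q] dg by (cases "q mod g = 0") auto
    have co: "(\<Sum>i<degree g. monom (coeff (q mod g) i) i) = q mod g" for q
      using md[of q] by (intro poly_eqI) (auto simp: coeff_sum coeff_eq_0)
    define c where "c b = (if b \<in> ?M then coeff (q mod g) (the_inv_into UNIV (\<lambda>i. u ^ i) b)
       else coeff (r mod g) (the_inv_into UNIV (\<lambda>i. u ^ i) (b / w)))" for b
    have c1: "c (u ^ i) = coeff (q mod g) i" if "i < degree g" for i
      using that by (simp add: c_def monoms_def the_inv_into_f_f[OF monoms_inj])
    have c2: "c (u ^ i * w) = coeff (r mod g) i" if "i < degree g" for i
    proof -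
      have "u ^ i * w \<notin> ?M" using disj that by (auto simp: monoms_def)
      then show ?thesis using w_nz by (simp add: c_def the_inv_into_f_f[OF monoms_inj])
    qed
    have cs: "(\<Sum>b\<in>B. const_fun (c b) * b) = el (q mod g) (r mod g)"
      unfolding s using co[of q] co[of r] c1 c2 by simp
    have "el (q - q mod g) (r - r mod g) \<in> place_ideal V"
      by (simp only: id el_R el_pin) (simp add: minus_mod_eq_mult_div)
    from place_ideal_add[OF F V_place 1 this] have "x - el (q mod g) (r mod g) \<in> place_ideal V"
      by (simp add: el_def algebra_simps)
    then have "x - (\<Sum>b\<in>B. const_fun (c b) * b) \<in> place_ideal V" unfolding cs .
    then show "\<exists>c. x - (\<Sum>b\<in>B. const_fun (c b) * b) \<in> place_ideal V" by (rule exI[of _ c])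
  qed
  with card show ?thesis unfolding VI_def by blast
qed

lemma VH_place: "root_mod g h \<Longrightarrow> VH g h \<in> places FF"
  unfolding VH_def by (rule dvr_center.V_place[OF center_ph])

lemma VI_place: "irreducible g \<Longrightarrow> (\<And>h. \<not> root_mod g h) \<Longrightarrow> VI g \<in> places FF"
  unfolding VI_def by (rule dvr_center.V_place[OF center_pin])

lemma VH_degree: "root_mod g h \<Longrightarrow> place_degree (VH g h) = degree g"
  using place_degree_eq[OF FF_field VH_place VH_basis] by (simp add: monoms_card)

lemma VI_degree:
  assumes "irreducible g" "\<And>h. \<not> root_mod g h" shows "place_degree (VI g) = 2 * degree g"
  using VI_basis[OF assms] place_degree_eq[OF FF_field VI_place[OF assms]] by auto

end

section \<open>Orders at finite places, and regular functions\<close>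

context quad
begin

definition places_over :: "'k poly \<Rightarrow> 'k funs set set" where
  "places_over g = {V \<in> places FF. u \<in> V \<and> evf u g \<in> place_ideal V}"

lemma VH_center: "root_mod g h \<Longrightarrow> R \<inter> place_ideal (VH g h) = ph g h"
  unfolding VH_def by (rule dvr_center.center[OF center_ph])

lemma VI_center: "irreducible g \<Longrightarrow> (\<And>h. \<not> root_mod g h) \<Longrightarrow> R \<inter> place_ideal (VI g) = pin g"
  unfolding VI_def by (rule dvr_center.center[OF center_pin])

lemma u_R: "u \<in> R" using evf_R[of "[:0, 1:]"] by simp

lemma VH_R: "root_mod g h \<Longrightarrow> R \<subseteq> VH g h"
  unfolding VH_def by (rule dvr_center.R_V[OF center_ph])

lemma VI_R: "irreducible g \<Longrightarrow> (\<And>h. \<not> root_mod g h) \<Longrightarrow> R \<subseteq> VI g"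
  unfolding VI_def by (rule dvr_center.R_V[OF center_pin])

lemma ideal_VH_iff: "root_mod g h \<Longrightarrow> el a b \<in> place_ideal (VH g h) \<longleftrightarrow> g dvd a + b * h"
  using VH_center[of g h] el_R[of a b] el_ph[of a b g h] by blast

lemma VH_over: "root_mod g h \<Longrightarrow> VH g h \<in> places_over g"
  using VH_place[of g h] VH_R[of g h] u_R ideal_VH_iff[of g h g 0] by (auto simp: places_over_def el_poly)

lemma VI_over: 
  assumes "irreducible g" "\<And>h. \<not> root_mod g h" shows "VI g \<in> places_over g"
proof -
  have "evf u g \<in> R \<inter> place_ideal (VI g)" unfolding VI_center[OF assms] by simp
  then show ?thesis using VI_place[OF assms] VI_R[OF assms] u_R by (auto simp: places_over_def)
qed

lemma VH_cong:
  assumes "g dvd h - h'" shows "VH g h = VH g h'"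
proof -
  have "g dvd a + b * h \<longleftrightarrow> g dvd a + b * h'" for a b
  proof -
    have "a + b * h = (a + b * h') + b * (h - h')" by (simp add: algebra_simps)
    moreover have "g dvd b * (h - h')" using assms by simp
    ultimately show ?thesis by (simp only: dvd_add_left_iff)
  qed
  then show ?thesis unfolding VH_def ph_def by simp
qed

text \<open>As \<open>g\<close> is irreducible, \<open>h\<close> and \<open>- h\<close> are the only
  square roots of \<open>f\<close> modulo \<open>g\<close>.\<close>

lemma over_root:
  assumes gh: "root_mod g h"
  shows "places_over g = {VH g h, VH g (- h)}"
proof
  have g: "irreducible g" using gh by (simp add: root_mod_def)
  show "{VH g h, VH g (- h)} \<subseteq> places_over g"
    using VH_over[OF gh] VH_over[OF root_mod_uminus[OF gh]] by simp
  show "places_over g \<subseteq> {VH g h, VH g (- h)}"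
  proof
    fix V assume "V \<in> places_over g"
    then have V: "V \<in> places FF" "u \<in> V" "evf u g \<in> place_ideal V" by (auto simp: places_over_def)
    from place_classify[OF V(1,2) g V(3)] gh obtain h' where h': "root_mod g h'" "V = VH g h'" by blast
    have "g dvd h' * h' - f" "g dvd h * h - f" using gh h' by (auto simp: root_mod_def)
    from dvd_diff[OF this] have "g dvd (h' - h) * (h' + h)" by (simp add: algebra_simps)
    then have "g dvd h' - h \<or> g dvd h' - (- h)" using irreducible_poly_dvd_mult_iff[OF g] by simp
    then show "V \<in> {VH g h, VH g (- h)}" using VH_cong h'(2) by blast
  qed
qed

lemma over_inert:
  assumes "irreducible g" "\<And>h. \<not> root_mod g h" shows "places_over g = {VI g}"
proof
  show "{VI g} \<subseteq> places_over g" using VI_over[OF assms] by simp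
  show "places_over g \<subseteq> {VI g}"
    using place_classify[OF _ _ assms(1)] assms(2) by (auto simp: places_over_def)
qed

lemma over_finite: "irreducible g \<Longrightarrow> finite (places_over g)"
  by (cases "\<exists>h. root_mod g h") (auto simp: over_root over_inert)

lemma VH_neq:
  assumes gh: "root_mod g h" and nf: "\<not> g dvd f" shows "VH g h \<noteq> VH g (- h)"
proof
  have g: "irreducible g" using gh by (simp add: root_mod_def)
  assume e: "VH g h = VH g (- h)"
  have "el (- h) 1 \<in> place_ideal (VH g h)" using ideal_VH_iff[OF gh] by simp
  then have "g dvd - h + 1 * (- h)" unfolding e using ideal_VH_iff[OF root_mod_uminus[OF gh]] by blast
  then have "g dvd 2 * h" by (metis dvd_minus_iff mult_1 mult_2 minus_add_distrib)
  then have "g dvd h" by (simp only: two_unit[OF g])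
  then show False using root_mod_dvd_iff[OF gh] nf by simp
qed

lemma VH_eq: 
  assumes gh: "root_mod g h" and "g dvd f" shows "VH g (- h) = VH g h"
proof -
  have "g dvd h" using root_mod_dvd_iff[OF gh] assms(2) by simp
  then show ?thesis by (intro VH_cong) simp
qed

text \<open>Hides the centre. The place at infinity is centred on another ring than the finite
  places, yet the rules \<open>dvr_ord\<close> hold for all of them.\<close>

definition dvr :: "'k funs set \<Rightarrow> bool" where
  "dvr V \<longleftrightarrow> (\<exists>R' p \<pi>. dvr_center FF R' p \<pi> \<and> V = dvr_center.V R' p)"

lemma affine_dvr:
  assumes "V \<in> places FF" "u \<in> V" shows "dvr V"
proof -
  obtain g where g: "irreducible g" "evf u g \<in> place_ideal V" using place_over_irreducible[OF assms] .
  from place_classify[OF assms g] show ?thesis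
  proof
    assume "\<exists>h. root_mod g h \<and> V = VH g h"
    then obtain h where "root_mod g h" "V = VH g h" by blast
    then show ?thesis unfolding dvr_def VH_def using center_ph by blast
  next
    assume *: "(\<forall>h. \<not> root_mod g h) \<and> V = VI g"
    then have "dvr_center FF R (pin g) (evf u g)" by (intro center_pin g) blast
    with * show ?thesis unfolding dvr_def VI_def by blast
  qed
qed

lemma dvr_ord:
  assumes "dvr V"
  shows "x \<in> FF \<Longrightarrow> x \<noteq> 0 \<Longrightarrow> y \<in> FF \<Longrightarrow> y \<noteq> 0 \<Longrightarrow> place_ord V (x * y) = place_ord V x + place_ord V y"
    "x \<in> FF \<Longrightarrow> x \<noteq> 0 \<Longrightarrow> place_ord V (inverse x) = - place_ord V x"
    "x \<in> FF \<Longrightarrow> x \<noteq> 0 \<Longrightarrow> y \<in> FF \<Longrightarrow> y \<noteq> 0 \<Longrightarrow> place_ord V (x / y) = place_ord V x - place_ord V y"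
    "x \<in> FF \<Longrightarrow> x \<noteq> 0 \<Longrightarrow> x \<in> V \<longleftrightarrow> place_ord V x \<ge> 0"
    "x \<in> FF \<Longrightarrow> x \<noteq> 0 \<Longrightarrow> x \<in> place_ideal V \<longleftrightarrow> place_ord V x > 0"
    "x \<in> FF \<Longrightarrow> x \<noteq> 0 \<Longrightarrow> y \<in> FF \<Longrightarrow> y = 0 \<or> place_ord V x < place_ord V y \<Longrightarrow> x + y \<noteq> 0 \<and> place_ord V (x + y) = place_ord V x"
    "V \<in> places FF"
    "c \<noteq> 0 \<Longrightarrow> place_ord V (const_fun c) = 0"
proof -
  obtain R' p \<pi> where d: "dvr_center FF R' p \<pi>" and V: "V = dvr_center.V R' p"
    using assms unfolding dvr_def by blast
  interpret d: dvr_center FF R' p \<pi> by (rule d)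
  note VV = V[symmetric]
  show "x \<in> FF \<Longrightarrow> x \<noteq> 0 \<Longrightarrow> y \<in> FF \<Longrightarrow> y \<noteq> 0 \<Longrightarrow> place_ord V (x * y) = place_ord V x + place_ord V y"
    unfolding V by (rule d.ord_mult)
  show inv: "x \<in> FF \<Longrightarrow> x \<noteq> 0 \<Longrightarrow> place_ord V (inverse x) = - place_ord V x" for x
    unfolding V by (rule d.ord_inverse)
  show "x \<in> FF \<Longrightarrow> x \<noteq> 0 \<Longrightarrow> y \<in> FF \<Longrightarrow> y \<noteq> 0 \<Longrightarrow> place_ord V (x / y) = place_ord V x - place_ord V y"
    unfolding V by (rule d.ord_divide)
  show inV: "x \<in> FF \<Longrightarrow> x \<noteq> 0 \<Longrightarrow> x \<in> V \<longleftrightarrow> place_ord V x \<ge> 0" for x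
    unfolding V by (rule d.in_V_iff)
  show "x \<in> FF \<Longrightarrow> x \<noteq> 0 \<Longrightarrow> x \<in> place_ideal V \<longleftrightarrow> place_ord V x > 0" for x
    using inV[of x] inV[of "inverse x"] inv[of x] field_setD(6)[OF FF_field, of x] by (auto simp: place_ideal_iff)
  show "x \<in> FF \<Longrightarrow> x \<noteq> 0 \<Longrightarrow> y \<in> FF \<Longrightarrow> y = 0 \<or> place_ord V x < place_ord V y \<Longrightarrow> x + y \<noteq> 0 \<and> place_ord V (x + y) = place_ord V x"
    unfolding V using d.ord_add_eq by blast
  show VF: "V \<in> places FF" unfolding V by (rule d.V_place)
  assume c: "c \<noteq> 0"
  have "const_fun c \<in> V" "inverse (const_fun c) \<in> V"
    using placeD(6)[OF VF] by (auto simp flip: const_fun_inverse)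
  moreover have "const_fun c \<in> FF" using R_ring(1) R_FF by blast
  ultimately show "place_ord V (const_fun c) = 0"
    using inV[of "const_fun c"] inV[of "inverse (const_fun c)"] inv[of "const_fun c"] c
      field_setD(6)[OF FF_field] by force
qed

lemma FF_el: "el a b \<in> FF" and FF_evf: "evf u a \<in> FF" and FF_const: "const_fun c \<in> FF"
  and FF_u: "u \<in> FF" and FF_w: "w \<in> FF"
  using R_FF el_R evf_R R_ring(1) u_R w_R by blast+

lemma affine_ord_ge: "V \<in> places FF \<Longrightarrow> u \<in> V \<Longrightarrow> el a b \<noteq> 0 \<Longrightarrow> place_ord V (el a b) \<ge> 0"
  using dvr_ord(4)[OF affine_dvr, of V "el a b"] R_sub_place[of V] FF_el el_R by blast

text \<open>The ramification index. Over a divisor \<open>g\<close> of \<open>f = g c\<close> the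
  order of \<open>w\<close> is one and \<open>c\<close> is a unit, so \<open>w^2 = g c\<close> gives
  order two.\<close>

lemma ord_over:
  assumes g: "irreducible g" and V: "V \<in> places_over g"
  shows "place_ord V (evf u g) = (if g dvd f then 2 else 1)"
proof (cases "\<exists>h. root_mod g h")
  case True
  then obtain h where "root_mod g h" by blast
  with V obtain h where gh: "root_mod g h" and Vh: "V = VH g h"
    using over_root root_mod_uminus by blast
  interpret d: dvr_center FF R "ph g h" "unif g" by (rule center_ph[OF gh])
  have Vd: "V = d.V" by (simp add: Vh VH_def)
  show ?thesis
  proof (cases "g dvd f")
    case True
    obtain c where c: "f = g * c" using True by (auto elim: dvdE)
    have nc: "\<not> g dvd c" using sqfree[OF g] c by (auto simp: dvd_def)
    then have c0: "c \<noteq> 0" by auto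
    have c1: "d.ord (evf u c) = 0" using nc by (intro d.ord_compl) auto
    have "d.ord w = 1" using d.ord_pi True by (simp add: unif_def)
    then have "d.ord (w * w) = 2" using d.ord_mult[OF FF_w w_nz FF_w w_nz] by simp
    then have "d.ord (evf u g * evf u c) = 2" unfolding w2 c by simp
    then have "d.ord (evf u g) = 2"
      using d.ord_mult[OF FF_evf _ FF_evf, of g c] irreducible_poly_degree[OF g] c0 c1 by simp
    then show ?thesis using True Vd by simp
  next
    case False
    then show ?thesis using d.ord_pi Vd by (simp add: unif_def)
  qed
next
  case False
  then have i: "\<And>h. \<not> root_mod g h" by blast
  interpret d: dvr_center FF R "pin g" "evf u g" by (rule center_pin[OF g i])
  have "\<not> g dvd f" using i[of 0] g by (simp add: root_mod_def)
  moreover have "V = d.V" using V over_inert[OF g i] by (simp add: VI_def)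
  ultimately show ?thesis using d.ord_pi by simp
qed

lemma not_over: "irreducible g \<Longrightarrow> V \<in> places FF \<Longrightarrow> u \<in> V \<Longrightarrow> V \<notin> places_over g \<Longrightarrow> place_ord V (evf u g) = 0"
proof -
  assume g: "irreducible g" and V: "V \<in> places FF" "u \<in> V" "V \<notin> places_over g"
  have nz: "evf u g \<noteq> 0" using irreducible_poly_degree[OF g] by simp
  have "evf u g \<notin> place_ideal V" using V by (simp add: places_over_def)
  then have "\<not> place_ord V (evf u g) > 0" using dvr_ord(5)[OF affine_dvr[OF V(1,2)] FF_evf nz] by blast
  moreover have "place_ord V (evf u g) \<ge> 0" using affine_ord_ge[OF V(1,2), of g 0] nz by (simp add: el_poly)
  ultimately show ?thesis by simp
qed

lemma finite_support_poly:
  assumes "N \<noteq> 0" shows "finite {V \<in> places FF. u \<in> V \<and> evf u N \<in> place_ideal V}"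
  using assms
proof (induction "degree N" arbitrary: N rule: less_induct)
  case less
  show ?case
  proof (cases "degree N = 0")
    case True
    then obtain c where "N = [:c:]" by (auto elim: degree_eq_zeroE)
    with less.prems const_notin_place_ideal[of _ FF c] have "{V \<in> places FF. u \<in> V \<and> evf u N \<in> place_ideal V} = {}"
      by auto
    then show ?thesis by (simp only: finite.emptyI)
  next
    case False
    then obtain g where g: "irreducible g" "g dvd N" using poly_irreducible_factor by blast
    then obtain r where r: "N = g * r" by (auto elim: dvdE)
    have r0: "r \<noteq> 0" using r less.prems by auto
    have "degree r < degree N"
      using r less.prems irreducible_poly_degree[OF g(1)] by (auto simp: degree_mult_eq)
    then have fin: "finite {V \<in> places FF. u \<in> V \<and> evf u r \<in> place_ideal V}" using less.hyps r0 by blast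
    have "{V \<in> places FF. u \<in> V \<and> evf u N \<in> place_ideal V} \<subseteq> places_over g \<union> {V \<in> places FF. u \<in> V \<and> evf u r \<in> place_ideal V}"
    proof
      fix V assume "V \<in> {V \<in> places FF. u \<in> V \<and> evf u N \<in> place_ideal V}"
      then have V: "V \<in> places FF" "u \<in> V" "evf u g * evf u r \<in> place_ideal V" by (auto simp: r)
      have "evf u g \<in> place_ideal V \<or> evf u r \<in> place_ideal V"
        using R_sub_place[OF V(1,2)] V(3) by (intro place_ideal_prime[OF V(1)]) auto
      then show "V \<in> places_over g \<union> {V \<in> places FF. u \<in> V \<and> evf u r \<in> place_ideal V}"
        using V by (auto simp: places_over_def)
    qed
    then show ?thesis using fin over_finite[OF g(1)] finite_subset by blast
  qed
qed

text \<open>A zero or pole of \<open>(a + b w) / c\<close> lies over the norm of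
  \<open>a + b w\<close> or over \<open>c\<close>.\<close>

lemma finite_support_affine:
  assumes x: "x \<in> FF" "x \<noteq> 0"
  shows "finite {V \<in> places FF. u \<in> V \<and> place_ord V x \<noteq> 0}"
proof -
  obtain a b c where c: "c \<noteq> 0" "x = el a b / evf u c" using FFE[OF x(1)] .
  have ab: "el a b \<noteq> 0" using c x(2) by auto
  then have N: "nrm a b \<noteq> 0" by simp
  have "{V \<in> places FF. u \<in> V \<and> place_ord V x \<noteq> 0} \<subseteq>
     {V \<in> places FF. u \<in> V \<and> evf u (nrm a b) \<in> place_ideal V} \<union> {V \<in> places FF. u \<in> V \<and> evf u c \<in> place_ideal V}"
  proof
    fix V assume "V \<in> {V \<in> places FF. u \<in> V \<and> place_ord V x \<noteq> 0}"
    then have V: "V \<in> places FF" "u \<in> V" and nz: "place_ord V x \<noteq> 0" by auto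
    note d = dvr_ord[OF affine_dvr[OF V]]
    have ge: "place_ord V (el a b) \<ge> 0" "place_ord V (evf u c) \<ge> 0"
      using affine_ord_ge[OF V ab] affine_ord_ge[OF V, of c 0] c by (auto simp: el_poly)
    have ec: "evf u c \<noteq> 0" using c by simp
    have "place_ord V x = place_ord V (el a b) - place_ord V (evf u c)"
      unfolding c(2) by (rule d(3)[OF FF_el ab FF_evf ec])
    then have "place_ord V (el a b) > 0 \<or> place_ord V (evf u c) > 0" using nz ge by linarith
    then have "el a b \<in> place_ideal V \<or> evf u c \<in> place_ideal V"
      using d(5)[OF FF_el ab] d(5)[OF FF_evf ec] by blast
    moreover have "evf u (nrm a b) \<in> place_ideal V" if "el a b \<in> place_ideal V"
      using place_ideal_mult[OF V(1) subsetD[OF R_sub_place[OF V] el_R] that, of a "- b"]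
      by (simp only: mult.commute[of "el a (- b)"] el_conj)
    ultimately show "V \<in> {V \<in> places FF. u \<in> V \<and> evf u (nrm a b) \<in> place_ideal V} \<union> {V \<in> places FF. u \<in> V \<and> evf u c \<in> place_ideal V}"
      using V by blast
  qed
  then show ?thesis using finite_support_poly[OF N] finite_support_poly[OF c(1)] finite_subset by blast
qed

text \<open>Local form of the fact that \<open>k[u, w]\<close> is integrally closed: a primitive
  element divided by \<open>g\<close> has a pole over \<open>g\<close>. Usually the element is a
  unit at one of the places over \<open>g\<close>. The exception is a \<open>g\<close> that divides
  both \<open>f\<close> and \<open>a\<close>; there the element has order one, but \<open>g\<close>
  has order two.\<close>

lemma bad_denominator:
  assumes g: "irreducible g" and nd: "\<not> (g dvd a \<and> g dvd b)"
  shows "\<exists>V\<in>places_over g. place_ord V (el a b) < place_ord V (evf u g)"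
proof -
  have ab: "el a b \<noteq> 0" using nd by auto
  have no: ?thesis if V: "V \<in> places_over g" "el a b \<notin> place_ideal V" for V
  proof -
    have V': "V \<in> places FF" "u \<in> V" using V by (auto simp: places_over_def)
    have "\<not> place_ord V (el a b) > 0" using dvr_ord(5)[OF affine_dvr[OF V'] FF_el ab] V(2) by blast
    moreover have "place_ord V (evf u g) > 0" using ord_over[OF g V(1)] by simp
    ultimately show ?thesis using V(1) by (intro bexI[of _ V]) linarith
  qed
  show ?thesis
  proof (cases "\<exists>h. root_mod g h")
    case False
    then have i: "\<And>h. \<not> root_mod g h" by blast
    have "el a b \<notin> place_ideal (VI g)" using VI_center[OF g i] nd el_R[of a b] el_pin[of a b g] by blast
    then show ?thesis using no VI_over[OF g i] by blast
  next
    case True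
    then obtain h where gh: "root_mod g h" by blast
    note gh' = root_mod_uminus[OF gh]
    show ?thesis
    proof (cases "g dvd a + b * h")
      case False
      then show ?thesis using no[OF VH_over[OF gh]] ideal_VH_iff[OF gh] by blast
    next
      case T: True
      show ?thesis
      proof (cases "g dvd f")
        case nf: False
        have "\<not> g dvd a + b * (- h)"
        proof
          assume c: "g dvd a + b * (- h)"
          have "g dvd (a + b * h) - (a + b * (- h))" using T c by (rule dvd_diff)
          then have "g dvd 2 * (b * h)" by (simp add: algebra_simps)
          then have "g dvd b * h" by (simp only: two_unit[OF g])
          then have b: "g dvd b" using root_mod_dvd_iff[OF gh] nf by (simp add: irreducible_poly_dvd_mult_iff[OF g])
          then have "g dvd a" using T by (simp add: dvd_add_left_iff)
          with b nd show False by blast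
        qed
        then show ?thesis using no[OF VH_over[OF gh']] ideal_VH_iff[OF gh'] by blast
      next
        case gf: True
        then have gdh: "g dvd h" using root_mod_dvd_iff[OF gh] by simp
        then have ga: "g dvd a" using T by (simp add: dvd_add_left_iff)
        then have gb: "\<not> g dvd b" using nd by blast
        interpret d: dvr_center FF R "ph g h" "unif g" by (rule center_ph[OF gh])
        have Vd: "VH g h = d.V" by (simp add: VH_def)
        have b0: "evf u b \<noteq> 0" using gb by auto
        have ow: "d.ord w = 1" using d.ord_pi gf by (simp add: unif_def)
        have ob: "d.ord (evf u b) = 0" using gb by (intro d.ord_compl) auto
        have obw: "d.ord (evf u b * w) = 1" using d.ord_mult[OF FF_evf b0 FF_w w_nz] ow ob by simp
        have og: "d.ord (evf u g) = 2" using ord_over[OF g VH_over[OF gh]] gf Vd by simp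
        have oa: "evf u a = 0 \<or> d.ord (evf u b * w) < d.ord (evf u a)"
        proof (cases "a = 0")
          case False
          obtain a' where a': "a = g * a'" using ga by (auto elim: dvdE)
          have nz: "evf u g \<noteq> 0" "evf u a' \<noteq> 0" using False a' by auto
          have "d.ord (evf u a) = d.ord (evf u g) + d.ord (evf u a')"
            unfolding a' evf_mult by (rule d.ord_mult[OF FF_evf nz(1) FF_evf nz(2)])
          moreover have "d.ord (evf u a') \<ge> 0" using nz(2) by (intro d.ord_R) auto
          ultimately show ?thesis using og obw by simp
        qed simp
        have bwF: "evf u b * w \<in> FF" using FF_evf FF_w by (intro field_setD(4)[OF FF_field])
        have bw0: "evf u b * w \<noteq> 0" using b0 w_nz by simp
        have "d.ord (evf u b * w + evf u a) = 1"
          using d.ord_add_eq(2)[OF bwF bw0 FF_evf oa] obw by simp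
        then have "place_ord (VH g h) (el a b) < place_ord (VH g h) (evf u g)"
          using og Vd by (simp add: el_def add.commute)
        then show ?thesis using VH_over[OF gh] by blast
      qed
    qed
  qed
qed

text \<open>In a representation with a denominator of least degree, an irreducible factor of that
  denominator does not divide the numerator and hence causes a pole.\<close>

lemma regular_R:
  assumes x: "x \<in> FF" "x \<noteq> 0" and reg: "\<And>V. V \<in> places FF \<Longrightarrow> u \<in> V \<Longrightarrow> place_ord V x \<ge> 0"
  shows "x \<in> R"
proof -
  have "\<exists>c. c \<noteq> 0 \<and> (\<exists>a b. x = el a b / evf u c)" using FFE[OF x(1)] by metis
  then obtain c where c: "c \<noteq> 0 \<and> (\<exists>a b. x = el a b / evf u c)"
    and min: "\<And>c'. c' \<noteq> 0 \<and> (\<exists>a b. x = el a b / evf u c') \<Longrightarrow> degree c \<le> degree c'"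
    using ex_has_least_nat[of "\<lambda>c. c \<noteq> 0 \<and> (\<exists>a b. x = el a b / evf u c)" _ degree] by metis
  then obtain a b where ab: "x = el a b / evf u c" by blast
  show ?thesis
  proof (cases "degree c = 0")
    case True
    then obtain k where k: "c = [:k:]" by (auto elim: degree_eq_zeroE)
    with c have k0: "k \<noteq> 0" by auto
    have "x = const_fun (inverse k) * el a b" unfolding ab k by (simp add: divide_inverse mult.commute)
    then show ?thesis using R_ring(3)[OF R_ring(1) el_R] by (simp only:)
  next
    case False
    then obtain g where g: "irreducible g" "g dvd c" using poly_irreducible_factor by blast
    obtain c' where c': "c = g * c'" using g(2) by (auto elim: dvdE)
    have c'0: "c' \<noteq> 0" "g \<noteq> 0" using c c' by auto
    have nd: "\<not> (g dvd a \<and> g dvd b)"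
    proof
      assume "g dvd a \<and> g dvd b"
      then obtain a' b' where ab': "a = g * a'" "b = g * b'" by (auto elim!: dvdE)
      have "x = el a' b' / evf u c'"
        unfolding ab ab' c' el_smult[symmetric] evf_mult using c'0 by simp
      then have "degree c \<le> degree c'" using c'0 by (intro min) blast
      then show False using c' c'0 irreducible_poly_degree[OF g(1)] by (simp add: degree_mult_eq)
    qed
    then obtain V where V: "V \<in> places_over g" "place_ord V (el a b) < place_ord V (evf u g)"
      using bad_denominator[OF g(1)] by blast
    have V': "V \<in> places FF" "u \<in> V" using V by (auto simp: places_over_def)
    note d = dvr_ord[OF affine_dvr[OF V']]
    have nz: "el a b \<noteq> 0" "evf u c \<noteq> 0" "evf u g \<noteq> 0" "evf u c' \<noteq> 0" using x(2) ab c c'0 by auto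
    have "place_ord V x = place_ord V (el a b) - place_ord V (evf u c)"
      unfolding ab by (rule d(3)[OF FF_el nz(1) FF_evf nz(2)])
    moreover have "place_ord V (evf u c) = place_ord V (evf u g) + place_ord V (evf u c')"
      unfolding c' evf_mult by (rule d(1)[OF FF_evf nz(3) FF_evf nz(4)])
    moreover have "place_ord V (evf u c') \<ge> 0"
      using affine_ord_ge[OF V', of c' 0] nz(4) by (simp add: el_poly)
    ultimately show ?thesis using V(2) reg[OF V'] by linarith
  qed
qed

end

section \<open>The cubic and the place at infinity\<close>

lemma irreducible_X: "irreducible ([:c, 1:] :: 'a::field poly)"
  by (intro irreducible_linear_field_poly) auto

lemma degree_one_dvd_root:
  fixes p :: "'a::field poly"
  shows "[:- a, 1:] dvd p \<longleftrightarrow> poly p a = 0"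
  by (simp add: poly_eq_0_iff_dvd)

lemma X_dvd_iff: "[:0, 1:] dvd (p :: 'a::field poly) \<longleftrightarrow> poly p 0 = 0"
  using degree_one_dvd_root[of 0 p] by simp

lemma linear_poly_root:
  fixes g :: "'a::field poly"
  assumes "degree g = 1"
  obtains r where "poly g r = 0"
proof -
  have c: "coeff g 1 \<noteq> 0" using assms leading_coeff_0_iff[of g] by (metis degree_0 zero_neq_one)
  have "poly g (- coeff g 0 / coeff g 1) = 0"
    using c assms by (simp add: poly_altdef)
  then show ?thesis by (rule that)
qed

lemma double_root:
  fixes g :: "'a::field_char_0 poly"
  assumes "poly g r = 0" "p = g * g * k"
  shows "poly p r = 0" "poly (pderiv p) r = 0"
  using assms by (simp_all add: pderiv_mult)

text \<open>The expression in \<open>D\<close> is the discriminant of the cubic. A square factor of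
  a cubic is the square of a linear one; its root \<open>r\<close> is also a root of the derivative,
  which expresses \<open>B\<close> and \<open>C\<close> by \<open>A\<close> and \<open>r\<close>,
  and then the discriminant vanishes identically.\<close>

lemma cubic_squarefree:
  fixes A B C :: "'a::field_char_0"
  assumes D: "18 * A * B * C - 4 * A ^ 3 * C + A ^ 2 * B ^ 2 - 4 * B ^ 3 - 27 * C ^ 2 \<noteq> 0"
    and g: "irreducible g"
  shows "\<not> g * g dvd [:C, B, A, 1:]"
proof
  assume "g * g dvd [:C, B, A, 1:]"
  then obtain k where k: "[:C, B, A, 1:] = g * g * k" by (auto elim: dvdE)
  have "g \<noteq> 0" "k \<noteq> 0" using k by auto
  then have "degree [:C, B, A, 1:] = 2 * degree g + degree k"
    unfolding k by (simp add: degree_mult_eq)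
  then have "degree g = 1" using irreducible_poly_degree[OF g] by simp
  then obtain r where r: "poly g r = 0" by (rule linear_poly_root)
  have 1: "C + r * (B + r * (A + r)) = 0" and 2: "B + r * (A + r + (A + 2 * r)) = 0"
    using double_root[OF r k] by (simp_all add: pderiv_pCons algebra_simps)
  have "C - (- (r ^ 3) - A * r ^ 2 - B * r) = C + r * (B + r * (A + r))"
    "B - (- 3 * r ^ 2 - 2 * A * r) = B + r * (A + r + (A + 2 * r))"
    by (simp_all add: algebra_simps power2_eq_square power3_eq_cube)
  then have B: "B = - 3 * r ^ 2 - 2 * A * r" and C: "C = - (r ^ 3) - A * r ^ 2 - B * r"
    unfolding 1 2 by simp_all
  have "18 * A * B * C - 4 * A ^ 3 * C + A ^ 2 * B ^ 2 - 4 * B ^ 3 - 27 * C ^ 2 = 0"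
    unfolding C B by (simp add: algebra_simps power2_eq_square power3_eq_cube)
  with D show False by simp
qed

text \<open>The quartic is \<open>x\<close> times the reversed cubic. Its root 0 is simple and
  belongs to the cofactor \<open>k\<close>, so that \<open>g\<close> must be linear; the inverse of
  its root is then a double root of the cubic. The bound on the degree is only
  \<open>\<le> 4\<close>, as \<open>C\<close> may vanish.\<close>

lemma quartic_squarefree:
  fixes A B C :: "'a::field_char_0"
  assumes D: "18 * A * B * C - 4 * A ^ 3 * C + A ^ 2 * B ^ 2 - 4 * B ^ 3 - 27 * C ^ 2 \<noteq> 0"
    and g: "irreducible g"
  shows "\<not> g * g dvd [:0, 1, A, B, C:]"
proof
  let ?p = "[:0, 1, A, B, C:]"
  assume "g * g dvd ?p"
  then obtain k where k: "?p = g * g * k" by (auto elim: dvdE)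
  have nz: "g \<noteq> 0" "k \<noteq> 0" using k by auto
  have g0: "poly g 0 \<noteq> 0"
  proof
    assume "poly g 0 = 0"
    from double_root(2)[OF this k] show False by (simp add: pderiv_pCons)
  qed
  have "poly (g * g * k) 0 = 0" unfolding k[symmetric] by simp
  then have "poly k 0 = 0" using g0 by simp
  then have "degree k > 0" using nz by (metis degree_eq_zeroE gr0I poly_const_conv pCons_0_0)
  moreover have "degree ?p = 2 * degree g + degree k"
    unfolding k using nz by (simp add: degree_mult_eq)
  moreover have "degree ?p \<le> 4" by simp
  ultimately have "degree g = 1" using irreducible_poly_degree[OF g] by linarith
  then obtain r where r: "poly g r = 0" by (rule linear_poly_root)
  have r0: "r \<noteq> 0" using r g0 by auto
  have 1: "r * (1 + r * (A + r * (B + r * C))) = 0" "1 + 2 * A * r + 3 * B * r ^ 2 + 4 * C * r ^ 3 = 0"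
    using double_root[OF r k] by (simp_all add: pderiv_pCons algebra_simps power2_eq_square power3_eq_cube)
  then have 2: "1 + r * (A + r * (B + r * C)) = 0" using r0 by simp
  define s where "s = inverse r"
  have rs: "r * s = 1" using r0 by (simp add: s_def)
  have "s ^ 3 * (1 + r * (A + r * (B + r * C))) = s ^ 3 + A * s ^ 2 * (r * s) + B * s * (r * s) ^ 2 + C * (r * s) ^ 3"
    by Groebner_Basis.algebra
  then have s1: "s ^ 3 + A * s ^ 2 + B * s + C = 0" unfolding 2 rs by simp
  have "s ^ 3 * (1 + 2 * A * r + 3 * B * r ^ 2 + 4 * C * r ^ 3) =
      s ^ 3 + 2 * A * s ^ 2 * (r * s) + 3 * B * s * (r * s) ^ 2 + 4 * C * (r * s) ^ 3"
    by Groebner_Basis.algebra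
  then have "s ^ 3 + 2 * A * s ^ 2 + 3 * B * s + 4 * C = 0" unfolding 1(2) rs by simp
  moreover have "s * (3 * s ^ 2 + 2 * A * s + B) = 4 * (s ^ 3 + A * s ^ 2 + B * s + C)
      - (s ^ 3 + 2 * A * s ^ 2 + 3 * B * s + 4 * C)"
    by (simp add: algebra_simps power2_eq_square power3_eq_cube)
  ultimately have "s * (3 * s ^ 2 + 2 * A * s + B) = 0" using s1 by simp
  moreover have "s \<noteq> 0" using r0 by (simp add: s_def)
  ultimately have s2: "3 * s ^ 2 + 2 * A * s + B = 0" by simp
  have "C - (- (s ^ 3) - A * s ^ 2 - B * s) = s ^ 3 + A * s ^ 2 + B * s + C"
    "B - (- 3 * s ^ 2 - 2 * A * s) = 3 * s ^ 2 + 2 * A * s + B"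
    by simp_all
  then have B: "B = - 3 * s ^ 2 - 2 * A * s" and C: "C = - (s ^ 3) - A * s ^ 2 - B * s"
    unfolding s1 s2 by simp_all
  have "18 * A * B * C - 4 * A ^ 3 * C + A ^ 2 * B ^ 2 - 4 * B ^ 3 - 27 * C ^ 2 = 0"
    unfolding C B by (simp add: algebra_simps power2_eq_square power3_eq_cube)
  with D show False by simp
qed

lemma evf_reflect:
  assumes "u \<noteq> 0"
  shows "evf u (reflect_poly q) = u ^ degree q * evf (inverse u) q"
proof -
  have inj: "inj (const_fun :: 'a \<Rightarrow> _)" by (auto intro: injI)
  have d: "degree (map_poly const_fun q) = degree q"
    by (rule degree_map_poly) simp
  have "map_poly const_fun (reflect_poly q) = reflect_poly (map_poly const_fun q)"
    by (rule poly_eqI) (simp add: coeff_map_poly coeff_reflect_poly d)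
  then show ?thesis unfolding evf_def using poly_reflect_poly_nz[OF assms, of "map_poly const_fun q"]
    by (simp add: d)
qed

lemma evf_in_field:
  assumes "field_set K" "\<And>c. const_fun c \<in> K" "u \<in> K"
  shows "evf u q \<in> K"
  by (induction q) (auto intro: field_setD[OF assms(1)] assms)

lemma (in quad) FF_least:
  assumes "field_set K" "\<And>c. const_fun c \<in> K" "u \<in> K" "w \<in> K"
  shows "FF \<subseteq> K"
proof
  fix x assume "x \<in> FF"
  then obtain a b c where "x = el a b / evf u c" by (rule FFE)
  then show "x \<in> K" using evf_in_field[OF assms(1-3)] assms(4)
    by (auto simp: el_def intro!: field_setD[OF assms(1)])
qed

locale ell =
  fixes u w :: "'k::field_char_0 funs" and A B C :: 'k
  assumes trans: "evf u q = 0 \<Longrightarrow> q = 0"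
    and w2: "w * w = evf u [:C, B, A, 1:]"
    and disc: "18 * A * B * C - 4 * A ^ 3 * C + A ^ 2 * B ^ 2 - 4 * B ^ 3 - 27 * C ^ 2 \<noteq> 0"

text \<open>The function \<open>w\<close> is not rational in \<open>u\<close>, because
  \<open>c^2\<close> times a cubic has odd degree and \<open>a^2\<close> has even degree.\<close>

sublocale ell \<subseteq> quad u w "[:C, B, A, 1:]"
proof
  show "evf u q = 0 \<Longrightarrow> q = 0" for q by (rule trans)
  show "w * w = evf u [:C, B, A, 1:]" by (rule w2)
  show "irreducible g \<Longrightarrow> \<not> g * g dvd [:C, B, A, 1:]" for g by (rule cubic_squarefree[OF disc])
  fix c a assume "evf u c * w = evf u a"
  then have "evf u c * w * (evf u c * w) = evf u a * evf u a" by simp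
  then have "evf u c * evf u c * (w * w) = evf u a * evf u a" by (simp only: mult_ac)
  then have "evf u (c * c * [:C, B, A, 1:] - a * a) = 0" by (simp only: w2 evf_mult evf_diff) simp
  from trans[OF this] have e: "c * c * [:C, B, A, 1:] = a * a" by (simp only: right_minus_eq)
  show "c = 0"
  proof (rule ccontr)
    assume c: "c \<noteq> 0"
    then have "degree (c * c * [:C, B, A, 1:]) = 2 * degree c + 3" by (subst degree_mult_eq) (simp_all add: degree_mult_eq)
    moreover have "a \<noteq> 0"
    proof
      assume "a = 0"
      then have "c * c * [:C, B, A, 1:] = 0" using e by (simp only: mult_zero_left)
      then show False using c by (simp only: mult_eq_0_iff pCons_eq_0_iff) simp
    qed
    then have "degree (a * a) = 2 * degree a" by (simp add: degree_mult_eq)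
    ultimately show False unfolding e by presburger
  qed
qed

context ell
begin

abbreviation "cub \<equiv> [:C, B, A, 1:]"

lemma u_nz: "u \<noteq> 0" using trans[of "[:0, 1:]"] by auto

end

text \<open>The neighbourhood of infinity: for \<open>v = 1 / u\<close> the function
  \<open>w v^2\<close> has the square \<open>v + A v^2 + B v^3 + C v^4\<close>. A place at which
  \<open>u\<close> has a pole thus becomes a finite place of a curve of the same kind.\<close>

sublocale ell \<subseteq> iq: quad "inverse u" "w * inverse u * inverse u" "[:0, 1, A, B, C:]"
proof
  note r = evf_reflect[OF u_nz]
  show "evf (inverse u) q = 0 \<Longrightarrow> q = 0" for q using r[of q] by simp
  define v where "v = inverse u"
  have uv: "u * v = 1" using u_nz by (simp add: v_def)
  have "w * v * v * (w * v * v) = (w * w) * v ^ 4"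
    by (simp add: power4_eq_xxxx mult_ac)
  also have "\<dots> = (const_fun C + u * (const_fun B + u * (const_fun A + u))) * v ^ 4"
    unfolding w2 by simp
  also have "\<dots> = const_fun C * v ^ 4 + const_fun B * v ^ 3 * (u * v) + const_fun A * v ^ 2 * (u * v) ^ 2 + v * (u * v) ^ 3"
    by (simp add: power4_eq_xxxx power3_eq_cube power2_eq_square algebra_simps)
  also have "\<dots> = v * (1 + v * (const_fun A + v * (const_fun B + v * const_fun C)))"
    unfolding uv by (simp add: power4_eq_xxxx power3_eq_cube power2_eq_square algebra_simps)
  also have "\<dots> = evf v [:0, 1, A, B, C:]" by simp
  finally have "w * v * v * (w * v * v) = evf v [:0, 1, A, B, C:]" .
  then show "w * inverse u * inverse u * (w * inverse u * inverse u) = evf (inverse u) [:0, 1, A, B, C:]"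
    unfolding v_def .
  show "irreducible g \<Longrightarrow> \<not> g * g dvd [:0, 1, A, B, C:]" for g by (rule quartic_squarefree[OF disc])
  fix c a assume e: "evf (inverse u) c * (w * inverse u * inverse u) = evf (inverse u) a"
  have ui: "u * inverse u = 1" using u_nz by simp
  \<comment> \<open>Reflecting \<open>c\<close> and \<open>a\<close> turns a relation over
    \<open>k[1/u]\<close> into one over \<open>k[u]\<close>; the powers of \<open>u\<close> balance
    the two degrees and the factor \<open>1 / u^2\<close> of the second coordinate.\<close>
  have "evf u (reflect_poly c * monom 1 (degree a)) * w =
     (u ^ degree c * evf (inverse u) c) * u ^ degree a * w * ((u * inverse u) * (u * inverse u))"
    unfolding ui by (simp add: r evf_monom)
  also have "\<dots> = (u ^ degree c * u ^ degree a * u * u) * (evf (inverse u) c * (w * inverse u * inverse u))"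
    by (simp only: mult_ac)
  also have "\<dots> = evf u (reflect_poly a * monom 1 (degree c + 2))"
    unfolding e by (simp add: r evf_monom power_add mult_ac)
  finally have "reflect_poly c * monom 1 (degree a) = 0" by (rule w_notin)
  then show "c = 0" by simp
qed

context ell
begin

lemma iq_FF: "iq.FF = FF"
proof
  show "iq.FF \<subseteq> FF"
    using FF_u FF_w by (intro iq.FF_least[OF FF_field FF_const] field_setD[OF FF_field])
  have "u \<in> iq.FF" using field_setD(6)[OF iq.FF_field iq.FF_u] by simp
  moreover have "w * inverse u * inverse u * u * u \<in> iq.FF"
    by (rule field_setD(4)[OF iq.FF_field field_setD(4)[OF iq.FF_field iq.FF_w \<open>u \<in> iq.FF\<close>] \<open>u \<in> iq.FF\<close>])
  moreover have "w * inverse u * inverse u * u * u = w * (u * inverse u) * (u * inverse u)"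
    by (simp only: mult_ac)
  then have "w * inverse u * inverse u * u * u = w" using u_nz by simp
  ultimately have "w \<in> iq.FF" by simp
  moreover note \<open>u \<in> iq.FF\<close>
  ultimately show "FF \<subseteq> iq.FF" by (intro FF_least[OF iq.FF_field iq.FF_const])
qed

text \<open>The quartic vanishes at \<open>1 / u = 0\<close>, so 0 is its square root there, and
  this is the only place over that point.\<close>

definition Vinf :: "'k funs set" where "Vinf = iq.VH [:0, 1:] 0"

lemma iq_root: "iq.root_mod [:0, 1:] 0"
  unfolding iq.root_mod_def X_dvd_iff using irreducible_X[of 0] by simp

lemma evf_X: "evf v [:0, 1:] = v" by simp

lemma Vinf_over: "Vinf \<in> iq.places_over [:0, 1:]"
  unfolding Vinf_def by (rule iq.VH_over[OF iq_root])

lemma Vinf_place: "Vinf \<in> places FF" and inv_u: "inverse u \<in> place_ideal Vinf"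
  using Vinf_over by (auto simp: iq.places_over_def iq_FF)

lemma Vinf_u: "u \<notin> Vinf"
  using inv_u u_nz by (auto simp: place_ideal_iff)

lemma Vinf_unique: assumes V: "V \<in> places FF" "u \<notin> V" shows "V = Vinf"
proof -
  have "inverse u \<in> V" using placeD(9)[OF V(1) FF_u V(2)] .
  then have i: "inverse u \<in> place_ideal V" using V(2) by (auto simp: place_ideal_iff)
  then have "V \<in> iq.places_over [:0, 1:]"
    using V(1) \<open>inverse u \<in> V\<close> by (simp add: iq.places_over_def iq_FF)
  then show ?thesis unfolding iq.over_root[OF iq_root] by (simp add: Vinf_def)
qed

lemma Vinf_dvr: "dvr Vinf"
proof -
  have "iq.dvr Vinf" using Vinf_over by (intro iq.affine_dvr) (auto simp: iq.places_over_def)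
  then show ?thesis by (simp add: dvr_def iq.dvr_def iq_FF)
qed

lemma all_dvr: "V \<in> places FF \<Longrightarrow> dvr V"
  using affine_dvr Vinf_dvr Vinf_unique by blast

lemmas oo = dvr_ord[OF all_dvr]

lemma Vinf_degree: "place_degree Vinf = 1"
  unfolding Vinf_def using iq.VH_degree[OF iq_root] by simp

lemma ord_inf_u: "place_ord Vinf u = - 2"
proof -
  have "place_ord Vinf (inverse u) = 2"
    using iq.ord_over[OF irreducible_X Vinf_over] by (simp add: X_dvd_iff)
  then show ?thesis using oo(2)[OF Vinf_place FF_u u_nz] by simp
qed

lemma ord_inf_w: "place_ord Vinf w = - 3"
proof -
  interpret d: dvr_center iq.FF iq.R "iq.ph [:0, 1:] 0" "iq.unif [:0, 1:]" by (rule iq.center_ph[OF iq_root])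
  have "place_ord Vinf (w * inverse u * inverse u) = 1"
    using d.ord_pi unfolding Vinf_def iq.VH_def by (simp add: iq.unif_def X_dvd_iff)
  moreover have "place_ord Vinf (w * inverse u * inverse u) = place_ord Vinf w - place_ord Vinf u - place_ord Vinf u"
    using u_nz w_nz FF_u FF_w by (simp add: oo(1,2)[OF Vinf_place] field_setD[OF FF_field])
  ultimately show ?thesis using ord_inf_u by simp
qed

lemma ord_inf_evf: "q \<noteq> 0 \<Longrightarrow> place_ord Vinf (evf u q) = - 2 * int (degree q)"
proof (induction q)
  case (pCons a p)
  show ?case
  proof (cases "p = 0")
    case True
    then show ?thesis using pCons by (simp add: oo(8)[OF Vinf_place])
  next
    case False
    have nz: "u * evf u p \<noteq> 0" using u_nz False by simp
    have F: "u * evf u p \<in> FF" by (rule field_setD(4)[OF FF_field FF_u FF_evf])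
    have 1: "place_ord Vinf (u * evf u p) = - 2 - 2 * int (degree p)"
      using oo(1)[OF Vinf_place FF_u u_nz FF_evf, of p] False pCons ord_inf_u by simp
    have "const_fun a = 0 \<or> place_ord Vinf (u * evf u p) < place_ord Vinf (const_fun a)"
      using oo(8)[OF Vinf_place, of a] 1 by (cases "a = 0") auto
    from oo(6)[OF Vinf_place F nz FF_const this]
    show ?thesis using 1 False by (simp add: add.commute)
  qed
qed simp

text \<open>The order at infinity of \<open>a(u)\<close> is even and that of \<open>b(u) w\<close>
  is odd, so the two never cancel.\<close>

lemma ord_inf_el:
  assumes "el a b \<noteq> 0"
  shows "place_ord Vinf (el a b) =
    (if b = 0 \<or> (a \<noteq> 0 \<and> 2 * degree a > 2 * degree b + 3) then - 2 * int (degree a)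
     else - (2 * int (degree b) + 3))"
proof (cases "b = 0")
  case True
  then show ?thesis using assms ord_inf_evf[of a] by (simp add: el_poly)
next
  case b: False
  have F: "evf u b * w \<in> FF" by (rule field_setD(4)[OF FF_field FF_evf FF_w])
  have nz: "evf u b * w \<noteq> 0" using b w_nz by simp
  have ob: "place_ord Vinf (evf u b * w) = - (2 * int (degree b) + 3)"
    using oo(1)[OF Vinf_place FF_evf _ FF_w w_nz, of b] b ord_inf_evf[OF b] ord_inf_w by simp
  show ?thesis
  proof (cases "a \<noteq> 0 \<and> 2 * degree a > 2 * degree b + 3")
    case True
    then have "evf u a \<noteq> 0" "place_ord Vinf (evf u a) < place_ord Vinf (evf u b * w)"
      using ob ord_inf_evf[of a] by auto
    then show ?thesis using oo(6)[OF Vinf_place FF_evf _ F, of a] True ord_inf_evf[of a] by (simp add: el_def)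
  next
    case False
    have "2 * degree a \<noteq> 2 * degree b + 3" by presburger
    with False have "evf u a = 0 \<or> place_ord Vinf (evf u b * w) < place_ord Vinf (evf u a)"
      using ob ord_inf_evf[of a] by (cases "a = 0") auto
    then show ?thesis using oo(6)[OF Vinf_place F nz FF_evf, of a] b ob False by (simp add: el_def add.commute)
  qed
qed

lemma finite_support: "x \<in> FF \<Longrightarrow> x \<noteq> 0 \<Longrightarrow> finite {V \<in> places FF. place_ord V x \<noteq> 0}"
proof -
  assume x: "x \<in> FF" "x \<noteq> 0"
  have "{V \<in> places FF. place_ord V x \<noteq> 0} \<subseteq> insert Vinf {V \<in> places FF. u \<in> V \<and> place_ord V x \<noteq> 0}"
    using Vinf_unique by blast
  then show ?thesis using finite_support_affine[OF x] finite_subset by blast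
qed

definition dv :: "'k funs \<Rightarrow> 'k funs set \<Rightarrow>\<^sub>0 int" where
  "dv x = Abs_poly_mapping (\<lambda>V. if V \<in> places FF then place_ord V x else 0)"

lemma lookup_dv:
  assumes "x \<in> FF" "x \<noteq> 0"
  shows "Poly_Mapping.lookup (dv x) V = (if V \<in> places FF then place_ord V x else 0)"
proof -
  have "{V. (if V \<in> places FF then place_ord V x else 0) \<noteq> 0} = {V \<in> places FF. place_ord V x \<noteq> 0}" by auto
  then show ?thesis unfolding dv_def using finite_support[OF assms]
    by (subst lookup_Abs_poly_mapping) simp_all
qed

lemma dv_keys: "x \<in> FF \<Longrightarrow> x \<noteq> 0 \<Longrightarrow> Poly_Mapping.keys (dv x) = {V \<in> places FF. place_ord V x \<noteq> 0}"
  by (auto simp: Poly_Mapping.in_keys_iff lookup_dv split: if_splits)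

lemma dv_mult: "x \<in> FF \<Longrightarrow> x \<noteq> 0 \<Longrightarrow> y \<in> FF \<Longrightarrow> y \<noteq> 0 \<Longrightarrow> dv (x * y) = dv x + dv y"
  by (rule poly_mapping_eqI)
     (simp add: lookup_dv field_setD[OF FF_field] lookup_add oo(1))

lemma dv_divide: "x \<in> FF \<Longrightarrow> x \<noteq> 0 \<Longrightarrow> y \<in> FF \<Longrightarrow> y \<noteq> 0 \<Longrightarrow> dv (x / y) = dv x - dv y"
  by (rule poly_mapping_eqI)
     (simp add: lookup_dv field_setD[OF FF_field] lookup_minus oo(3))

lemma dv_const: "c \<noteq> 0 \<Longrightarrow> dv (const_fun c) = 0"
  by (rule poly_mapping_eqI) (simp add: lookup_dv FF_const oo(8))

end

section \<open>Principal divisors have degree zero\<close>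

lemma divisor_degree_sum:
  assumes "finite S" "Poly_Mapping.keys D \<subseteq> S"
  shows "divisor_degree D = (\<Sum>V\<in>S. Poly_Mapping.lookup D V * int (place_degree V))"
  unfolding divisor_degree_def
  by (rule sum.mono_neutral_left[OF assms]) (simp add: in_keys_iff)

lemma divisor_degree_add: "divisor_degree (D + E) = divisor_degree D + divisor_degree E"
proof -
  let ?S = "Poly_Mapping.keys D \<union> Poly_Mapping.keys E"
  have "Poly_Mapping.keys (D + E) \<subseteq> ?S" by (rule Poly_Mapping.keys_add)
  then show ?thesis
    by (simp add: divisor_degree_sum[of ?S] lookup_add algebra_simps sum.distrib)
qed

lemma divisor_degree_diff: "divisor_degree (D - E) = divisor_degree D - divisor_degree E"
  using divisor_degree_add[of "D - E" E] by simp

lemma divisor_degree_0 [simp]: "divisor_degree 0 = 0"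
  by (simp add: divisor_degree_def)

lemma divisor_degree_single [simp]:
  "divisor_degree (Poly_Mapping.single V n) = n * int (place_degree V)"
  by (subst divisor_degree_sum[of "{V}"]) auto

context ell
begin

text \<open>In the split, ramified and inert cases alike, ramification indices times residue degrees
  add up to \<open>2 * degree g\<close>, which is the order of the pole at infinity.\<close>

lemma degree_dv_irreducible:
  assumes g: "irreducible g" shows "divisor_degree (dv (evf u g)) = 0"
proof -
  have nz: "g \<noteq> 0" "evf u g \<noteq> 0" using irreducible_poly_degree[OF g] by auto
  have sub: "places_over g \<subseteq> places FF" by (auto simp: places_over_def)
  have notinf: "Vinf \<notin> places_over g" using Vinf_u by (auto simp: places_over_def)
  have "Poly_Mapping.keys (dv (evf u g)) \<subseteq> insert Vinf (places_over g)"
    using not_over[OF g] Vinf_unique by (auto simp: dv_keys[OF FF_evf nz(2)])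
  then have "divisor_degree (dv (evf u g)) =
    (\<Sum>V\<in>insert Vinf (places_over g). Poly_Mapping.lookup (dv (evf u g)) V * int (place_degree V))"
    using over_finite[OF g] by (intro divisor_degree_sum) auto
  also have "\<dots> = - 2 * int (degree g) + (\<Sum>V\<in>places_over g. place_ord V (evf u g) * int (place_degree V))"
    using over_finite[OF g] notinf sub nz ord_inf_evf Vinf_place Vinf_degree
    by (simp add: lookup_dv[OF FF_evf] subset_iff)
  also have "(\<Sum>V\<in>places_over g. place_ord V (evf u g) * int (place_degree V)) =
     (\<Sum>V\<in>places_over g. (if g dvd cub then 2 else 1) * int (place_degree V))"
    using ord_over[OF g] by (intro sum.cong) auto
  also have "\<dots> = 2 * int (degree g)"
  proof (cases "\<exists>h. root_mod g h")
    case True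
    then obtain h where gh: "root_mod g h" by blast
    note d = VH_degree[OF gh] VH_degree[OF root_mod_uminus[OF gh]]
    show ?thesis unfolding over_root[OF gh]
      using VH_neq[OF gh] VH_eq[OF gh] d by (cases "g dvd cub") auto
  next
    case False
    then have i: "\<And>h. \<not> root_mod g h" by blast
    have "\<not> g dvd cub" using i[of 0] g unfolding root_mod_def mult_zero_left diff_0 dvd_minus_iff by blast
    then show ?thesis unfolding over_inert[OF g i] using VI_degree[OF g i] by simp
  qed
  finally show ?thesis by simp
qed

lemma degree_dv_poly: "q \<noteq> 0 \<Longrightarrow> divisor_degree (dv (evf u q)) = 0"
proof (induction "degree q" arbitrary: q rule: less_induct)
  case less
  show ?case
  proof (cases "degree q = 0")
    case True
    then obtain c where c: "q = [:c:]" by (auto elim: degree_eq_zeroE)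
    then have "dv (evf u q) = 0" using less.prems dv_const[of c] by simp
    then show ?thesis by simp
  next
    case False
    then obtain g where g: "irreducible g" "g dvd q" using poly_irreducible_factor by blast
    then obtain r where r: "q = g * r" by (auto elim: dvdE)
    have nz: "g \<noteq> 0" "r \<noteq> 0" using r less.prems by auto
    have "degree r < degree q"
      using r nz irreducible_poly_degree[OF g(1)] by (auto simp: degree_mult_eq)
    then have "divisor_degree (dv (evf u r)) = 0" using less.hyps nz by blast
    then show ?thesis
      using nz by (simp add: r dv_mult FF_evf divisor_degree_add degree_dv_irreducible[OF g(1)])
  qed
qed

lemma cj_Vinf: "cj ` Vinf = Vinf"
proof (rule Vinf_unique[OF cj_place[OF Vinf_place]])
  show "u \<notin> cj ` Vinf" using cj_image_iff[OF placeD(7)[OF Vinf_place] FF_u] Vinf_u by simp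
qed

lemma cj_degree: assumes V: "V \<in> places FF" shows "place_degree (cj ` V) = place_degree V"
proof (cases "u \<in> V")
  case False
  then show ?thesis using Vinf_unique[OF V] cj_Vinf by simp
next
  case True
  have *: ?thesis if B: "residue_basis V B" for B
  proof -
    have "inj_on cj B" using B placeD(7)[OF V]
      by (intro inj_on_subset[OF cj_inj]) (auto simp: residue_basis_def)
    then have "card (cj ` B) = card B" by (rule card_image)
    then show ?thesis
      using place_degree_eq[OF FF_field V B]
        place_degree_eq[OF FF_field cj_place[OF V] cj_residue_basis[OF V B]] by simp
  qed
  obtain g where g: "irreducible g" "evf u g \<in> place_ideal V" using place_over_irreducible[OF V True] .
  from place_classify[OF V True g] show ?thesis
    using * VH_basis VI_basis[OF g(1)] by blast
qed

lemma degree_dv_cj: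
  assumes x: "x \<in> FF" "x \<noteq> 0" shows "divisor_degree (dv (cj x)) = divisor_degree (dv x)"
proof -
  have x': "cj x \<in> FF" "cj x \<noteq> 0" using x cj_FF cj_eq_0_iff by auto
  have bij: "bij_betw ((`) cj) (Poly_Mapping.keys (dv x)) (Poly_Mapping.keys (dv (cj x)))"
  proof (rule bij_betw_byWitness[of _ "(`) cj"])
    have cc: "cj ` cj ` V = V" if "V \<in> places FF" for V by (rule cj_cj_image[OF placeD(7)[OF that]])
    show "\<forall>V\<in>Poly_Mapping.keys (dv x). cj ` cj ` V = V"
      "\<forall>V\<in>Poly_Mapping.keys (dv (cj x)). cj ` cj ` V = V"
      using cc x x' by (auto simp: dv_keys simp del: image_image)
    show "(`) cj ` Poly_Mapping.keys (dv x) \<subseteq> Poly_Mapping.keys (dv (cj x))"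
      using x x' cj_ord[OF _ x(1)] by (auto simp: dv_keys intro: cj_place)
    show "(`) cj ` Poly_Mapping.keys (dv (cj x)) \<subseteq> Poly_Mapping.keys (dv x)"
      using x x' cj_ord[OF _ x'(1)] cj_cj[OF x(1)] by (auto simp: dv_keys intro: cj_place)
  qed
  show ?thesis unfolding divisor_degree_def
    by (rule sum.reindex_bij_betw[OF bij, symmetric, THEN HOL.trans])
       (use x x' cj_ord[OF _ x(1)] cj_degree cj_place in \<open>auto simp: dv_keys lookup_dv intro!: sum.cong\<close>)
qed

text \<open>The divisors of a numerator and of its conjugate have the same degree, and the product
  of the two functions is a polynomial in \<open>u\<close>.\<close>

lemma degree_dv: assumes x: "x \<in> FF" "x \<noteq> 0" shows "divisor_degree (dv x) = 0"
proof -
  obtain a b c where c: "c \<noteq> 0" "x = el a b / evf u c" using FFE[OF x(1)] .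
  have ab: "el a b \<noteq> 0" "el a (- b) \<noteq> 0" and N: "nrm a b \<noteq> 0" using c x(2) by auto
  have "dv (el a b) + dv (cj (el a b)) = dv (el a b * el a (- b))"
    using dv_mult[OF FF_el ab(1) FF_el ab(2)] by simp
  then have "divisor_degree (dv (el a b)) + divisor_degree (dv (cj (el a b))) = 0"
    using degree_dv_poly[OF N] by (simp only: el_conj divisor_degree_add[symmetric])
  then have "divisor_degree (dv (el a b)) = 0" using degree_dv_cj[OF FF_el ab(1)] by simp
  then show ?thesis
    unfolding c(2) using c(1) ab by (simp add: dv_divide FF_el FF_evf divisor_degree_diff degree_dv_poly)
qed

end

section \<open>Divisors of lines and the group law\<close>

text \<open>The abscissae of the intersection with the line \<open>y = l x + m\<close> are the roots
  of the cubic minus \<open>(l x + m)^2\<close>; two are known, and \<open>x3\<close> comes from the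
  sum of the roots.\<close>

lemma line_cubic:
  fixes A B C :: "'a::field_char_0"
  assumes c1: "y1 ^ 2 = x1 ^ 3 + A * x1 ^ 2 + B * x1 + C" and c2: "y2 ^ 2 = x2 ^ 3 + A * x2 ^ 2 + B * x2 + C"
    and ne: "\<not> (x1 = x2 \<and> y1 + y2 = 0)"
    and l: "l = (if x1 = x2 then (3 * x1 ^ 2 + 2 * A * x1 + B) / (2 * y1) else (y2 - y1) / (x2 - x1))"
    and m: "m = y1 - l * x1" and x3: "x3 = l ^ 2 - A - x1 - x2"
  shows "[:C, B, A, 1:] - [:m, l:] * [:m, l:] = [:- x1, 1:] * [:- x2, 1:] * [:- x3, 1:]"
    and "y2 = l * x2 + m"
proof -
  \<comment> \<open>By the choice of \<open>x3\<close>, the two sides differ by the linear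
    polynomial \<open>q - p X\<close>. It vanishes at \<open>x1\<close> and \<open>x2\<close>; if
    these agree, its derivative vanishes there by the tangent condition.\<close>
  define p where "p = x1 * x2 + x1 * x3 + x2 * x3 - (B - 2 * l * m)"
  define q where "q = C - m ^ 2 + x1 * x2 * x3"
  have y1: "y1 = l * x1 + m" by (simp add: m)
  have y2: "y2 = l * x2 + m \<and> (x1 = x2 \<longrightarrow> 2 * y1 * l = 3 * x1 ^ 2 + 2 * A * x1 + B)"
  proof (cases "x1 = x2")
    case True
    have "(y1 - y2) * (y1 + y2) = y1 ^ 2 - y2 ^ 2" by (simp add: power2_eq_square algebra_simps)
    also have "\<dots> = 0" unfolding c1 c2 True by simp
    finally have e: "y1 = y2" using ne True by simp
    then have "y1 \<noteq> 0" using ne True by auto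
    have "l = (3 * x1 ^ 2 + 2 * A * x1 + B) / (2 * y1)" unfolding l by (rule if_P[OF True])
    then have "2 * y1 * l = 3 * x1 ^ 2 + 2 * A * x1 + B" using \<open>y1 \<noteq> 0\<close> by simp
    then show ?thesis using e y1 True by simp
  next
    case False
    have d: "x2 - x1 \<noteq> 0" using False by simp
    have "l = (y2 - y1) / (x2 - x1)" unfolding l by (rule if_not_P[OF False])
    then have "y2 - y1 = l * (x2 - x1)" using nonzero_eq_divide_eq[OF d] by simp
    then have "y2 = y1 + l * (x2 - x1)" by (simp only: diff_eq_eq add.commute)
    also have "\<dots> = l * x2 + m" unfolding m by (simp add: right_diff_distrib)
    finally show ?thesis using False by simp
  qed
  then show "y2 = l * x2 + m" by blast
  have q1: "q - p * x1 = (x1 ^ 3 + A * x1 ^ 2 + B * x1 + C) - (l * x1 + m) ^ 2"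
    unfolding p_def q_def x3 by (simp add: power2_eq_square power3_eq_cube algebra_simps)
  then have q1: "q = p * x1" using c1 y1 by simp
  have "q - p * x2 = (x2 ^ 3 + A * x2 ^ 2 + B * x2 + C) - (l * x2 + m) ^ 2"
    unfolding p_def q_def x3 by (simp add: power2_eq_square power3_eq_cube algebra_simps)
  then have q2: "q = p * x2" using c2 y2 by simp
  have "p = 0"
  proof (cases "x1 = x2")
    case True
    have "p = 2 * (l * x1 + m) * l - (3 * x1 ^ 2 + 2 * A * x1 + B)"
      unfolding p_def x3 True by (simp add: power2_eq_square algebra_simps)
    then show ?thesis using y2 y1 True by simp
  next
    case False
    have "p * (x1 - x2) = 0" using q1 q2 by (simp only: right_diff_distrib diff_self)
    then show ?thesis using False by simp
  qed
  moreover from this q1 have "q = 0" by simp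
  ultimately have p: "x1 * x2 + x1 * x3 + x2 * x3 = B - 2 * l * m" and q: "m ^ 2 - C = x1 * x2 * x3"
    unfolding p_def q_def by (simp_all add: algebra_simps)
  have "[:- x1, 1:] * [:- x2, 1:] * [:- x3, 1:] =
     [:- (x1 * x2 * x3), x1 * x2 + x1 * x3 + x2 * x3, - (x1 + x2 + x3), 1:]"
    by (simp add: algebra_simps)
  also have "\<dots> = [:C - m ^ 2, B - 2 * l * m, A - l ^ 2, 1:]"
    unfolding p q[symmetric] by (simp add: x3)
  also have "\<dots> = [:C, B, A, 1:] - [:m, l:] * [:m, l:]"
    by (simp add: power2_eq_square algebra_simps)
  finally show "[:C, B, A, 1:] - [:m, l:] * [:m, l:] = [:- x1, 1:] * [:- x2, 1:] * [:- x3, 1:]" ..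
qed

fun neg_point :: "'a::field weierstrass \<Rightarrow> 'a ec_point \<Rightarrow> 'a ec_point" where
  "neg_point E Infinity = Infinity"
| "neg_point E (Affine x y) = Affine x (- y - wa1 E * x - wa3 E)"

context ell
begin

abbreviation "EC \<equiv> Weierstrass 0 A 0 B C"

lemma on_EC: "on_curve EC (Affine x y) \<longleftrightarrow> y ^ 2 = x ^ 3 + A * x ^ 2 + B * x + C"
  by simp

fun pt :: "'k ec_point \<Rightarrow> 'k funs set" where
  "pt Infinity = Vinf"
| "pt (Affine x y) = VH [:- x, 1:] [:y:]"

lemma poly_cub: "poly cub x = x ^ 3 + A * x ^ 2 + B * x + C"
  by (simp add: power2_eq_square power3_eq_cube algebra_simps)

lemma cub_dvd_iff: "on_curve EC (Affine x y) \<Longrightarrow> [:- x, 1:] dvd cub \<longleftrightarrow> y = 0"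
  unfolding degree_one_dvd_root poly_cub on_EC by (metis power_eq_0_iff zero_power2 zero_less_numeral)

lemma pt_root: "on_curve EC (Affine x y) \<Longrightarrow> root_mod [:- x, 1:] [:y:]"
  unfolding root_mod_def degree_one_dvd_root on_EC poly_diff poly_mult poly_cub
  using irreducible_X[of "- x"] by (simp add: power2_eq_square)

lemma pt_ideal_iff: "on_curve EC (Affine x y) \<Longrightarrow> el a b \<in> place_ideal (pt (Affine x y)) \<longleftrightarrow> poly a x + poly b x * y = 0"
  unfolding pt.simps ideal_VH_iff[OF pt_root] degree_one_dvd_root by (simp add: mult.commute)

lemma pt_place: "on_curve EC P \<Longrightarrow> pt P \<in> places FF"
  by (cases P) (auto intro: Vinf_place VH_place pt_root simp del: on_curve.simps)

lemma pt_degree: "on_curve EC P \<Longrightarrow> place_degree (pt P) = 1"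
proof (cases P)
  case (Affine x y)
  then show "on_curve EC P \<Longrightarrow> place_degree (pt P) = 1"
    using VH_degree[OF pt_root, of x y] by (simp del: on_curve.simps)
qed (simp add: Vinf_degree)

lemma pt_u: "on_curve EC (Affine x y) \<Longrightarrow> u \<in> pt (Affine x y)"
  unfolding pt.simps using VH_R[OF pt_root] u_R by blast

lemma pt_unique:
  assumes V: "V \<in> places FF" "u \<in> V" and c: "on_curve EC (Affine x y)"
    and i: "V \<in> places_over [:- x, 1:]" "el [:- y:] 1 \<in> place_ideal V"
  shows "V = pt (Affine x y)"
proof -
  from i(1) over_root[OF pt_root[OF c]] have "V = VH [:- x, 1:] [:y:] \<or> V = VH [:- x, 1:] (- [:y:])" by blast
  then show ?thesis
  proof
    assume V': "V = VH [:- x, 1:] (- [:y:])"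
    with i(2) have "[:- x, 1:] dvd [:- y:] + 1 * (- [:y:])"
      using ideal_VH_iff[OF root_mod_uminus[OF pt_root[OF c]]] by blast
    then have "y = 0" unfolding degree_one_dvd_root by simp
    with V' show ?thesis by simp
  qed simp
qed

lemma pt_inj:
  assumes "on_curve EC (Affine x y)" "on_curve EC (Affine x' y')" "pt (Affine x y) = pt (Affine x' y')"
  shows "x = x'"
proof -
  have "el [:- x, 1:] 0 \<in> place_ideal (pt (Affine x y))" unfolding pt_ideal_iff[OF assms(1)] by simp
  then show ?thesis unfolding assms(3) pt_ideal_iff[OF assms(2)] by simp
qed

lemma pt_neq_Vinf: "on_curve EC (Affine x y) \<Longrightarrow> pt (Affine x y) \<noteq> Vinf"
  using pt_u Vinf_u by metis

lemma not_ideal_ord0: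
  assumes V: "V \<in> places FF" "u \<in> V" and nz: "el a b \<noteq> 0" and "el a b \<notin> place_ideal V"
  shows "place_ord V (el a b) = 0"
  using oo(5)[OF V(1) FF_el nz] affine_ord_ge[OF V nz] assms(4) by linarith

lemma ord_linear:
  assumes V: "V \<in> places FF" "u \<in> V" and c: "on_curve EC (Affine x y)"
  shows "place_ord V (evf u [:- x, 1:]) = (if V \<in> places_over [:- x, 1:] then (if y = 0 then 2 else 1) else 0)"
  using ord_over[OF irreducible_X, of V "- x"] not_over[OF irreducible_X V, of "- x"] cub_dvd_iff[OF c]
  by (simp del: evf_simps)

definition dP :: "'k ec_point \<Rightarrow> 'k funs set \<Rightarrow>\<^sub>0 int" where
  "dP P = Poly_Mapping.single (pt P) 1 - Poly_Mapping.single Vinf 1"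

lemma dv_vertical:
  assumes c: "on_curve EC (Affine x y)"
  shows "dv (evf u [:- x, 1:]) = dP (Affine x y) + dP (Affine x (- y))"
proof (rule poly_mapping_eqI)
  fix V
  have c': "on_curve EC (Affine x (- y))" using c by simp
  have nz: "evf u [:- x, 1:] \<noteq> 0" by (simp del: evf_simps)
  note l = lookup_dv[OF FF_evf nz, of V]
  have o: "places_over [:- x, 1:] = {pt (Affine x y), pt (Affine x (- y))}"
    using over_root[OF pt_root[OF c]] by simp
  have eq: "pt (Affine x y) = pt (Affine x (- y)) \<longleftrightarrow> y = 0"
    using VH_neq[OF pt_root[OF c]] VH_eq[OF pt_root[OF c]] cub_dvd_iff[OF c] by auto
  consider "V \<notin> places FF" | "V = Vinf" | "V \<in> places FF" "u \<in> V" using Vinf_unique by blast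
  then show "Poly_Mapping.lookup (dv (evf u [:- x, 1:])) V =
      Poly_Mapping.lookup (dP (Affine x y) + dP (Affine x (- y))) V"
  proof cases
    case 1
    then have "V \<noteq> pt (Affine x y)" "V \<noteq> pt (Affine x (- y))" "V \<noteq> Vinf"
      using pt_place[OF c] pt_place[OF c'] Vinf_place by auto
    then show ?thesis using 1 unfolding l by (simp add: dP_def lookup_add lookup_minus lookup_single when_def)
  next
    case 2
    then show ?thesis using pt_neq_Vinf[OF c] pt_neq_Vinf[OF c'] ord_inf_evf[of "[:- x, 1:]"] Vinf_place
      unfolding l by (simp add: dP_def lookup_add lookup_minus lookup_single when_def del: pt.simps evf_simps)
  next
    case 3
    then have "V \<noteq> Vinf" using Vinf_u by auto
    then show ?thesis unfolding l ord_linear[OF 3 c] o using 3 eq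
      by (auto simp add: dP_def lookup_add lookup_minus lookup_single when_def simp del: pt.simps)
  qed
qed

text \<open>The function of the line times its conjugate is, up to sign, the product of three
  vertical lines, whose orders are known. At a point with \<open>y \<noteq> 0\<close> the conjugate
  does not vanish, so the line takes the whole order. At a point with \<open>y = 0\<close> the place
  is its own conjugate, so the line takes half of it.\<close>

lemma dv_line:
  assumes id: "cub - [:m, l:] * [:m, l:] = [:- x1, 1:] * [:- x2, 1:] * [:- x3, 1:]"
  shows "on_curve EC (Affine x1 (l * x1 + m))" "on_curve EC (Affine x2 (l * x2 + m))"
    "on_curve EC (Affine x3 (l * x3 + m))"
    "dv (el (- [:m, l:]) 1) =
       dP (Affine x1 (l * x1 + m)) + dP (Affine x2 (l * x2 + m)) + dP (Affine x3 (l * x3 + m))"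
proof -
  let ?M = "[:m, l:]"
  define f where "f x = Affine x (l * x + m)" for x
  have oc: "on_curve EC (f x)" if "x \<in> {x1, x2, x3}" for x
  proof -
    have "poly (cub - ?M * ?M) x = 0" unfolding id poly_mult using that by auto
    then show ?thesis unfolding f_def on_EC poly_diff poly_cub poly_mult by (simp add: power2_eq_square algebra_simps)
  qed
  then show c: "on_curve EC (Affine x1 (l * x1 + m))" "on_curve EC (Affine x2 (l * x2 + m))"
    "on_curve EC (Affine x3 (l * x3 + m))"
    unfolding f_def by blast+
  define L where "L = el (- ?M) 1"
  have L: "L \<in> FF" "L \<noteq> 0" unfolding L_def using FF_el by simp_all
  have L': "cj L \<in> FF" "cj L \<noteq> 0" using L cj_FF cj_eq_0_iff by auto
  have cjL: "cj L = el (- ?M) (- 1)" by (simp add: L_def)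
  define g1 g2 g3 where "g1 = evf u [:- x1, 1:]" and "g2 = evf u [:- x2, 1:]" and "g3 = evf u [:- x3, 1:]"
  have g: "g1 \<in> FF" "g2 \<in> FF" "g3 \<in> FF" unfolding g1_def g2_def g3_def by (rule FF_evf)+
  have g0: "g1 \<noteq> 0" "g2 \<noteq> 0" "g3 \<noteq> 0" unfolding g1_def g2_def g3_def by (simp_all del: evf_simps)
  have LL: "L * cj L = const_fun (- 1) * (g1 * g2 * g3)"
  proof -
    have n: "nrm (- ?M) 1 = - (cub - ?M * ?M)" by (simp add: nrm_def)
    have "L * cj L = evf u (nrm (- ?M) 1)" unfolding cjL unfolding L_def by (rule el_conj)
    also have "\<dots> = - (g1 * g2 * g3)" unfolding n id evf_minus evf_mult g1_def g2_def g3_def ..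
    finally show ?thesis by simp
  qed
  have "dv L = dP (f x1) + dP (f x2) + dP (f x3)"
  proof (rule poly_mapping_eqI)
    fix V
    note ld = lookup_dv[OF L, of V]
    note s = dP_def lookup_add lookup_minus lookup_single when_def
    consider "V \<notin> places FF" | "V = Vinf" | "V \<in> places FF" "u \<in> V" using Vinf_unique by blast
    then show "Poly_Mapping.lookup (dv L) V = Poly_Mapping.lookup (dP (f x1) + dP (f x2) + dP (f x3)) V"
    proof cases
      case 1
      then have "V \<noteq> pt (f x1)" "V \<noteq> pt (f x2)" "V \<noteq> pt (f x3)" "V \<noteq> Vinf"
        using pt_place[OF oc] Vinf_place by auto
      then show ?thesis using 1 unfolding ld by (simp add: s)
    next
      case 2
      have "place_ord Vinf L = - 3" unfolding L_def using L ord_inf_el[of "- ?M" 1] by (simp add: L_def split: if_splits)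
      moreover have "pt (f x) \<noteq> Vinf" if "x \<in> {x1, x2, x3}" for x
        using pt_neq_Vinf oc[OF that] unfolding f_def by blast
      then have "pt (f x1) \<noteq> Vinf" "pt (f x2) \<noteq> Vinf" "pt (f x3) \<noteq> Vinf" by auto
      ultimately show ?thesis unfolding ld using 2 Vinf_place by (simp add: s)
    next
      case V: 3
      have Vn: "V \<noteq> Vinf" using Vinf_u V by auto
      have Lpt: "L \<in> place_ideal (pt (f x))" if "x \<in> {x1, x2, x3}" for x
        using oc[OF that] unfolding f_def L_def by (subst pt_ideal_iff) (simp_all add: algebra_simps)
      show ?thesis
      proof (cases "L \<in> place_ideal V")
        case False
        then have "V \<noteq> pt (f x1)" "V \<noteq> pt (f x2)" "V \<noteq> pt (f x3)" using Lpt by auto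
        moreover have "place_ord V L = 0" using False L V unfolding L_def by (intro not_ideal_ord0) auto
        ultimately show ?thesis unfolding ld using V Vn by (simp add: s)
      next
        case True
        note RV = R_sub_place[OF V]
        have gV: "g1 \<in> V" "g2 \<in> V" "g3 \<in> V" unfolding g1_def g2_def g3_def using RV evf_R by blast+
        have cLV: "cj L \<in> V" unfolding cjL using RV el_R by blast
        have "const_fun (- 1) * (L * cj L) \<in> place_ideal V"
          by (subst mult.commute[of L]) (intro place_ideal_mult[OF V(1)] placeD(6)[OF V(1)] cLV True)
        then have "g1 * g2 * g3 \<in> place_ideal V" unfolding LL by simp
        then have "g1 \<in> place_ideal V \<or> g2 \<in> place_ideal V \<or> g3 \<in> place_ideal V"
          using place_ideal_prime[OF V(1)] gV placeD(4)[OF V(1)] by blast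
        then obtain x where x: "x \<in> {x1, x2, x3}" and xo: "V \<in> places_over [:- x, 1:]"
          unfolding g1_def g2_def g3_def places_over_def using V by blast
        have ox: "on_curve EC (Affine x (l * x + m))" using oc[OF x] by (simp only: f_def)
        define y where "y = l * x + m"
        have lin: "const_fun l * evf u [:- x, 1:] \<in> place_ideal V"
          using xo by (intro place_ideal_mult[OF V(1)] placeD(6)[OF V(1)]) (simp add: places_over_def)
        have "L + const_fun l * evf u [:- x, 1:] = el [:- y:] 1"
          unfolding L_def y_def by (simp add: el_def algebra_simps)
        then have "el [:- y:] 1 \<in> place_ideal V" using place_ideal_add[OF FF_field V(1) True lin] by simp
        then have Vx: "V = pt (f x)" using pt_unique[OF V ox xo] unfolding y_def f_def by blast
        have eqx: "V = pt (f x') \<longleftrightarrow> x' = x" if "x' \<in> {x1, x2, x3}" for x'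
          using Vx pt_inj oc[OF that] oc[OF x] unfolding f_def by metis
        have other: "V \<notin> places_over [:- x', 1:]" if "x' \<noteq> x" for x'
        proof
          assume "V \<in> places_over [:- x', 1:]"
          then have "evf u [:- x, 1:] - evf u [:- x', 1:] \<in> place_ideal V"
            using xo place_ideal_diff[OF FF_field V(1)] by (simp add: places_over_def del: evf_simps)
          then have "const_fun (x' - x) \<in> place_ideal V" by simp
          then show False using const_notin_place_ideal[OF V(1), of "x' - x"] that by simp
        qed
        \<comment> \<open>The order of the vertical line at its point is 2 if the point is its own
          negative. Below, \<open>n\<close> is the multiplicity of \<open>x\<close> among the three
          abscissae.\<close>
        define e where "e = (if y = 0 then 2 else 1 :: int)"
        have og: "place_ord V (evf u [:- x', 1:]) = (if x' = x then e else 0)" if "x' \<in> {x1, x2, x3}" for x'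
          using ord_linear[OF V oc[OF that, unfolded f_def]] other[of x'] xo by (auto simp: e_def y_def)
        define n where "n = (if x1 = x then 1 else 0) + (if x2 = x then 1 else 0) + (if x3 = x then 1 else (0::int))"
        have "place_ord V (L * cj L) = place_ord V (g1 * g2 * g3)"
          unfolding LL using oo(1)[OF V(1) FF_const, of "- 1" "g1 * g2 * g3"] oo(8)[OF V(1), of "- 1"] g g0
          by (simp add: field_setD(4)[OF FF_field])
        also have "\<dots> = place_ord V g1 + place_ord V g2 + place_ord V g3"
          using oo(1)[OF V(1)] g g0 by (simp add: field_setD(4)[OF FF_field])
        also have "\<dots> = e * n"
          using og[of x1] og[of x2] og[of x3] unfolding g1_def g2_def g3_def n_def by simp
        finally have sum: "place_ord V L + place_ord V (cj L) = e * n"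
          using oo(1)[OF V(1) L L'] by simp
        have "place_ord V L = n"
        proof (cases "y = 0")
          case False
          have "el (- ?M) (- 1) \<notin> place_ideal V"
          proof -
            have "poly (- ?M) x + poly (- 1) x * (l * x + m) = - 2 * y" by (simp add: y_def algebra_simps)
            then show ?thesis unfolding Vx f_def pt_ideal_iff[OF ox] using False by (simp only:) simp
          qed
          then have "place_ord V (cj L) = 0" using L' unfolding cjL by (intro not_ideal_ord0 V) auto
          then show ?thesis using sum False by (simp add: e_def)
        next
          case y0: True
          have "u \<in> cj ` V" using cj_image_iff[OF placeD(7)[OF V(1)] FF_u] V by simp
          moreover have "evf u [:- x, 1:] \<in> place_ideal (cj ` V)"
          proof -
            have "evf u [:- x, 1:] \<in> place_ideal V" using xo by (simp add: places_over_def)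
            then have "cj (evf u [:- x, 1:]) \<in> cj ` place_ideal V" by (rule imageI)
            then show ?thesis unfolding cj_ideal[OF placeD(7)[OF V(1)]] cj_evf .
          qed
          ultimately have "cj ` V \<in> places_over [:- x, 1:]"
            using cj_place[OF V(1)] by (simp add: places_over_def)
          moreover have yy: "l * x + m = 0" using y0 by (simp only: y_def)
          have "places_over [:- x, 1:] = {V}"
            using over_root[OF pt_root[OF ox]] Vx unfolding f_def pt.simps yy by simp
          ultimately have "cj ` V = V" by simp
          then have "place_ord V (cj L) = place_ord V L" using cj_ord[OF V(1) L(1)] by simp
          then show ?thesis using sum y0 by (simp add: e_def)
        qed
        moreover have "Poly_Mapping.lookup (dP (f x1) + dP (f x2) + dP (f x3)) V = n"
        proof -
          have c: "pt (f x') = V \<longleftrightarrow> x' = x" if "x' \<in> {x1, x2, x3}" for x'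
          proof
            show "x' = x" if "pt (f x') = V" using iffD1[OF eqx[OF \<open>x' \<in> _\<close>] sym[OF that]] .
            show "pt (f x') = V" if "x' = x" using sym[OF iffD2[OF eqx[OF \<open>x' \<in> _\<close>] that]] .
          qed
          have "Poly_Mapping.lookup (dP (f x')) V = (if x' = x then 1 else 0)" if "x' \<in> {x1, x2, x3}" for x'
            unfolding s c[OF that] if_not_P[OF not_sym[OF Vn]] by simp
          then show ?thesis unfolding n_def lookup_add by (simp only: insert_iff simp_thms)
        qed
        ultimately show ?thesis unfolding ld using V by simp
      qed
    qed
  qed
  then show "dv (el (- [:m, l:]) 1) =
       dP (Affine x1 (l * x1 + m)) + dP (Affine x2 (l * x2 + m)) + dP (Affine x3 (l * x3 + m))"
    by (simp only: L_def f_def)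
qed

text \<open>Linear equivalence of divisors.\<close>

definition sim :: "('k funs set \<Rightarrow>\<^sub>0 int) \<Rightarrow> ('k funs set \<Rightarrow>\<^sub>0 int) \<Rightarrow> bool" where
  "sim D E \<longleftrightarrow> (\<exists>z\<in>FF. z \<noteq> 0 \<and> D - E = dv z)"

lemma sim_dv: "z \<in> FF \<Longrightarrow> z \<noteq> 0 \<Longrightarrow> sim (dv z) 0"
  by (auto simp: sim_def)

lemma sim_refl: "sim D D"
  unfolding sim_def using dv_const[of 1] FF_const[of 1] by (intro bexI[of _ 1]) auto

lemma sim_add: "sim D E \<Longrightarrow> sim D' E' \<Longrightarrow> sim (D + D') (E + E')"
proof -
  assume "sim D E" "sim D' E'"
  then obtain z z' where z: "z \<in> FF" "z \<noteq> 0" "D - E = dv z" "z' \<in> FF" "z' \<noteq> 0" "D' - E' = dv z'"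
    by (auto simp: sim_def)
  have "(D + D') - (E + E') = (D - E) + (D' - E')" by simp
  also have "\<dots> = dv (z * z')" unfolding z(3,6) using z by (simp add: dv_mult)
  finally show ?thesis unfolding sim_def using z field_setD(4)[OF FF_field] by (intro bexI[of _ "z * z'"]) auto
qed

lemma sim_uminus: "sim D E \<Longrightarrow> sim (- D) (- E)"
proof -
  assume "sim D E"
  then obtain z where z: "z \<in> FF" "z \<noteq> 0" "D - E = dv z" by (auto simp: sim_def)
  have "- D - - E = dv 1 - (D - E)" using dv_const[of 1] by simp
  also have "\<dots> = dv (1 / z)" unfolding z(3) using z FF_const[of 1] by (subst dv_divide) auto
  finally show ?thesis unfolding sim_def using z field_setD(1,8)[OF FF_field] by (intro bexI[of _ "1 / z"]) auto
qed

lemma sim_diff: "sim D E \<Longrightarrow> sim D' E' \<Longrightarrow> sim (D - D') (E - E')"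
  using sim_add[of D E "- D'" "- E'"] sim_uminus by simp

lemma sim_iff: "sim D E \<longleftrightarrow> sim (D - E) 0"
  by (simp add: sim_def)

lemma sim_sym: "sim D E \<Longrightarrow> sim E D"
  using sim_uminus[of D E] by (simp add: sim_def)

lemma sim_trans: "sim D E \<Longrightarrow> sim E G \<Longrightarrow> sim D G"
  using sim_add[of D E E G] by (simp add: sim_def)

lemma dP_Infinity [simp]: "dP Infinity = 0" by (simp add: dP_def)

lemma neg_on: "on_curve EC P \<Longrightarrow> on_curve EC (neg_point EC P)"
  by (cases P) auto

lemma dP_neg: "on_curve EC P \<Longrightarrow> sim (dP P + dP (neg_point EC P)) 0"
proof (cases P)
  case (Affine x y)
  assume "on_curve EC P"
  then have c: "on_curve EC (Affine x y)" by (simp only: Affine)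
  have "sim (dv (evf u [:- x, 1:])) 0" by (rule sim_dv[OF FF_evf]) (simp del: evf_simps)
  then show ?thesis unfolding dv_vertical[OF c] by (simp add: Affine)
qed (simp add: sim_refl)

text \<open>The line through \<open>P\<close> and \<open>Q\<close>, or the tangent, makes the sum of
  \<open>P\<close>, \<open>Q\<close> and its third point \<open>S\<close> principal; the vertical
  line through \<open>S\<close> replaces \<open>S\<close> by its negative.\<close>

lemma ec_add_hom:
  assumes P: "on_curve EC P" and Q: "on_curve EC Q"
  shows "on_curve EC (ec_add EC P Q) \<and> sim (dP P + dP Q) (dP (ec_add EC P Q))"
proof (cases P)
  case Infinity
  then show ?thesis using Q by (simp add: sim_refl)
next
  case PA: (Affine x1 y1)
  show ?thesis
  proof (cases Q)
    case Infinity
    then show ?thesis using P PA by (simp add: sim_refl)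
  next
    case QA: (Affine x2 y2)
    show ?thesis
    proof (cases "x1 = x2 \<and> y1 + y2 = 0")
      case True
      then have "Q = neg_point EC P" using PA QA by (simp add: add_eq_0_iff)
      then show ?thesis using dP_neg[OF P] True PA QA by simp
    next
      case False
      define l where "l = (if x1 = x2 then (3 * x1 ^ 2 + 2 * A * x1 + B) / (2 * y1) else (y2 - y1) / (x2 - x1))"
      define m where "m = y1 - l * x1"
      define x3 where "x3 = l ^ 2 - A - x1 - x2"
      have c: "y1 ^ 2 = x1 ^ 3 + A * x1 ^ 2 + B * x1 + C" "y2 ^ 2 = x2 ^ 3 + A * x2 ^ 2 + B * x2 + C"
        using P Q PA QA by simp_all
      note lc = line_cubic[OF c False l_def m_def x3_def]
      note dl = dv_line[OF lc(1)]
      have y1: "l * x1 + m = y1" by (simp add: m_def)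
      define S where "S = Affine x3 (l * x3 + m)"
      have S: "on_curve EC S" using dl(3) by (simp only: S_def)
      have add: "ec_add EC P Q = neg_point EC S"
      proof -
        have sl: "(if x1 = x2 then (3 * x1 ^ 2 + 2 * wa2 EC * x1 + wa4 EC - wa1 EC * y1) /
            (2 * y1 + wa1 EC * x1 + wa3 EC) else (y2 - y1) / (x2 - x1)) = l"
          by (simp add: l_def)
        have cond: "\<not> (x1 = x2 \<and> y1 + y2 + wa1 EC * x2 + wa3 EC = 0)" using False by simp
        show ?thesis unfolding PA QA ec_add.simps Let_def sl if_not_P[OF cond]
          by (simp add: S_def x3_def m_def algebra_simps)
      qed
      have nz: "el (- [:m, l:]) 1 \<noteq> 0" by simp
      have 1: "sim (dP P + dP Q + dP S) 0"
        using sim_dv[OF FF_el nz] unfolding dl(4) y1 lc(2)[symmetric] PA QA S_def .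
      have "sim ((dP P + dP Q + dP S) - (dP S + dP (neg_point EC S))) (0 - 0)"
        by (rule sim_diff[OF 1 dP_neg[OF S]])
      then have "sim (dP P + dP Q) (dP (neg_point EC S))" by (simp add: sim_iff[of "dP P + dP Q"] algebra_simps)
      then show ?thesis using neg_on[OF S] unfolding add by blast
    qed
  qed
qed

text \<open>A function whose only pole is a simple one at infinity would lie in
  \<open>k[u, w]\<close>, but there the order at infinity is even or at most
  \<open>- 3\<close>.\<close>

lemma dP_0_imp: 
  assumes P: "on_curve EC P" and s: "sim (dP P) 0" shows "P = Infinity"
proof (rule ccontr)
  assume "P \<noteq> Infinity"
  then obtain x y where PA: "P = Affine x y" by (cases P) auto
  have c: "on_curve EC (Affine x y)" using P PA by (simp only:)
  obtain z where z: "z \<in> FF" "z \<noteq> 0" "dP P = dv z" using s by (auto simp: sim_def)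
  have ld: "place_ord V z = Poly_Mapping.lookup (dP P) V" if "V \<in> places FF" for V
    unfolding z(3) using lookup_dv[OF z(1,2), of V] that by simp
  have "z \<in> R"
  proof (rule regular_R[OF z(1,2)])
    fix V assume V: "V \<in> places FF" "u \<in> V"
    then have "V \<noteq> Vinf" using Vinf_u by auto
    then show "place_ord V z \<ge> 0"
      unfolding ld[OF V(1)] by (simp add: dP_def lookup_minus lookup_single when_def)
  qed
  then obtain a b where ab: "z = el a b" by (auto simp: R_def)
  have "place_ord Vinf z = - 1"
    unfolding ld[OF Vinf_place] using pt_neq_Vinf[OF c] by (simp add: PA dP_def lookup_minus lookup_single when_def del: pt.simps)
  moreover have "- 2 * int (degree a) \<noteq> - 1" "- (2 * int (degree b) + 3) \<noteq> - 1" by presburger+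
  then have "place_ord Vinf z \<noteq> - 1"
    unfolding ab ord_inf_el[OF z(2)[unfolded ab]] by (simp only: split: if_split) blast
  ultimately show False by simp
qed

lemma dP_eq_imp:
  assumes P: "on_curve EC P" and Q: "on_curve EC Q" and s: "sim (dP P) (dP Q)"
  shows "P = Q"
proof -
  note n = neg_on[OF Q]
  have h: "sim (dP P + dP (neg_point EC Q)) (dP (ec_add EC P (neg_point EC Q)))"
    and c: "on_curve EC (ec_add EC P (neg_point EC Q))" using ec_add_hom[OF P n] by auto
  have "sim ((dP P - dP Q) + (dP Q + dP (neg_point EC Q))) (0 + 0)"
    by (rule sim_add) (use s sim_iff dP_neg[OF Q] in auto)
  then have "sim (dP P + dP (neg_point EC Q)) 0" by simp
  with h have "sim (dP (ec_add EC P (neg_point EC Q))) 0" using sim_trans sim_sym by blast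
  from dP_0_imp[OF c this] show ?thesis
    by (cases P; cases Q) (auto simp: Let_def split: if_splits)
qed

text \<open>Points embed into divisor classes and \<open>ec_add\<close> becomes addition, so the
  associative and commutative laws are those of divisors.\<close>

theorem group_EC: "comm_group (mordell_weil EC)"
proof (rule comm_groupI)
  note h = ec_add_hom
  have eqI: "S = T" if "on_curve EC S" "on_curve EC T" "sim D (dP S)" "sim D (dP T)" for S T D
    using dP_eq_imp that sim_trans sim_sym by blast
  fix P Q
  assume P: "P \<in> carrier (mordell_weil EC)"
  then have P: "on_curve EC P" by (simp add: mordell_weil_def)
  have "ec_add EC (neg_point EC P) P = Infinity"
    by (cases P) auto
  then show "\<exists>Q\<in>carrier (mordell_weil EC). Q \<otimes>\<^bsub>mordell_weil EC\<^esub> P = \<one>\<^bsub>mordell_weil EC\<^esub>"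
    using neg_on[OF P] by (auto simp: mordell_weil_def)
  assume "Q \<in> carrier (mordell_weil EC)"
  then have Q: "on_curve EC Q" by (simp add: mordell_weil_def)
  have "ec_add EC P Q = ec_add EC Q P"
    using h[OF P Q] h[OF Q P] eqI[of "ec_add EC P Q" "ec_add EC Q P" "dP P + dP Q"] by (simp add: add.commute)
  then show "P \<otimes>\<^bsub>mordell_weil EC\<^esub> Q = Q \<otimes>\<^bsub>mordell_weil EC\<^esub> P" by (simp add: mordell_weil_def)
  show "P \<otimes>\<^bsub>mordell_weil EC\<^esub> Q \<in> carrier (mordell_weil EC)" using h[OF P Q] by (simp add: mordell_weil_def)
  fix S assume "S \<in> carrier (mordell_weil EC)"
  then have S: "on_curve EC S" by (simp add: mordell_weil_def)
  note PQ = h[OF P Q] and QS = h[OF Q S]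
  note L = h[OF conjunct1[OF PQ] S] and Rr = h[OF P conjunct1[OF QS]]
  have "sim (dP P + dP Q + dP S) (dP (ec_add EC (ec_add EC P Q) S))"
    using sim_trans[OF sim_add[OF conjunct2[OF PQ] sim_refl] conjunct2[OF L]] .
  moreover have "sim (dP P + (dP Q + dP S)) (dP (ec_add EC P (ec_add EC Q S)))"
    using sim_trans[OF sim_add[OF sim_refl conjunct2[OF QS]] conjunct2[OF Rr]] .
  ultimately have "ec_add EC (ec_add EC P Q) S = ec_add EC P (ec_add EC Q S)"
    using L Rr by (intro eqI) (auto simp: add.assoc)
  then show "P \<otimes>\<^bsub>mordell_weil EC\<^esub> Q \<otimes>\<^bsub>mordell_weil EC\<^esub> S = P \<otimes>\<^bsub>mordell_weil EC\<^esub> (Q \<otimes>\<^bsub>mordell_weil EC\<^esub> S)"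
    by (simp add: mordell_weil_def)
qed (simp_all add: mordell_weil_def)

end

section \<open>Every divisor class of degree zero comes from a point\<close>

context ell
begin

definition J :: "('k funs set \<Rightarrow>\<^sub>0 int) \<Rightarrow> bool" where
  "J D \<longleftrightarrow> (\<exists>P. on_curve EC P \<and> sim D (dP P))"

lemma J_sim: "sim D E \<Longrightarrow> J E \<Longrightarrow> J D"
  unfolding J_def using sim_trans by blast

lemma J_0: "J 0"
  unfolding J_def by (rule exI[of _ Infinity]) (simp add: sim_refl)

lemma J_add: "J D \<Longrightarrow> J E \<Longrightarrow> J (D + E)"
proof -
  assume "J D" "J E"
  then obtain P Q where PQ: "on_curve EC P" "sim D (dP P)" "on_curve EC Q" "sim E (dP Q)"
    unfolding J_def by blast
  note h = ec_add_hom[OF PQ(1,3)]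
  have "sim (D + E) (dP (ec_add EC P Q))"
    by (rule sim_trans[OF sim_add[OF PQ(2,4)] conjunct2[OF h]])
  with h show ?thesis unfolding J_def by blast
qed

lemma J_uminus: "J D \<Longrightarrow> J (- D)"
proof -
  assume "J D"
  then obtain P where P: "on_curve EC P" "sim D (dP P)" unfolding J_def by blast
  have "sim (- D + (dP P + dP (neg_point EC P))) (- dP P + (dP P + dP (neg_point EC P)))"
    by (rule sim_add[OF sim_uminus[OF P(2)] sim_refl])
  moreover have "sim (- D + 0) (- D + (dP P + dP (neg_point EC P)))"
    by (rule sim_add[OF sim_refl sim_sym[OF dP_neg[OF P(1)]]])
  ultimately have "sim (- D) (dP (neg_point EC P))" using sim_trans by fastforce
  with neg_on[OF P(1)] show ?thesis unfolding J_def by blast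
qed

lemma J_diff: "J D \<Longrightarrow> J E \<Longrightarrow> J (D - E)"
  using J_add[of D "- E"] J_uminus[of E] by simp

text \<open>Brings a divisor to degree zero by a multiple of the place at infinity, whose degree is
  one.\<close>

definition dred :: "('k funs set \<Rightarrow>\<^sub>0 int) \<Rightarrow> ('k funs set \<Rightarrow>\<^sub>0 int)" where
  "dred D = D - Poly_Mapping.single Vinf (divisor_degree D)"

lemma dred_diff: "dred (D - E) = dred D - dred E"
  by (simp add: dred_def divisor_degree_diff single_diff algebra_simps)

lemma J_keys:
  assumes "\<And>V. V \<in> Poly_Mapping.keys D \<Longrightarrow> J (dred (Poly_Mapping.single V 1))"
  shows "J (dred D)"
proof -
  show ?thesis
  proof (rule free_Abelian_group_induct[of D "Poly_Mapping.keys D" "\<lambda>D. J (dred D)"])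
    show "Poly_Mapping.keys D \<subseteq> Poly_Mapping.keys D" by simp
    show "J (dred 0)" using J_0 by (simp add: dred_def)
    show "J (dred (x - y))" if "J (dred x)" "J (dred y)" for x y
      unfolding dred_diff using that by (rule J_diff)
    show "J (dred (frag_of V))" if "V \<in> Poly_Mapping.keys D" for V using assms[OF that] .
  qed
qed

lemma root_mod_cong:
  assumes "root_mod g h" "g dvd h - h'" shows "root_mod g h'"
proof -
  have e: "h' * h' - cub = (h * h - cub) - (h - h') * (h + h')" by (simp add: algebra_simps)
  have "g dvd h * h - cub" using assms(1) by (simp only: root_mod_def)
  from dvd_diff[OF this dvd_mult2[OF assms(2)]] have "g dvd h' * h' - cub" unfolding e .
  then show ?thesis using assms(1) by (simp only: root_mod_def)
qed

text \<open>The only zero of \<open>g\<close> is this place, and its pole at infinity is the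
  correction made by \<open>dred\<close>, so the divisor is principal.\<close>

lemma J_inert:
  assumes g: "irreducible g" and i: "\<And>h. \<not> root_mod g h"
  shows "J (dred (Poly_Mapping.single (VI g) 1))"
proof -
  have nz: "g \<noteq> 0" "evf u g \<noteq> 0" using irreducible_poly_degree[OF g] by auto
  have nf: "\<not> g dvd cub" using i[of 0] g unfolding root_mod_def mult_zero_left diff_0 dvd_minus_iff by blast
  have V: "VI g \<in> places FF" "u \<in> VI g" using VI_over[OF g i] by (auto simp: places_over_def)
  then have ninf: "VI g \<noteq> Vinf" using Vinf_u by auto
  have "dv (evf u g) = dred (Poly_Mapping.single (VI g) 1)"
  proof (rule poly_mapping_eqI)
    fix W
    note ld = lookup_dv[OF FF_evf nz(2), of W]
    have r: "Poly_Mapping.lookup (dred (Poly_Mapping.single (VI g) 1)) W =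
       (if VI g = W then 1 else 0) - (if Vinf = W then 2 * int (degree g) else 0)"
      by (simp add: dred_def lookup_minus lookup_single when_def VI_degree[OF g i])
    consider "W \<notin> places FF" | "W = Vinf" | "W = VI g" | "W \<in> places FF" "u \<in> W" "W \<noteq> VI g" using Vinf_unique by blast
    then show "Poly_Mapping.lookup (dv (evf u g)) W = Poly_Mapping.lookup (dred (Poly_Mapping.single (VI g) 1)) W"
    proof cases
      case 1
      then show ?thesis unfolding ld r using V Vinf_place by auto
    next
      case 2
      then show ?thesis unfolding ld r using Vinf_place ninf ord_inf_evf[OF nz(1)] by simp
    next
      case 3
      then show ?thesis unfolding ld r using V ninf ord_over[OF g VI_over[OF g i]] nf by simp
    next
      case 4
      then have "W \<noteq> Vinf" using Vinf_u by auto
      moreover have "place_ord W (evf u g) = 0" using 4 over_inert[OF g i] by (intro not_over[OF g]) auto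
      ultimately show ?thesis unfolding ld r using 4 by auto
    qed
  qed
  then show ?thesis using sim_dv[OF FF_evf nz(2)] J_sim J_0 by metis
qed

text \<open>Induction on the degree. If \<open>w\<close> is congruent to \<open>h(u)\<close> at
  \<open>V\<close>, with \<open>h\<close> reduced modulo \<open>g\<close>, then
  \<open>w - h(u)\<close> vanishes at \<open>V\<close>, and its remaining zeros form an effective
  divisor of smaller degree, to whose places the hypothesis applies.\<close>

lemma J_place: "V \<in> places FF \<Longrightarrow> J (dred (Poly_Mapping.single V 1))"
proof (induction "place_degree V" arbitrary: V rule: less_induct)
  case less
  show ?case
  proof (cases "u \<in> V")
    case False
    then have "V = Vinf" using Vinf_unique less.prems by blast
    then show ?thesis using J_0 by (simp add: dred_def Vinf_degree)
  next
    case uV: True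
    obtain g where g: "irreducible g" "evf u g \<in> place_ideal V" using place_over_irreducible[OF less.prems uV] .
    show ?thesis
    proof (cases "\<exists>h. root_mod g h \<and> V = VH g h")
      case False
      then have "(\<forall>h. \<not> root_mod g h) \<and> V = VI g" using place_classify[OF less.prems uV g] by blast
      then show ?thesis using J_inert[OF g(1)] by blast
    next
      case True
      then obtain h0 where h0: "root_mod g h0" "V = VH g h0" by blast
      define h where "h = h0 mod g"
      have gd: "g dvd h0 - h" unfolding h_def by (simp add: minus_mod_eq_mult_div)
      have gh: "root_mod g h" and V: "V = VH g h" using root_mod_cong[OF h0(1) gd] VH_cong[OF gd] h0(2) by auto
      note dg = irreducible_poly_degree[OF g(1)]
      have dh: "degree h < degree g" using degree_mod_less'[of g h0] dg unfolding h_def by (cases "h0 mod g = 0") auto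
      have degV: "place_degree V = degree g" unfolding V by (rule VH_degree[OF gh])
      show ?thesis
      proof (cases "degree g = 1")
        case True
        then obtain x where x: "poly g x = 0" by (rule linear_poly_root)
        obtain y where y: "h = [:y:]" using dh True by (auto elim: degree_eq_zeroE)
        obtain k' where k': "h * h - cub = g * k'" using gh by (auto simp: root_mod_def simp del: diff_pCons elim: dvdE)
        have "poly (h * h - cub) x = 0" unfolding k' using x by simp
        then have c: "on_curve EC (Affine x y)" unfolding on_EC poly_diff poly_mult poly_cub y by (simp add: power2_eq_square)
        obtain k where k: "g = [:- x, 1:] * k" using x by (auto simp: poly_eq_0_iff_dvd elim: dvdE)
        have k0: "k \<noteq> 0" using k dg by auto
        have "degree g = degree [:- x, 1:] + degree k" unfolding k by (rule degree_mult_eq) (use k0 in auto)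
        then have "degree k = 0" using True by simp
        then obtain q where q: "k = [:q:]" by (auto elim: degree_eq_zeroE)
        then have q0: "q \<noteq> 0" using k0 by auto
        have "const_fun (inverse q) * evf u g \<in> place_ideal V"
          by (intro place_ideal_mult[OF less.prems] placeD(6)[OF less.prems] g(2))
        moreover have "const_fun (inverse q) * evf u g = (const_fun (inverse q) * const_fun q) * evf u [:- x, 1:]"
          unfolding k evf_mult q by simp
        moreover have "const_fun (inverse q) * const_fun q = 1" using q0 by simp
        ultimately have "evf u [:- x, 1:] \<in> place_ideal V" by (simp only: mult_1)
        then have o: "V \<in> places_over [:- x, 1:]" using less.prems uV by (simp add: places_over_def)
        have "el [:- y:] 1 \<in> place_ideal V" unfolding V ideal_VH_iff[OF gh] by (simp add: y)
        from pt_unique[OF less.prems uV c o this] have "dred (Poly_Mapping.single V 1) = dP (Affine x y)"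
          unfolding dred_def dP_def using pt_degree[OF c] by (simp del: pt.simps)
        then show ?thesis unfolding J_def using c sim_refl by metis
      next
        case False
        then have d2: "degree g \<ge> 2" using dg by linarith
        define \<phi> where "\<phi> = el (- h) 1"
        have \<phi>: "\<phi> \<in> FF" "\<phi> \<noteq> 0" unfolding \<phi>_def using FF_el by auto
        define m where "m = (if 2 * degree h > 3 then 2 * int (degree h) else 3)"
        have om: "place_ord Vinf \<phi> = - m"
          using ord_inf_el[of "- h" 1] \<phi>(2) unfolding \<phi>_def m_def by (auto split: if_splits)
        have md: "m - int (degree g) < int (degree g)" using dh d2 unfolding m_def by auto
        have Vni: "V \<noteq> Vinf" using uV Vinf_u by auto
        have "\<phi> \<in> place_ideal V" unfolding \<phi>_def V ideal_VH_iff[OF gh] by simp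
        then have oV: "place_ord V \<phi> \<ge> 1" using oo(5)[OF less.prems \<phi>] by simp
        \<comment> \<open>The zeros of \<open>\<phi>\<close> with one copy of \<open>V\<close> taken
          away. The pole at infinity, of the order \<open>m\<close> of \<open>h(u)\<close> or of
          \<open>w\<close>, is cancelled.\<close>
        define E where "E = dv \<phi> - Poly_Mapping.single V 1 + Poly_Mapping.single Vinf m"
        have lE: "Poly_Mapping.lookup E W = (if W \<in> places FF then place_ord W \<phi> else 0)
            - (if V = W then 1 else 0) + (if Vinf = W then m else 0)" for W
          by (simp add: E_def lookup_minus lookup_add lookup_single when_def lookup_dv[OF \<phi>])
        have lE0: "Poly_Mapping.lookup E Vinf = 0" using om Vni Vinf_place by (simp add: lE)
        have lEge: "Poly_Mapping.lookup E W \<ge> 0" and kE: "Poly_Mapping.lookup E W \<noteq> 0 \<Longrightarrow> W \<in> places FF" for W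
        proof -
          consider "W \<notin> places FF" | "W = Vinf" | "W \<in> places FF" "u \<in> W" using Vinf_unique by blast
          then have "Poly_Mapping.lookup E W \<ge> 0 \<and> (Poly_Mapping.lookup E W \<noteq> 0 \<longrightarrow> W \<in> places FF)"
          proof cases
            case 1
            then have "V \<noteq> W" "Vinf \<noteq> W" using less.prems Vinf_place by auto
            with 1 show ?thesis by (simp add: lE)
          next
            case 2
            then show ?thesis using lE0 by simp
          next
            case 3
            then have "Vinf \<noteq> W" using Vinf_u by auto
            moreover have "place_ord W \<phi> \<ge> 0" using 3 \<phi> unfolding \<phi>_def by (intro affine_ord_ge) auto
            ultimately show ?thesis using 3 oV by (auto simp: lE)
          qed
          then show "Poly_Mapping.lookup E W \<ge> 0" "Poly_Mapping.lookup E W \<noteq> 0 \<Longrightarrow> W \<in> places FF" by blast+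
        qed
        have degE: "divisor_degree E = m - int (degree g)"
          unfolding E_def divisor_degree_add divisor_degree_diff using degree_dv[OF \<phi>] degV Vinf_degree by simp
        have "J (dred E)"
        proof (rule J_keys)
          fix W assume W: "W \<in> Poly_Mapping.keys E"
          then have l: "Poly_Mapping.lookup E W \<noteq> 0" by (simp add: in_keys_iff)
          then have l1: "Poly_Mapping.lookup E W \<ge> 1" using lEge[of W] by linarith
          have "int (place_degree W) \<le> Poly_Mapping.lookup E W * int (place_degree W)"
            using mult_right_mono[OF l1, of "int (place_degree W)"] by simp
          also have "\<dots> \<le> divisor_degree E"
            unfolding divisor_degree_def using W lEge by (intro member_le_sum) auto
          finally have "place_degree W < place_degree V" using degE md degV by linarith
          then show "J (dred (Poly_Mapping.single W 1))" using less.hyps kE[OF l] by blast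
        qed
        moreover have "dred (Poly_Mapping.single V 1) = dv \<phi> - dred E"
          unfolding dred_def degE by (simp add: E_def degV single_diff algebra_simps)
        moreover have "J (dv \<phi>)" using J_sim[OF sim_dv[OF \<phi>] J_0] .
        ultimately show ?thesis using J_diff by metis
      qed
    qed
  qed
qed

lemma J_all: "Poly_Mapping.keys D \<subseteq> places FF \<Longrightarrow> divisor_degree D = 0 \<Longrightarrow> J D"
  using J_keys[of D] J_place by (auto simp: dred_def)

definition D0 :: "('k funs set \<Rightarrow>\<^sub>0 int) monoid" where
  "D0 = (divisor_group FF)\<lparr>carrier := {D \<in> carrier (divisor_group FF). divisor_degree D = 0}\<rparr>"

lemma D0_simps: "carrier D0 = {D. Poly_Mapping.keys D \<subseteq> places FF \<and> divisor_degree D = 0}"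
  "x \<otimes>\<^bsub>D0\<^esub> y = x + y" "\<one>\<^bsub>D0\<^esub> = 0"
  by (auto simp: D0_def divisor_group_def)

lemma keys_uminus_int: "Poly_Mapping.keys (- D :: _ \<Rightarrow>\<^sub>0 int) = Poly_Mapping.keys D"
  by (auto simp: in_keys_iff)

lemma D0_group: "comm_group D0"
proof (rule comm_groupI)
  fix x y z assume "x \<in> carrier D0" "y \<in> carrier D0"
  then show "x \<otimes>\<^bsub>D0\<^esub> y \<in> carrier D0"
    using Poly_Mapping.keys_add[of x y] by (auto simp: D0_simps divisor_degree_add)
next
  fix x assume "x \<in> carrier D0"
  then show "\<exists>y\<in>carrier D0. y \<otimes>\<^bsub>D0\<^esub> x = \<one>\<^bsub>D0\<^esub>"
    using divisor_degree_diff[of 0 x] by (intro bexI[of _ "- x"]) (auto simp: D0_simps keys_uminus_int)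
qed (auto simp: D0_simps algebra_simps)

lemma principal_eq: "principal_divisors FF = {dv z |z. z \<in> FF \<and> z \<noteq> 0}"
proof
  show "principal_divisors FF \<subseteq> {dv z |z. z \<in> FF \<and> z \<noteq> 0}"
  proof
    fix D assume "D \<in> principal_divisors FF"
    then obtain z where k: "Poly_Mapping.keys D \<subseteq> places FF" and z: "z \<in> FF" "z \<noteq> 0"
      and l: "\<forall>V\<in>places FF. Poly_Mapping.lookup D V = place_ord V z"
      by (auto simp: principal_divisors_def divisor_group_def)
    have "D = dv z"
    proof (rule poly_mapping_eqI)
      fix V
      show "Poly_Mapping.lookup D V = Poly_Mapping.lookup (dv z) V"
        unfolding lookup_dv[OF z] using k l by (auto simp: in_keys_iff)
    qed
    with z show "D \<in> {dv z |z. z \<in> FF \<and> z \<noteq> 0}" by blast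
  qed
  show "{dv z |z. z \<in> FF \<and> z \<noteq> 0} \<subseteq> principal_divisors FF"
    using lookup_dv dv_keys by (auto simp: principal_divisors_def divisor_group_def)
qed

abbreviation "N \<equiv> principal_divisors FF"

lemma N_iff: "D \<in> N \<longleftrightarrow> sim D 0"
  by (auto simp: principal_eq sim_def)

lemma N_sub: "N \<subseteq> carrier D0"
  by (auto simp: principal_eq D0_simps dv_keys degree_dv)

lemma N_subgroup: "subgroup N D0"
proof -
  interpret comm_group D0 by (rule D0_group)
  show ?thesis
  proof (rule subgroupI)
    show "N \<subseteq> carrier D0" by (rule N_sub)
    show "N \<noteq> {}" using N_iff[of 0] sim_refl by auto
    fix a assume a: "a \<in> N"
    then have "- a \<in> N" using sim_uminus[of a 0] by (simp add: N_iff)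
    moreover have "inv\<^bsub>D0\<^esub> a = - a"
      using a calculation N_sub by (intro inv_equality) (auto simp: D0_simps)
    ultimately show "inv\<^bsub>D0\<^esub> a \<in> N" by simp
    fix b assume "b \<in> N"
    with a show "a \<otimes>\<^bsub>D0\<^esub> b \<in> N" using sim_add[of a 0 b 0] by (simp add: N_iff D0_simps)
  qed
qed

lemma Pic0_eq: "Pic0 FF = D0 Mod N"
  by (simp add: Pic0_def D0_def)

lemma Pic0_group: "comm_group (Pic0 FF)"
  unfolding Pic0_eq by (rule comm_group.abelian_FactGroup[OF D0_group N_subgroup])

definition cls :: "('k funs set \<Rightarrow>\<^sub>0 int) \<Rightarrow> ('k funs set \<Rightarrow>\<^sub>0 int) set" where
  "cls D = N #>\<^bsub>D0\<^esub> D"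

lemma cls_eq: "cls D = {h + D |h. h \<in> N}"
  by (auto simp: cls_def r_coset_def D0_simps)

lemma cls_eq_iff: "cls D = cls E \<longleftrightarrow> sim D E"
proof
  assume e: "cls D = cls E"
  have "0 + D \<in> cls D" using N_iff[of 0] sim_refl unfolding cls_eq by blast
  then obtain h where h: "h \<in> N" "D = h + E" unfolding e unfolding cls_eq by auto
  then have "sim (D - E) 0" by (simp add: N_iff)
  then show "sim D E" using sim_iff by blast
next
  have sub: "cls D \<subseteq> cls E" if s: "sim D E" for D E
  proof
    fix x assume "x \<in> cls D"
    then obtain h where h: "h \<in> N" "x = h + D" unfolding cls_eq by auto
    have "sim (h + (D - E)) (0 + 0)" by (rule sim_add) (use h s sim_iff N_iff in auto)
    then have "h + (D - E) \<in> N" by (simp add: N_iff)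
    moreover have "x = (h + (D - E)) + E" using h by simp
    ultimately show "x \<in> cls E" unfolding cls_eq by blast
  qed
  assume "sim D E"
  then show "cls D = cls E" using sub sim_sym by blast
qed

lemma cls_hom: "cls \<in> hom D0 (Pic0 FF)"
proof -
  interpret comm_group D0 by (rule D0_group)
  interpret normal N D0 using normal_iff_subgroup N_subgroup by blast
  show ?thesis using r_coset_hom_Mod unfolding cls_def Pic0_eq .
qed

text \<open>The Abel-Jacobi map with base point at infinity.\<close>

definition jmap :: "'k ec_point \<Rightarrow> ('k funs set \<Rightarrow>\<^sub>0 int) set" where "jmap P = cls (dP P)"

lemma dP_D0: "on_curve EC P \<Longrightarrow> dP P \<in> carrier D0"
proof -
  assume P: "on_curve EC P"
  have "Poly_Mapping.keys (dP P) \<subseteq> {pt P, Vinf}"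
    by (auto simp: dP_def in_keys_iff lookup_minus lookup_single when_def split: if_splits)
  then show ?thesis using pt_place[OF P] Vinf_place pt_degree[OF P] Vinf_degree
    by (auto simp: D0_simps dP_def divisor_degree_diff)
qed

lemma mw_simps: "carrier (mordell_weil E) = {P. on_curve E P}" "P \<otimes>\<^bsub>mordell_weil E\<^esub> Q = ec_add E P Q"
  "\<one>\<^bsub>mordell_weil E\<^esub> = Infinity"
  by (auto simp: mordell_weil_def)

lemma jmap_hom: "jmap \<in> hom (mordell_weil EC) (Pic0 FF)"
proof (rule homI)
  fix P Q assume "P \<in> carrier (mordell_weil EC)" "Q \<in> carrier (mordell_weil EC)"
  then have PQ: "on_curve EC P" "on_curve EC Q" by (auto simp: mw_simps)
  show "jmap P \<in> carrier (Pic0 FF)"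
    using cls_hom dP_D0[OF PQ(1)] unfolding jmap_def hom_def by blast
  have "cls (dP P + dP Q) = cls (dP P) \<otimes>\<^bsub>Pic0 FF\<^esub> cls (dP Q)"
    using hom_mult[OF cls_hom dP_D0[OF PQ(1)] dP_D0[OF PQ(2)]] by (simp add: D0_simps)
  moreover have "cls (dP (ec_add EC P Q)) = cls (dP P + dP Q)"
    unfolding cls_eq_iff using ec_add_hom[OF PQ] sim_sym by blast
  ultimately show "jmap (P \<otimes>\<^bsub>mordell_weil EC\<^esub> Q) = jmap P \<otimes>\<^bsub>Pic0 FF\<^esub> jmap Q"
    by (simp add: jmap_def mw_simps)
qed

lemma jmap_inj: "inj_on jmap (carrier (mordell_weil EC))"
  unfolding jmap_def by (rule inj_onI) (simp add: cls_eq_iff mw_simps dP_eq_imp)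

lemma jmap_surj: "carrier (Pic0 FF) = jmap ` carrier (mordell_weil EC)"
proof
  show "jmap ` carrier (mordell_weil EC) \<subseteq> carrier (Pic0 FF)" using jmap_hom by (auto simp: hom_def)
  show "carrier (Pic0 FF) \<subseteq> jmap ` carrier (mordell_weil EC)"
  proof
    fix c assume "c \<in> carrier (Pic0 FF)"
    then obtain D where D: "D \<in> carrier D0" "c = cls D"
      by (auto simp: Pic0_eq FactGroup_def RCOSETS_def cls_def)
    then obtain P where "on_curve EC P" "sim D (dP P)" using J_all unfolding D0_simps J_def by blast
    then show "c \<in> jmap ` carrier (mordell_weil EC)" using D(2) by (auto simp: jmap_def mw_simps cls_eq_iff)
  qed
qed

end

section \<open>Positive rank and points of infinite order\<close>

lemma rank_ge_1_imp:
  assumes "comm_group G" "abelian_rank G \<ge> 1"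
  shows "\<exists>x\<in>carrier G. \<forall>n::int. x [^]\<^bsub>G\<^esub> n = \<one>\<^bsub>G\<^esub> \<longrightarrow> n = 0"
proof -
  interpret comm_group G by fact
  have "\<exists>S. independent_in G S \<and> card S \<ge> 1"
  proof (rule ccontr)
    assume n: "\<not> ?thesis"
    have "enat (card S) \<le> 0" if "S \<in> {S. independent_in G S}" for S
      using n that by (auto simp: zero_enat_def not_less_eq_eq)
    then have "abelian_rank G \<le> 0" unfolding abelian_rank_def by (rule SUP_least)
    with assms(2) show False by (simp add: one_enat_def zero_enat_def) (metis le_zero_eq assms(2) zero_neq_one order_trans zero_enat_def one_enat_def)
  qed
  then obtain S where S: "independent_in G S" "card S \<ge> 1" by blast
  then obtain x where x: "x \<in> S" by (metis card.empty ex_in_conv not_one_le_zero)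
  have fin: "finite S" and sub: "S \<subseteq> carrier G" using S by (auto simp: independent_in_def)
  have "n = 0" if n: "x [^]\<^bsub>G\<^esub> n = \<one>\<^bsub>G\<^esub>" for n :: int
  proof -
    let ?c = "\<lambda>y. if y = x then n else 0"
    have "finprod G (\<lambda>y. y [^]\<^bsub>G\<^esub> ?c y) S = finprod G (\<lambda>y. \<one>\<^bsub>G\<^esub>) S"
      by (rule finprod_cong') (use n sub in auto)
    also have "\<dots> = \<one>\<^bsub>G\<^esub>" by simp
    finally have f: "finprod G (\<lambda>y. y [^]\<^bsub>G\<^esub> ?c y) S = \<one>\<^bsub>G\<^esub>" .
    have "\<And>c :: 'a \<Rightarrow> int. finprod G (\<lambda>y. y [^]\<^bsub>G\<^esub> c y) S = \<one>\<^bsub>G\<^esub> \<Longrightarrow> \<forall>y\<in>S. c y = 0"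
      using S(1) by (simp add: independent_in_def)
    from bspec[OF this[OF f] x] show ?thesis by simp
  qed
  with x sub show ?thesis by blast
qed

lemma rank_ge_1I:
  assumes "comm_group G" "x \<in> carrier G" "\<And>n::int. x [^]\<^bsub>G\<^esub> n = \<one>\<^bsub>G\<^esub> \<Longrightarrow> n = 0"
  shows "abelian_rank G \<ge> 1"
proof -
  interpret comm_group G by fact
  have "independent_in G {x}"
    unfolding independent_in_def using assms(2,3) by auto
  then have "enat (card {x}) \<le> abelian_rank G" unfolding abelian_rank_def by (intro SUP_upper) simp
  then show ?thesis by (simp add: one_enat_def)
qed

lemma finite_group_torsion:
  assumes "group G" and "finite (carrier G)" "x \<in> carrier G"
  shows "\<exists>n::int. n \<noteq> 0 \<and> x [^]\<^bsub>G\<^esub> n = \<one>\<^bsub>G\<^esub>"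
proof -
  interpret group G by fact
  have "\<not> inj_on (\<lambda>n::nat. x [^]\<^bsub>G\<^esub> n) UNIV"
    using assms(2,3) finite_subset[of "range (\<lambda>n::nat. x [^]\<^bsub>G\<^esub> n)" "carrier G"] finite_imageD by (metis image_subsetI infinite_UNIV_nat nat_pow_closed)
  then obtain m n :: nat where "m \<noteq> n" and e: "x [^]\<^bsub>G\<^esub> m = x [^]\<^bsub>G\<^esub> n" by (auto simp: inj_on_def)
  have "x [^]\<^bsub>G\<^esub> (int m - int n) = x [^]\<^bsub>G\<^esub> int m \<otimes>\<^bsub>G\<^esub> inv\<^bsub>G\<^esub> (x [^]\<^bsub>G\<^esub> int n)"
    using assms(3) by (simp add: int_pow_diff)
  also have "\<dots> = \<one>\<^bsub>G\<^esub>" using e assms(3) by (simp add: int_pow_int)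
  finally show ?thesis using \<open>m \<noteq> n\<close> by (intro exI[of _ "int m - int n"]) simp
qed

context ell
begin

theorem rank_imp_infinite: "abelian_rank (Pic0 FF) \<ge> 1 \<Longrightarrow> infinite {P. on_curve EC P}"
proof
  assume r: "abelian_rank (Pic0 FF) \<ge> 1" and f: "finite {P. on_curve EC P}"
  interpret comm_group "Pic0 FF" by (rule Pic0_group)
  have "finite (carrier (Pic0 FF))" unfolding jmap_surj using f by (simp add: mw_simps)
  then show False using rank_ge_1_imp[OF Pic0_group r] finite_group_torsion[OF is_group] by blast
qed

theorem nontorsion_imp_rank:
  assumes P: "on_curve EC P" and n: "\<And>n::int. P [^]\<^bsub>mordell_weil EC\<^esub> n = Infinity \<Longrightarrow> n = 0"
  shows "abelian_rank (Pic0 FF) \<ge> 1"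
proof (rule rank_ge_1I[OF Pic0_group])
  interpret M: comm_group "mordell_weil EC" by (rule group_EC)
  interpret P: comm_group "Pic0 FF" by (rule Pic0_group)
  interpret group_hom "mordell_weil EC" "Pic0 FF" jmap
    by unfold_locales (rule jmap_hom)
  have P': "P \<in> carrier (mordell_weil EC)" using P by (simp add: mw_simps)
  then show "jmap P \<in> carrier (Pic0 FF)" by (rule hom_closed)
  fix n :: int assume "jmap P [^]\<^bsub>Pic0 FF\<^esub> n = \<one>\<^bsub>Pic0 FF\<^esub>"
  then have "jmap (P [^]\<^bsub>mordell_weil EC\<^esub> n) = jmap \<one>\<^bsub>mordell_weil EC\<^esub>"
    using hom_int_pow[OF P'] hom_one by simp
  then have "P [^]\<^bsub>mordell_weil EC\<^esub> n = \<one>\<^bsub>mordell_weil EC\<^esub>"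
    using jmap_inj P' by (auto simp: inj_on_def)
  then show "n = 0" using n by (simp add: mw_simps)
qed

end

section \<open>The group law on arbitrary elliptic curves\<close>

lemma sqrt_exists:
  fixes c :: "'a::alg_closed_field"
  shows "\<exists>y. y * y = c"
proof -
  obtain y where "poly [:- c, 0, 1:] y = 0"
    using alg_closed_imp_poly_has_root[of "[:- c, 0, 1:]"] by auto
  then show ?thesis by (auto simp: algebra_simps)
qed

lemma evf_to_ac: "evf (to_ac (to_fract [:0, 1:])) q = to_ac (to_fract q)"
proof (induction q)
  case (pCons a p)
  have "pCons a p = [:a:] + [:0, 1:] * p" by simp
  then have "to_ac (to_fract (pCons a p)) = to_ac (to_fract [:a:]) + to_ac (to_fract [:0, 1:]) * to_ac (to_fract p)"
    by (simp only: to_fract_add to_fract_mult to_ac_add to_ac_mult)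
  then show ?case using pCons by (simp add: const_fun_def)
qed simp

text \<open>The claim concerns points over \<open>k\<close> only, but its proof takes place in a
  function field: \<open>u = t\<close>, and \<open>w\<close> is a square root in the algebraic
  closure of \<open>k(t)\<close>.\<close>

lemma group_cubic:
  fixes A B C :: "'k::field_char_0"
  assumes "18 * A * B * C - 4 * A ^ 3 * C + A ^ 2 * B ^ 2 - 4 * B ^ 3 - 27 * C ^ 2 \<noteq> 0"
  shows "comm_group (mordell_weil (Weierstrass 0 A 0 B C))"
proof -
  define u where "u = to_ac (to_fract [:0, 1 :: 'k:])"
  obtain w where w: "w * w = evf u [:C, B, A, 1:]" using sqrt_exists by blast
  interpret ell u w A B C
    by unfold_locales (use w assms in \<open>auto simp: u_def evf_to_ac simp del: evf_simps\<close>)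
  show ?thesis by (rule group_EC)
qed

definition wiso :: "'a::field \<Rightarrow> 'a \<Rightarrow> 'a \<Rightarrow> 'a \<Rightarrow> 'a weierstrass \<Rightarrow> 'a weierstrass \<Rightarrow> bool" where
  "wiso u r s t E E' \<longleftrightarrow> u \<noteq> 0 \<and>
     u * wa1 E' = wa1 E + 2 * s \<and>
     u ^ 2 * wa2 E' = wa2 E - s * wa1 E + 3 * r - s ^ 2 \<and>
     u ^ 3 * wa3 E' = wa3 E + r * wa1 E + 2 * t \<and>
     u ^ 4 * wa4 E' = wa4 E - s * wa3 E + 2 * r * wa2 E - (t + r * s) * wa1 E
                      + 3 * r ^ 2 - 2 * s * t \<and>
     u ^ 6 * wa6 E' = wa6 E + r * wa4 E + r ^ 2 * wa2 E + r ^ 3 - t * wa3 E - t ^ 2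
                      - r * t * wa1 E"

lemma weierstrass_iso_iff: "weierstrass_iso E E' \<longleftrightarrow> (\<exists>u r s t. wiso u r s t E E')"
  unfolding weierstrass_iso_def wiso_def ..

text \<open>Points travel from \<open>E'\<close> to \<open>E\<close>, because the substitution gives
  the coordinates of \<open>E\<close> in terms of those of \<open>E'\<close>.\<close>

fun wback :: "'a::field \<Rightarrow> 'a \<Rightarrow> 'a \<Rightarrow> 'a \<Rightarrow> 'a ec_point \<Rightarrow> 'a ec_point" where
  "wback u r s t Infinity = Infinity"
| "wback u r s t (Affine x y) = Affine (u ^ 2 * x + r) (u ^ 3 * y + s * u ^ 2 * x + t)"

text \<open>Solved for the coefficients of \<open>E\<close>, so that claims about both curves become
  polynomial identities in the coefficients of \<open>E'\<close> and the parameters.\<close>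

lemma wiso_params:
  fixes u :: "'a::field"
  assumes "wiso u r s t E E'"
  shows "u \<noteq> 0" "wa1 E = u * wa1 E' - 2 * s" "wa2 E = u ^ 2 * wa2 E' + s * (u * wa1 E' - 2 * s) - 3 * r + s ^ 2"
    "wa3 E = u ^ 3 * wa3 E' - r * (u * wa1 E' - 2 * s) - 2 * t"
    "wa4 E = u ^ 4 * wa4 E' + s * (u ^ 3 * wa3 E' - r * (u * wa1 E' - 2 * s) - 2 * t)
       - 2 * r * (u ^ 2 * wa2 E' + s * (u * wa1 E' - 2 * s) - 3 * r + s ^ 2) + (t + r * s) * (u * wa1 E' - 2 * s)
       - 3 * r ^ 2 + 2 * s * t"
    "wa6 E = u ^ 6 * wa6 E' - r * wa4 E - r ^ 2 * wa2 E - r ^ 3 + t * wa3 E + t ^ 2 + r * t * wa1 E"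
proof -
  show "u \<noteq> 0" using assms by (simp add: wiso_def)
  show 1: "wa1 E = u * wa1 E' - 2 * s" using assms by (simp add: wiso_def)
  have "u ^ 2 * wa2 E' = wa2 E - s * wa1 E + 3 * r - s ^ 2" using assms by (simp add: wiso_def)
  then show 2: "wa2 E = u ^ 2 * wa2 E' + s * (u * wa1 E' - 2 * s) - 3 * r + s ^ 2" unfolding 1[symmetric] by simp
  have "u ^ 3 * wa3 E' = wa3 E + r * wa1 E + 2 * t" using assms by (simp add: wiso_def)
  then show 3: "wa3 E = u ^ 3 * wa3 E' - r * (u * wa1 E' - 2 * s) - 2 * t" unfolding 1[symmetric] by simp
  have "u ^ 4 * wa4 E' = wa4 E - s * wa3 E + 2 * r * wa2 E - (t + r * s) * wa1 E + 3 * r ^ 2 - 2 * s * t"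
    using assms by (simp add: wiso_def)
  then show "wa4 E = u ^ 4 * wa4 E' + s * (u ^ 3 * wa3 E' - r * (u * wa1 E' - 2 * s) - 2 * t)
       - 2 * r * (u ^ 2 * wa2 E' + s * (u * wa1 E' - 2 * s) - 3 * r + s ^ 2) + (t + r * s) * (u * wa1 E' - 2 * s)
       - 3 * r ^ 2 + 2 * s * t" unfolding 2[symmetric] 3[symmetric] unfolding 1[symmetric] by simp
  have "u ^ 6 * wa6 E' = wa6 E + r * wa4 E + r ^ 2 * wa2 E + r ^ 3 - t * wa3 E - t ^ 2 - r * t * wa1 E"
    using assms by (simp add: wiso_def)
  then show "wa6 E = u ^ 6 * wa6 E' - r * wa4 E - r ^ 2 * wa2 E - r ^ 3 + t * wa3 E + t ^ 2 + r * t * wa1 E" by simp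
qed

context
  fixes u r s t :: "'a::field" and E E' :: "'a weierstrass"
  assumes iso: "wiso u r s t E E'"
begin

lemma unz: "u \<noteq> 0" using wiso_params(1)[OF iso] .

lemma wback_on: "on_curve E (wback u r s t P) \<longleftrightarrow> on_curve E' P"
proof (cases P)
  case (Affine x y)
  let ?x = "u ^ 2 * x + r" and ?y = "u ^ 3 * y + s * u ^ 2 * x + t"
  have "?y ^ 2 + wa1 E * ?x * ?y + wa3 E * ?y - (?x ^ 3 + wa2 E * ?x ^ 2 + wa4 E * ?x + wa6 E) =
     u ^ 6 * (y ^ 2 + wa1 E' * x * y + wa3 E' * y - (x ^ 3 + wa2 E' * x ^ 2 + wa4 E' * x + wa6 E'))"
    unfolding wiso_params(6)[OF iso] unfolding wiso_params(2-5)[OF iso]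
    by Groebner_Basis.algebra
  then have "?y ^ 2 + wa1 E * ?x * ?y + wa3 E * ?y - (?x ^ 3 + wa2 E * ?x ^ 2 + wa4 E * ?x + wa6 E) = 0 \<longleftrightarrow>
     y ^ 2 + wa1 E' * x * y + wa3 E' * y - (x ^ 3 + wa2 E' * x ^ 2 + wa4 E' * x + wa6 E') = 0"
    using unz by simp
  then show ?thesis by (simp only: Affine wback.simps on_curve.simps right_minus_eq)
qed simp

lemma wback_inj: "wback u r s t P = wback u r s t Q \<longleftrightarrow> P = Q"
  using unz by (cases P; cases Q) auto

lemma wback_surj: "\<exists>P. Q = wback u r s t P"
proof (cases Q)
  case Infinity
  then show ?thesis by (intro exI[of _ Infinity]) simp
next
  case (Affine x y)
  then show ?thesis using unz
    by (intro exI[of _ "Affine ((x - r) / u ^ 2) ((y - s * (x - r) - t) / u ^ 3)"]) simp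
qed

lemma wback_add:
  assumes P: "on_curve E' P" and Q: "on_curve E' Q"
  shows "wback u r s t (ec_add E' P Q) = ec_add E (wback u r s t P) (wback u r s t Q)"
proof (cases P)
  case PA: (Affine x1 y1)
  show ?thesis
  proof (cases Q)
    case QA: (Affine x2 y2)
    let ?x1 = "u ^ 2 * x1 + r" and ?y1 = "u ^ 3 * y1 + s * u ^ 2 * x1 + t"
    let ?x2 = "u ^ 2 * x2 + r" and ?y2 = "u ^ 3 * y2 + s * u ^ 2 * x2 + t"
    have xeq: "?x1 = ?x2 \<longleftrightarrow> x1 = x2" using unz by simp
    have den: "?y1 + ?y2 + wa1 E * ?x2 + wa3 E = u ^ 3 * (y1 + y2 + wa1 E' * x2 + wa3 E')" if "x1 = x2"
      unfolding that wiso_params(2-4)[OF iso] by Groebner_Basis.algebra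
    have c: "(?x1 = ?x2 \<and> ?y1 + ?y2 + wa1 E * ?x2 + wa3 E = 0) \<longleftrightarrow> (x1 = x2 \<and> y1 + y2 + wa1 E' * x2 + wa3 E' = 0)"
    proof (cases "x1 = x2")
      case True
      then show ?thesis unfolding xeq den[OF True] using unz by simp
    next
      case False
      then show ?thesis unfolding xeq by simp
    qed
    show ?thesis
    proof (cases "x1 = x2 \<and> y1 + y2 + wa1 E' * x2 + wa3 E' = 0")
      case True
      then show ?thesis using c unfolding PA QA wback.simps ec_add.simps by simp
    next
      case False
      define l where "l = (if x1 = x2 then (3 * x1 ^ 2 + 2 * wa2 E' * x1 + wa4 E' - wa1 E' * y1) /
          (2 * y1 + wa1 E' * x1 + wa3 E') else (y2 - y1) / (x2 - x1))"
      \<comment> \<open>The substitution takes lines to lines and the slope \<open>l\<close> to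
        \<open>u * l + s\<close>.\<close>
      have L: "(if ?x1 = ?x2 then (3 * ?x1 ^ 2 + 2 * wa2 E * ?x1 + wa4 E - wa1 E * ?y1) /
          (2 * ?y1 + wa1 E * ?x1 + wa3 E) else (?y2 - ?y1) / (?x2 - ?x1)) = u * l + s"
      proof (cases "x1 = x2")
        case True
        have e1: "y1 ^ 2 + wa1 E' * x2 * y1 + wa3 E' * y1 = y2 ^ 2 + wa1 E' * x2 * y2 + wa3 E' * y2"
          using P Q unfolding PA QA True on_curve.simps by simp
        have "(y1 - y2) * (y1 + y2 + wa1 E' * x2 + wa3 E') = (y1 ^ 2 + wa1 E' * x2 * y1 + wa3 E' * y1)
            - (y2 ^ 2 + wa1 E' * x2 * y2 + wa3 E' * y2)"
          by (simp add: algebra_simps power2_eq_square)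
        also have "\<dots> = 0" unfolding e1 by simp
        finally have "(y1 - y2) * (y1 + y2 + wa1 E' * x2 + wa3 E') = 0" .
        moreover have n0: "y1 + y2 + wa1 E' * x2 + wa3 E' \<noteq> 0" using False True by blast
        ultimately have "y1 = y2" by simp
        define d where "d = 2 * y1 + wa1 E' * x1 + wa3 E'"
        have "d = y1 + y2 + wa1 E' * x2 + wa3 E'" unfolding d_def True \<open>y1 = y2\<close> by simp
        then have d0: "d \<noteq> 0" using n0 by simp
        have dd: "2 * ?y1 + wa1 E * ?x1 + wa3 E = u ^ 3 * d"
          unfolding d_def wiso_params(2-4)[OF iso] by Groebner_Basis.algebra
        have nn: "3 * ?x1 ^ 2 + 2 * wa2 E * ?x1 + wa4 E - wa1 E * ?y1 =
           u ^ 4 * (3 * x1 ^ 2 + 2 * wa2 E' * x1 + wa4 E' - wa1 E' * y1) + s * (u ^ 3 * d)"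
          unfolding d_def wiso_params(2-5)[OF iso] by Groebner_Basis.algebra
        have ll: "l = (3 * x1 ^ 2 + 2 * wa2 E' * x1 + wa4 E' - wa1 E' * y1) / d"
          using True by (simp add: l_def d_def)
        have lN: "3 * x1 ^ 2 + 2 * wa2 E' * x1 + wa4 E' - wa1 E' * y1 = l * d"
          using iffD1[OF nonzero_eq_divide_eq[OF d0] ll] by simp
        have ud: "u ^ 3 * d \<noteq> 0" using d0 unz by simp
        have "u ^ 4 * (l * d) + s * (u ^ 3 * d) = (u * l + s) * (u ^ 3 * d)"
          by (simp add: algebra_simps numeral_eq_Suc)
        then have "(u ^ 4 * (l * d) + s * (u ^ 3 * d)) / (u ^ 3 * d) = u * l + s"
          by (simp only: nonzero_mult_div_cancel_right[OF ud])
        then show ?thesis unfolding dd nn lN using True by simp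
      next
        case False
        then have d0: "x2 - x1 \<noteq> 0" by simp
        have dd: "?x2 - ?x1 = u ^ 2 * (x2 - x1)" by (simp add: algebra_simps)
        have nn: "?y2 - ?y1 = u ^ 2 * (u * (y2 - y1) + s * (x2 - x1))" by (simp add: algebra_simps numeral_eq_Suc)
        have ll: "l = (y2 - y1) / (x2 - x1)" using False by (simp add: l_def)
        have lN: "y2 - y1 = l * (x2 - x1)" using iffD1[OF nonzero_eq_divide_eq[OF d0] ll] by simp
        have ud: "u ^ 2 * (x2 - x1) \<noteq> 0" using d0 unz by simp
        have "u ^ 2 * (u * (l * (x2 - x1)) + s * (x2 - x1)) = (u * l + s) * (u ^ 2 * (x2 - x1))"
          by (simp add: algebra_simps)
        then have "(u ^ 2 * (u * (l * (x2 - x1)) + s * (x2 - x1))) / (u ^ 2 * (x2 - x1)) = u * l + s"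
          by (simp only: nonzero_mult_div_cancel_right[OF ud])
        then have "(?y2 - ?y1) / (?x2 - ?x1) = u * l + s" unfolding dd nn lN .
        then show ?thesis using False xeq by (simp only: if_False)
      qed
      define x3 where "x3 = l ^ 2 + wa1 E' * l - wa2 E' - x1 - x2"
      have 1: "ec_add E' P Q = Affine x3 (- (l + wa1 E') * x3 - (y1 - l * x1) - wa3 E')"
        unfolding PA QA ec_add.simps if_not_P[OF False] l_def[symmetric] Let_def x3_def ..
      have 2: "ec_add E (wback u r s t P) (wback u r s t Q) =
         (let x3 = (u * l + s) ^ 2 + wa1 E * (u * l + s) - wa2 E - ?x1 - ?x2 in
          Affine x3 (- ((u * l + s) + wa1 E) * x3 - (?y1 - (u * l + s) * ?x1) - wa3 E))"
        unfolding PA QA wback.simps ec_add.simps if_not_P[OF False[folded c]] L Let_def ..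
      have 3: "(u * l + s) ^ 2 + wa1 E * (u * l + s) - wa2 E - ?x1 - ?x2 = u ^ 2 * x3 + r"
        unfolding x3_def wiso_params(2,3)[OF iso] by Groebner_Basis.algebra
      show ?thesis unfolding 1 2 Let_def 3 wback.simps ec_point.inject
        unfolding wiso_params(2,4)[OF iso] by (rule conjI[OF refl]) Groebner_Basis.algebra
    qed
  qed (simp add: PA)
qed simp

lemma wiso_group:
  assumes "comm_group (mordell_weil E')" shows "comm_group (mordell_weil E)"
proof -
  interpret G: comm_group "mordell_weil E'" by fact
  let ?b = "wback u r s t"
  have pull: "\<exists>P'. on_curve E' P' \<and> P = ?b P'" if "on_curve E P" for P
    using wback_surj[of P] wback_on that by metis
  have closed: "on_curve E' (ec_add E' P Q)" if "on_curve E' P" "on_curve E' Q" for P Q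
    using G.m_closed[of P Q] that by (simp add: mordell_weil_def)
  show ?thesis
  proof (rule comm_groupI)
    fix P Q assume "P \<in> carrier (mordell_weil E)" "Q \<in> carrier (mordell_weil E)"
    then have "on_curve E P" "on_curve E Q" by (simp_all add: mordell_weil_def)
    from pull[OF this(1)] pull[OF this(2)]
    obtain P' Q' where PQ: "on_curve E' P'" "P = ?b P'" "on_curve E' Q'" "Q = ?b Q'" by blast
    have add: "ec_add E P Q = ?b (ec_add E' P' Q')" unfolding PQ(2,4) using wback_add[OF PQ(1,3)] by simp
    show "P \<otimes>\<^bsub>mordell_weil E\<^esub> Q \<in> carrier (mordell_weil E)"
      using add closed[OF PQ(1,3)] wback_on by (simp add: mordell_weil_def)
    have "ec_add E' P' Q' = ec_add E' Q' P'"
      using G.m_comm[of P' Q'] PQ by (simp add: mordell_weil_def)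
    then show "P \<otimes>\<^bsub>mordell_weil E\<^esub> Q = Q \<otimes>\<^bsub>mordell_weil E\<^esub> P"
      using wback_add[OF PQ(1,3)] wback_add[OF PQ(3,1)] PQ by (simp add: mordell_weil_def)
    fix S assume "S \<in> carrier (mordell_weil E)"
    then have "on_curve E S" by (simp add: mordell_weil_def)
    from pull[OF this] obtain S' where S: "on_curve E' S'" "S = ?b S'" by blast
    have "ec_add E' (ec_add E' P' Q') S' = ec_add E' P' (ec_add E' Q' S')"
      using G.m_assoc[of P' Q' S'] PQ S by (simp add: mordell_weil_def)
    then show "P \<otimes>\<^bsub>mordell_weil E\<^esub> Q \<otimes>\<^bsub>mordell_weil E\<^esub> S = P \<otimes>\<^bsub>mordell_weil E\<^esub> (Q \<otimes>\<^bsub>mordell_weil E\<^esub> S)"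
      using wback_add[OF PQ(1,3)] wback_add[OF PQ(3) S(1)] wback_add[OF closed[OF PQ(1,3)] S(1)]
        wback_add[OF PQ(1) closed[OF PQ(3) S(1)]] PQ S by (simp add: mordell_weil_def)
  next
    fix P assume "P \<in> carrier (mordell_weil E)"
    then have "on_curve E P" by (simp add: mordell_weil_def)
    from pull[OF this] obtain P' where P: "on_curve E' P'" "P = ?b P'" by blast
    obtain Q' where Q: "on_curve E' Q'" "ec_add E' Q' P' = Infinity"
      using G.l_inv_ex[of P'] P by (auto simp: mordell_weil_def)
    then show "\<exists>Q\<in>carrier (mordell_weil E). Q \<otimes>\<^bsub>mordell_weil E\<^esub> P = \<one>\<^bsub>mordell_weil E\<^esub>"
      using wback_add[OF Q(1) P(1)] P(2) wback_on by (intro bexI[of _ "?b Q'"]) (auto simp: mordell_weil_def)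
  qed (simp_all add: mordell_weil_def)
qed

end

text \<open>Completing the square in \<open>y\<close> leads to
  \<open>y^2 = x^3 + A x^2 + B x + C\<close>, and \<open>wdisc E\<close> is 16 times the
  discriminant of that cubic.\<close>

theorem elliptic_group:
  fixes E :: "'k::field_char_0 weierstrass"
  assumes "elliptic E" shows "comm_group (mordell_weil E)"
proof -
  define A B C where "A = wb2 E / 4" and "B = wb4 E / 2" and "C = wb6 E / 4"
  let ?E = "Weierstrass 0 A 0 B C"
  have iso: "wiso 1 0 (- wa1 E / 2) (- wa3 E / 2) E ?E"
    by (simp add: wiso_def A_def B_def C_def wb2_def wb4_def wb6_def field_simps power2_eq_square)
  have "16 * (18 * A * B * C - 4 * A ^ 3 * C + A ^ 2 * B ^ 2 - 4 * B ^ 3 - 27 * C ^ 2) = wdisc E"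
    unfolding A_def B_def C_def wdisc_def wb8_def wb2_def wb4_def wb6_def
    by (simp add: field_simps power2_eq_square power3_eq_cube)
  then have "18 * A * B * C - 4 * A ^ 3 * C + A ^ 2 * B ^ 2 - 4 * B ^ 3 - 27 * C ^ 2 \<noteq> 0"
    using assms unfolding elliptic_def by (metis mult_zero_right)
  then show ?thesis by (intro wiso_group[OF iso] group_cubic)
qed

section \<open>Automorphisms of the algebraic closure of \<open>k(t)\<close>\<close>

instance fract :: ("{idom, ring_char_0}") field_char_0 ..

text \<open>The graph of a homomorphism over \<open>k(t)\<close> from a subring of the closure into
  the closure. As sets of pairs such partial maps are ordered by inclusion, ready for Zorn's lemma;
  together with additivity the last clause makes the relation single-valued.\<close>

definition ring_graph :: "('k::field_char_0 funs \<times> 'k funs) set \<Rightarrow> bool" where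
  "ring_graph G \<longleftrightarrow> (\<forall>c. (to_ac c, to_ac c) \<in> G) \<and>
     (\<forall>a b c d. (a, b) \<in> G \<longrightarrow> (c, d) \<in> G \<longrightarrow> (a + c, b + d) \<in> G \<and> (a * c, b * d) \<in> G) \<and>
     (\<forall>b. (0, b) \<in> G \<longrightarrow> b = 0)"

lemma ring_graphD:
  assumes "ring_graph G"
  shows "(to_ac c, to_ac c) \<in> G" "(0, 0) \<in> G" "(1, 1) \<in> G"
    "(a, b) \<in> G \<Longrightarrow> (c', d) \<in> G \<Longrightarrow> (a + c', b + d) \<in> G"
    "(a, b) \<in> G \<Longrightarrow> (c', d) \<in> G \<Longrightarrow> (a * c', b * d) \<in> G"
    "(a, b) \<in> G \<Longrightarrow> (- a, - b) \<in> G"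
    "(a, b) \<in> G \<Longrightarrow> (c', d) \<in> G \<Longrightarrow> (a - c', b - d) \<in> G"
    "(0, b) \<in> G \<Longrightarrow> b = 0" "(a, b) \<in> G \<Longrightarrow> (a, d) \<in> G \<Longrightarrow> b = d"
proof -
  show c: "(to_ac c, to_ac c) \<in> G" for c using assms by (simp add: ring_graph_def)
  show "(0, 0) \<in> G" "(1, 1) \<in> G" using c[of 0] c[of 1] by simp_all
  show add: "(a, b) \<in> G \<Longrightarrow> (c', d) \<in> G \<Longrightarrow> (a + c', b + d) \<in> G" for a b c' d
    using assms by (simp add: ring_graph_def)
  show mult: "(a, b) \<in> G \<Longrightarrow> (c', d) \<in> G \<Longrightarrow> (a * c', b * d) \<in> G" for a b c' d
    using assms by (simp add: ring_graph_def)
  show neg: "(a, b) \<in> G \<Longrightarrow> (- a, - b) \<in> G" for a b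
    using mult[of a b "- 1" "- 1"] c[of "- 1"] by simp
  show sub: "(a, b) \<in> G \<Longrightarrow> (c', d) \<in> G \<Longrightarrow> (a - c', b - d) \<in> G" for a b c' d
    using add[of a b "- c'" "- d"] neg[of c' d] by simp
  show z: "(0, b) \<in> G \<Longrightarrow> b = 0" for b using assms unfolding ring_graph_def by blast
  show "(a, b) \<in> G \<Longrightarrow> (a, d) \<in> G \<Longrightarrow> b = d" using sub[of a b a d] z[of "b - d"] by simp
qed

lemma ring_graph_poly:
  assumes G: "ring_graph G" and ab: "(a, b) \<in> G" and pq: "\<forall>i. (coeff p i, coeff q i) \<in> G"
  shows "(poly p a, poly q b) \<in> G"
  using pq
proof (induction p q rule: poly_induct2)
  case (pCons x p y q)
  have "(x, y) \<in> G" using spec[OF pCons(2), of 0] by simp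
  moreover have "\<forall>i. (coeff p i, coeff q i) \<in> G"
  proof
    fix i show "(coeff p i, coeff q i) \<in> G" using spec[OF pCons(2), of "Suc i"] by simp
  qed
  then have "(poly p a, poly q b) \<in> G" by (rule pCons.IH)
  ultimately show ?case using ab by (simp add: ring_graphD(4,5)[OF G])
qed (simp add: ring_graphD(2)[OF G])

text \<open>The inverse of an algebraic \<open>a\<close> is a polynomial in \<open>a\<close> over
  \<open>k(t)\<close>: in an equation for \<open>a\<close> of least degree the constant term is
  nonzero. The image \<open>b\<close> satisfies the same equation.\<close>

lemma ring_graph_inverse:
  assumes G: "ring_graph G" and ab: "(a, b) \<in> G"
  shows "(inverse a, inverse b) \<in> G"
proof (cases "a = 0")
  case True
  then have "b = 0" using ring_graphD(8)[OF G] ab by simp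
  then show ?thesis using True ab by simp
next
  case False
  let ?P = "\<lambda>p :: 'a poly fract poly. p \<noteq> 0 \<and> poly (map_poly to_ac p) a = 0"
  obtain p0 where "?P p0"
    using alg_closure_algebraic[of a] by blast
  then obtain p where p: "?P p" and min: "\<And>q. ?P q \<Longrightarrow> degree p \<le> degree q"
    using ex_has_least_nat[of ?P p0 degree] by blast
  obtain r s where rs: "p = pCons r s" by (cases p)
  have r0: "r \<noteq> 0"
  proof
    assume "r = 0"
    then have "?P s" using p False rs by (auto simp: map_poly_pCons)
    moreover then have "degree s < degree p" using rs by auto
    ultimately show False using min[of s] by simp
  qed
  have eq: "to_ac r + a * poly (map_poly to_ac s) a = 0" using p rs by (simp add: map_poly_pCons)
  have "\<forall>i. (coeff (map_poly to_ac s) i, coeff (map_poly to_ac s) i) \<in> G" for s :: "'a poly fract poly"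
    by (simp add: coeff_map_poly ring_graphD(1)[OF G])
  note pg = ring_graph_poly[OF G ab this]
  have "(poly (map_poly to_ac p) a, poly (map_poly to_ac p) b) \<in> G" by (rule pg)
  then have "poly (map_poly to_ac p) b = 0" using p ring_graphD(8)[OF G] by simp
  then have eq': "to_ac r + b * poly (map_poly to_ac s) b = 0" using rs by (simp add: map_poly_pCons)
  have inv: "inverse x = - (poly (map_poly to_ac s) x * to_ac (inverse r))"
    if e: "to_ac r + x * poly (map_poly to_ac s) x = 0" for x
  proof (rule inverse_unique)
    have "x * - (poly (map_poly to_ac s) x * to_ac (inverse r)) = - (x * poly (map_poly to_ac s) x) * to_ac (inverse r)"
      by simp
    also have "- (x * poly (map_poly to_ac s) x) = to_ac r" using e by (simp add: add_eq_0_iff2)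
    also have "to_ac r * to_ac (inverse r) = 1" using r0 by simp
    finally show "x * - (poly (map_poly to_ac s) x * to_ac (inverse r)) = 1" .
  qed
  show ?thesis unfolding inv[OF eq] inv[OF eq']
    by (rule ring_graphD(6)[OF G ring_graphD(5)[OF G pg ring_graphD(1)[OF G]]])
qed

definition poly_graph :: "('k::field_char_0 funs \<times> 'k funs) set \<Rightarrow> ('k funs poly \<times> 'k funs poly) set" where
  "poly_graph G = {(p, q). \<forall>i. (coeff p i, coeff q i) \<in> G}"

lemma poly_graph_add: "ring_graph G \<Longrightarrow> (p, q) \<in> poly_graph G \<Longrightarrow> (p', q') \<in> poly_graph G \<Longrightarrow> (p + p', q + q') \<in> poly_graph G"
  by (simp add: poly_graph_def ring_graphD(4))

lemma poly_graph_diff: "ring_graph G \<Longrightarrow> (p, q) \<in> poly_graph G \<Longrightarrow> (p', q') \<in> poly_graph G \<Longrightarrow> (p - p', q - q') \<in> poly_graph G"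
  by (simp add: poly_graph_def ring_graphD(7))

lemma ring_graph_sum:
  assumes G: "ring_graph G" and "\<And>i. i \<in> I \<Longrightarrow> (f i, g i) \<in> G"
  shows "(sum f I, sum g I) \<in> G"
  using assms(2) by (induction I rule: infinite_finite_induct) (auto simp: ring_graphD(2,4)[OF G])

lemma poly_graph_mult: "ring_graph G \<Longrightarrow> (p, q) \<in> poly_graph G \<Longrightarrow> (p', q') \<in> poly_graph G \<Longrightarrow> (p * p', q * q') \<in> poly_graph G"
  by (simp add: poly_graph_def coeff_mult ring_graph_sum ring_graphD(5))

lemma poly_graph_monom: "ring_graph G \<Longrightarrow> (a, b) \<in> G \<Longrightarrow> (monom a n, monom b n) \<in> poly_graph G"
  by (simp add: poly_graph_def ring_graphD(2))

lemma poly_graph_0: "ring_graph G \<Longrightarrow> (0, q) \<in> poly_graph G \<Longrightarrow> q = 0"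
  by (rule poly_eqI) (simp add: poly_graph_def ring_graphD(8))

text \<open>Division by the monic \<open>m\<close> is carried out in parallel on a polynomial and
  its image, with corresponding leading coefficients at each stage.\<close>

lemma poly_graph_division:
  assumes G: "ring_graph G" and m: "(m, m') \<in> poly_graph G" "lead_coeff m = 1" "degree m > 0"
    and pq: "(p, q) \<in> poly_graph G"
  shows "\<exists>r r' s s'. (r, r') \<in> poly_graph G \<and> degree r < degree m \<and> p = s * m + r \<and> q = s' * m' + r'"
  using pq
proof (induction "degree p" arbitrary: p q rule: less_induct)
  case less
  show ?case
  proof (cases "degree p < degree m")
    case True
    then show ?thesis using less.prems by (intro exI[of _ p] exI[of _ q] exI[of _ 0]) simp
  next
    case False
    define k where "k = degree p - degree m"
    let ?a = "lead_coeff p" and ?b = "coeff q (degree p)"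
    have ab: "(?a, ?b) \<in> G" using less.prems by (simp add: poly_graph_def)
    define p1 q1 where "p1 = p - monom ?a k * m" and "q1 = q - monom ?b k * m'"
    have 1: "(p1, q1) \<in> poly_graph G" unfolding p1_def q1_def
      by (intro poly_graph_diff[OF G] less.prems poly_graph_mult[OF G] poly_graph_monom[OF G] ab m(1))
    have p0: "?a \<noteq> 0" using False m(3) by auto
    have "degree p1 < degree p"
    proof (rule degree_lessI)
      show "p1 \<noteq> 0 \<or> degree p > 0" using False m(3) by simp
      show "\<forall>i\<ge>degree p. coeff p1 i = 0"
      proof (intro allI impI)
        fix i assume i: "i \<ge> degree p"
        have c: "coeff p1 i = coeff p i - ?a * coeff m (i - k)"
          using i unfolding p1_def by (simp add: coeff_monom_mult k_def)
        show "coeff p1 i = 0"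
        proof (cases "i = degree p")
          case True
          then have "i - k = degree m" using False by (simp add: k_def)
          then show ?thesis using c m(2) True by simp
        next
          case F: False
          then have "degree p < i" "degree m < i - k" using i False by (auto simp: k_def)
          then show ?thesis using c by (simp add: coeff_eq_0)
        qed
      qed
    qed
    from less.hyps[OF this 1] obtain r r' s s' where r: "(r, r') \<in> poly_graph G" "degree r < degree m"
      "p1 = s * m + r" "q1 = s' * m' + r'" by blast
    have "p = (monom ?a k + s) * m + r" using r(3) by (simp add: p1_def algebra_simps)
    moreover have "q = (monom ?b k + s') * m' + r'" using r(4) by (simp add: q1_def algebra_simps)
    ultimately show ?thesis using r by blast
  qed
qed

text \<open>The minimal polynomial of \<open>a\<close> over the domain of the partial map, together
  with its image \<open>m'\<close>. The image has positive degree, so it has a root to which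
  \<open>a\<close> can be sent.\<close>

lemma minimal_poly_graph:
  assumes G: "ring_graph G"
  obtains m m' where "(m, m') \<in> poly_graph G" "lead_coeff m = 1" "degree m > 0" "poly m a = 0"
    "\<forall>p q. (p, q) \<in> poly_graph G \<longrightarrow> poly p a = 0 \<longrightarrow> p \<noteq> 0 \<longrightarrow> degree m \<le> degree p" "degree m' > 0"
proof -
  let ?P = "\<lambda>p. p \<noteq> 0 \<and> poly p a = 0 \<and> (\<exists>q. (p, q) \<in> poly_graph G)"
  obtain p0 :: "'a poly fract poly" where "p0 \<noteq> 0" "poly (map_poly to_ac p0) a = 0"
    using alg_closure_algebraic[of a] by blast
  then have "?P (map_poly to_ac p0)"
    by (auto simp: poly_graph_def coeff_map_poly ring_graphD(1)[OF G] map_poly_eq_0_iff intro!: exI[of _ "map_poly to_ac p0"])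
  then obtain p where p: "?P p" and min: "\<And>q. ?P q \<Longrightarrow> degree p \<le> degree q"
    using ex_has_least_nat[of ?P "map_poly to_ac p0" degree] by blast
  then obtain q where q: "(p, q) \<in> poly_graph G" by blast
  let ?a = "lead_coeff p" and ?b = "coeff q (degree p)"
  have ab: "(?a, ?b) \<in> G" using q by (simp add: poly_graph_def)
  have a0: "?a \<noteq> 0" using p by simp
  define m m' where "m = smult (inverse ?a) p" and "m' = smult (inverse ?b) q"
  have m: "(m, m') \<in> poly_graph G"
    using q ring_graphD(5)[OF G ring_graph_inverse[OF G ab]] by (simp add: m_def m'_def poly_graph_def)
  have lm: "lead_coeff m = 1" and dm: "degree m = degree p" using a0 by (simp_all add: m_def)
  have pm: "poly m a = 0" using p by (simp add: m_def)
  have d0: "degree m > 0"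
  proof (rule ccontr)
    assume "\<not> degree m > 0"
    then obtain c where "m = [:c:]" by (auto elim: degree_eq_zeroE)
    with lm pm show False by simp
  qed
  \<comment> \<open>The leading coefficient 1 corresponds to 1, so the degree does not drop to zero
    in the image.\<close>
  have "(1, coeff m' (degree m)) \<in> G" using m lm unfolding poly_graph_def by (auto dest!: spec[of _ "degree m"])
  then have "coeff m' (degree m) = 1" using ring_graphD(9)[OF G _ ring_graphD(3)[OF G]] by blast
  then have "degree m' > 0" using d0 le_degree[of m' "degree m"] by simp
  then show ?thesis using m lm d0 pm dm min by (intro that[of m m']) auto
qed

text \<open>The pairs \<open>(p(a), q(a'))\<close> again form a graph: \<open>p(a) = 0\<close> makes
  \<open>p\<close> a multiple of the minimal polynomial \<open>m\<close>, with its image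
  \<open>q\<close> the corresponding multiple of \<open>m'\<close>, which vanishes at
  \<open>a'\<close>.\<close>

lemma ring_graph_extend:
  assumes G: "ring_graph G" and m: "(m, m') \<in> poly_graph G" "lead_coeff m = 1" "degree m > 0"
    and min: "\<forall>p q. (p, q) \<in> poly_graph G \<longrightarrow> poly p a = 0 \<longrightarrow> p \<noteq> 0 \<longrightarrow> degree m \<le> degree p"
    and ma: "poly m a = 0" and a': "poly m' a' = 0"
  obtains G' where "ring_graph G'" "G \<subseteq> G'" "(a, a') \<in> G'"
proof
  let ?G = "{(poly p a, poly q a') |p q. (p, q) \<in> poly_graph G}"
  have c: "([:x:], [:y:]) \<in> poly_graph G" if "(x, y) \<in> G" for x y
    using poly_graph_monom[OF G that, of 0] by (simp add: monom_0)
  show sub: "G \<subseteq> ?G"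
  proof
    fix z assume "z \<in> G"
    then obtain x y where z: "z = (x, y)" "(x, y) \<in> G" by (cases z) auto
    have "(poly [:x:] a, poly [:y:] a') \<in> ?G" using c[OF z(2)] by blast
    then show "z \<in> ?G" using z(1) by simp
  qed
  have "([:0, 1:], [:0, 1:]) \<in> poly_graph G"
    using poly_graph_monom[OF G ring_graphD(3)[OF G], of 1] by (simp add: monom_altdef)
  then have "(poly [:0, 1:] a, poly [:0, 1:] a') \<in> ?G" by blast
  then show "(a, a') \<in> ?G" by simp
  show "ring_graph ?G"
    unfolding ring_graph_def
  proof (intro conjI allI impI)
    fix x show "(to_ac x, to_ac x) \<in> ?G" using sub ring_graphD(1)[OF G] by blast
  next
    fix x y z v assume "(x, y) \<in> ?G" "(z, v) \<in> ?G"
    then obtain p q p' q' where *: "(p, q) \<in> poly_graph G" "(p', q') \<in> poly_graph G"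
      "x = poly p a" "y = poly q a'" "z = poly p' a" "v = poly q' a'" by blast
    have "(poly (p + p') a, poly (q + q') a') \<in> ?G" using poly_graph_add[OF G *(1,2)] by blast
    then show "(x + z, y + v) \<in> ?G" using * by simp
    have "(poly (p * p') a, poly (q * q') a') \<in> ?G" using poly_graph_mult[OF G *(1,2)] by blast
    then show "(x * z, y * v) \<in> ?G" using * by simp
  next
    fix y assume "(0, y) \<in> ?G"
    then obtain p q where pq: "(p, q) \<in> poly_graph G" "poly p a = 0" "y = poly q a'" by auto
    obtain r r' s s' where r: "(r, r') \<in> poly_graph G" "degree r < degree m" "p = s * m + r" "q = s' * m' + r'"
      using poly_graph_division[OF G m pq(1)] by blast
    have "poly r a = 0" using pq(2) ma unfolding r(3) by simp
    then have r0: "r = 0" using min r(1,2) by (meson not_le)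
    have "r' = 0" by (rule poly_graph_0[OF G r(1)[unfolded r0]])
    then show "y = 0" unfolding pq(3) r(4) using a' by simp
  qed
qed

text \<open>A maximal graph is total, since any element can be sent to a root of the image of its
  minimal polynomial.\<close>

lemma ring_graph_total:
  assumes G: "ring_graph G"
  obtains M where "ring_graph M" "G \<subseteq> M" "\<forall>a. \<exists>b. (a, b) \<in> M"
proof -
  let ?A = "{H. ring_graph H \<and> G \<subseteq> H}"
  have "\<exists>M\<in>?A. \<forall>H\<in>?A. M \<subseteq> H \<longrightarrow> H = M"
  proof (rule subset_Zorn_nonempty)
    show "?A \<noteq> {}" using G by blast
    fix C assume ne: "C \<noteq> {}" and ch: "subset.chain ?A C"
    have CA: "\<And>H. H \<in> C \<Longrightarrow> ring_graph H \<and> G \<subseteq> H" using ch by (auto simp: subset_chain_def)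
    have two: "\<exists>H\<in>C. x \<in> H \<and> y \<in> H" if xy: "x \<in> \<Union>C" "y \<in> \<Union>C" for x y
    proof -
      obtain H1 H2 where H: "H1 \<in> C" "x \<in> H1" "H2 \<in> C" "y \<in> H2" using xy by blast
      then have "H1 \<subseteq> H2 \<or> H2 \<subseteq> H1" using ch by (auto simp: subset_chain_def)
      with H show ?thesis by blast
    qed
    have "ring_graph (\<Union>C)"
      unfolding ring_graph_def
    proof (intro conjI allI impI)
      fix x show "(to_ac x, to_ac x) \<in> \<Union>C" using ne CA ring_graphD(1) by blast
    next
      fix a b c d assume "(a, b) \<in> \<Union>C" "(c, d) \<in> \<Union>C"
      from two[OF this] obtain H where "H \<in> C" "(a, b) \<in> H" "(c, d) \<in> H" by blast
      then show "(a + c, b + d) \<in> \<Union>C" "(a * c, b * d) \<in> \<Union>C"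
        using CA ring_graphD(4,5) by blast+
    next
      fix b assume "(0, b) \<in> \<Union>C" then show "b = 0" using CA ring_graphD(8) by blast
    qed
    moreover have "G \<subseteq> \<Union>C" using ne CA by blast
    ultimately show "\<Union>C \<in> ?A" by blast
  qed
  then obtain M where MA: "M \<in> ?A" and mx: "\<forall>H\<in>?A. M \<subseteq> H \<longrightarrow> H = M"
    by (rule bexE)
  from MA have M: "ring_graph M" "G \<subseteq> M" by simp_all
  have max: "H = M" if "ring_graph H" "M \<subseteq> H" for H
  proof -
    have "H \<in> ?A" using that M(2) by simp
    with mx that(2) show ?thesis by simp
  qed
  have "\<exists>b. (a, b) \<in> M" for a
  proof -
    obtain m m' where m: "(m, m') \<in> poly_graph M" "lead_coeff m = 1" "degree m > 0" "poly m a = 0"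
      "\<forall>p q. (p, q) \<in> poly_graph M \<longrightarrow> poly p a = 0 \<longrightarrow> p \<noteq> 0 \<longrightarrow> degree m \<le> degree p" "degree m' > 0"
      by (rule minimal_poly_graph[OF M(1), of a])
    obtain a' where "poly m' a' = 0" using alg_closed_imp_poly_has_root[OF m(6)] by blast
    then obtain H where "ring_graph H" "M \<subseteq> H" "(a, a') \<in> H"
      by (rule ring_graph_extend[OF M(1) m(1-3,5,4)])
    with max[of H] show ?thesis by blast
  qed
  then have "\<forall>a. \<exists>b. (a, b) \<in> M" by blast
  with M show ?thesis by (rule that)
qed

lemma ring_graph_galois:
  assumes G: "ring_graph G"
  obtains \<sigma> where "\<sigma> \<in> galois_group" "\<forall>a b. (a, b) \<in> G \<longrightarrow> \<sigma> a = b"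
proof -
  obtain M where M: "ring_graph M" "G \<subseteq> M" "\<forall>a. \<exists>b. (a, b) \<in> M" by (rule ring_graph_total[OF G])
  note D = ring_graphD[OF M(1)]
  define \<sigma> where "\<sigma> a = (SOME b. (a, b) \<in> M)" for a
  have s: "(a, \<sigma> a) \<in> M" for a unfolding \<sigma>_def using spec[OF M(3), of a] by (rule someI_ex)
  have se: "\<sigma> a = b" if "(a, b) \<in> M" for a b using D(9)[OF s that] .
  have hom: "\<sigma> (a + b) = \<sigma> a + \<sigma> b" "\<sigma> (a * b) = \<sigma> a * \<sigma> b" "\<sigma> 1 = 1" "\<sigma> (to_ac c) = to_ac c" for a b c
    by (rule se, intro D s)+
  have diff: "\<sigma> (a - b) = \<sigma> a - \<sigma> b" for a b by (rule se, intro D s)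
  have inj: "inj \<sigma>"
  proof (rule injI, rule ccontr)
    fix a b assume e: "\<sigma> a = \<sigma> b" "a \<noteq> b"
    then have "\<sigma> ((a - b) * inverse (a - b)) = 0" unfolding hom diff by simp
    then show False using e(2) hom(3) by simp
  qed
  have root: "poly (map_poly to_ac p) (\<sigma> x) = \<sigma> (poly (map_poly to_ac p) x)" for p :: "'a poly fract poly" and x
    by (rule sym, rule se, rule ring_graph_poly[OF M(1) s]) (simp add: coeff_map_poly D(1))
  have "\<sigma> 0 = 0" using se[OF D(2)] .
  \<comment> \<open>Each \<open>b\<close> is among the finitely many roots of a polynomial over
    \<open>k(t)\<close>, and the injective map \<open>\<sigma>\<close> permutes these roots.\<close>
  have surj: "surj \<sigma>"
    unfolding surj_def
  proof (rule allI)
    fix b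
    obtain p :: "'a poly fract poly" where p: "p \<noteq> 0" "poly (map_poly to_ac p) b = 0"
      using alg_closure_algebraic[of b] by blast
    let ?S = "{x. poly (map_poly to_ac p) x = 0}"
    have "map_poly to_ac p \<noteq> 0" using p(1) by (simp add: map_poly_eq_0_iff)
    then have "finite ?S" by (rule poly_roots_finite)
    moreover have "\<sigma> ` ?S \<subseteq> ?S" using \<open>\<sigma> 0 = 0\<close> by (auto simp: root)
    ultimately have "\<sigma> ` ?S = ?S" by (intro endo_inj_surj inj_on_subset[OF inj]) auto
    then have "b \<in> \<sigma> ` ?S" using p(2) by blast
    then show "\<exists>a. b = \<sigma> a" by blast
  qed
  have "\<sigma> \<in> galois_group"
    using hom inj surj unfolding galois_group_def ring_iso_def ring_hom_def
    by (auto simp: ring_of_type_algebra_def bij_betw_def)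
  moreover have "\<forall>a b. (a, b) \<in> G \<longrightarrow> \<sigma> a = b" using se M(2) by blast
  ultimately show ?thesis by (rule that)
qed

text \<open>The fixed field of the automorphisms over \<open>L\<close> is \<open>L\<close>: the
  minimal polynomial of \<open>z\<close> over \<open>L\<close> is not linear, and in characteristic
  0 it has a root other than \<open>z\<close>. Sending \<open>z\<close> there extends to an
  automorphism.\<close>

theorem galois_moves:
  fixes L :: "'k::field_char_0 funs set"
  assumes L: "field_set L" and base: "range to_ac \<subseteq> L" and z: "z \<notin> L"
  obtains \<sigma> where "\<sigma> \<in> galois_group" "\<forall>x\<in>L. \<sigma> x = x" "\<sigma> z \<noteq> z"
proof -
  let ?G = "{(x, x) |x. x \<in> L}"
  have G: "ring_graph ?G"
    using base field_setD[OF L] by (auto simp: ring_graph_def)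
  obtain m m' where m: "(m, m') \<in> poly_graph ?G" "lead_coeff m = 1" "degree m > 0" "poly m z = 0"
    "\<forall>p q. (p, q) \<in> poly_graph ?G \<longrightarrow> poly p z = 0 \<longrightarrow> p \<noteq> 0 \<longrightarrow> degree m \<le> degree p" "degree m' > 0"
    by (rule minimal_poly_graph[OF G, of z])
  have mL: "coeff m i \<in> L" for i using m(1) by (auto simp: poly_graph_def)
  have mm: "m' = m" using m(1) by (intro poly_eqI) (auto simp: poly_graph_def)
  obtain k where k: "m = [:- z, 1:] * k" using m(4) by (auto simp: poly_eq_0_iff_dvd elim: dvdE)
  have k0: "k \<noteq> 0" using k m(3) by auto
  have dk: "degree m = Suc (degree k)" unfolding k using k0 by (subst degree_mult_eq) auto
  have "degree k \<noteq> 0"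
  proof
    assume "degree k = 0"
    then obtain c where c: "k = [:c:]" by (auto elim: degree_eq_zeroE)
    then have "c = 1" using m(2) k k0 by simp
    then have "coeff m 0 = - z" using k c by simp
    then show False using mL[of 0] field_setD(5)[OF L, of "- z"] z by simp
  qed
  then obtain a' where a': "poly k a' = 0" using alg_closed_imp_poly_has_root[of k] by blast
  \<comment> \<open>The derivative is nonzero and of smaller degree than the minimal polynomial.
    Hence \<open>z\<close> is a simple root of \<open>m\<close>, and a root of the cofactor
    \<open>k\<close> differs from \<open>z\<close>.\<close>
  have "poly (pderiv m) z \<noteq> 0"
  proof
    assume e: "poly (pderiv m) z = 0"
    have "of_nat n \<in> L" for n by (induction n) (auto intro: field_setD[OF L])
    then have "(pderiv m, pderiv m) \<in> poly_graph ?G"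
      using mL by (auto simp: poly_graph_def coeff_pderiv intro!: field_setD(4)[OF L] simp del: of_nat_Suc)
    moreover have "pderiv m \<noteq> 0" using m(3) by (simp add: pderiv_eq_0_iff)
    ultimately have "degree m \<le> degree (pderiv m)" using m(5) e by blast
    then show False using m(3) by (simp add: degree_pderiv)
  qed
  moreover have "poly (pderiv m) z = poly k z"
    unfolding k pderiv_mult poly_add poly_mult by (simp add: pderiv_pCons)
  ultimately have "poly k z \<noteq> 0" by simp
  then have ne: "a' \<noteq> z" using a' by auto
  have "poly m' a' = 0" unfolding mm k using a' by simp
  then obtain H where H: "ring_graph H" "?G \<subseteq> H" "(z, a') \<in> H"
    by (rule ring_graph_extend[OF G m(1-3,5,4)])
  obtain \<sigma> where s: "\<sigma> \<in> galois_group" "\<forall>a b. (a, b) \<in> H \<longrightarrow> \<sigma> a = b"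
    by (rule ring_graph_galois[OF H(1)])
  show ?thesis
  proof (rule that[OF s(1)])
    show "\<forall>x\<in>L. \<sigma> x = x" using s(2) H(2) by blast
    have "\<sigma> z = a'" using s(2) H(3) by blast
    then show "\<sigma> z \<noteq> z" using ne by simp
  qed
qed

section \<open>Tate normal form for a point of order 10\<close>

text \<open>The denominator of the parameter \<open>r = s^2 / (3 s - s^2 - 1)\<close> that belongs
  to order 10 in Tate's family.\<close>

definition md :: "'a::field_char_0 \<Rightarrow> 'a" where "md s = 3 * s - s ^ 2 - 1"

text \<open>Numerator of Tate's coefficient \<open>c = s (r - 1) = mC s / md s\<close>.\<close>

definition mC :: "'a::field_char_0 \<Rightarrow> 'a" where "mC s = s * (2 * s - 1) * (s - 1)"

text \<open>Tate's curve \<open>y^2 + (1 - c) x y - b y = x^3 - b x^2\<close> with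
  \<open>b = c r\<close>, rescaled by \<open>md s\<close> so that the coefficients are polynomials
  in \<open>s\<close>.\<close>

definition mE :: "'a::field_char_0 \<Rightarrow> 'a weierstrass" where
  "mE s = Weierstrass (md s - mC s) (- (s ^ 2 * mC s)) (- (s ^ 2 * mC s * md s)) 0 0"

text \<open>The cubic of the 2-torsion of \<open>mE s\<close> has the abscissa of five times the
  origin as a root; what remains is \<open>4 x^2 + mlin s * x - mk s\<close>.\<close>

definition mlin :: "'a::field_char_0 \<Rightarrow> 'a" where "mlin s = 1 - 4 * s + 12 * s ^ 3 - 8 * s ^ 4"

definition mk :: "'a::field_char_0 \<Rightarrow> 'a" where "mk s = s ^ 3 * (2 * s - 1) ^ 2 * (s - 1) * md s"

lemma mE_simps [simp]: "wa1 (mE s) = md s - mC s" "wa2 (mE s) = - (s ^ 2 * mC s)"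
  "wa3 (mE s) = - (s ^ 2 * mC s * md s)" "wa4 (mE s) = 0" "wa6 (mE s) = 0"
  by (simp_all add: mE_def)

lemma mC_alt: "mC s = s * (s ^ 2 - md s)"
  by (simp add: mC_def md_def algebra_simps power2_eq_square)

lemma wdisc_mE: "wdisc (mE s) = s ^ 10 * (s - 1) ^ 10 * (2 * s - 1) ^ 5 * md s ^ 2 * (4 * s ^ 2 - 2 * s - 1)"
proof -
  have i: "((md s - mC s) ^ 2 - 4 * s ^ 2 * mC s) ^ 2 - (md s - mC s) ^ 3 * md s
      + 36 * (md s - mC s) * s ^ 2 * mC s * md s - 27 * s ^ 2 * mC s * md s ^ 2 =
      s * (s - 1) ^ 7 * (2 * s - 1) ^ 2 * (4 * s ^ 2 - 2 * s - 1)"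
    unfolding mC_def md_def by (Groebner_Basis.algebra | (simp add: algebra_simps eval_nat_numeral))
  have "- ((a ^ 2 + 4 * - (t * c)) ^ 2 * (- (t * c) * (- (t * c * d)) ^ 2)) - 8 * (a * - (t * c * d)) ^ 3
     - 27 * ((- (t * c * d)) ^ 2) ^ 2 + 9 * (a ^ 2 + 4 * - (t * c)) * (a * - (t * c * d)) * (- (t * c * d)) ^ 2
     = t ^ 3 * c ^ 3 * d ^ 2 * ((a ^ 2 - 4 * t * c) ^ 2 - a ^ 3 * d + 36 * a * t * c * d - 27 * t * c * d ^ 2)"
    for a t c d :: 'a
    by (Groebner_Basis.algebra | (simp add: algebra_simps eval_nat_numeral))
  from this[of "md s - mC s" "s ^ 2" "mC s" "md s"]
  have "wdisc (mE s) = (s ^ 2) ^ 3 * mC s ^ 3 * md s ^ 2 * (s * (s - 1) ^ 7 * (2 * s - 1) ^ 2 * (4 * s ^ 2 - 2 * s - 1))"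
    unfolding i by (simp add: wdisc_def wb2_def wb4_def wb6_def wb8_def)
  then show ?thesis by (simp add: mC_def power_mult_distrib mult_ac flip: power_mult power_add power_Suc power_Suc2)
qed

lemma wiso_b:
  assumes "wiso u r s t E E'"
  shows "u ^ 2 * wb2 E' = wb2 E + 12 * r" "u ^ 4 * wb4 E' = wb4 E + r * wb2 E + 6 * r ^ 2"
    "u ^ 6 * wb6 E' = wb6 E + 2 * r * wb4 E + r ^ 2 * wb2 E + 4 * r ^ 3"
    "u ^ 8 * wb8 E' = wb8 E + 3 * r * wb6 E + 3 * r ^ 2 * wb4 E + r ^ 3 * wb2 E + 3 * r ^ 4"
proof -
  note p = wiso_params[OF assms]
  show "u ^ 2 * wb2 E' = wb2 E + 12 * r"
    unfolding wb2_def p(2,3) by Groebner_Basis.algebra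
  show "u ^ 4 * wb4 E' = wb4 E + r * wb2 E + 6 * r ^ 2"
    unfolding wb2_def wb4_def p(2-5) by Groebner_Basis.algebra
  show "u ^ 6 * wb6 E' = wb6 E + 2 * r * wb4 E + r ^ 2 * wb2 E + 4 * r ^ 3"
    unfolding wb2_def wb4_def wb6_def p(6) unfolding p(2-5) by Groebner_Basis.algebra
  show "u ^ 8 * wb8 E' = wb8 E + 3 * r * wb6 E + 3 * r ^ 2 * wb4 E + r ^ 3 * wb2 E + 3 * r ^ 4"
    unfolding wb2_def wb4_def wb6_def wb8_def p(6) unfolding p(2-5) by Groebner_Basis.algebra
qed

definition wc4 :: "'a::field weierstrass \<Rightarrow> 'a" where "wc4 E = wb2 E ^ 2 - 24 * wb4 E"

definition wc6 :: "'a::field weierstrass \<Rightarrow> 'a" where "wc6 E = - (wb2 E ^ 3) + 36 * wb2 E * wb4 E - 216 * wb6 E"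

lemma wiso_c:
  assumes "wiso u r s t E E'"
  shows "wc4 E = u ^ 4 * wc4 E'" "wc6 E = u ^ 6 * wc6 E'" "wdisc E = u ^ 12 * wdisc E'"
proof -
  note b = wiso_b[OF assms]
  have b2: "wb2 E = u ^ 2 * wb2 E' - 12 * r" using b(1) by simp
  have b4: "wb4 E = u ^ 4 * wb4 E' - r * wb2 E - 6 * r ^ 2" using b(2) by simp
  have b6: "wb6 E = u ^ 6 * wb6 E' - 2 * r * wb4 E - r ^ 2 * wb2 E - 4 * r ^ 3" using b(3) by simp
  have b8: "wb8 E = u ^ 8 * wb8 E' - 3 * r * wb6 E - 3 * r ^ 2 * wb4 E - r ^ 3 * wb2 E - 3 * r ^ 4" using b(4) by simp
  show "wc4 E = u ^ 4 * wc4 E'" unfolding wc4_def b4 b2 by Groebner_Basis.algebra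
  show "wc6 E = u ^ 6 * wc6 E'" unfolding wc6_def b6 b4 b2 by Groebner_Basis.algebra
  have e': "4 * wb8 E' = wb2 E' * wb6 E' - wb4 E' ^ 2"
    unfolding wb2_def wb4_def wb6_def wb8_def by Groebner_Basis.algebra
  show "wdisc E = u ^ 12 * wdisc E'" unfolding wdisc_def b8 b6 b4 b2 using e' by Groebner_Basis.algebra
qed

lemma wiso_elliptic: "wiso u r s t E E' \<Longrightarrow> elliptic E \<longleftrightarrow> elliptic E'"
  using wiso_c(3)[of u r s t E E'] by (auto simp: elliptic_def wiso_def)

lemma j_alt: "j_invariant E = wc4 E ^ 3 / wdisc E"
  by (simp add: j_invariant_def wc4_def)

lemma wiso_j:
  assumes "wiso u r s t E E'" shows "j_invariant E = j_invariant E'"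
proof -
  have "u ^ 12 \<noteq> 0" using assms by (simp add: wiso_def)
  moreover have "(u ^ 4 * wc4 E') ^ 3 = u ^ 12 * wc4 E' ^ 3" by (simp add: power_mult_distrib flip: power_mult)
  ultimately show ?thesis unfolding j_alt wiso_c[OF assms] by simp
qed

lemma disc_c4_c6:
  fixes E :: "'a::field_char_0 weierstrass"
  shows "1728 * wdisc E = wc4 E ^ 3 - wc6 E ^ 2"
  unfolding wdisc_def wc4_def wc6_def wb2_def wb4_def wb6_def wb8_def by Groebner_Basis.algebra

text \<open>The base point fixes the translation. Since \<open>a4\<close> vanishes and
  \<open>a3\<close> does not, \<open>\<sigma>\<close> is the slope of the tangent there. The
  coefficients then determine \<open>U d\<close>, \<open>U C\<close> and \<open>U s^2\<close>, where
  \<open>d = md s\<close> and \<open>C = mC s\<close>, and \<open>s\<close> is the quotient of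
  \<open>U C\<close> by \<open>U (s^2 - d)\<close>.\<close>

lemma wiso_unique:
  assumes 1: "wiso U x \<sigma> y E (mE s)" and 2: "wiso U' x \<sigma>' y E (mE s')" and e: "elliptic E"
  shows "s = s'" "U = U'"
proof -
  have el: "elliptic (mE s)" "elliptic (mE s')" using wiso_elliptic[OF 1] wiso_elliptic[OF 2] e by auto
  then have nz: "md s \<noteq> 0" "mC s \<noteq> 0" "s \<noteq> 0" "md s' \<noteq> 0" "mC s' \<noteq> 0" "s' \<noteq> 0"
    by (auto simp: elliptic_def wdisc_mE mC_def)
  have U: "U \<noteq> 0" "U' \<noteq> 0" using 1 2 by (auto simp: wiso_def)
  define A3 where "A3 = wa3 E + x * wa1 E + 2 * y"
  have a3: "U ^ 3 * - (s ^ 2 * mC s * md s) = A3" "U' ^ 3 * - (s' ^ 2 * mC s' * md s') = A3"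
    using 1 2 by (simp_all add: wiso_def A3_def)
  then have A30: "A3 \<noteq> 0" using U nz by auto
  have "\<sigma> * A3 = wa4 E + 2 * x * wa2 E - y * wa1 E + 3 * x ^ 2"
    "\<sigma>' * A3 = wa4 E + 2 * x * wa2 E - y * wa1 E + 3 * x ^ 2"
    using 1 2 by (simp_all add: wiso_def A3_def algebra_simps)
  then have "\<sigma> * A3 = \<sigma>' * A3" by simp
  then have \<sigma>: "\<sigma> = \<sigma>'" using A30 by simp
  have a1: "U * (md s - mC s) = U' * (md s' - mC s')" using 1 2 by (simp add: wiso_def \<sigma>)
  have "U ^ 2 * wa2 (mE s) = U' ^ 2 * wa2 (mE s')"
    using 1 2 by (simp only: wiso_def \<sigma>)
  then have a2: "U ^ 2 * (s ^ 2 * mC s) = U' ^ 2 * (s' ^ 2 * mC s')" by simp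
  have "U ^ 3 * - (s ^ 2 * mC s * md s) = U' ^ 3 * - (s' ^ 2 * mC s' * md s')" unfolding a3 ..
  then have "(U ^ 2 * (s ^ 2 * mC s)) * (U * md s) = (U' ^ 2 * (s' ^ 2 * mC s')) * (U' * md s')"
    by (simp add: power3_eq_cube power2_eq_square algebra_simps)
  then have d: "U * md s = U' * md s'" unfolding a2 using U nz by simp
  have c: "U * mC s = U' * mC s'" using a1 d by (simp add: algebra_simps)
  have "(U * mC s) * (U * s ^ 2) = (U' * mC s') * (U' * s' ^ 2)"
    using a2 by (simp add: power2_eq_square algebra_simps)
  then have s2: "U * s ^ 2 = U' * s' ^ 2" unfolding c using U nz by simp
  have k: "U * (s ^ 2 - md s) = U' * (s' ^ 2 - md s')" using s2 d by (simp add: algebra_simps)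
  have "s * (U * (s ^ 2 - md s)) = U * mC s" by (simp add: mC_alt)
  also have "\<dots> = s' * (U' * (s' ^ 2 - md s'))" unfolding c by (simp add: mC_alt)
  finally have "s * (U * (s ^ 2 - md s)) = s' * (U * (s ^ 2 - md s))" unfolding k .
  moreover have "U * (s ^ 2 - md s) \<noteq> 0" using U nz by (auto simp: mC_alt)
  ultimately show s: "s = s'" by simp
  show "U = U'" using d nz unfolding s by simp
qed

text \<open>For automorphisms that send \<open>P\<close> to its inverse: moving \<open>- P\<close>
  to the origin changes the sign of \<open>U\<close> and keeps \<open>s\<close>.\<close>

lemma wiso_neg:
  assumes "wiso U x \<sigma> y E (mE s)"
  shows "wiso (- U) x (- \<sigma> - wa1 E) (- y - wa1 E * x - wa3 E) E (mE s)"
proof -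
  have p: "U \<noteq> 0" "U * wa1 (mE s) = wa1 E + 2 * \<sigma>"
     "U ^ 2 * wa2 (mE s) = wa2 E - \<sigma> * wa1 E + 3 * x - \<sigma> ^ 2"
     "U ^ 3 * wa3 (mE s) = wa3 E + x * wa1 E + 2 * y"
     "U ^ 4 * wa4 (mE s) = wa4 E - \<sigma> * wa3 E + 2 * x * wa2 E - (y + x * \<sigma>) * wa1 E + 3 * x ^ 2 - 2 * \<sigma> * y"
     "U ^ 6 * wa6 (mE s) = wa6 E + x * wa4 E + x ^ 2 * wa2 E + x ^ 3 - y * wa3 E - y ^ 2 - x * y * wa1 E"
    using assms unfolding wiso_def by blast+
  show ?thesis unfolding wiso_def
  proof (intro conjI)
    show "- U \<noteq> 0" using p(1) by simp
    show "- U * wa1 (mE s) = wa1 E + 2 * (- \<sigma> - wa1 E)" using p(2) by simp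
    show "(- U) ^ 2 * wa2 (mE s) = wa2 E - (- \<sigma> - wa1 E) * wa1 E + 3 * x - (- \<sigma> - wa1 E) ^ 2"
      unfolding power2_minus p(3) by Groebner_Basis.algebra
    have o: "(- U) ^ 3 = - (U ^ 3)" by simp
    show "(- U) ^ 3 * wa3 (mE s) = wa3 E + x * wa1 E + 2 * (- y - wa1 E * x - wa3 E)"
      unfolding o minus_mult_left[symmetric] p(4) by Groebner_Basis.algebra
    have e: "(- U) ^ 4 = U ^ 4" "(- U) ^ 6 = U ^ 6" by simp_all
    show "(- U) ^ 4 * wa4 (mE s) = wa4 E - (- \<sigma> - wa1 E) * wa3 E + 2 * x * wa2 E -
       (- y - wa1 E * x - wa3 E + x * (- \<sigma> - wa1 E)) * wa1 E + 3 * x ^ 2 - 2 * (- \<sigma> - wa1 E) * (- y - wa1 E * x - wa3 E)"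
      unfolding e p(5) by Groebner_Basis.algebra
    show "(- U) ^ 6 * wa6 (mE s) = wa6 E + x * wa4 E + x ^ 2 * wa2 E + x ^ 3 - (- y - wa1 E * x - wa3 E) * wa3 E -
       (- y - wa1 E * x - wa3 E) ^ 2 - x * (- y - wa1 E * x - wa3 E) * wa1 E"
      unfolding e p(6) by Groebner_Basis.algebra
  qed
qed

text \<open>Eliminating \<open>yr\<close> gives the cubic
  \<open>4 x^3 + 4 a2 x^2 + (a1 x + a3)^2\<close>, from which the abscissa of five times the origin
  splits off.\<close>

lemma two_torsion_poly:
  assumes c: "on_curve (mE s) (Affine xr yr)" and t: "2 * yr + wa1 (mE s) * xr + wa3 (mE s) = 0"
  shows "(xr - s ^ 3 * (s - 1) * md s) * (4 * xr ^ 2 + mlin s * xr - mk s) = 0"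
proof -
  define a1 a2 a3 where "a1 = wa1 (mE s)" and "a2 = wa2 (mE s)" and "a3 = wa3 (mE s)"
  have c': "yr ^ 2 + a1 * xr * yr + a3 * yr = xr ^ 3 + a2 * xr ^ 2" using c by (simp add: a1_def a2_def a3_def)
  have t': "2 * yr + a1 * xr + a3 = 0" using t by (simp add: a1_def a3_def)
  have "4 * xr ^ 3 + 4 * a2 * xr ^ 2 + (a1 * xr + a3) ^ 2 = (2 * yr + a1 * xr + a3) ^ 2
      - 4 * ((yr ^ 2 + a1 * xr * yr + a3 * yr) - (xr ^ 3 + a2 * xr ^ 2))"
    by Groebner_Basis.algebra
  also have "\<dots> = 0" unfolding c' t' by simp
  finally have z: "4 * xr ^ 3 + 4 * a2 * xr ^ 2 + (a1 * xr + a3) ^ 2 = 0" .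
  have "(xr - s ^ 3 * (s - 1) * md s) * (4 * xr ^ 2 + mlin s * xr - mk s) = 4 * xr ^ 3 + 4 * a2 * xr ^ 2 + (a1 * xr + a3) ^ 2"
    unfolding a1_def a2_def a3_def mE_simps mlin_def mk_def mC_def md_def by Groebner_Basis.algebra
  with z show ?thesis by simp
qed

text \<open>The discriminant \<open>mlin s ^ 2 + 16 * mk s\<close> of the quadratic equals
  \<open>u^4 (u^3 + u^2 - u)\<close>; thus \<open>w\<close> is its square root divided by
  \<open>u^2\<close>.\<close>

lemma quadratic_iff_point:
  fixes s xr w :: "'a::field_char_0"
  assumes u: "u = 2 * s - 1" "u \<noteq> 0" and w: "u ^ 2 * w = 8 * xr + mlin s"
  shows "4 * xr ^ 2 + mlin s * xr - mk s = 0 \<longleftrightarrow> w ^ 2 = u ^ 3 + u ^ 2 - u"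
proof -
  have m: "mlin s ^ 2 + 16 * mk s = u ^ 4 * (u ^ 3 + u ^ 2 - u)"
    unfolding u(1) mlin_def mk_def md_def by Groebner_Basis.algebra
  have "16 * (4 * xr ^ 2 + mlin s * xr - mk s) = (8 * xr + mlin s) ^ 2 - (mlin s ^ 2 + 16 * mk s)"
    by Groebner_Basis.algebra
  also have "\<dots> = u ^ 4 * (w ^ 2 - (u ^ 3 + u ^ 2 - u))"
    unfolding m w[symmetric] by Groebner_Basis.algebra
  finally have "16 * (4 * xr ^ 2 + mlin s * xr - mk s) = u ^ 4 * (w ^ 2 - (u ^ 3 + u ^ 2 - u))" .
  note e = this
  have "4 * xr ^ 2 + mlin s * xr - mk s = 0 \<longleftrightarrow> 16 * (4 * xr ^ 2 + mlin s * xr - mk s) = 0"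
    by (subst mult_eq_0_iff) simp
  also have "\<dots> \<longleftrightarrow> u ^ 4 * (w ^ 2 - (u ^ 3 + u ^ 2 - u)) = 0" unfolding e ..
  also have "\<dots> \<longleftrightarrow> w ^ 2 = u ^ 3 + u ^ 2 - u" using u(2) by simp
  finally show ?thesis .
qed

text \<open>The double, triple and fivefold of the origin. The values \<open>c = 0\<close> and
  \<open>b = c\<close>, which the parameters \<open>r = b / c\<close> and
  \<open>s = c / (r - 1)\<close> exclude, belong to order 4 and order 5.\<close>

lemma tate_multiples:
  fixes b c :: "'a::field_char_0"
  defines "T \<equiv> Weierstrass (1 - c) (- b) (- b) 0 0"
  assumes b: "b \<noteq> 0"
  shows "ec_add T (Affine 0 0) (Affine 0 0) = Affine b (b * c)"
    "ec_add T (Affine b (b * c)) (Affine 0 0) = Affine c (b - c)"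
    "c = 0 \<Longrightarrow> ec_add T (Affine c (b - c)) (Affine 0 0) = Infinity"
    "b = c \<Longrightarrow> ec_add T (Affine b (b * c)) (Affine c (b - c)) = Infinity"
    "b = c * r \<Longrightarrow> c = s * (r - 1) \<Longrightarrow> c \<noteq> 0 \<Longrightarrow> ec_add T (Affine b (b * c)) (Affine c (b - c)) =
       Affine (r * s * (s - 1)) (r * s ^ 2 * (r - s))"
proof -
  show "ec_add T (Affine 0 0) (Affine 0 0) = Affine b (b * c)"
    using b by (simp add: T_def Let_def algebra_simps)
  have l: "(0 - b * c) / (0 - b) = c" using b by simp
  show "ec_add T (Affine b (b * c)) (Affine 0 0) = Affine c (b - c)"
    unfolding ec_add.simps l using b by (simp add: T_def Let_def algebra_simps power2_eq_square)
  show "c = 0 \<Longrightarrow> ec_add T (Affine c (b - c)) (Affine 0 0) = Infinity"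
    by (simp add: T_def)
  show "b = c \<Longrightarrow> ec_add T (Affine b (b * c)) (Affine c (b - c)) = Infinity"
    by (simp add: T_def algebra_simps)
  assume br: "b = c * r" and cs: "c = s * (r - 1)" and c0: "c \<noteq> 0"
  then have r1: "r - 1 \<noteq> 0" by auto
  have ne: "b \<noteq> c" using br r1 c0 by auto
  have d0: "c - b \<noteq> 0" using ne by simp
  have "(b - c) - b * c = (r * s - 1) * (c - b)" unfolding br cs by (simp add: algebra_simps)
  then have l: "((b - c) - b * c) / (c - b) = r * s - 1"
    by (simp only: nonzero_mult_div_cancel_right[OF d0])
  show "ec_add T (Affine b (b * c)) (Affine c (b - c)) = Affine (r * s * (s - 1)) (r * s ^ 2 * (r - s))"
    unfolding ec_add.simps l Let_def using ne
    by (simp add: T_def) (simp add: br cs algebra_simps power2_eq_square)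
qed

text \<open>With \<open>P\<close> at the origin and the tangent there as the axis
  \<open>y = 0\<close>, a scaling makes \<open>a2\<close> and \<open>a3\<close> equal. In the
  parameters \<open>r\<close> and \<open>s\<close>, the condition that \<open>5 P\<close> is its own
  negative becomes \<open>r (3 s - s^2 - 1) = s^2\<close>.\<close>

theorem tate_form:
  fixes E :: "'a::field_char_0 weierstrass"
  assumes e: "elliptic E" and P: "on_curve E P"
    and P2: "P2 = ec_add E P P" and P3: "P3 = ec_add E P2 P" and P5: "P5 = ec_add E P2 P3"
    and nz: "P \<noteq> Infinity" "P2 \<noteq> Infinity" "P3 \<noteq> Infinity" "ec_add E P3 P \<noteq> Infinity" "P5 \<noteq> Infinity"
    and P10: "ec_add E P5 P5 = Infinity"
  obtains U x \<sigma> y s where "wiso U x \<sigma> y E (mE s)" "P = Affine x y"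
    "P5 = wback U x \<sigma> y (Affine (s ^ 3 * (s - 1) * md s) (s ^ 5 * (s - md s) * md s))"
proof -
  obtain x y where PA: "P = Affine x y" using nz(1) by (cases P) auto
  have Pc: "y ^ 2 + wa1 E * x * y + wa3 E * y = x ^ 3 + wa2 E * x ^ 2 + wa4 E * x + wa6 E"
    using P unfolding PA on_curve.simps .
  define A3 where "A3 = wa3 E + x * wa1 E + 2 * y"
  have A3: "A3 \<noteq> 0"
  proof
    assume "A3 = 0"
    then have "y + y + wa1 E * x + wa3 E = 0" by (simp add: A3_def algebra_simps)
    then have "ec_add E P P = Infinity" unfolding PA ec_add.simps by simp
    with nz(2) P2 show False by simp
  qed
  \<comment> \<open>The slope of the tangent at \<open>P\<close>; it is finite because
    \<open>2 P\<close> is not zero. This choice removes \<open>a4\<close>.\<close>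
  define \<sigma> where "\<sigma> = (wa4 E + 2 * x * wa2 E - y * wa1 E + 3 * x ^ 2) / A3"
  have \<sigma>: "\<sigma> * A3 = wa4 E + 2 * x * wa2 E - y * wa1 E + 3 * x ^ 2" using A3 by (simp add: \<sigma>_def)
  define A1 A2 where "A1 = wa1 E + 2 * \<sigma>" and "A2 = wa2 E - \<sigma> * wa1 E + 3 * x - \<sigma> ^ 2"
  let ?E1 = "Weierstrass A1 A2 A3 0 0"
  have iso1: "wiso 1 x \<sigma> y E ?E1"
  proof -
    have "wa4 E - \<sigma> * wa3 E + 2 * x * wa2 E - (y + x * \<sigma>) * wa1 E + 3 * x ^ 2 - 2 * \<sigma> * y =
        (wa4 E + 2 * x * wa2 E - y * wa1 E + 3 * x ^ 2) - \<sigma> * A3"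
      by (simp add: A3_def algebra_simps)
    then have 4: "wa4 E - \<sigma> * wa3 E + 2 * x * wa2 E - (y + x * \<sigma>) * wa1 E + 3 * x ^ 2 - 2 * \<sigma> * y = 0"
      unfolding \<sigma> by simp
    have "wa6 E + x * wa4 E + x ^ 2 * wa2 E + x ^ 3 - y * wa3 E - y ^ 2 - x * y * wa1 E =
       (x ^ 3 + wa2 E * x ^ 2 + wa4 E * x + wa6 E) - (y ^ 2 + wa1 E * x * y + wa3 E * y)"
      by (simp add: algebra_simps)
    then have 6: "wa6 E + x * wa4 E + x ^ 2 * wa2 E + x ^ 3 - y * wa3 E - y ^ 2 - x * y * wa1 E = 0"
      unfolding Pc by simp
    show ?thesis unfolding wiso_def 4 6 by (simp add: A1_def A2_def A3_def)
  qed
  have f0: "wback U x \<sigma> y (Affine 0 0) = P" for U by (simp add: PA)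
  \<comment> \<open>With \<open>a2 = 0\<close> the tangent \<open>y = 0\<close> would meet the curve
    three times at the origin, and \<open>P\<close> would have order 3.\<close>
  have A2: "A2 \<noteq> 0"
  proof
    assume A20: "A2 = 0"
    note wb = wback_add[OF iso1]
    have c0: "on_curve ?E1 (Affine 0 0)" by simp
    have d: "ec_add ?E1 (Affine 0 0) (Affine 0 0) = Affine 0 (- A3)" using A3 A20 by (simp add: Let_def)
    have c1: "on_curve ?E1 (Affine 0 (- A3))" by (simp add: power2_eq_square)
    have "wback 1 x \<sigma> y (Affine 0 (- A3)) = P2" using wb[OF c0 c0] unfolding d f0 P2 .
    then have "P3 = wback 1 x \<sigma> y (ec_add ?E1 (Affine 0 (- A3)) (Affine 0 0))"
      using wb[OF c1 c0] unfolding P3 f0 by simp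
    then show False using nz(3) by simp
  qed
  define U0 where "U0 = A3 / A2"
  define b c where "b = - (A2 ^ 3) / A3 ^ 2" and "c = 1 - A1 * A2 / A3"
  have b0: "b \<noteq> 0" using A2 A3 by (simp add: b_def)
  define T where "T = Weierstrass (1 - c) (- b) (- b) 0 0"
  have U00: "U0 \<noteq> 0" using A2 A3 by (simp add: U0_def)
  have s1: "A1 = U0 * (1 - c)" "A2 = U0 ^ 2 * (- b)" "A3 = U0 ^ 3 * (- b)"
    using A2 A3 by (simp_all add: U0_def b_def c_def field_simps power2_eq_square power3_eq_cube)
  have iso: "wiso U0 x \<sigma> y E T"
    using iso1 U00 s1 unfolding wiso_def T_def by simp
  note wb = wback_add[OF iso] and on = wback_on[OF iso] and inj = wback_inj[OF iso]
  note tm = tate_multiples[OF b0, of c, folded T_def]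
  let ?f = "wback U0 x \<sigma> y"
  let ?Q2 = "Affine b (b * c)" and ?Q3 = "Affine c (b - c)"
  have q1: "on_curve T (Affine 0 0)" by (simp add: T_def)
  have q2: "on_curve T ?Q2" by (simp add: T_def algebra_simps power2_eq_square power3_eq_cube)
  have q3: "on_curve T ?Q3" by (simp add: T_def algebra_simps power2_eq_square power3_eq_cube)
  have f2: "P2 = ?f ?Q2" using wb[OF q1 q1] unfolding tm(1) f0 P2 ..
  have f3: "P3 = ?f ?Q3" using wb[OF q2 q1] unfolding tm(2) f0 P3 f2 ..
  have c0: "c \<noteq> 0"
  proof
    assume z: "c = 0"
    have "ec_add E P3 P = ?f (ec_add T ?Q3 (Affine 0 0))" using wb[OF q3 q1] unfolding f0 f3 by (rule sym)
    then have "ec_add E P3 P = Infinity" unfolding tm(3)[OF z] wback.simps .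
    with nz(4) show False by contradiction
  qed
  have f5: "P5 = ?f (ec_add T ?Q2 ?Q3)" using wb[OF q2 q3] unfolding P5 f2 f3 by simp
  have bc: "b \<noteq> c"
  proof
    assume z: "b = c"
    have "P5 = Infinity" unfolding f5 tm(4)[OF z] wback.simps ..
    with nz(5) show False by contradiction
  qed
  define r s where "r = b / c" and "s = c / (r - 1)"
  have br: "b = c * r" using c0 by (simp add: r_def)
  have r1: "r - 1 \<noteq> 0" using bc br by auto
  have cs: "c = s * (r - 1)" using r1 by (simp add: s_def)
  have s0: "s \<noteq> 0" and r0: "r \<noteq> 0" using cs c0 br b0 by auto
  note t5 = tm(5)[OF br cs c0]
  let ?Q5 = "Affine (r * s * (s - 1)) (r * s ^ 2 * (r - s))"
  have f5': "P5 = ?f ?Q5" using f5 unfolding t5 .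
  have q5: "on_curve T ?Q5"
    unfolding T_def on_curve.simps br cs by (simp add: algebra_simps power2_eq_square power3_eq_cube)
  have "?f (ec_add T ?Q5 ?Q5) = Infinity" using wb[OF q5 q5] P10 unfolding f5' by simp
  then have "ec_add T ?Q5 ?Q5 = Infinity" by (cases "ec_add T ?Q5 ?Q5") auto
  have "r * s ^ 2 * (r - s) + r * s ^ 2 * (r - s) + (1 - c) * (r * s * (s - 1)) + - b = 0"
  proof (rule ccontr)
    assume n: "\<not> ?thesis"
    have "ec_add T ?Q5 ?Q5 \<noteq> Infinity" unfolding ec_add.simps using n by (simp add: T_def Let_def)
    then show False using \<open>ec_add T ?Q5 ?Q5 = Infinity\<close> by contradiction
  qed
  moreover have "r * s ^ 2 * (r - s) + r * s ^ 2 * (r - s) + (1 - c) * (r * s * (s - 1)) + - b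
      = (r * s) * (r * md s - s ^ 2)"
    unfolding br cs md_def by Groebner_Basis.algebra
  ultimately have rd: "r * md s = s ^ 2" using r0 s0 by simp
  then have d0: "md s \<noteq> 0" using s0 by auto
  have r: "r = s ^ 2 / md s" using rd d0 by (simp add: nonzero_eq_divide_eq)
  have cd: "c * md s = mC s"
  proof -
    have "c * md s = s * (r * md s - md s)" unfolding cs by (simp add: algebra_simps)
    then show ?thesis unfolding rd mC_alt .
  qed
  have bd: "b * md s ^ 2 = s ^ 2 * mC s"
  proof -
    have "b * md s ^ 2 = (r * md s) * (c * md s)" unfolding br by (simp add: power2_eq_square)
    then show ?thesis unfolding rd cd .
  qed
  \<comment> \<open>Rescaling by \<open>md s\<close> clears the denominators of \<open>b\<close> and
    \<open>c\<close> and turns Tate's curve into \<open>mE s\<close>.\<close>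
  define U where "U = U0 / md s"
  have U0: "U0 = U * md s" using d0 by (simp add: U_def)
  have u1: "A1 = U * (md s - mC s)" unfolding s1 U0 cd[symmetric] by (simp add: algebra_simps)
  have u2: "A2 = U ^ 2 * (- (s ^ 2 * mC s))" unfolding s1 U0 bd[symmetric] by (simp add: algebra_simps power2_eq_square)
  have u3: "A3 = U ^ 3 * (- (s ^ 2 * mC s * md s))" unfolding s1 U0 bd[symmetric]
    by (simp add: algebra_simps power2_eq_square power3_eq_cube)
  have "U \<noteq> 0" using U00 U0 by auto
  then have iso': "wiso U x \<sigma> y E (mE s)"
    using iso1 u1 u2 u3 unfolding wiso_def by simp
  have "P5 = wback U x \<sigma> y (Affine (s ^ 3 * (s - 1) * md s) (s ^ 5 * (s - md s) * md s))"
  proof -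
    have x5: "r * s * (s - 1) * md s ^ 2 = s ^ 3 * (s - 1) * md s"
    proof -
      have "r * s * (s - 1) * md s ^ 2 = (r * md s) * (s * (s - 1) * md s)" by (simp add: power2_eq_square)
      then show ?thesis unfolding rd by (simp add: power2_eq_square power3_eq_cube)
    qed
    have y5: "r * s ^ 2 * (r - s) * md s ^ 3 = s ^ 5 * (s - md s) * md s"
    proof -
      have "r * s ^ 2 * (r - s) * md s ^ 3 = (r * md s) * s ^ 2 * (r * md s - s * md s) * md s"
        by (simp add: power3_eq_cube algebra_simps)
      then show ?thesis unfolding rd by (simp add: algebra_simps numeral_eq_Suc)
    qed
    show ?thesis unfolding f5' wback.simps U0 power_mult_distrib x5[symmetric] y5[symmetric] 
      by (simp add: algebra_simps)
  qed
  with iso' PA show ?thesis by (rule that)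
qed

section \<open>Subgroups isomorphic to Z/2 x Z/10\<close>

lemma (in group) pow10_facts:
  assumes x: "x \<in> carrier G" and p: "x [^] (10::nat) = \<one>" "x [^] (5::nat) \<noteq> \<one>" "x [^] (2::nat) \<noteq> \<one>"
  shows "x \<noteq> \<one>" "x \<otimes> x \<noteq> \<one>" "(x \<otimes> x) \<otimes> x \<noteq> \<one>" "((x \<otimes> x) \<otimes> x) \<otimes> x \<noteq> \<one>"
    "(x \<otimes> x) \<otimes> ((x \<otimes> x) \<otimes> x) = x [^] (5::nat)" "x [^] (5::nat) \<otimes> x [^] (5::nat) = \<one>"
    "ord x = 10"
proof -
  have d: "ord x dvd 10" "\<not> ord x dvd 5" "\<not> ord x dvd 2"
    using p pow_eq_id[OF x] by blast+
  have "ord x \<le> 10" using d(1) by (rule dvd_imp_le) simp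
  then have "ord x \<in> {0,1,2,3,4,5,6,7,8,9,10}" by (auto simp: numeral_eq_Suc le_Suc_eq)
  then show o: "ord x = 10" using d by auto
  have n: "x [^] (n::nat) = \<one> \<longleftrightarrow> 10 dvd n" for n using pow_eq_id[OF x] o by simp
  have x1: "x = x [^] (1::nat)" and x2: "x \<otimes> x = x [^] (2::nat)" using x by (simp_all add: numeral_2_eq_2)
  have x3: "(x \<otimes> x) \<otimes> x = x [^] (3::nat)" using x by (simp add: numeral_3_eq_3)
  have x4: "((x \<otimes> x) \<otimes> x) \<otimes> x = x [^] (4::nat)" using x by (simp add: numeral_eq_Suc)
  show "x \<noteq> \<one>" using n[of 1] x by auto
  show "x \<otimes> x \<noteq> \<one>" unfolding x2 by (rule p(3))
  show "(x \<otimes> x) \<otimes> x \<noteq> \<one>" unfolding x3 n by simp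
  show "((x \<otimes> x) \<otimes> x) \<otimes> x \<noteq> \<one>" unfolding x4 n by simp
  show "(x \<otimes> x) \<otimes> ((x \<otimes> x) \<otimes> x) = x [^] (5::nat)"
    unfolding x3 unfolding x2 nat_pow_mult[OF x] by simp
  show "x [^] (5::nat) \<otimes> x [^] (5::nat) = \<one>" unfolding nat_pow_mult[OF x] using p(1) by simp
qed

lemma (in group) int_pow_mod:
  assumes x: "x \<in> carrier G" and n: "x [^] (n::nat) = \<one>"
  shows "x [^] (k mod int n) = x [^] (k::int)"
proof -
  have "x [^] k = x [^] (int n * (k div int n) + k mod int n)" by simp
  also have "\<dots> = (x [^] int n) [^] (k div int n) \<otimes> x [^] (k mod int n)"
    unfolding int_pow_mult[OF x] int_pow_pow[OF x] ..
  also have "\<dots> = x [^] (k mod int n)" using x n by (simp add: int_pow_int)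
  finally show ?thesis ..
qed

lemma (in comm_group) Z2_Z10_subgroup:
  assumes x: "x \<in> carrier G" and p: "x [^] (10::nat) = \<one>" "x [^] (5::nat) \<noteq> \<one>" "x [^] (2::nat) \<noteq> \<one>"
    and r: "r \<in> carrier G" "r [^] (2::nat) = \<one>" "r \<noteq> \<one>" "r \<noteq> x [^] (5::nat)"
  shows "\<exists>H. subgroup H G \<and> G\<lparr>carrier := H\<rparr> \<cong> integer_mod_group 2 \<times>\<times> integer_mod_group 10"
proof -
  let ?D = "integer_mod_group 2 \<times>\<times> integer_mod_group 10"
  define f where "f = (\<lambda>(a::int, b::int). r [^] a \<otimes> x [^] b)"
  have D: "group ?D" by (intro DirProd_group group_integer_mod_group)
  have cD: "carrier ?D = {0..<2} \<times> {0..<10}" by (simp add: DirProd_def carrier_integer_mod_group)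
  have hom: "f \<in> hom ?D G"
  proof (rule homI)
    fix y assume "y \<in> carrier ?D" then show "f y \<in> carrier G" using x r by (auto simp: f_def split_beta)
  next
    fix y z :: "int \<times> int"
    obtain a b a' b' where yz: "y = (a, b)" "z = (a', b')" by (cases y, cases z) auto
    have m: "r [^] ((a + a') mod 2) = r [^] (a + a')" "x [^] ((b + b') mod 10) = x [^] (b + b')"
      using int_pow_mod[OF r(1,2), of "a + a'"] int_pow_mod[OF x p(1), of "b + b'"] by simp_all
    have "y \<otimes>\<^bsub>?D\<^esub> z = ((a + a') mod 2, (b + b') mod 10)"
      unfolding yz by (simp add: DirProd_def mult_integer_mod_group)
    then have "f (y \<otimes>\<^bsub>?D\<^esub> z) = r [^] (a + a') \<otimes> x [^] (b + b')" by (simp add: f_def m)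
    also have "\<dots> = (r [^] a \<otimes> r [^] a') \<otimes> (x [^] b \<otimes> x [^] b')" using x r by (simp add: int_pow_mult)
    also have "\<dots> = f y \<otimes> f z" using x r by (simp add: f_def yz m_ac)
    finally show "f (y \<otimes>\<^bsub>?D\<^esub> z) = f y \<otimes> f z" .
  qed
  interpret f: group_hom ?D G f
    using hom D by (intro group_hom.intro group_hom_axioms.intro is_group) auto
  have o: "x [^] (i::int) = \<one> \<longleftrightarrow> 10 dvd i" for i
    using int_pow_eq_id[OF x] pow10_facts(7)[OF x p] by simp
  have inj: "inj_on f (carrier ?D)"
    unfolding f.inj_on_one_iff
  proof (intro allI impI)
    fix y assume y: "y \<in> carrier ?D" "f y = \<one>"
    obtain a b where yab: "y = (a, b)" by (cases y) auto
    have ab: "a = 0 \<or> a = 1" "0 \<le> b" "b < 10" using y(1) unfolding cD yab by auto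
    have e: "r [^] a \<otimes> x [^] b = \<one>" using y(2) by (simp add: f_def yab)
    have "b = 0 \<and> a = 0"
    proof (cases "a = 0")
      case True
      then have "10 dvd b" using e x by (simp flip: o)
      then show ?thesis using ab True by (auto elim!: dvdE)
    next
      case False
      then have e: "r \<otimes> x [^] b = \<one>" using e ab r by simp
      have "r \<otimes> r = \<one>" using r(1,2) by (simp add: numeral_2_eq_2)
      \<comment> \<open>A power of \<open>x\<close> whose square is trivial has exponent 0 or 5, and
        \<open>r\<close> is neither of these powers.\<close>
      then have rb: "x [^] b = r" using e x r(1) by (metis int_pow_closed inv_comm inv_unique')
      then have "x [^] (b + b) = \<one>" unfolding int_pow_mult[OF x] rb using \<open>r \<otimes> r = \<one>\<close> by simp
      then have "10 dvd b + b" by (simp only: o)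
      then have "b = 0 \<or> b = 5" using ab by (auto elim!: dvdE)
      moreover have "b \<noteq> 0" using rb r(3) by auto
      moreover have "b \<noteq> int 5" using rb r(4) int_pow_int[of G x 5] by metis
      ultimately show ?thesis by simp
    qed
    then show "y = \<one>\<^bsub>?D\<^esub>" by (simp add: yab DirProd_def)
  qed
  let ?H = "f ` carrier ?D"
  have "f \<in> iso ?D (G\<lparr>carrier := ?H\<rparr>)"
    using hom inj by (auto simp: iso_def hom_def bij_betw_def)
  then have "?D \<cong> G\<lparr>carrier := ?H\<rparr>" by (auto simp: is_iso_def)
  then have "G\<lparr>carrier := ?H\<rparr> \<cong> ?D" using group.iso_sym[OF D] by blast
  then show ?thesis using f.img_is_subgroup by blast
qed

lemma (in comm_group) Z2_Z10_elements:
  assumes H: "subgroup H G" and i: "G\<lparr>carrier := H\<rparr> \<cong> integer_mod_group 2 \<times>\<times> integer_mod_group 10"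
  obtains x r where "x \<in> carrier G" "x [^] (10::nat) = \<one>" "x [^] (5::nat) \<noteq> \<one>" "x [^] (2::nat) \<noteq> \<one>"
    "r \<in> carrier G" "r [^] (2::nat) = \<one>" "r \<noteq> \<one>" "r \<noteq> x [^] (5::nat)"
proof -
  let ?D = "integer_mod_group 2 \<times>\<times> integer_mod_group 10"
  let ?G = "G\<lparr>carrier := H\<rparr>"
  have D: "group ?D" by (intro DirProd_group group_integer_mod_group)
  have cD: "carrier ?D = {0..<2} \<times> {0..<10}" by (simp add: DirProd_def carrier_integer_mod_group)
  have G: "group ?G" using H by (rule subgroup_imp_group)
  obtain f where f: "f \<in> iso ?D ?G" using group.iso_sym[OF G i] by (auto simp: is_iso_def)
  interpret f: group_hom ?D ?G f
    using f D G by (intro group_hom.intro group_hom_axioms.intro) (auto simp: iso_def)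
  have inj: "inj_on f (carrier ?D)" using f by (simp add: iso_def bij_betw_def)
  have HG: "H \<subseteq> carrier G" using H by (rule subgroup.subset)
  have pw: "f y [^] (n::nat) = f (y [^]\<^bsub>?D\<^esub> n)" if "y \<in> carrier ?D" for y n
    using f.hom_nat_pow[OF that, of n] nat_pow_consistent[of "f y" n H] by simp
  have cl: "f y \<in> carrier G" if "y \<in> carrier ?D" for y
    using f.hom_closed[OF that] HG by auto
  have x: "(0, 1) \<in> carrier ?D" and r: "(1, 0) \<in> carrier ?D" unfolding cD by auto
  have px: "(0, 1) [^]\<^bsub>?D\<^esub> n = (0, int n mod 10)" for n :: nat
    by (induction n) (simp_all add: DirProd_def mult_integer_mod_group mod_simps add.commute)
  have pr: "(1, 0) [^]\<^bsub>?D\<^esub> n = (int n mod 2, 0)" for n :: nat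
    by (induction n) (simp_all add: DirProd_def mult_integer_mod_group mod_simps add.commute)
  have x5: "(0, 5) \<in> carrier ?D" and x2: "(0, 2) \<in> carrier ?D" and x0: "(0, 0) \<in> carrier ?D" unfolding cD by auto
  have px': "(0, 1) [^]\<^bsub>?D\<^esub> (10::nat) = (0, 0)" "(0, 1) [^]\<^bsub>?D\<^esub> (5::nat) = (0, 5)" "(0, 1) [^]\<^bsub>?D\<^esub> (2::nat) = (0, 2)"
    "(1, 0) [^]\<^bsub>?D\<^esub> (2::nat) = (0, 0)" unfolding px pr by simp_all
  have one: "f y = \<one> \<longleftrightarrow> y = (0, 0)" if "y \<in> carrier ?D" for y
  proof -
    have o: "(0, 0) = \<one>\<^bsub>?D\<^esub>" by (simp add: DirProd_def)
    have "f (0, 0) = \<one>" using f.hom_one unfolding o by simp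
    moreover have "(0, 0) \<in> carrier ?D" unfolding cD by simp
    ultimately show ?thesis using inj_on_eq_iff[OF inj that, of "(0, 0)"] by simp
  qed
  show ?thesis
  proof (rule that[of "f (0, 1)" "f (1, 0)"])
    show "f (0, 1) \<in> carrier G" "f (1, 0) \<in> carrier G" using cl x r by auto
    show "f (0, 1) [^] (10::nat) = \<one>" "f (0, 1) [^] (5::nat) \<noteq> \<one>" "f (0, 1) [^] (2::nat) \<noteq> \<one>"
      unfolding pw[OF x] px' one[OF x0] one[OF x5] one[OF x2] by simp_all
    show "f (1, 0) [^] (2::nat) = \<one>" unfolding pw[OF r] px' one[OF x0] by simp
    show "f (1, 0) \<noteq> \<one>" using one[OF r] by simp
    show "f (1, 0) \<noteq> f (0, 1) [^] (5::nat)"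
      unfolding pw[OF x] px' inj_on_eq_iff[OF inj r x5] by simp
  qed
qed

section \<open>Level structures and non-cuspidal points\<close>

lemma mw_sel: "carrier (mordell_weil E) = {P. on_curve E P}" "monoid.mult (mordell_weil E) = ec_add E"
  "\<one>\<^bsub>mordell_weil E\<^esub> = Infinity"
  by (simp_all add: mordell_weil_def)

lemma ec_double_Infinity:
  "ec_add E (Affine x y) (Affine x y) = Infinity \<longleftrightarrow> 2 * y + wa1 E * x + wa3 E = 0"
proof -
  have e: "y + y + wa1 E * x + wa3 E = 2 * y + wa1 E * x + wa3 E" by simp
  show ?thesis unfolding ec_add.simps e by (simp add: Let_def)
qed

text \<open>The factors of \<open>wdisc (mE s)\<close> in terms of \<open>u = 2 * s - 1\<close>; the
  last one is \<open>- 4 * md s\<close>.\<close>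

definition noncusp :: "'a::field \<Rightarrow> bool" where
  "noncusp u \<longleftrightarrow> u \<noteq> 0 \<and> u \<noteq> 1 \<and> u \<noteq> - 1 \<and> u ^ 2 + u - 1 \<noteq> 0 \<and> u ^ 2 - 4 * u - 1 \<noteq> 0"

lemma noncusp_iff:
  fixes s :: "'a::field_char_0"
  shows "elliptic (mE s) \<longleftrightarrow> noncusp (2 * s - 1)"
proof -
  have 1: "(2 * s - 1) ^ 2 + (2 * s - 1) - 1 = 4 * s ^ 2 - 2 * s - 1" by Groebner_Basis.algebra
  have 2: "(2 * s - 1) ^ 2 - 4 * (2 * s - 1) - 1 = - 4 * md s" unfolding md_def by Groebner_Basis.algebra
  have 3: "2 * s - 1 = 1 \<longleftrightarrow> s - 1 = 0" "2 * s - 1 = - 1 \<longleftrightarrow> s = 0" by auto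
  show ?thesis unfolding elliptic_def wdisc_mE noncusp_def 1 2 unfolding 3 by auto
qed

text \<open>The change of variables and the coordinates of \<open>R\<close> are returned along with
  the point \<open>(2 s - 1, w)\<close>, because the function field is found by comparing the Galois
  action on \<open>P\<close> and \<open>R\<close> with that on \<open>s\<close> and
  \<open>w\<close>.\<close>

theorem level_point:
  fixes E :: "'a::field_char_0 weierstrass"
  defines "G \<equiv> mordell_weil E"
  assumes e: "elliptic E" and P: "P \<in> carrier G"
    and p: "P [^]\<^bsub>G\<^esub> (10::nat) = \<one>\<^bsub>G\<^esub>" "P [^]\<^bsub>G\<^esub> (5::nat) \<noteq> \<one>\<^bsub>G\<^esub>" "P [^]\<^bsub>G\<^esub> (2::nat) \<noteq> \<one>\<^bsub>G\<^esub>"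
    and R: "R \<in> carrier G" and r: "R [^]\<^bsub>G\<^esub> (2::nat) = \<one>\<^bsub>G\<^esub>" "R \<noteq> \<one>\<^bsub>G\<^esub>" "R \<noteq> P [^]\<^bsub>G\<^esub> (5::nat)"
  obtains U x \<sigma> y s xr yr w where "wiso U x \<sigma> y E (mE s)" "P = Affine x y"
    "R = wback U x \<sigma> y (Affine xr yr)" "2 * yr + wa1 (mE s) * xr + wa3 (mE s) = 0"
    "(2 * s - 1) ^ 2 * w = 8 * xr + mlin s"
    "w ^ 2 = (2 * s - 1) ^ 3 + (2 * s - 1) ^ 2 - (2 * s - 1)" "noncusp (2 * s - 1)"
proof -
  interpret G: comm_group G unfolding G_def by (rule elliptic_group[OF e])
  have G1: "\<one>\<^bsub>G\<^esub> = Infinity" and Gm: "monoid.mult G = ec_add E" and Gc: "carrier G = {P. on_curve E P}"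
    unfolding G_def by (simp_all only: mw_sel)
  note f = G.pow10_facts[OF P p]
  obtain U x \<sigma> y s where i: "wiso U x \<sigma> y E (mE s)" and PA: "P = Affine x y"
    and P5: "P [^]\<^bsub>G\<^esub> (5::nat) = wback U x \<sigma> y (Affine (s ^ 3 * (s - 1) * md s) (s ^ 5 * (s - md s) * md s))"
  proof (rule tate_form[OF e, of P "ec_add E P P" "ec_add E (ec_add E P P) P" "P [^]\<^bsub>G\<^esub> (5::nat)"])
    show "on_curve E P" using P unfolding Gc by simp
    show "P [^]\<^bsub>G\<^esub> (5::nat) = ec_add E (ec_add E P P) (ec_add E (ec_add E P P) P)"
      using f(5) unfolding Gm by (rule sym)
    show "P \<noteq> Infinity" "ec_add E P P \<noteq> Infinity" "ec_add E (ec_add E P P) P \<noteq> Infinity"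
       "ec_add E (ec_add E (ec_add E P P) P) P \<noteq> Infinity" using f(1-4) unfolding Gm G1 .
    show "P [^]\<^bsub>G\<^esub> (5::nat) \<noteq> Infinity" using p(2) unfolding G1 .
    show "ec_add E (P [^]\<^bsub>G\<^esub> (5::nat)) (P [^]\<^bsub>G\<^esub> (5::nat)) = Infinity" using f(6) unfolding Gm G1 .
  qed (rule refl, rule refl, rule that)
  let ?x5 = "s ^ 3 * (s - 1) * md s" and ?y5 = "s ^ 5 * (s - md s) * md s"
  note wb = wback_add[OF i] and on = wback_on[OF i]
  have el: "elliptic (mE s)" using wiso_elliptic[OF i] e by simp
  have nc: "noncusp (2 * s - 1)" using el by (simp add: noncusp_iff)
  obtain R' where R': "R = wback U x \<sigma> y R'" using wback_surj[OF i] by blast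
  have Rc: "on_curve (mE s) R'" using R on[of R'] unfolding R' Gc by simp
  have two: "2 * y' + wa1 (mE s) * x' + wa3 (mE s) = 0"
    if c: "on_curve (mE s) (Affine x' y')" and d: "ec_add E (wback U x \<sigma> y (Affine x' y')) (wback U x \<sigma> y (Affine x' y')) = Infinity" for x' y'
  proof -
    have "wback U x \<sigma> y (ec_add (mE s) (Affine x' y') (Affine x' y')) = wback U x \<sigma> y Infinity"
      unfolding wb[OF c c] d by simp
    then have "ec_add (mE s) (Affine x' y') (Affine x' y') = Infinity" unfolding wback_inj[OF i] .
    then show ?thesis unfolding ec_double_Infinity .
  qed
  obtain xr yr where RA: "R' = Affine xr yr" using r(2) unfolding R' G1 by (cases R') auto
  have RR: "ec_add E R R = Infinity"
    using r(1) R unfolding numeral_2_eq_2 G.nat_pow_Suc G.nat_pow_0 by (simp add: G1 Gm Gc)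
  have tr: "2 * yr + wa1 (mE s) * xr + wa3 (mE s) = 0"
    using two[OF Rc[unfolded RA] RR[unfolded R' RA]] .
  have P5c: "P [^]\<^bsub>G\<^esub> (5::nat) \<in> carrier G" using P by (rule G.nat_pow_closed)
  have c5: "on_curve (mE s) (Affine ?x5 ?y5)" using P5c unfolding P5 Gc mem_Collect_eq on .
  have t5: "2 * ?y5 + wa1 (mE s) * ?x5 + wa3 (mE s) = 0"
    by (rule two[OF c5 f(6)[unfolded P5 Gm G1]])
  have ne: "xr \<noteq> ?x5"
  proof
    assume a: "xr = ?x5"
    have "2 * (yr - ?y5) = (2 * yr + wa1 (mE s) * ?x5 + wa3 (mE s)) - (2 * ?y5 + wa1 (mE s) * ?x5 + wa3 (mE s))"
      by (simp only: algebra_simps)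
    also have "\<dots> = 0" unfolding t5 tr[unfolded a] by simp
    finally have "yr = ?y5" by (simp only: mult_eq_0_iff right_minus_eq) simp
    then have "R = P [^]\<^bsub>G\<^esub> (5::nat)" unfolding R' RA P5 a by simp
    with r(3) show False by contradiction
  qed
  have q: "4 * xr ^ 2 + mlin s * xr - mk s = 0"
    using two_torsion_poly[OF Rc[unfolded RA] tr] ne by simp
  have u0: "2 * s - 1 \<noteq> 0" using nc by (simp add: noncusp_def)
  define w where "w = (8 * xr + mlin s) / (2 * s - 1) ^ 2"
  have w: "(2 * s - 1) ^ 2 * w = 8 * xr + mlin s" using u0 by (simp add: w_def)
  have "w ^ 2 = (2 * s - 1) ^ 3 + (2 * s - 1) ^ 2 - (2 * s - 1)"
    using quadratic_iff_point[OF refl u0 w] q by simp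
  from i PA R'[unfolded RA] tr w this nc show ?thesis by (rule that)
qed

text \<open>The normal form is read backwards: \<open>r * md s = s^2\<close> gives the origin the
  order 10, and \<open>w\<close> solves the quadratic for a further point of order 2.\<close>

theorem mE_contains:
  fixes s w :: "'a::field_char_0"
  assumes nc: "noncusp (2 * s - 1)" and w: "w ^ 2 = (2 * s - 1) ^ 3 + (2 * s - 1) ^ 2 - (2 * s - 1)"
  shows "elliptic (mE s)" "contains_Z2_Z10 (mE s)"
proof -
  show el: "elliptic (mE s)" using nc by (simp add: noncusp_iff)
  define G where "G = mordell_weil (mE s)"
  interpret G: comm_group G unfolding G_def by (rule elliptic_group[OF el])
  have G1: "\<one>\<^bsub>G\<^esub> = Infinity" and Gm: "monoid.mult G = ec_add (mE s)" and Gc: "carrier G = {P. on_curve (mE s) P}"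
    unfolding G_def by (simp_all only: mw_sel)
  have nz: "s \<noteq> 0" "s - 1 \<noteq> 0" "2 * s - 1 \<noteq> 0" "md s \<noteq> 0"
    using el by (auto simp: elliptic_def wdisc_mE)
  have C0: "mC s \<noteq> 0" using nz by (simp add: mC_def)
  define c r where "c = mC s / md s" and "r = s ^ 2 / md s"
  define b where "b = c * r"
  have rd: "r * md s = s ^ 2" and cd: "c * md s = mC s" using nz by (simp_all add: r_def c_def)
  have c0: "c \<noteq> 0" and r0: "r \<noteq> 0" using nz C0 by (simp_all add: c_def r_def)
  have b0: "b \<noteq> 0" using c0 r0 by (simp add: b_def)
  have cs: "c = s * (r - 1)"
  proof -
    have "c * md s = s * (r * md s - md s)" unfolding rd cd mC_alt ..
    also have "\<dots> = (s * (r - 1)) * md s" by (simp add: algebra_simps)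
    finally show ?thesis using nz(4) by simp
  qed
  define T where "T = Weierstrass (1 - c) (- b) (- b) 0 0"
  have iso: "wiso (md s) 0 0 0 (mE s) T"
  proof -
    have 1: "md s * (1 - c) = md s - mC s" using cd by (simp add: algebra_simps)
    have "md s ^ 2 * b = (r * md s) * (c * md s)" by (simp add: b_def power2_eq_square)
    then have 2: "md s ^ 2 * b = s ^ 2 * mC s" unfolding rd cd .
    have 3: "md s ^ 3 * b = s ^ 2 * mC s * md s" unfolding 2[symmetric] by (simp add: power2_eq_square power3_eq_cube)
    show ?thesis unfolding wiso_def T_def using nz(4) by (simp add: 1 2 3)
  qed
  note wb = wback_add[OF iso] and on = wback_on[OF iso]
  note tm = tate_multiples[OF b0, of c, folded T_def]
  let ?f = "wback (md s) 0 0 0"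
  let ?Q2 = "Affine b (b * c)" and ?Q3 = "Affine c (b - c)"
  let ?Q5 = "Affine (r * s * (s - 1)) (r * s ^ 2 * (r - s))"
  note t5 = tm(5)[OF b_def cs c0]
  have q1: "on_curve T (Affine 0 0)" by (simp add: T_def)
  have q2: "on_curve T ?Q2" by (simp add: T_def algebra_simps power2_eq_square power3_eq_cube)
  have q3: "on_curve T ?Q3" by (simp add: T_def algebra_simps power2_eq_square power3_eq_cube)
  have q5: "on_curve T ?Q5"
    unfolding T_def on_curve.simps b_def cs by (simp add: algebra_simps power2_eq_square power3_eq_cube)
  let ?P = "Affine 0 0 :: 'a ec_point"
  have f0: "?f ?P = ?P" by simp
  have Pc: "?P \<in> carrier G" unfolding Gc by simp
  have p2: "?P \<otimes>\<^bsub>G\<^esub> ?P = ?f ?Q2" using wb[OF q1 q1] unfolding tm(1) f0 Gm ..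
  have p3: "?P \<otimes>\<^bsub>G\<^esub> ?P \<otimes>\<^bsub>G\<^esub> ?P = ?f ?Q3" using wb[OF q2 q1] unfolding tm(2) p2 unfolding f0 Gm ..
  have P2: "?P [^]\<^bsub>G\<^esub> (2::nat) = ?f ?Q2" unfolding p2[symmetric] using Pc by (simp add: numeral_2_eq_2)
  have P3: "?P [^]\<^bsub>G\<^esub> (3::nat) = ?f ?Q3" unfolding p3[symmetric] using Pc by (simp add: numeral_3_eq_3)
  have "?P [^]\<^bsub>G\<^esub> (2 + 3 :: nat) = ?f (ec_add T ?Q2 ?Q3)"
    unfolding G.nat_pow_mult[OF Pc, symmetric] P2 P3 unfolding Gm wb[OF q2 q3] ..
  then have P5: "?P [^]\<^bsub>G\<^esub> (5::nat) = ?f ?Q5" unfolding t5 by simp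
  have z: "2 * (r * s ^ 2 * (r - s)) + wa1 T * (r * s * (s - 1)) + wa3 T = 0"
  proof -
    have "2 * (r * s ^ 2 * (r - s)) + wa1 T * (r * s * (s - 1)) + wa3 T = (r * s) * (r * md s - s ^ 2)"
      unfolding T_def weierstrass.sel b_def cs md_def by Groebner_Basis.algebra
    then show ?thesis unfolding rd by simp
  qed
  have "?P [^]\<^bsub>G\<^esub> (5 + 5 :: nat) = ?f (ec_add T ?Q5 ?Q5)"
    unfolding G.nat_pow_mult[OF Pc, symmetric] P5 unfolding Gm wb[OF q5 q5] ..
  also have "\<dots> = Infinity" using z unfolding ec_double_Infinity[symmetric] by simp
  finally have P10: "?P [^]\<^bsub>G\<^esub> (10::nat) = \<one>\<^bsub>G\<^esub>" unfolding G1 by simp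
  \<comment> \<open>Solves the definition of \<open>w\<close> for the abscissa; the ordinate is then
    forced by the 2-torsion condition.\<close>
  define xr where "xr = ((2 * s - 1) ^ 2 * w - mlin s) / 8"
  define yr where "yr = - (wa1 (mE s) * xr + wa3 (mE s)) / 2"
  have "8 * xr = (2 * s - 1) ^ 2 * w - mlin s"
    unfolding xr_def times_divide_eq_right by (rule nonzero_mult_div_cancel_left) simp
  then have xw: "(2 * s - 1) ^ 2 * w = 8 * xr + mlin s" by simp
  have q: "4 * xr ^ 2 + mlin s * xr - mk s = 0" using quadratic_iff_point[OF refl nz(3) xw] w by simp
  have yr: "2 * yr = - (wa1 (mE s) * xr + wa3 (mE s))"
    unfolding yr_def times_divide_eq_right by (rule nonzero_mult_div_cancel_left) simp
  have tr: "2 * yr + wa1 (mE s) * xr + wa3 (mE s) = 0"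
    unfolding yr add.assoc by (rule left_minus)
  have Rc: "on_curve (mE s) (Affine xr yr)"
  proof -
    define a1 a2 a3 where "a1 = wa1 (mE s)" and "a2 = wa2 (mE s)" and "a3 = wa3 (mE s)"
    have t': "2 * yr + a1 * xr + a3 = 0" using tr by (simp add: a1_def a3_def)
    have "(xr - s ^ 3 * (s - 1) * md s) * (4 * xr ^ 2 + mlin s * xr - mk s) = 4 * xr ^ 3 + 4 * a2 * xr ^ 2 + (a1 * xr + a3) ^ 2"
      unfolding a1_def a2_def a3_def mE_simps mlin_def mk_def mC_def md_def by Groebner_Basis.algebra
    then have z: "4 * xr ^ 3 + 4 * a2 * xr ^ 2 + (a1 * xr + a3) ^ 2 = 0" unfolding q by simp
    have "4 * ((yr ^ 2 + a1 * xr * yr + a3 * yr) - (xr ^ 3 + a2 * xr ^ 2)) =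
      (2 * yr + a1 * xr + a3) ^ 2 - (4 * xr ^ 3 + 4 * a2 * xr ^ 2 + (a1 * xr + a3) ^ 2)"
      by Groebner_Basis.algebra
    also have "\<dots> = 0" unfolding t' z by simp
    finally have "yr ^ 2 + a1 * xr * yr + a3 * yr = xr ^ 3 + a2 * xr ^ 2" by (subst (asm) mult_eq_0_iff) simp
    then show ?thesis unfolding on_curve.simps a1_def a2_def a3_def by simp
  qed
  let ?R = "Affine xr yr"
  have RG: "?R \<in> carrier G" using Rc unfolding Gc by simp
  have R2: "?R [^]\<^bsub>G\<^esub> (2::nat) = \<one>\<^bsub>G\<^esub>"
  proof -
    have "?R [^]\<^bsub>G\<^esub> (2::nat) = ?R \<otimes>\<^bsub>G\<^esub> ?R" using RG by (simp add: numeral_2_eq_2)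
    then show ?thesis using tr unfolding Gm G1 ec_double_Infinity[symmetric] by simp
  qed
  have R5: "?R \<noteq> ?P [^]\<^bsub>G\<^esub> (5::nat)"
  proof
    assume "?R = ?P [^]\<^bsub>G\<^esub> (5::nat)"
    then have "xr = md s ^ 2 * (r * s * (s - 1)) + 0" unfolding P5 wback.simps by simp
    also have "\<dots> = (r * md s) * md s * s * (s - 1)" by (simp add: power2_eq_square)
    finally have xr: "xr = s ^ 3 * (s - 1) * md s" unfolding rd by (simp add: power2_eq_square power3_eq_cube)
    \<comment> \<open>The quadratic does not vanish at the abscissa of five times the origin, so its
      roots belong to other 2-torsion points.\<close>
    have "4 * xr ^ 2 + mlin s * xr - mk s = - 4 * s ^ 5 * (s - 1) ^ 5 * md s"
      unfolding xr mlin_def mk_def md_def by Groebner_Basis.algebra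
    then show False using q nz by simp
  qed
  have "\<exists>H. subgroup H G \<and> G\<lparr>carrier := H\<rparr> \<cong> integer_mod_group 2 \<times>\<times> integer_mod_group 10"
    using Pc P10 _ _ RG R2 _ R5
  proof (rule G.Z2_Z10_subgroup)
    show "?P [^]\<^bsub>G\<^esub> (5::nat) \<noteq> \<one>\<^bsub>G\<^esub>" unfolding P5 G1 by simp
    show "?P [^]\<^bsub>G\<^esub> (2::nat) \<noteq> \<one>\<^bsub>G\<^esub>" unfolding P2 G1 by simp
    show "?R \<noteq> \<one>\<^bsub>G\<^esub>" unfolding G1 by simp
  qed
  then show "contains_Z2_Z10 (mE s)" unfolding contains_Z2_Z10_def G_def .
qed

lemma contains_point:
  fixes E :: "'a::field_char_0 weierstrass"
  assumes e: "elliptic E" and c: "contains_Z2_Z10 E"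
  obtains u w :: 'a where "w ^ 2 = u ^ 3 + u ^ 2 - u" "noncusp u"
proof -
  interpret G: comm_group "mordell_weil E" by (rule elliptic_group[OF e])
  obtain H where H: "subgroup H (mordell_weil E)"
    "(mordell_weil E)\<lparr>carrier := H\<rparr> \<cong> integer_mod_group 2 \<times>\<times> integer_mod_group 10"
    using c unfolding contains_Z2_Z10_def by blast
  show ?thesis
    by (rule G.Z2_Z10_elements[OF H], rule level_point[OF e], assumption+) (rule that)
qed

section \<open>Infinitely many points give infinitely many curves\<close>

lemma wiso_refl: "wiso 1 0 0 0 E E"
  unfolding wiso_def by simp

lemma finite_square_roots: "finite {w::'a::idom. w ^ 2 = c}"
proof -
  have "{w. w ^ 2 = c} \<subseteq> {w. poly [:- c, 0, 1:] w = 0}" by (auto simp: power2_eq_square)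
  moreover have "finite {w. poly [:- c, 0, 1:] w = 0}" by (rule poly_roots_finite) simp
  ultimately show ?thesis by (rule finite_subset)
qed

text \<open>Such an \<open>s\<close> is a root of \<open>c4^3 - j * disc\<close> as a polynomial in
  \<open>s\<close>. It is not the zero polynomial: at \<open>s = 0\<close> the discriminant vanishes
  and \<open>c4\<close> is 1.\<close>

lemma finite_mE_j: "finite {s :: 'a::field_char_0. elliptic (mE s) \<and> j_invariant (mE s) = j}"
proof -
  define q :: "'a poly" where "q = [:0, 1:]"
  define D where "D = 3 * q - q ^ 2 - 1"
  define C where "C = q * (2 * q - 1) * (q - 1)"
  define p where "p = (((D - C) ^ 2 + 4 * - (q ^ 2 * C)) ^ 2 - 24 * ((D - C) * - (q ^ 2 * C * D))) ^ 3
      - smult j (q ^ 10 * (q - 1) ^ 10 * (2 * q - 1) ^ 5 * D ^ 2 * (4 * q ^ 2 - 2 * q - 1))"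
  have q: "poly q s = s" for s by (simp add: q_def)
  have D: "poly D s = md s" for s by (simp add: D_def md_def q)
  have C: "poly C s = mC s" for s by (simp add: C_def mC_def q)
  have p: "poly p s = wc4 (mE s) ^ 3 - j * wdisc (mE s)" for s
    unfolding wdisc_mE wc4_def wb2_def wb4_def by (simp add: p_def q D C)
  have "poly p 0 = 1" by (simp add: p_def q D C md_def mC_def)
  then have "p \<noteq> 0" by auto
  then have "finite {s. poly p s = 0}" by (rule poly_roots_finite)
  moreover have "{s :: 'a. elliptic (mE s) \<and> j_invariant (mE s) = j} \<subseteq> {s. poly p s = 0}"
    by (auto simp: p j_alt elliptic_def)
  ultimately show ?thesis by (rule rev_finite_subset)
qed

text \<open>Finitely many classes have finitely many j-invariants, hence leave finitely many
  \<open>s\<close>. Adding the cusps, only finitely many \<open>u\<close> remain, and each carries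
  at most two points.\<close>

theorem infinite_classes:
  assumes inf: "infinite {P :: 'a::field_char_0 ec_point. on_curve (Weierstrass 0 1 0 (- 1) 0) P}"
  shows "infinite ({E :: 'a weierstrass. elliptic E \<and> contains_Z2_Z10 E} // {(E, E'). weierstrass_iso E E'})"
    (is "infinite (?L // ?R)")
proof
  assume fin: "finite (?L // ?R)"
  define S :: "'a set" where "S = {s. noncusp (2 * s - 1) \<and> (\<exists>w. w ^ 2 = (2 * s - 1) ^ 3 + (2 * s - 1) ^ 2 - (2 * s - 1))}"
  have S: "mE s \<in> ?L" if "s \<in> S" for s using that mE_contains unfolding S_def by blast
  have "j_invariant ` ?L \<subseteq> (\<lambda>C. j_invariant (SOME E. E \<in> C)) ` (?L // ?R)"
  proof
    fix j assume "j \<in> j_invariant ` ?L"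
    then obtain E where E: "E \<in> ?L" "j = j_invariant E" by blast
    let ?C = "?R `` {E}"
    have "E \<in> ?C" using wiso_refl[of E] unfolding weierstrass_iso_iff by blast
    then have "(SOME E. E \<in> ?C) \<in> ?C" by (rule someI)
    then obtain u r s t where "wiso u r s t E (SOME E. E \<in> ?C)" unfolding weierstrass_iso_iff by blast
    from wiso_j[OF this] have "j = j_invariant (SOME E. E \<in> ?C)" using E(2) by simp
    moreover have "?C \<in> ?L // ?R" using E(1) by (rule quotientI)
    ultimately show "j \<in> (\<lambda>C. j_invariant (SOME E. E \<in> C)) ` (?L // ?R)" by (rule image_eqI)
  qed
  then have J: "finite (j_invariant ` ?L)" using fin by (rule finite_subset[OF _ finite_imageI])
  have "S \<subseteq> (\<Union>j\<in>j_invariant ` ?L. {s. elliptic (mE s) \<and> j_invariant (mE s) = j})"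
    using S by auto
  then have finS: "finite S" using J finite_mE_j by (rule finite_subset[OF _ finite_UN_I])
  have c1: "finite {u::'a. u ^ 2 + u - 1 = 0}"
    by (rule finite_subset[OF _ poly_roots_finite[of "[:- 1, 1, 1:]"]]) (auto simp: power2_eq_square algebra_simps)
  have c2: "finite {u::'a. u ^ 2 - 4 * u - 1 = 0}"
    by (rule finite_subset[OF _ poly_roots_finite[of "[:- 1, - 4, 1:]"]]) (auto simp: power2_eq_square algebra_simps)
  define N :: "'a set" where "N = {0, 1, -1} \<union> {u. u ^ 2 + u - 1 = 0} \<union> {u. u ^ 2 - 4 * u - 1 = 0} \<union> (\<lambda>s. 2 * s - 1) ` S"
  have N: "finite N" unfolding N_def using c1 c2 finS by simp
  have "{P :: 'a ec_point. on_curve (Weierstrass 0 1 0 (- 1) 0) P} \<subseteq>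
     {Infinity} \<union> (\<Union>u\<in>N. Affine u ` {w. w ^ 2 = u ^ 3 + u ^ 2 - u})"
  proof
    fix P :: "'a ec_point" assume "P \<in> {P. on_curve (Weierstrass 0 1 0 (- 1) 0) P}"
    then have c: "on_curve (Weierstrass 0 1 0 (- 1) 0) P" by simp
    show "P \<in> {Infinity} \<union> (\<Union>u\<in>N. Affine u ` {w. w ^ 2 = u ^ 3 + u ^ 2 - u})"
    proof (cases P)
      case (Affine u w)
      have w: "w ^ 2 = u ^ 3 + u ^ 2 - u" using c unfolding Affine by simp
      have "u \<in> N"
      proof (cases "noncusp u")
        case True
        have us: "2 * ((u + 1) / 2) - 1 = u" by (simp del: distrib_left_numeral)
        have "(u + 1) / 2 \<in> S" unfolding S_def mem_Collect_eq us using True w by blast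
        then have "2 * ((u + 1) / 2) - 1 \<in> (\<lambda>s. 2 * s - 1) ` S" by (rule imageI)
        then show ?thesis unfolding us N_def by blast
      qed (auto simp: noncusp_def N_def)
      then show ?thesis using w Affine by blast
    qed simp
  qed
  moreover have "finite ({Infinity} \<union> (\<Union>u\<in>N. Affine u ` {w. w ^ 2 = u ^ 3 + u ^ 2 - u}))"
    using N finite_square_roots by auto
  ultimately show False using inf finite_subset by blast
qed

section \<open>Field endomorphisms acting on curves and points\<close>

text \<open>Covers both the automorphisms of the closure of \<open>k(t)\<close> and the involutions
  of a multi-quadratic field.\<close>

locale field_endo =
  fixes \<sigma> :: "'a::field_char_0 \<Rightarrow> 'a"
  assumes s_add: "\<sigma> (x + y) = \<sigma> x + \<sigma> y" and s_mult: "\<sigma> (x * y) = \<sigma> x * \<sigma> y" and s_1: "\<sigma> 1 = 1"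
begin

lemma s_0: "\<sigma> 0 = 0"
  using s_add[of 0 0] by simp

lemma s_minus: "\<sigma> (- x) = - \<sigma> x"
  using s_add[of x "- x"] s_0 by (simp add: eq_neg_iff_add_eq_0 add.commute)

lemma s_diff: "\<sigma> (x - y) = \<sigma> x - \<sigma> y"
  using s_add[of x "- y"] s_minus by simp

lemma s_power: "\<sigma> (x ^ n) = \<sigma> x ^ n"
  by (induction n) (simp_all add: s_1 s_mult)

lemma s_numeral: "\<sigma> (numeral n) = numeral n"
proof -
  have "\<sigma> (of_nat m) = of_nat m" for m by (induction m) (simp_all add: s_0 s_1 s_add)
  from this[of "numeral n"] show ?thesis by simp
qed

lemma s_inverse: "\<sigma> (inverse x) = inverse (\<sigma> x)"
proof (cases "x = 0")
  case False
  then have "\<sigma> x * \<sigma> (inverse x) = 1" using s_mult[of x "inverse x"] by (simp add: s_1)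
  then show ?thesis by (rule inverse_unique[symmetric])
qed (simp add: s_0)

lemma s_divide: "\<sigma> (x / y) = \<sigma> x / \<sigma> y"
  by (simp add: divide_inverse s_mult s_inverse)

lemmas s_simps = s_0 s_1 s_add s_mult s_minus s_diff s_power s_numeral s_inverse s_divide

lemma s_eq_0: "\<sigma> x = 0 \<longleftrightarrow> x = 0"
proof
  assume z: "\<sigma> x = 0"
  show "x = 0"
  proof (rule ccontr)
    assume "x \<noteq> 0"
    then have "\<sigma> 1 = \<sigma> x * \<sigma> (inverse x)" by (simp flip: s_mult)
    then show False unfolding z s_1 by simp
  qed
qed (simp add: s_0)

lemma s_eq: "\<sigma> x = \<sigma> y \<longleftrightarrow> x = y"
  using s_eq_0[of "x - y"] by (simp add: s_diff)

lemma s_on_curve: "on_curve E P \<Longrightarrow> on_curve (map_weierstrass \<sigma> E) (map_ec_point \<sigma> P)"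
proof (cases P)
  case (Affine x y)
  assume "on_curve E P"
  then have "\<sigma> (y ^ 2 + wa1 E * x * y + wa3 E * y) = \<sigma> (x ^ 3 + wa2 E * x ^ 2 + wa4 E * x + wa6 E)"
    unfolding Affine by simp
  then show ?thesis unfolding Affine by (simp add: weierstrass.map_sel s_simps)
qed simp

lemma s_ec_add: "map_ec_point \<sigma> (ec_add E P Q) = ec_add (map_weierstrass \<sigma> E) (map_ec_point \<sigma> P) (map_ec_point \<sigma> Q)"
proof (cases P)
  case P: (Affine x1 y1)
  show ?thesis
  proof (cases Q)
    case Q: (Affine x2 y2)
    have z: "\<sigma> y1 + \<sigma> y2 + \<sigma> (wa1 E) * \<sigma> x2 + \<sigma> (wa3 E) = 0 \<longleftrightarrow> y1 + y2 + wa1 E * x2 + wa3 E = 0"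
      unfolding s_mult[symmetric] s_add[symmetric] s_eq_0 ..
    show ?thesis
      unfolding P Q ec_point.map ec_add.simps weierstrass.map_sel z s_eq Let_def
      by (simp only: s_simps if_distrib[of \<sigma>] if_distrib[of "map_ec_point \<sigma>"] ec_point.map)
  qed (simp add: P)
qed simp

lemma s_mE: "map_weierstrass \<sigma> (mE s) = mE (\<sigma> s)"
  by (simp add: mE_def md_def mC_def s_simps)

lemma s_wc: "wc4 (map_weierstrass \<sigma> E) = \<sigma> (wc4 E)" "wc6 (map_weierstrass \<sigma> E) = \<sigma> (wc6 E)"
  "wb2 (map_weierstrass \<sigma> E) = \<sigma> (wb2 E)"
  unfolding wc4_def wc6_def wb2_def wb4_def wb6_def weierstrass.map_sel s_simps by (rule refl)+

lemma s_mlin: "\<sigma> (mlin s) = mlin (\<sigma> s)"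
  unfolding mlin_def s_simps ..

lemma s_wiso:
  assumes "wiso u r s t E E'"
  shows "wiso (\<sigma> u) (\<sigma> r) (\<sigma> s) (\<sigma> t) (map_weierstrass \<sigma> E) (map_weierstrass \<sigma> E')"
proof -
  note p = assms[unfolded wiso_def]
  have u: "\<sigma> u \<noteq> 0" unfolding s_eq_0 by (rule conjunct1[OF p])
  have e: "\<sigma> (u * wa1 E') = \<sigma> (wa1 E + 2 * s)"
     "\<sigma> (u ^ 2 * wa2 E') = \<sigma> (wa2 E - s * wa1 E + 3 * r - s ^ 2)"
     "\<sigma> (u ^ 3 * wa3 E') = \<sigma> (wa3 E + r * wa1 E + 2 * t)"
     "\<sigma> (u ^ 4 * wa4 E') = \<sigma> (wa4 E - s * wa3 E + 2 * r * wa2 E - (t + r * s) * wa1 E + 3 * r ^ 2 - 2 * s * t)"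
     "\<sigma> (u ^ 6 * wa6 E') = \<sigma> (wa6 E + r * wa4 E + r ^ 2 * wa2 E + r ^ 3 - t * wa3 E - t ^ 2 - r * t * wa1 E)"
    by (rule arg_cong[where f = \<sigma>], insert p, elim conjE, assumption)+
  show ?thesis unfolding wiso_def weierstrass.map_sel
    by (intro conjI u e[unfolded s_simps])
qed

end

lemma galois_endo:
  assumes "\<sigma> \<in> galois_group" shows "field_endo \<sigma>" "\<sigma> (to_ac c) = to_ac c"
proof -
  have a: "\<sigma> \<in> ring_iso ring_of_type_algebra ring_of_type_algebra" "\<forall>z. \<sigma> (to_ac z) = to_ac z"
    using assms unfolding galois_group_def by blast+
  show "\<sigma> (to_ac c) = to_ac c" using a(2) by (rule spec)
  have h: "\<sigma> \<in> ring_hom ring_of_type_algebra ring_of_type_algebra" using a(1) by (simp only: ring_iso_def mem_Collect_eq)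
  show "field_endo \<sigma>"
  proof
    show "\<sigma> (x + y) = \<sigma> x + \<sigma> y" for x y
      using ring_hom_add[OF h, of x y] by (simp add: ring_of_type_algebra_def)
    show "\<sigma> (x * y) = \<sigma> x * \<sigma> y" for x y
      using ring_hom_mult[OF h, of x y] by (simp add: ring_of_type_algebra_def)
    show "\<sigma> 1 = 1" using ring_hom_one[OF h] by (simp add: ring_of_type_algebra_def)
  qed
qed

section \<open>The level structure group in terms of points\<close>

lemma sign_mod:
  fixes a b c d e :: int
  assumes "e = 1 \<or> e = - 1" and a: "a mod 10 = 1" "b mod 10 = 0" "c mod 2 = 0" "d mod 2 = 1"
  shows "(e * a) mod 10 = e mod 10" "(e * b) mod 10 = 0 mod 10" "(e * c * 5) mod 10 = 0 mod 10" "(e * d * 5) mod 10 = 5 mod 10"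
    "(e * c) mod 2 = 0" "(e * d) mod 2 = 1"
proof -
  consider "e = 1" | "e = - 1" using assms(1) by blast
  then have "(e * a) mod 10 = e mod 10 \<and> (e * b) mod 10 = 0 mod 10 \<and> (e * c * 5) mod 10 = 0 mod 10 \<and>
     (e * d * 5) mod 10 = 5 mod 10 \<and> (e * c) mod 2 = 0 \<and> (e * d) mod 2 = 1"
  proof cases
    case 1 show ?thesis unfolding 1 mult_1 using a by (intro conjI; ((simp; fail) | (simp?, presburger)))
  next
    case 2 show ?thesis unfolding 2 mult_minus_left mult_1 using a by (intro conjI; ((simp; fail) | (simp?, presburger)))
  qed
  then show "(e * a) mod 10 = e mod 10" "(e * b) mod 10 = 0 mod 10" "(e * c * 5) mod 10 = 0 mod 10" "(e * d * 5) mod 10 = 5 mod 10"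
    "(e * c) mod 2 = 0" "(e * d) mod 2 = 1" by blast+
qed

text \<open>A matrix of \<open>Gamma1 2 10\<close> has first column \<open>(1, 0)\<close> modulo 10
  and second column \<open>(0, 1)\<close> modulo 2; the first says that \<open>P\<close> is fixed,
  the second that \<open>5 Q\<close> is fixed. A sign affects only the former, because
  \<open>5 Q\<close> is its own inverse.\<close>

lemma (in comm_group) level_action:
  assumes P: "P \<in> carrier G" "P [^] (10::nat) = \<one>" and Q: "Q \<in> carrier G" "Q [^] (10::nat) = \<one>"
    and uq: "\<And>(i::int) (j::int) (i'::int) (j'::int). P [^] i \<otimes> Q [^] j = P [^] i' \<otimes> Q [^] j' \<Longrightarrow> i mod 10 = i' mod 10 \<and> j mod 10 = j' mod 10"
    and ex: "\<And>S. S \<in> carrier G \<Longrightarrow> S [^] (10::nat) = \<one> \<Longrightarrow> \<exists>(i::int) (j::int). S = P [^] i \<otimes> Q [^] j"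
    and h: "group_hom G G h" and inj: "inj_on h (carrier G)"
    and act: "\<And>A :: int^2^2. act A \<longleftrightarrow>
      h P = P [^] (A $ 1 $ 1) \<otimes> Q [^] (A $ 2 $ 1) \<and> h Q = P [^] (A $ 1 $ 2) \<otimes> Q [^] (A $ 2 $ 2)"
  shows "(\<exists>A\<in>Gamma1 2 10. act A \<or> act (- A)) \<longleftrightarrow> (h P = P \<or> h P = inv P) \<and> h (Q [^] (5::nat)) = Q [^] (5::nat)" (is "?L \<longleftrightarrow> ?R")
proof -
  interpret h: group_hom G G h by (rule h)
  have pm: "P [^] i = P [^] j" if "i mod 10 = j mod 10" for i j :: int
  proof -
    have e: "i mod int 10 = j mod int 10" using that by simp
    show ?thesis using int_pow_mod[OF P, of i] unfolding e int_pow_mod[OF P] by (rule sym)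
  qed
  have qm: "Q [^] i = Q [^] j" if "i mod 10 = j mod 10" for i j :: int
  proof -
    have e: "i mod int 10 = j mod int 10" using that by simp
    show ?thesis using int_pow_mod[OF Q, of i] unfolding e int_pow_mod[OF Q] by (rule sym)
  qed
  have Q5: "Q [^] (5::nat) = Q [^] (5::int)" using int_pow_int[of G Q 5] by simp
  have hp: "h (P [^] i \<otimes> Q [^] j) = h P [^] i \<otimes> h Q [^] j" for i j :: int
    using P(1) Q(1) by (simp add: h.hom_int_pow)
  have pw: "(P [^] i \<otimes> Q [^] j) [^] k = P [^] (i * k) \<otimes> Q [^] (j * k)" for i j k :: int
    using P(1) Q(1) by (simp add: int_pow_distrib int_pow_pow)
  have P1: "P [^] (1::int) = P" and P_1: "P [^] (- 1::int) = inv P" using P(1) by (simp_all add: int_pow_neg)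
  have Q0: "Q [^] (0::int) = \<one>" and P0: "P [^] (0::int) = \<one>" by simp_all
  have hQ5: "h (Q [^] (5::nat)) = h Q [^] (5::int)" unfolding Q5 using Q(1) by (rule h.hom_int_pow)
  show ?thesis
  proof
    assume ?L
    then obtain A where A: "A \<in> Gamma1 2 10" and "act A \<or> act (- A)" by blast
    then obtain e :: int where e: "e = 1 \<or> e = - 1" "h P = P [^] (e * A $ 1 $ 1) \<otimes> Q [^] (e * A $ 2 $ 1)"
       "h Q = P [^] (e * A $ 1 $ 2) \<otimes> Q [^] (e * A $ 2 $ 2)"
    proof (elim disjE)
      assume "act A"
      then show ?thesis unfolding act by (intro that[of 1]) simp_all
    next
      assume "act (- A)"
      then show ?thesis unfolding act by (intro that[of "- 1"]) simp_all
    qed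
    have m: "A $ 1 $ 1 mod 10 = 1" "A $ 2 $ 1 mod 10 = 0" "A $ 1 $ 2 mod 2 = 0" "A $ 2 $ 2 mod 2 = 1"
      using A by (simp_all add: Gamma1_def cong_def)
    note m' = sign_mod[OF e(1) m]
    have "h P = P [^] e" unfolding e(2) pm[OF m'(1)] qm[OF m'(2)] using P(1) by simp
    then have "h P = P \<or> h P = inv P" using e(1) P1 P_1 by auto
    moreover have "h (Q [^] (5::nat)) = Q [^] (5::nat)"
      unfolding hQ5 unfolding e(3) pw pm[OF m'(3)] qm[OF m'(4)] Q5 using Q(1) by simp
    ultimately show ?R ..
  next
    assume R: ?R
    then obtain e :: int where e: "e = 1 \<or> e = - 1" "h P = P [^] e"
      using P1 P_1 by metis
    have ee: "e * e = 1" using e(1) by auto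
    have "h Q [^] (10::nat) = \<one>" using h.hom_nat_pow[OF Q(1), of 10] Q(2) by simp
    from ex[OF h.hom_closed[OF Q(1)] this]
    obtain a b :: int where ab: "h Q = P [^] a \<otimes> Q [^] b" by (elim exE) (rule that)
    have "P [^] (a * 5) \<otimes> Q [^] (b * 5) = P [^] (0::int) \<otimes> Q [^] (5::int)"
      using R Q(1) unfolding hQ5 unfolding ab pw Q5 by simp
    from uq[OF this] have m5: "(a * 5) mod 10 = 0" "(b * 5) mod 10 = 5" by simp_all
    then have m2: "a mod 2 = 0" "b mod 2 = 1" by presburger+
    \<comment> \<open>Otherwise \<open>h\<close> would send \<open>2 Q\<close> to a multiple of
      \<open>P\<close>, which is also the image of a multiple of \<open>P\<close>, against
      injectivity. Together with \<open>b\<close> odd this makes the determinant prime to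
      10.\<close>
    have "b mod 5 \<noteq> 0"
    proof
      assume "b mod 5 = 0"
      then have b: "(b * 2) mod 10 = 0 mod 10" by presburger
      have "h (Q [^] (2::int)) = h Q [^] (2::int)" using Q(1) by (rule h.hom_int_pow)
      also have "\<dots> = P [^] (a * 2)" unfolding ab pw qm[OF b] using P(1) by simp
      also have "\<dots> = P [^] (e * (e * a * 2))" by (simp add: ee flip: mult.assoc)
      also have "\<dots> = h (P [^] (e * a * 2))" using P(1) by (simp add: h.hom_int_pow e(2) int_pow_pow)
      finally have "Q [^] (2::int) = P [^] (e * a * 2)" using inj P(1) Q(1) by (simp add: inj_on_eq_iff)
      then have "P [^] (0::int) \<otimes> Q [^] (2::int) = P [^] (e * a * 2) \<otimes> Q [^] (0::int)" using P(1) Q(1) by simp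
      from uq[OF this] show False by simp
    qed
    then have b: "coprime b 10"
    proof -
      have b2: "coprime b 2" using m2(2) by (metis coprime_commute coprime_right_2_iff_odd odd_iff_mod_2_eq_one coprime_commute)
      have "prime (5::int)" by simp
      then have "coprime 5 b" using \<open>b mod 5 \<noteq> 0\<close> by (intro prime_imp_coprime) (auto simp: dvd_eq_mod_eq_0)
      then have "coprime b (2 * 5)" unfolding coprime_mult_right_iff coprime_commute[of b 5] using b2 by blast
      then show ?thesis by (simp only: mult_numeral_left semiring_norm)
    qed
    \<comment> \<open>The matrix of \<open>h\<close> times the sign \<open>e\<close>, which
      normalizes the first column to \<open>(1, 0)\<close>.\<close>
    define A :: "int^2^2" where "A = vector [vector [1, e * a], vector [0, e * b]]"
    have As: "A $ 1 $ 1 = 1" "A $ 1 $ 2 = e * a" "A $ 2 $ 1 = 0" "A $ 2 $ 2 = e * b"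
      by (simp_all add: A_def)
    have "coprime (e * b) 10" using b e(1) by auto
    moreover have "e * a mod 2 = 0" "e * b mod 2 = 1" using sign_mod(5,6)[OF e(1) _ _ m2, of 1 0] by simp_all
    ultimately have A: "A \<in> Gamma1 2 10"
      by (simp add: Gamma1_def det_2 As cong_def)
    have "e * (e * a) = a" "e * (e * b) = b" by (simp_all add: ee flip: mult.assoc)
    then have "h P = P [^] (e * A $ 1 $ 1) \<otimes> Q [^] (e * A $ 2 $ 1)" "h Q = P [^] (e * A $ 1 $ 2) \<otimes> Q [^] (e * A $ 2 $ 2)"
      unfolding As ab e(2) \<open>e * (e * a) = a\<close> \<open>e * (e * b) = b\<close> using P(1) by simp_all
    then have "act A \<or> act (- A)" using e(1) unfolding act by auto
    then show ?L using A by blast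
  qed
qed

section \<open>The function field of X_1(2,10)\<close>

lemma evf_closed: "field_set K \<Longrightarrow> (\<And>c. const_fun c \<in> K) \<Longrightarrow> x \<in> K \<Longrightarrow> evf x q \<in> K"
  by (induction q) (auto intro: field_setD)

lemma field_set_numeral:
  assumes "field_set K" shows "numeral n \<in> K"
proof -
  have "of_nat m \<in> K" for m by (induction m) (auto intro: field_setD[OF assms])
  from this[of "numeral n"] show ?thesis by simp
qed

lemma field_set_j_mE:
  assumes K: "field_set K" and s: "s \<in> K"
  shows "j_invariant (mE s) \<in> K"
proof -
  note c = field_setD[OF K] field_set_power[OF K] field_set_numeral[OF K] s
  have d: "md s \<in> K" unfolding md_def by (intro c)
  have C: "mC s \<in> K" unfolding mC_def by (intro c)
  show ?thesis unfolding j_alt wdisc_mE wc4_def wb2_def wb4_def mE_simps by (intro c d C)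
qed

lemma evf_expand: "evf u q = (\<Sum>i\<le>degree q. const_fun (coeff q i) * u ^ i)"
proof -
  have "evf u q = evf u (\<Sum>i\<le>degree q. monom (coeff q i) i)" by (simp add: poly_as_sum_of_monoms)
  then show ?thesis by (simp only: evf_sum evf_monom)
qed

text \<open>The second premise says \<open>t \<in> k(u)\<close> without naming that field. If
  \<open>u\<close> were algebraic over \<open>k\<close>, then \<open>k[u]\<close> would be a field
  of finite dimension over \<open>k\<close> and would contain all powers of \<open>t\<close>, which
  are independent.\<close>

lemma transcendental_generator:
  fixes t u :: "'k::field_char_0 funs"
  assumes t: "\<And>q. evf t q = 0 \<Longrightarrow> q = 0"
    and tu: "\<And>K. field_set K \<Longrightarrow> (\<And>c. const_fun c \<in> K) \<Longrightarrow> u \<in> K \<Longrightarrow> t \<in> K"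
    and q: "evf u q = 0"
  shows "q = 0"
proof (rule ccontr)
  assume q0: "q \<noteq> 0"
  let ?S = "\<lambda>d. d \<noteq> 0 \<and> evf u d = 0"
  have "?S q" using q0 q by blast
  from ex_has_least_nat[of ?S, OF this, of degree] obtain p
    where pS: "p \<noteq> 0" "evf u p = 0" and min: "\<forall>d. ?S d \<longrightarrow> degree p \<le> degree d" by blast
  have "irreducible p"
  proof (rule irreducibleI)
    show "p \<noteq> 0" by (rule pS)
    show "\<not> is_unit p"
    proof
      assume "is_unit p"
      then obtain c where "p = [:c:]" "c \<noteq> 0" by (metis is_unit_iff_degree degree_eq_zeroE pCons_0_0 pS(1))
      then show False using pS(2) by simp
    qed
    fix a b assume ab: "p = a * b"
    then have nz: "a \<noteq> 0" "b \<noteq> 0" using pS(1) by auto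
    have d: "degree p = degree a + degree b" unfolding ab using nz by (rule degree_mult_eq)
    have "evf u a * evf u b = 0" using pS(2) unfolding ab by simp
    then have "degree p \<le> degree a \<or> degree p \<le> degree b" using min nz by auto
    then have "degree a = 0 \<or> degree b = 0" using d by linarith
    then show "is_unit a \<or> is_unit b" using nz by (simp add: is_unit_iff_degree)
  qed
  note p = this pS(2)
  note p0 = pS(1)
  let ?W = "range (evf u)"
  have W: "field_set ?W"
    unfolding field_set_def
  proof (intro conjI ballI)
    show "1 \<in> ?W" by (rule range_eqI[of _ _ 1]) simp
    fix x assume "x \<in> ?W"
    then obtain a where a: "x = evf u a" by blast
    show "- x \<in> ?W" by (rule range_eqI[of _ _ "- a"]) (simp add: a)
    show "inverse x \<in> ?W"
    proof (cases "p dvd a")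
      case True
      then have "x = 0" using p(2) by (auto simp: a elim!: dvdE)
      then show ?thesis by (intro range_eqI[of _ _ 0]) simp
    next
      case False
      obtain y z where "y * a + z * p = 1" by (rule irreducible_bezout[OF p(1) False])
      then have "evf u (y * a + z * p) = 1" by simp
      then have "x * evf u y = 1" using p(2) by (simp add: a mult.commute)
      then have "inverse x = evf u y" by (rule inverse_unique)
      then show ?thesis by blast
    qed
    fix y assume "y \<in> ?W"
    then obtain b where b: "y = evf u b" by blast
    show "x + y \<in> ?W" by (rule range_eqI[of _ _ "a + b"]) (simp add: a b)
    show "x * y \<in> ?W" by (rule range_eqI[of _ _ "a * b"]) (simp add: a b)
  qed
  have cW: "const_fun c \<in> ?W" for c by (rule range_eqI[of _ _ "[:c:]"]) simp
  have uW: "u \<in> ?W" by (rule range_eqI[of _ _ "[:0, 1:]"]) simp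
  have tW: "t \<in> ?W" by (rule tu[OF W cW uW])
  define d where "d = degree p"
  have span: "?W \<subseteq> funs.span ((\<lambda>i. u ^ i) ` {..d})"
  proof
    fix x assume "x \<in> ?W"
    then obtain a where a: "x = evf u a" by blast
    have "evf u a = evf u (a div p * p + a mod p)" by simp
    also have "\<dots> = evf u (a mod p)" unfolding evf_add evf_mult p(2) by simp
    finally have x: "x = (\<Sum>i\<le>degree (a mod p). const_fun (coeff (a mod p) i) * u ^ i)" unfolding a evf_expand .
    have "degree (a mod p) \<le> d" using degree_mod_less[OF p0, of a] by (auto simp: d_def)
    then show "x \<in> funs.span ((\<lambda>i. u ^ i) ` {..d})"
      unfolding x by (intro funs.span_sum funs.span_scale funs.span_base) auto
  qed
  have inj: "inj_on (\<lambda>i. t ^ i) {..Suc d}"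
  proof (rule inj_onI)
    fix i j assume "t ^ i = t ^ j"
    then have "evf t (monom 1 i - monom 1 j) = 0" by (simp add: evf_monom)
    then have "monom 1 i - monom 1 j = (0 :: 'k poly)" by (rule t)
    then have "coeff (monom 1 i :: 'k poly) i = coeff (monom 1 j) i" by simp
    then show "i = j" by (simp split: if_splits)
  qed
  let ?T = "(\<lambda>i. t ^ i) ` {..Suc d}"
  have "funs.independent ?T"
  proof
    assume "funs.dependent ?T"
    then obtain c where c: "\<exists>v\<in>?T. c v \<noteq> 0" "(\<Sum>v\<in>?T. const_fun (c v) * v) = 0"
      by (subst (asm) funs.dependent_finite) auto
    define g where "g = (\<Sum>i\<le>Suc d. monom (c (t ^ i)) i)"
    have "evf t g = (\<Sum>v\<in>?T. const_fun (c v) * v)"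
      unfolding g_def evf_sum evf_monom sum.reindex[OF inj] by simp
    then have "g = 0" using c(2) t by simp
    have cg: "coeff g i = (if i \<le> Suc d then c (t ^ i) else 0)" for i
      by (simp only: g_def coeff_sum_monom atMost_iff coeff_sum coeff_monom) (simp add: sum.delta)
    have "c (t ^ i) = 0" if "i \<le> Suc d" for i using cg[of i] that unfolding \<open>g = 0\<close> by simp
    then show False using c(1) by auto
  qed
  moreover have "?T \<subseteq> funs.span ((\<lambda>i. u ^ i) ` {..d})"
    using span field_set_power[OF W tW] by auto
  ultimately have "card ?T \<le> card ((\<lambda>i. u ^ i) ` {..d})"
    using funs.independent_span_bound[of "(\<lambda>i. u ^ i) ` {..d}" ?T] by simp
  also have "\<dots> \<le> card {..d}" by (rule card_image_le) simp
  finally show False using card_image[OF inj] by simp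
qed

lemma map_to_ac_wdisc: "wdisc (map_weierstrass to_ac E) = to_ac (wdisc E)"
  "wc4 (map_weierstrass to_ac E) = to_ac (wc4 E)" "j_invariant (map_weierstrass to_ac E) = to_ac (j_invariant E)"
  by (simp_all add: j_alt wdisc_def wc4_def wb2_def wb4_def wb6_def wb8_def weierstrass.map_sel)


text \<open>The automorphisms in the definition of \<open>F\<close> turn out to be those that fix
  \<open>s\<close> and \<open>w\<close>. Hence \<open>F\<close> contains \<open>k(u, w)\<close>, and
  an element of \<open>F\<close> outside \<open>k(u, w)\<close> would be moved by an automorphism
  over \<open>k(u, w)\<close>.\<close>

theorem X1_2_10:
  fixes F :: "'k::field_char_0 funs set"
  assumes X: "is_X1_function_field 2 10 F"
  obtains u w where "ell u w 1 (- 1) 0" "F = quad.FF u w"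
proof -
  obtain E :: "'k poly fract weierstrass" and P Q where E: "elliptic E" "j_invariant E = to_fract [:0, 1:]"
    and tb: "torsion_basis (map_weierstrass to_ac E) 10 P Q"
    and F: "F = {z. \<forall>\<sigma>\<in>galois_group.
               (\<exists>A\<in>Gamma1 2 10. acts_by (map_weierstrass to_ac E) P Q \<sigma> A \<or>
                              acts_by (map_weierstrass to_ac E) P Q \<sigma> (- A)) \<longrightarrow> \<sigma> z = z}"
    using X unfolding is_X1_function_field_def by (elim exE conjE)
  define EE where "EE = map_weierstrass to_ac E"
  define t where "t = to_ac (to_fract [:0, 1 :: 'k:])"
  have eE: "elliptic EE" using E(1) by (simp add: elliptic_def EE_def map_to_ac_wdisc)
  have jE: "j_invariant EE = t" unfolding EE_def map_to_ac_wdisc E(2) t_def ..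
  have tq: "evf t q = 0 \<Longrightarrow> q = 0" for q :: "'k poly" unfolding t_def evf_to_ac by simp
  define G where "G = mordell_weil EE"
  interpret G: comm_group G unfolding G_def by (rule elliptic_group[OF eE])
  have G1: "\<one>\<^bsub>G\<^esub> = Infinity" and Gm: "monoid.mult G = ec_add EE" and Gc: "carrier G = {P. on_curve EE P}"
    unfolding G_def by (simp_all only: mw_sel)
  let ?f = "\<lambda>(a::nat, b::nat). (P [^]\<^bsub>G\<^esub> a) \<otimes>\<^bsub>G\<^esub> (Q [^]\<^bsub>G\<^esub> b)"
  have tb': "bij_betw ?f ({..<10} \<times> {..<10}) {R \<in> carrier G. R [^]\<^bsub>G\<^esub> (10::nat) = \<one>\<^bsub>G\<^esub>}"
    "{P, Q} \<subseteq> {R \<in> carrier G. R [^]\<^bsub>G\<^esub> (10::nat) = \<one>\<^bsub>G\<^esub>}"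
    using tb unfolding torsion_basis_def Let_def G_def EE_def by blast+
  have P: "P \<in> carrier G" "P [^]\<^bsub>G\<^esub> (10::nat) = \<one>\<^bsub>G\<^esub>" and Q: "Q \<in> carrier G" "Q [^]\<^bsub>G\<^esub> (10::nat) = \<one>\<^bsub>G\<^esub>"
    using tb'(2) by auto
  have inj: "inj_on ?f ({..<10} \<times> {..<10})" using tb'(1) by (rule bij_betw_imp_inj_on)
  have surj: "?f ` ({..<10} \<times> {..<10}) = {R \<in> carrier G. R [^]\<^bsub>G\<^esub> (10::nat) = \<one>\<^bsub>G\<^esub>}"
    using tb'(1) by (rule bij_betw_imp_surj_on)
  have nf: "P [^]\<^bsub>G\<^esub> i \<otimes>\<^bsub>G\<^esub> Q [^]\<^bsub>G\<^esub> j = ?f (nat (i mod 10), nat (j mod 10))" for i j :: int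
  proof -
    have "S [^]\<^bsub>G\<^esub> i = S [^]\<^bsub>G\<^esub> nat (i mod 10)" if "S \<in> carrier G" "S [^]\<^bsub>G\<^esub> (10::nat) = \<one>\<^bsub>G\<^esub>" for S and i :: int
    proof -
      have "S [^]\<^bsub>G\<^esub> i = S [^]\<^bsub>G\<^esub> (i mod int 10)" by (rule G.int_pow_mod[OF that, symmetric])
      also have "i mod int 10 = int (nat (i mod 10))" by simp
      also have "S [^]\<^bsub>G\<^esub> int (nat (i mod 10)) = S [^]\<^bsub>G\<^esub> nat (i mod 10)" by (rule int_pow_int)
      finally show ?thesis .
    qed
    from this[OF P] this[OF Q] show ?thesis by simp
  qed
  have uq: "i mod 10 = i' mod 10 \<and> j mod 10 = j' mod 10"
    if "P [^]\<^bsub>G\<^esub> i \<otimes>\<^bsub>G\<^esub> Q [^]\<^bsub>G\<^esub> j = P [^]\<^bsub>G\<^esub> i' \<otimes>\<^bsub>G\<^esub> Q [^]\<^bsub>G\<^esub> j'" for i j i' j' :: int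
  proof -
    have m: "nat (k mod 10) < 10" for k :: int by simp
    have "(nat (i mod 10), nat (j mod 10)) = (nat (i' mod 10), nat (j' mod 10))"
      by (rule inj_onD[OF inj that[unfolded nf]]) (simp_all add: m)
    then show ?thesis by (simp add: eq_nat_nat_iff)
  qed
  have ex: "\<exists>(i::int) (j::int). S = P [^]\<^bsub>G\<^esub> i \<otimes>\<^bsub>G\<^esub> Q [^]\<^bsub>G\<^esub> j" if "S \<in> carrier G" "S [^]\<^bsub>G\<^esub> (10::nat) = \<one>\<^bsub>G\<^esub>" for S
  proof -
    have "S \<in> ?f ` ({..<10} \<times> {..<10})" unfolding surj using that by simp
    then obtain a b where "S = P [^]\<^bsub>G\<^esub> (a::nat) \<otimes>\<^bsub>G\<^esub> Q [^]\<^bsub>G\<^esub> (b::nat)" by auto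
    then have "S = P [^]\<^bsub>G\<^esub> int a \<otimes>\<^bsub>G\<^esub> Q [^]\<^bsub>G\<^esub> int b" by (simp only: int_pow_int)
    then show ?thesis by (intro exI)
  qed
  have PQ0: "P [^]\<^bsub>G\<^esub> (0::int) = \<one>\<^bsub>G\<^esub>" "Q [^]\<^bsub>G\<^esub> (0::int) = \<one>\<^bsub>G\<^esub>" by simp_all
  \<comment> \<open>The second point of the level structure, \<open>(10 / 2) Q\<close>, of order
    2.\<close>
  define R where "R = Q [^]\<^bsub>G\<^esub> (5::nat)"
  have pi: "P [^]\<^bsub>G\<^esub> (n::nat) = P [^]\<^bsub>G\<^esub> int n \<otimes>\<^bsub>G\<^esub> Q [^]\<^bsub>G\<^esub> (0::int)" for n
    unfolding int_pow_int PQ0 using P(1) by simp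
  have R0: "R = P [^]\<^bsub>G\<^esub> (0::int) \<otimes>\<^bsub>G\<^esub> Q [^]\<^bsub>G\<^esub> int 5"
    unfolding int_pow_int PQ0 R_def using Q(1) by simp
  have one: "\<one>\<^bsub>G\<^esub> = P [^]\<^bsub>G\<^esub> (0::int) \<otimes>\<^bsub>G\<^esub> Q [^]\<^bsub>G\<^esub> (0::int)" unfolding PQ0 by simp
  have RG: "R \<in> carrier G" unfolding R_def using Q(1) by simp
  have p5: "P [^]\<^bsub>G\<^esub> (5::nat) \<noteq> \<one>\<^bsub>G\<^esub>" using uq[of 5 0 0 0] unfolding pi[of 5] one by auto
  have p2: "P [^]\<^bsub>G\<^esub> (2::nat) \<noteq> \<one>\<^bsub>G\<^esub>" using uq[of 2 0 0 0] unfolding pi[of 2] one by auto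
  have r1: "R \<noteq> \<one>\<^bsub>G\<^esub>" using uq[of 0 5 0 0] unfolding R0 one by auto
  have r5: "R \<noteq> P [^]\<^bsub>G\<^esub> (5::nat)" using uq[of 0 5 5 0] unfolding R0 pi[of 5] by auto
  have r2: "R [^]\<^bsub>G\<^esub> (2::nat) = \<one>\<^bsub>G\<^esub>" unfolding R_def G.nat_pow_pow[OF Q(1)] using Q(2) by simp
  obtain U x \<tau> y s xr yr w where i: "wiso U x \<tau> y EE (mE s)" and PA: "P = Affine x y"
    and RA: "R = wback U x \<tau> y (Affine xr yr)"
    and tr: "2 * yr + wa1 (mE s) * xr + wa3 (mE s) = 0"
    and xw: "(2 * s - 1) ^ 2 * w = 8 * xr + mlin s"
    and w2: "w ^ 2 = (2 * s - 1) ^ 3 + (2 * s - 1) ^ 2 - (2 * s - 1)" and nc: "noncusp (2 * s - 1)"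
    by (rule level_point[OF eE, folded G_def, OF P p5 p2 RG r2 r1 r5])
  have U0: "U \<noteq> 0" using i by (rule wiso_params(1))
  have u0: "2 * s - 1 \<noteq> 0" using nc by (simp add: noncusp_def)
  define XR YR where "XR = U ^ 2 * xr + x" and "YR = U ^ 3 * yr + \<tau> * U ^ 2 * xr + y"
  have RX: "R = Affine XR YR" unfolding RA XR_def YR_def wback.simps ..
  have "ec_add EE R R = Infinity"
    using r2 RG unfolding numeral_2_eq_2 G.nat_pow_Suc G.nat_pow_0 by (simp add: G1 Gm Gc)
  then have R2: "2 * YR + wa1 EE * XR + wa3 EE = 0" unfolding RX ec_double_Infinity .
  have Pon: "y ^ 2 + wa1 EE * x * y + wa3 EE * y = x ^ 3 + wa2 EE * x ^ 2 + wa4 EE * x + wa6 EE"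
    using P(1) unfolding Gc PA by simp
  have invP: "inv\<^bsub>G\<^esub> P = Affine x (- y - wa1 EE * x - wa3 EE)"
  proof (rule G.inv_equality)
    show "Affine x (- y - wa1 EE * x - wa3 EE) \<otimes>\<^bsub>G\<^esub> P = \<one>\<^bsub>G\<^esub>" unfolding Gm G1 PA by simp
    have "(- y - wa1 EE * x - wa3 EE) ^ 2 + wa1 EE * x * (- y - wa1 EE * x - wa3 EE) + wa3 EE * (- y - wa1 EE * x - wa3 EE)
       = y ^ 2 + wa1 EE * x * y + wa3 EE * y" by Groebner_Basis.algebra
    then show "Affine x (- y - wa1 EE * x - wa3 EE) \<in> carrier G" unfolding Gc using Pon by simp
  qed (rule P(1))
  \<comment> \<open>The j-invariant \<open>t\<close> is transcendental, hence neither 0 nor 1728. So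
    \<open>c4\<close> and \<open>c6\<close> are nonzero and determine the scaling factor
    \<open>U\<close> up to sign.\<close>
  have c40: "wc4 EE \<noteq> 0"
  proof
    assume "wc4 EE = 0"
    then have "t = 0" unfolding jE[symmetric] j_alt by simp
    then have "evf t [:0, 1:] = 0" by simp
    from tq[OF this] show False by simp
  qed
  have c60: "wc6 EE \<noteq> 0"
  proof
    assume "wc6 EE = 0"
    then have "wc4 EE ^ 3 = 1728 * wdisc EE" using disc_c4_c6[of EE] by simp
    then have t: "t = 1728" unfolding jE[symmetric] j_alt using eE by (simp add: elliptic_def)
    have "evf t (of_nat n) = of_nat n" for n by (induction n) simp_all
    from this[of 1728] have "evf t ([:0, 1:] - of_nat 1728) = 0" by (simp add: t)
    from tq[OF this] have "coeff ([:0, 1:] - of_nat 1728) 1 = (0 :: 'k)" by simp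
    then show False by (simp only: of_nat_poly) simp
  qed
  have iff: "(\<exists>A\<in>Gamma1 2 10. acts_by EE P Q \<sigma> A \<or> acts_by EE P Q \<sigma> (- A)) \<longleftrightarrow> \<sigma> s = s \<and> \<sigma> w = w"
    if \<sigma>: "\<sigma> \<in> galois_group" for \<sigma>
  proof -
    interpret field_endo \<sigma> by (rule galois_endo(1)[OF \<sigma>])
    have "\<sigma> \<circ> to_ac = to_ac" by (rule ext) (simp add: galois_endo(2)[OF \<sigma>])
    then have fx: "map_weierstrass \<sigma> EE = EE" by (simp add: EE_def weierstrass.map_comp)
    note fixw = weierstrass.map_sel[of \<sigma> EE, unfolded fx, symmetric]
    let ?h = "map_ec_point \<sigma>"
    have on: "on_curve EE (?h S)" if "on_curve EE S" for S using s_on_curve[OF that] unfolding fx .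
    have add: "?h (ec_add EE S T) = ec_add EE (?h S) (?h T)" for S T using s_ec_add[of EE S T] unfolding fx .
    have hom: "?h \<in> hom G G" by (rule homI) (simp_all add: Gc Gm on add)
    have gh: "group_hom G G ?h"
      by (intro group_hom.intro group_hom_axioms.intro hom G.is_group)
    have "inj ?h" by (rule ec_point.inj_map) (rule injI, simp add: s_eq)
    then have hinj: "inj_on ?h (carrier G)" by (rule inj_on_subset) simp
    have 1: "(\<exists>A\<in>Gamma1 2 10. acts_by EE P Q \<sigma> A \<or> acts_by EE P Q \<sigma> (- A)) \<longleftrightarrow>
        (?h P = P \<or> ?h P = inv\<^bsub>G\<^esub> P) \<and> ?h R = R"
      unfolding R_def
      by (rule G.level_action[OF P Q uq ex gh hinj]) (auto simp: acts_by_def Let_def G_def)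
    \<comment> \<open>The curve \<open>EE\<close> is defined over \<open>k(t)\<close>, so
      \<open>\<sigma>\<close> carries the normal form of \<open>(EE, P)\<close> to that of
      \<open>(EE, \<sigma> P)\<close>, with parameter \<open>\<sigma> s\<close>. If
      \<open>\<sigma> P\<close> is \<open>P\<close> or its inverse, uniqueness of the normal form
      gives \<open>\<sigma> s = s\<close>.\<close>
    have i\<sigma>: "wiso (\<sigma> U) (\<sigma> x) (\<sigma> \<tau>) (\<sigma> y) EE (mE (\<sigma> s))" using s_wiso[OF i] unfolding fx s_mE .
    have w\<sigma>: "(2 * \<sigma> s - 1) ^ 2 * \<sigma> w = 8 * \<sigma> xr + mlin (\<sigma> s)"
      using arg_cong[OF xw, of \<sigma>] unfolding s_simps s_mlin .
    show ?thesis unfolding 1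
    proof
      assume a: "(?h P = P \<or> ?h P = inv\<^bsub>G\<^esub> P) \<and> ?h R = R"
      have x: "\<sigma> x = x" using a unfolding invP unfolding PA by auto
      have "\<sigma> s = s \<and> (\<sigma> U = U \<or> \<sigma> U = - U)"
      proof (cases "?h P = P")
        case True
        then have y: "\<sigma> y = y" unfolding PA by simp
        from wiso_unique[OF i i\<sigma>[unfolded x y] eE] show ?thesis by simp
      next
        case False
        then have "?h P = inv\<^bsub>G\<^esub> P" using a by blast
        then have y: "\<sigma> y = - y - wa1 EE * x - wa3 EE" unfolding invP unfolding PA by simp
        from wiso_unique[OF wiso_neg[OF i] i\<sigma>[unfolded x y] eE] show ?thesis by simp
      qed
      then have s: "\<sigma> s = s" and U: "\<sigma> U ^ 2 = U ^ 2" by auto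
      have "\<sigma> XR = XR" using a unfolding RX by simp
      then have "U ^ 2 * \<sigma> xr = U ^ 2 * xr" unfolding XR_def s_simps x U by simp
      then have "\<sigma> xr = xr" using U0 by simp
      then have "(2 * s - 1) ^ 2 * \<sigma> w = (2 * s - 1) ^ 2 * w" using w\<sigma> unfolding s xw by simp
      then have "\<sigma> w = w" using u0 by simp
      then show "\<sigma> s = s \<and> \<sigma> w = w" using s by simp
    next
      assume a: "\<sigma> s = s \<and> \<sigma> w = w"
      then have s: "\<sigma> s = s" and w: "\<sigma> w = w" by auto
      have "8 * \<sigma> xr = 8 * xr" using w\<sigma> unfolding s w xw by simp
      then have xr: "\<sigma> xr = xr" by simp
      have m: "map_weierstrass \<sigma> (mE s) = mE s" unfolding s_mE s ..
      \<comment> \<open>Comparing \<open>c4\<close> and \<open>c6\<close> fixes \<open>U^4\<close>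
        and \<open>U^6\<close>, hence \<open>U^2\<close>. Then \<open>b2\<close> fixes the abscissa
        of \<open>P\<close>, whose ordinate is left with the two values of \<open>P\<close> and
        \<open>- P\<close>; the abscissa of \<open>R\<close> is fixed as well, and the ordinate of a
        2-torsion point follows from it.\<close>
      note c = wiso_c(1,2)[OF i]
      note fc = s_wc[of EE, unfolded fx, symmetric] s_wc[of "mE s", unfolded m, symmetric]
      have "wc4 EE = \<sigma> U ^ 4 * wc4 (mE s)"
        using arg_cong[OF c(1), of \<sigma>] unfolding s_mult s_power fc .
      then have "\<sigma> U ^ 4 * wc4 (mE s) = U ^ 4 * wc4 (mE s)" using c(1) by (rule HOL.trans[OF sym])
      moreover have m4: "wc4 (mE s) \<noteq> 0"
      proof
        assume "wc4 (mE s) = 0"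
        then have "wc4 EE = 0" unfolding c(1) by simp
        with c40 show False by contradiction
      qed
      ultimately have 4: "\<sigma> U ^ 4 = U ^ 4" by (metis mult_right_cancel)
      have "wc6 EE = \<sigma> U ^ 6 * wc6 (mE s)"
        using arg_cong[OF c(2), of \<sigma>] unfolding s_mult s_power fc .
      then have "\<sigma> U ^ 6 * wc6 (mE s) = U ^ 6 * wc6 (mE s)" using c(2) by (rule HOL.trans[OF sym])
      moreover have m6: "wc6 (mE s) \<noteq> 0"
      proof
        assume "wc6 (mE s) = 0"
        then have "wc6 EE = 0" unfolding c(2) by simp
        with c60 show False by contradiction
      qed
      ultimately have 6: "\<sigma> U ^ 6 = U ^ 6" by (metis mult_right_cancel)
      have "\<sigma> U ^ 2 * \<sigma> U ^ 4 = U ^ 2 * U ^ 4" using 6 by (simp flip: power_add)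
      then have "\<sigma> U ^ 2 * U ^ 4 = U ^ 2 * U ^ 4" unfolding 4 .
      moreover have "U ^ 4 \<noteq> 0" using U0 by simp
      ultimately have U: "\<sigma> U ^ 2 = U ^ 2" by (metis mult_right_cancel)
      have b: "U ^ 2 * wb2 (mE s) = wb2 EE + 12 * x" by (rule wiso_b(1)[OF i])
      have "U ^ 2 * wb2 (mE s) = wb2 EE + 12 * \<sigma> x"
        using arg_cong[OF b, of \<sigma>] unfolding s_mult s_power s_add s_numeral U fc .
      then have "12 * \<sigma> x = 12 * x" unfolding b by simp
      then have x: "\<sigma> x = x" by simp
      have "\<sigma> y ^ 2 + wa1 EE * x * \<sigma> y + wa3 EE * \<sigma> y = x ^ 3 + wa2 EE * x ^ 2 + wa4 EE * x + wa6 EE"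
        using arg_cong[OF Pon, of \<sigma>] unfolding s_simps fixw x .
      then have "(\<sigma> y - y) * (\<sigma> y + y + wa1 EE * x + wa3 EE) = 0"
        using Pon by Groebner_Basis.algebra
      then have "\<sigma> y - y = 0 \<or> \<sigma> y + y + wa1 EE * x + wa3 EE = 0" by (simp only: mult_eq_0_iff)
      then have "\<sigma> y = y \<or> \<sigma> y = - y - wa1 EE * x - wa3 EE"
      proof
        assume h: "\<sigma> y + y + wa1 EE * x + wa3 EE = 0"
        have "\<sigma> y = - y - wa1 EE * x - wa3 EE" using h by Groebner_Basis.algebra
        then show ?thesis ..
      qed simp
      then have hP: "?h P = P \<or> ?h P = inv\<^bsub>G\<^esub> P" unfolding invP unfolding PA by (simp add: x)
      have XR: "\<sigma> XR = XR" unfolding XR_def s_simps U xr x ..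
      have "2 * \<sigma> YR + wa1 EE * XR + wa3 EE = 0" using arg_cong[OF R2, of \<sigma>] unfolding s_simps fixw XR .
      then have "2 * \<sigma> YR = 2 * YR" using R2 by (metis add_right_cancel)
      then have "\<sigma> YR = YR" by simp
      then show "(?h P = P \<or> ?h P = inv\<^bsub>G\<^esub> P) \<and> ?h R = R" using hP unfolding RX by (simp add: XR)
    qed
  qed
  define u where "u = 2 * s - 1"
  have su: "s = (u + 1) / 2" by (simp add: u_def)
  have j: "j_invariant (mE s) = t" using wiso_j[OF i] jE by simp
  \<comment> \<open>As the j-invariant of \<open>mE s\<close>, the function \<open>t\<close> is
    rational in \<open>u\<close>, which makes \<open>u\<close> transcendental over
    \<open>k\<close>.\<close>
  have gen: "t \<in> K" if K: "field_set K" "u \<in> K" for K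
  proof -
    have "s \<in> K" unfolding su by (intro field_setD[OF K(1)] K field_set_numeral)
    from field_set_j_mE[OF K(1) this] show ?thesis unfolding j .
  qed
  interpret ell u w 1 "- 1" "0 :: 'k"
  proof
    show "evf u q = 0 \<Longrightarrow> q = 0" for q using tq by (rule transcendental_generator[of t u]) (auto intro: gen)
    show "w * w = evf u [:0, - 1, 1, 1:]"
      using w2 unfolding u_def[symmetric] by (simp add: algebra_simps power2_eq_square power3_eq_cube)
  qed simp
  have FF: "F = {z. \<forall>\<sigma>\<in>galois_group. \<sigma> s = s \<and> \<sigma> w = w \<longrightarrow> \<sigma> z = z}"
    unfolding F EE_def[symmetric] using iff by auto
  have Ffield: "field_set F"
    unfolding field_set_def
  proof (intro conjI ballI)
    note s = field_endo.s_simps[OF galois_endo(1)]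
    show "1 \<in> F" unfolding FF by (simp add: s)
    fix a assume a: "a \<in> F"
    show "- a \<in> F" "inverse a \<in> F" using a unfolding FF by (simp_all add: s)
    fix b assume b: "b \<in> F"
    have fx: "\<sigma> z = z" if "\<sigma> \<in> galois_group" "\<sigma> s = s \<and> \<sigma> w = w" "z \<in> F" for \<sigma> z
      using that unfolding FF by blast
    have FI: "z \<in> F" if "\<forall>\<sigma>. \<sigma> \<in> galois_group \<longrightarrow> \<sigma> s = s \<and> \<sigma> w = w \<longrightarrow> \<sigma> z = z" for z
      using that unfolding FF by blast
    show "a + b \<in> F"
    proof (rule FI, intro allI impI)
      fix \<sigma> assume h: "\<sigma> \<in> galois_group" "\<sigma> s = s \<and> \<sigma> w = w"
      show "\<sigma> (a + b) = a + b" unfolding s(3)[OF h(1)] fx[OF h a] fx[OF h b] ..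
    qed
    show "a * b \<in> F"
    proof (rule FI, intro allI impI)
      fix \<sigma> assume h: "\<sigma> \<in> galois_group" "\<sigma> s = s \<and> \<sigma> w = w"
      show "\<sigma> (a * b) = a * b" unfolding s(4)[OF h(1)] fx[OF h a] fx[OF h b] ..
    qed
  qed
  have sF: "s \<in> F" "w \<in> F" unfolding FF by simp_all
  have cF: "const_fun c \<in> F" for c
    unfolding FF const_fun_def using galois_endo(2) by blast
  have "u \<in> F" unfolding u_def by (intro field_setD[OF Ffield] sF field_set_numeral[OF Ffield])
  from Ffield cF this sF(2) have le: "FF \<subseteq> F" by (rule FF_least)
  have tFF: "t \<in> FF" by (rule gen[OF FF_field FF_u])
  have sFF: "s \<in> FF" unfolding su by (intro field_setD[OF FF_field] FF_u field_set_numeral[OF FF_field])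
  have base: "range to_ac \<subseteq> FF"
  proof (rule subsetI, elim rangeE)
    fix z and c :: "'k poly fract" assume z: "z = to_ac c"
    obtain a b where "c = Fract a b" by (cases c rule: Fract_cases) auto
    then have "c = to_fract a / to_fract b" by (simp add: Fract_conv_to_fract)
    then have "z = evf t a / evf t b" unfolding z t_def evf_to_ac by simp
    then show "z \<in> FF" using evf_closed[OF FF_field FF_const tFF] field_setD(8)[OF FF_field] by simp
  qed
  have "F \<subseteq> FF"
  proof
    fix z assume zF: "z \<in> F"
    show "z \<in> FF"
    proof (rule ccontr)
      assume "z \<notin> FF"
      then obtain \<sigma> where \<sigma>: "\<sigma> \<in> galois_group" "\<forall>x\<in>FF. \<sigma> x = x" "\<sigma> z \<noteq> z"
        by (rule galois_moves[OF FF_field base])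
      then have "\<sigma> s = s \<and> \<sigma> w = w" using sFF FF_w by blast
      then show False using zF \<sigma>(1,3) unfolding FF by blast
    qed
  qed
  with le have "F = FF" by blast
  with ell_axioms show ?thesis by (rule that)
qed

section \<open>Doubling on \<open>w^2 = u^3 + u^2 - u\<close> over a multi-quadratic field\<close>

lemma (in field_endo) s_of_rat: "\<sigma> (of_rat r) = of_rat r"
proof -
  have n: "\<sigma> (of_nat m) = of_nat m" for m by (induction m) (simp_all add: s_simps)
  have i: "\<sigma> (of_int m) = of_int m" for m by (cases m rule: int_cases2) (simp_all add: s_minus n)
  obtain a b :: int where "r = Rat.Fract a b" "b > 0" by (cases r rule: Rat_cases) auto
  then show ?thesis by (simp add: of_rat_rat s_divide i)
qed

abbreviation E0 :: "'a::field_char_0 weierstrass" where "E0 \<equiv> Weierstrass 0 1 0 (- 1) 0"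

lemma E0_elliptic: "elliptic E0"
  by (simp add: elliptic_def wdisc_def wb2_def wb4_def wb6_def wb8_def)

text \<open>In this form the abscissa of a double is visibly a square, which \<open>halving\<close>
  exploits, and a function of \<open>u\<close> alone, as the height estimate requires.\<close>

lemma E0_double:
  fixes u w :: "'a::field_char_0"
  assumes w: "w ^ 2 = u ^ 3 + u ^ 2 - u" "w \<noteq> 0"
  shows "\<exists>w'. ec_add E0 (Affine u w) (Affine u w) = Affine ((u ^ 2 + 1) ^ 2 / (4 * w ^ 2)) w'"
proof -
  define l where "l = (3 * u ^ 2 + 2 * u - 1) / (2 * w)"
  have l: "l * (2 * w) = 3 * u ^ 2 + 2 * u - 1" using w(2) by (simp add: l_def)
  have a: "ec_add E0 (Affine u w) (Affine u w) = Affine (l ^ 2 - 1 - u - u) (- l * (l ^ 2 - 1 - u - u) - (w - l * u))"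
    using w(2) by (simp add: Let_def l_def)
  have "(l ^ 2 - 1 - u - u) * (4 * w ^ 2) = (l * (2 * w)) ^ 2 - 4 * (1 + 2 * u) * w ^ 2" by Groebner_Basis.algebra
  also have "\<dots> = (u ^ 2 + 1) ^ 2" unfolding l w(1) by Groebner_Basis.algebra
  finally have "l ^ 2 - 1 - u - u = (u ^ 2 + 1) ^ 2 / (4 * w ^ 2)" using w(2) by (simp add: nonzero_eq_divide_eq)
  then show ?thesis unfolding a by blast
qed

lemma not_square_5: "r * r \<noteq> (5::rat)"
proof
  assume r: "r * r = 5"
  obtain p q where pq: "quotient_of r = (p, q)" by (cases "quotient_of r") auto
  have rq: "r = of_int p / of_int q" and q: "q > 0" and c: "coprime p q"
    using quotient_of_div[OF pq] quotient_of_denom_pos[OF pq] quotient_of_coprime[OF pq] by auto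
  have "r * of_int q = of_int p" using rq q by simp
  then have "of_int (p * p) = (r * r) * of_int (q * q)" by (simp add: algebra_simps flip: \<open>r * of_int q = of_int p\<close>)
  also have "\<dots> = of_int (5 * (q * q))" unfolding r by simp
  finally have e: "p * p = 5 * (q * q)" by (simp only: of_int_eq_iff)
  have p5: "prime (5::int)" by simp
  have "5 dvd p * p" unfolding e by simp
  then have "5 dvd p" using p5 by (simp add: prime_dvd_mult_iff)
  then obtain k where k: "p = 5 * k" by (elim dvdE)
  have "q * q = 5 * (k * k)" using e unfolding k by simp
  then have "5 dvd q * q" by simp
  then have "5 dvd q" using p5 by (simp add: prime_dvd_mult_iff)
  with \<open>5 dvd p\<close> c have "is_unit (5::int)" by (meson coprime_common_divisor)
  then show False by simp
qed

lemma not_square_minus1: "r * r \<noteq> (- 1::rat)"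
proof -
  have "r * r \<ge> 0" by simp
  then show ?thesis by linarith
qed

text \<open>Generators of the Galois group of a multi-quadratic field: commuting involutions whose
  common fixed field consists of the rational numbers.\<close>

locale mq =
  fixes Sg :: "('k::field_char_0 \<Rightarrow> 'k) set"
  assumes fin: "finite Sg" and endo: "\<sigma> \<in> Sg \<Longrightarrow> field_endo \<sigma>" and inv2: "\<sigma> \<in> Sg \<Longrightarrow> \<sigma> (\<sigma> x) = x"
    and comm: "\<sigma> \<in> Sg \<Longrightarrow> \<tau> \<in> Sg \<Longrightarrow> \<sigma> (\<tau> x) = \<tau> (\<sigma> x)"
    and fixed: "(\<forall>\<sigma>\<in>Sg. \<sigma> x = x) \<Longrightarrow> x \<in> range of_rat"
begin

lemma flip:
  assumes "\<sigma> \<in> Sg" "g * g = of_rat d" "\<sigma> g \<noteq> g" shows "\<sigma> g = - g"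
proof -
  interpret field_endo \<sigma> by (rule endo[OF assms(1)])
  have "\<sigma> g * \<sigma> g = g * g" unfolding s_mult[symmetric] assms(2) s_of_rat ..
  then show ?thesis using assms(3) by (simp add: square_eq_iff)
qed

text \<open>A common automorphism flipping \<open>g\<close> maps \<open>z\<close> to a square root of the conjugate, so the norm
  of \<open>p + q g\<close> has a square root \<open>h = z \<tau> z\<close>; if \<open>h\<close> were irrational, some product of the involutions
  would flip both \<open>g\<close> and \<open>h\<close>.\<close>

lemma norm_square:
  fixes g z :: 'k
  assumes g: "g * g = of_rat d" "\<not> (\<exists>r. r * r = d)" and z: "z * z = of_rat p + of_rat q * g"
  shows "\<exists>r. r * r = p * p - q * q * d"
proof -
  let ?N = "p * p - q * q * d"
  have gQ: "g \<notin> range of_rat"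
  proof
    assume "g \<in> range of_rat"
    then obtain r where "g = of_rat r" by (elim rangeE)
    then have "of_rat (r * r) = (of_rat d :: 'k)" using g(1) by (simp add: of_rat_mult)
    then show False using g(2) by (simp only: of_rat_eq_iff) blast
  qed
  then obtain \<tau> where \<tau>: "\<tau> \<in> Sg" "\<tau> g \<noteq> g" using fixed by blast
  have \<tau>g: "\<tau> g = - g" by (rule flip[OF \<tau>(1) g(1) \<tau>(2)])
  have prod: "(z * \<kappa> z) * (z * \<kappa> z) = of_rat ?N \<and> \<kappa> (z * \<kappa> z) = z * \<kappa> z"
    if k: "field_endo \<kappa>" "\<kappa> (\<kappa> z) = z" "\<kappa> g = - g" for \<kappa>
  proof -
    interpret field_endo \<kappa> by (rule k(1))
    have "\<kappa> z * \<kappa> z = of_rat p - of_rat q * g"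
      unfolding s_mult[symmetric] z unfolding s_add s_mult s_of_rat k(3) by simp
    then have "(z * \<kappa> z) * (z * \<kappa> z) = (of_rat p + of_rat q * g) * (of_rat p - of_rat q * g)"
      unfolding z[symmetric] by (simp add: mult_ac)
    also have "\<dots> = of_rat p * of_rat p - of_rat q * of_rat q * (g * g)" by (simp add: algebra_simps)
    also have "\<dots> = of_rat ?N" unfolding g(1) by (simp add: of_rat_mult of_rat_diff)
    finally show ?thesis unfolding s_mult k(2) by (simp add: mult.commute)
  qed
  define h where "h = z * \<tau> z"
  have h: "h * h = of_rat ?N" "\<tau> h = h" using prod[OF endo[OF \<tau>(1)] inv2[OF \<tau>(1)] \<tau>g] by (simp_all add: h_def)
  have key: "\<kappa> h = h" if k: "field_endo \<kappa>" "\<kappa> (\<kappa> z) = z" "\<kappa> g = - g" for \<kappa>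
  proof -
    interpret field_endo \<kappa> by (rule k(1))
    have p: "(z * \<kappa> z) * (z * \<kappa> z) = h * h" "\<kappa> (z * \<kappa> z) = z * \<kappa> z" using prod[OF k] h(1) by simp_all
    have "z * \<kappa> z = h \<or> z * \<kappa> z = - h" using p(1) by (simp add: square_eq_iff)
    then show ?thesis
    proof
      assume "z * \<kappa> z = h" with p(2) show ?thesis by simp
    next
      assume "z * \<kappa> z = - h" with p(2) show ?thesis by (simp add: s_minus)
    qed
  qed
  have "h \<in> range of_rat"
  proof (rule ccontr)
    assume "h \<notin> range of_rat"
    then obtain \<rho> where \<rho>: "\<rho> \<in> Sg" "\<rho> h \<noteq> h" using fixed by blast
    have \<rho>h: "\<rho> h = - h" by (rule flip[OF \<rho>(1) h(1) \<rho>(2)])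
    show False
    proof (cases "\<rho> g = g")
      case False
      have "\<rho> g = - g" by (rule flip[OF \<rho>(1) g(1) False])
      then show False using key[OF endo[OF \<rho>(1)] inv2[OF \<rho>(1)]] \<rho>(2) by blast
    next
      case True
      interpret t: field_endo \<tau> by (rule endo[OF \<tau>(1)])
      interpret r: field_endo \<rho> by (rule endo[OF \<rho>(1)])
      have "field_endo (\<lambda>x. \<tau> (\<rho> x))"
        by unfold_locales (simp_all add: t.s_simps r.s_simps)
      moreover have "\<tau> (\<rho> (\<tau> (\<rho> z))) = z"
        by (simp add: comm[OF \<rho>(1) \<tau>(1)] inv2 \<tau>(1) \<rho>(1))
      moreover have "\<tau> (\<rho> g) = - g" unfolding True by (rule \<tau>g)
      ultimately have "\<tau> (\<rho> h) = h" by (rule key)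
      then have "- h = h" unfolding \<rho>h t.s_minus h(2) .
      then show False using \<rho>h \<rho>(2) by simp
    qed
  qed
  then obtain r where "h = of_rat r" by (elim rangeE)
  then have "of_rat (r * r) = (of_rat ?N :: 'k)" using h(1) by (simp add: of_rat_mult)
  then have "r * r = ?N" by (simp only: of_rat_eq_iff)
  then show ?thesis by blast
qed

text \<open>Let \<open>x\<close> be the abscissa of the double. A cusp value of \<open>x\<close>
  either forces \<open>u\<close> to be a cusp, or makes a square in \<open>K\<close> out of an
  element of norm 5 from \<open>\<rat>(i)\<close> or of norm -1 from the field of the square root of
  5. By \<open>norm_square\<close> such a norm would be the square of a rational number.\<close>

lemma halving:
  fixes u w :: 'k
  assumes on: "w ^ 2 = u ^ 3 + u ^ 2 - u" and nc: "noncusp u"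
  shows "\<exists>u' w'. ec_add E0 (Affine u w) (Affine u w) = Affine u' w' \<and> noncusp u'"
proof -
  have u: "u \<noteq> 0" "u \<noteq> 1" "u \<noteq> - 1" "u ^ 2 + u - 1 \<noteq> 0" "u ^ 2 - 4 * u - 1 \<noteq> 0"
    using nc by (simp_all add: noncusp_def)
  have "w ^ 2 = u * (u ^ 2 + u - 1)" unfolding on by Groebner_Basis.algebra
  then have w: "w \<noteq> 0" using u by auto
  define x where "x = (u ^ 2 + 1) ^ 2 / (4 * w ^ 2)"
  define z where "z = (u ^ 2 + 1) / (2 * w)"
  have xz: "z * z = x" using w by (simp add: x_def z_def power2_eq_square)
  have xw: "x * (4 * (u ^ 3 + u ^ 2 - u)) = (u ^ 2 + 1) ^ 2" using w unfolding on[symmetric] x_def by simp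
  have i1: "\<not> (\<exists>r. r * r = (- 1::rat))" and i5: "\<not> (\<exists>r. r * r = (5::rat))"
    using not_square_minus1 not_square_5 by blast+
  have c5: "of_rat 5 = (5 :: 'k)" and c1: "of_rat (- 1) = (- 1 :: 'k)" and c2: "of_rat 2 = (2 :: 'k)"
    by (simp_all add: of_rat_minus)
  have "noncusp x"
    unfolding noncusp_def
  proof (intro conjI notI)
    \<comment> \<open>Here \<open>u\<close> is a square root \<open>i\<close> of -1, and
      \<open>w^2 = - 1 - 2 i\<close> has norm 5.\<close>
    assume "x = 0"
    then have "u ^ 2 + 1 = 0" using xw by simp
    then have uu: "u * u = - 1" by (simp add: power2_eq_square eq_neg_iff_add_eq_0)
    have "w * w = - 1 + (- 2) * u" using on uu by Groebner_Basis.algebra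
    then have z: "w * w = of_rat (- 1) + of_rat (- 2) * u" by (simp add: of_rat_minus)
    show False using norm_square[OF uu[folded c1] i1 z] i5 by simp
  next
    \<comment> \<open>The equation for \<open>u\<close> factors into cusp conditions.\<close>
    assume "x = 1"
    then have "(u - 1) * (u + 1) * (u ^ 2 - 4 * u - 1) = 0" using xw by Groebner_Basis.algebra
    then show False using u by (auto simp: eq_neg_iff_add_eq_0)
  next
    \<comment> \<open>The equation for \<open>u\<close> says that \<open>g\<close> is a square root
      of -1. Since \<open>u^2 + (2 - 2 g) u - 1 = 0\<close>, completing the square shows that
      \<open>1 - 2 g\<close>, of norm 5, is a square.\<close>
    assume "x = - 1"
    define g where "g = (u ^ 2 + 2 * u - 1) / (2 * u)"
    have gu: "g * (2 * u) = u ^ 2 + 2 * u - 1" using u by (simp add: g_def)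
    have "(u ^ 2 + 2 * u - 1) ^ 2 + 4 * u ^ 2 = 0" using xw \<open>x = - 1\<close> by Groebner_Basis.algebra
    then have "(g * g + 1) * (4 * u ^ 2) = 0" unfolding gu[symmetric] by Groebner_Basis.algebra
    then have "g * g + 1 = 0" using u by simp
    then have gg: "g * g = - 1" by (simp add: eq_neg_iff_add_eq_0)
    have "(u + 1 - g) * (u + 1 - g) = 1 + (- 2) * g" using gg gu by Groebner_Basis.algebra
    then have z: "(u + 1 - g) * (u + 1 - g) = of_rat 1 + of_rat (- 2) * g" by (simp add: of_rat_minus)
    show False using norm_square[OF gg[folded c1] i1 z] i5 by simp
  next
    \<comment> \<open>In this case and in the next, \<open>x\<close> itself has norm -1 over the
      rational numbers, and it is the square of \<open>z\<close> by the duplication formula.\<close>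
    assume "x ^ 2 + x - 1 = 0"
    then have gg: "(2 * x + 1) * (2 * x + 1) = 5" by Groebner_Basis.algebra
    have h: "of_rat (1 / 2) = (1 / 2 :: 'k)" "of_rat (- 1 / 2) = (- 1 / 2 :: 'k)" by (simp_all add: of_rat_divide of_rat_minus)
    have z: "z * z = of_rat (- 1 / 2) + of_rat (1 / 2) * (2 * x + 1)" unfolding xz h by (simp add: field_simps)
    have "\<exists>r. r * r = (- 1 / 2) * (- 1 / 2) - 1 / 2 * (1 / 2) * (5 :: rat)"
      by (rule norm_square[OF gg[folded c5] i5 z])
    then show False using i1 by simp
  next
    assume "x ^ 2 - 4 * x - 1 = 0"
    then have gg: "(x - 2) * (x - 2) = 5" by Groebner_Basis.algebra
    have z: "z * z = of_rat 2 + of_rat 1 * (x - 2)" unfolding xz by simp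
    show False using norm_square[OF gg[folded c5] i5 z] i1 by simp
  qed
  then show ?thesis using E0_double[OF on w] unfolding x_def[symmetric] by blast
qed

end

section \<open>Heights and torsion points with rational abscissa\<close>

text \<open>Bounds the cancellation in the duplication formula for the abscissa
  \<open>p / q\<close>. A common divisor is prime to \<open>p\<close> and \<open>q\<close>, hence
  divides \<open>4 * L\<close>; eliminating \<open>p\<close> between the numerator and
  \<open>L\<close> leaves \<open>20 q^3 (q - p)\<close>, and then \<open>20 q^2\<close>.\<close>

lemma gcd_double:
  fixes p q d :: int
  assumes c: "coprime p q" and F: "d dvd (p ^ 2 + q ^ 2) ^ 2" and G: "d dvd 4 * (p * q * (p ^ 2 + p * q - q ^ 2))"
  shows "d dvd 20"
proof -
  have cp: "coprime ((a ^ 2 + b ^ 2) ^ 2) a" if "coprime a b" for a b :: int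
  proof -
    have "coprime (a ^ 2 + b ^ 2) a"
    proof (rule coprimeI)
      fix e assume e: "e dvd a ^ 2 + b ^ 2" "e dvd a"
      then have "e dvd (a ^ 2 + b ^ 2) - a * a" by (intro dvd_diff) auto
      then have "e dvd b ^ 2" by (simp add: power2_eq_square)
      moreover have "coprime a (b ^ 2)" using that by simp
      ultimately show "is_unit e" using e(2) coprime_common_divisor by blast
    qed
    then show ?thesis by simp
  qed
  have dp: "coprime d p" by (rule coprime_divisors[OF F dvd_refl cp[OF c]])
  have "d dvd (q ^ 2 + p ^ 2) ^ 2" using F by (simp add: add.commute)
  then have dq: "coprime d q" by (rule coprime_divisors[OF _ dvd_refl cp]) (use c in \<open>simp add: coprime_commute\<close>)
  define L where "L = p ^ 2 + p * q - q ^ 2"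
  have "d dvd p * (q * (4 * L))" using G by (simp add: L_def mult_ac)
  then have L: "d dvd 4 * L" using dp dq by (simp add: coprime_dvd_mult_right_iff)
  have "q * (q * (q * (20 * (q - p)))) = 4 * (p ^ 2 + q ^ 2) ^ 2 - 4 * L * (p ^ 2 - p * q + 4 * q ^ 2)"
    unfolding L_def by Groebner_Basis.algebra
  also have "d dvd \<dots>" using F L by (intro dvd_diff) auto
  finally have qp: "d dvd 20 * (q - p)" using dq by (simp only: coprime_dvd_mult_right_iff)
  have "q * (q * 20) = 5 * (4 * L) + 20 * (q - p) * (p + 2 * q)" unfolding L_def by Groebner_Basis.algebra
  also have "d dvd \<dots>" by (rule dvd_add[OF dvd_mult[OF L] dvd_mult2[OF qp]])
  finally show ?thesis using dq by (simp only: coprime_dvd_mult_right_iff)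
qed

text \<open>The naive height without logarithm; it is 1 exactly for 0, 1 and -1.\<close>

definition ht :: "rat \<Rightarrow> int" where
  "ht r = max \<bar>fst (quotient_of r)\<bar> (snd (quotient_of r))"

text \<open>Before cancellation the numerator \<open>F\<close> is at least \<open>H^4\<close>, where
  \<open>H\<close> is the height, and at most 20 cancels. For \<open>H \<ge> 3\<close> this
  suffices, since \<open>H^4 \<ge> 27 H\<close>.\<close>

lemma ht_double:
  assumes h: "ht r \<ge> 2"
  shows "r ^ 3 + r ^ 2 - r \<noteq> 0" "ht ((r ^ 2 + 1) ^ 2 / (4 * (r ^ 3 + r ^ 2 - r))) > ht r"
proof -
  obtain p q where pq: "quotient_of r = (p, q)" by (cases "quotient_of r") auto
  have rq: "r = of_int p / of_int q" and q: "q > 0" and c: "coprime p q"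
    using quotient_of_div[OF pq] quotient_of_denom_pos[OF pq] quotient_of_coprime[OF pq] by auto
  have hr: "ht r = max \<bar>p\<bar> q" by (simp add: ht_def pq)
  have r0: "r \<noteq> 0" using h by (auto simp: ht_def)
  show nz: "r ^ 3 + r ^ 2 - r \<noteq> 0"
  proof
    assume "r ^ 3 + r ^ 2 - r = 0"
    then have "r * (r ^ 2 + r - 1) = 0" by Groebner_Basis.algebra
    then have "r ^ 2 + r - 1 = 0" using r0 by simp
    then have "(2 * r + 1) * (2 * r + 1) = 5" by Groebner_Basis.algebra
    then show False using not_square_5 by blast
  qed
  define r' where "r' = (r ^ 2 + 1) ^ 2 / (4 * (r ^ 3 + r ^ 2 - r))"
  define F G where "F = (p ^ 2 + q ^ 2) ^ 2" and "G = 4 * (p * q * (p ^ 2 + p * q - q ^ 2))"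
  have rp: "of_int p = r * of_int q" using rq q by simp
  have r'nz: "r' * (4 * (r ^ 3 + r ^ 2 - r)) = (r ^ 2 + 1) ^ 2" using nz by (simp add: r'_def)
  have "r' * of_int G = of_int q ^ 4 * (r' * (4 * (r ^ 3 + r ^ 2 - r)))"
    unfolding G_def by (simp only: of_int_mult of_int_add of_int_diff of_int_power of_int_numeral rp) Groebner_Basis.algebra
  also have "\<dots> = of_int F"
    unfolding F_def r'nz by (simp only: of_int_mult of_int_add of_int_diff of_int_power of_int_numeral rp) Groebner_Basis.algebra
  finally have r'G: "r' * of_int G = of_int F" .
  obtain p' q' where pq': "quotient_of r' = (p', q')" by (cases "quotient_of r'") auto
  have rq': "r' = of_int p' / of_int q'" and q': "q' > 0" and c': "coprime p' q'"
    using quotient_of_div[OF pq'] quotient_of_denom_pos[OF pq'] quotient_of_coprime[OF pq'] by auto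
  have "of_int p' = r' * of_int q'" using rq' q' by simp
  then have "of_int (p' * G) = (r' * of_int G) * of_int q'" by simp
  also have "\<dots> = of_int (F * q')" unfolding r'G by simp
  finally have e: "p' * G = F * q'" by (simp only: of_int_eq_iff)
  have "p' dvd F * q'" unfolding e[symmetric] by simp
  then have "p' dvd F" using c' by (simp add: coprime_dvd_mult_left_iff)
  then obtain d where d: "F = p' * d" by (elim dvdE)
  have F0: "F > 0"
  proof -
    have "q ^ 2 > 0" using q by simp
    then have "p ^ 2 + q ^ 2 \<noteq> 0" by (smt (verit) zero_le_power2)
    then show ?thesis unfolding F_def by (rule iffD2[OF zero_less_power2])
  qed
  then have p'0: "p' \<noteq> 0" using d by auto
  have "p' * G = p' * (d * q')" using e unfolding d by (simp add: mult_ac)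
  then have "G = d * q'" using p'0 by simp
  then have dG: "d dvd G" by simp
  have dF: "d dvd F" unfolding d by simp
  have d20: "d dvd 20" by (rule gcd_double[OF c dF[unfolded F_def] dG[unfolded G_def]])
  have "\<bar>p'\<bar> > ht r"
  proof (cases "ht r = 2")
    case True
    \<comment> \<open>For height 2 the general bound is too weak, but then \<open>F = 25\<close>, so
      that at most 5 cancels.\<close>
    have bd: "\<bar>p\<bar> \<le> 2" "q \<le> 2" using True unfolding hr by auto
    have "p = - 2 \<or> p = - 1 \<or> p = 0 \<or> p = 1 \<or> p = 2" "q = 1 \<or> q = 2" using bd q by auto
    then have F25: "F = 25" using c True unfolding hr F_def by auto
    have "d dvd 25" using dF F25 by simp
    then have "d dvd 25 - 20" using d20 by (rule dvd_diff)
    then have "d dvd 5" by simp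
    then have "\<bar>d\<bar> \<le> 5" using dvd_imp_le_int[of 5 d] by simp
    moreover have "\<bar>p'\<bar> * \<bar>d\<bar> = 25" using d F25 by (simp flip: abs_mult)
    moreover have "\<bar>p'\<bar> * \<bar>d\<bar> \<le> \<bar>p'\<bar> * 5" by (rule mult_left_mono[OF \<open>\<bar>d\<bar> \<le> 5\<close>]) simp
    ultimately have "25 \<le> \<bar>p'\<bar> * 5" by simp
    then show ?thesis unfolding True by simp
  next
    case False
    define H where "H = ht r"
    have H3: "H \<ge> 3" using h False by (simp add: H_def)
    have "H ^ 2 \<le> p ^ 2 + q ^ 2"
    proof (cases "\<bar>p\<bar> \<ge> q")
      case True
      then have "H ^ 2 = p ^ 2" unfolding H_def hr by simp
      then show ?thesis by simp
    next
      case False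
      then have "H = q" unfolding H_def hr by simp
      then show ?thesis by simp
    qed
    then have "(H ^ 2) ^ 2 \<le> F" unfolding F_def by (intro power_mono) auto
    moreover have "(H ^ 2) ^ 2 = H ^ 3 * H" by (simp add: numeral_eq_Suc)
    moreover have "3 ^ 3 \<le> H ^ 3" using H3 by (intro power_mono) auto
    then have "27 * H \<le> H ^ 3 * H" using H3 by (intro mult_right_mono) auto
    ultimately have 1: "27 * H \<le> F" by linarith
    have "\<bar>d\<bar> \<le> 20" using dvd_imp_le_int[of 20 d] d20 by simp
    moreover have "F = \<bar>p'\<bar> * \<bar>d\<bar>" using d F0 by (simp flip: abs_mult)
    ultimately have "F \<le> \<bar>p'\<bar> * 20" by (simp add: mult_left_mono)
    then show ?thesis using 1 H3 unfolding H_def[symmetric] by linarith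
  qed
  moreover have "ht r' = max \<bar>p'\<bar> q'" by (simp add: ht_def pq')
  ultimately show "ht ((r ^ 2 + 1) ^ 2 / (4 * (r ^ 3 + r ^ 2 - r))) > ht r" unfolding r'_def[symmetric] by simp
qed

text \<open>A subgroup of order 3.\<close>

abbreviation C3 :: "'a::field_char_0 ec_point set" where "C3 \<equiv> {Infinity, Affine 1 1, Affine 1 (- 1)}"

lemma C3_closed: "P \<in> C3 \<Longrightarrow> Q \<in> C3 \<Longrightarrow> ec_add E0 P Q \<in> C3"
  by (auto simp: Let_def)

text \<open>Only finitely many rational abscissae occur among the multiples of \<open>P\<close>. One
  of maximal height has height 1, as doubling would increase a larger one. So the abscissa of
  \<open>P\<close> is -1, 0 or 1, and doubling leads to the abscissa 1 or to infinity.\<close>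

lemma rational_torsion:
  fixes r0 :: rat and w0 :: "'k::field_char_0"
  defines "M \<equiv> mordell_weil (E0 :: 'k weierstrass)" and "P \<equiv> Affine (of_rat r0) w0"
  assumes P: "P \<in> carrier M" and N: "N > 0" "P [^]\<^bsub>M\<^esub> (N::nat) = \<one>\<^bsub>M\<^esub>"
  shows "P [^]\<^bsub>M\<^esub> (2::nat) \<in> C3"
proof -
  interpret M: comm_group M unfolding M_def by (rule elliptic_group[OF E0_elliptic])
  have M1: "\<one>\<^bsub>M\<^esub> = Infinity" and Mm: "monoid.mult M = ec_add E0" and Mc: "carrier M = {P. on_curve E0 P}"
    unfolding M_def by (simp_all only: mw_sel)
  have on: "w ^ 2 = u ^ 3 + u ^ 2 - u" if "Affine u w \<in> carrier M" for u w using that by (simp add: Mc)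
  have dbl: "S [^]\<^bsub>M\<^esub> (2::nat) = ec_add E0 S S" if "S \<in> carrier M" for S
    using that unfolding numeral_2_eq_2 M.nat_pow_Suc M.nat_pow_0 by (simp add: Mm M1)
  let ?T = "\<lambda>n::nat. {r. \<exists>w. P [^]\<^bsub>M\<^esub> n = Affine (of_rat r) w}"
  define S where "S = (\<Union>n. ?T n)"
  have fT: "finite (?T n)" for n
  proof (cases "?T n = {}")
    case False
    then obtain r w where "P [^]\<^bsub>M\<^esub> n = Affine (of_rat r) w" by blast
    then have "?T n \<subseteq> {r}" by auto
    then show ?thesis by (rule finite_subset) simp
  qed simp
  have "S \<subseteq> (\<Union>n<N. ?T n)"
  proof
    fix r assume "r \<in> S"
    then obtain n w where n: "P [^]\<^bsub>M\<^esub> (n::nat) = Affine (of_rat r) w" unfolding S_def by blast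
    have "P [^]\<^bsub>M\<^esub> n = P [^]\<^bsub>M\<^esub> (N * (n div N) + n mod N)" by simp
    also have "\<dots> = (P [^]\<^bsub>M\<^esub> N) [^]\<^bsub>M\<^esub> (n div N) \<otimes>\<^bsub>M\<^esub> P [^]\<^bsub>M\<^esub> (n mod N)"
      unfolding M.nat_pow_mult[OF P, symmetric] M.nat_pow_pow[OF P] ..
    also have "\<dots> = P [^]\<^bsub>M\<^esub> (n mod N)" unfolding N(2) using P by simp
    finally have e: "P [^]\<^bsub>M\<^esub> n = P [^]\<^bsub>M\<^esub> (n mod N)" .
    have "P [^]\<^bsub>M\<^esub> (n mod N) = Affine (of_rat r) w" by (rule HOL.trans[OF e[symmetric] n])
    then have "r \<in> ?T (n mod N)" by blast
    then show "r \<in> (\<Union>n<N. ?T n)" using N(1) by (intro UN_I[of "n mod N"]) auto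
  qed
  then have fS: "finite S" by (rule finite_subset) (intro finite_UN_I finite_lessThan fT)
  have r0S: "r0 \<in> S"
  proof -
    have "P [^]\<^bsub>M\<^esub> (1::nat) = Affine (of_rat r0) w0" using P by (simp add: P_def)
    then show ?thesis unfolding S_def by blast
  qed
  have "Max (ht ` S) \<in> ht ` S" using fS r0S by (intro Max_in) auto
  then obtain r where r: "r \<in> S" "ht r = Max (ht ` S)" by auto
  have mx: "ht r' \<le> ht r" if "r' \<in> S" for r' unfolding r(2) using fS that by simp
  have "ht r < 2"
  proof (rule ccontr)
    assume "\<not> ht r < 2"
    then have h: "ht r \<ge> 2" by simp
    obtain n w where n: "P [^]\<^bsub>M\<^esub> (n::nat) = Affine (of_rat r) w" using r(1) unfolding S_def by blast
    have A: "Affine (of_rat r) w \<in> carrier M" unfolding n[symmetric] using P by simp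
    define r' where "r' = (r ^ 2 + 1) ^ 2 / (4 * (r ^ 3 + r ^ 2 - r))"
    have ow: "w ^ 2 = of_rat (r ^ 3 + r ^ 2 - r)"
      using on[OF A] by (simp add: of_rat_add of_rat_diff of_rat_power)
    then have w0: "w \<noteq> 0" using ht_double(1)[OF h] by auto
    have w4: "4 * w ^ 2 = of_rat (4 * (r ^ 3 + r ^ 2 - r))" unfolding ow of_rat_mult of_rat_numeral_eq ..
    have n4: "(of_rat r ^ 2 + 1) ^ 2 = (of_rat ((r ^ 2 + 1) ^ 2) :: 'k)" by (simp only: of_rat_add of_rat_power of_rat_1)
    have x: "(of_rat r ^ 2 + 1) ^ 2 / (4 * w ^ 2) = of_rat r'"
      unfolding w4 n4 r'_def of_rat_divide ..
    obtain w' where "ec_add E0 (Affine (of_rat r) w) (Affine (of_rat r) w) = Affine (of_rat r') w'"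
      using E0_double[OF on[OF A] w0] unfolding x by (elim exE)
    then have "P [^]\<^bsub>M\<^esub> (n * 2) = Affine (of_rat r') w'"
      unfolding M.nat_pow_pow[OF P, symmetric] n dbl[OF A] .
    then have "r' \<in> S" unfolding S_def by blast
    then show False using mx ht_double(2)[OF h] unfolding r'_def by fastforce
  qed
  then have h: "ht r0 < 2" using mx[OF r0S] by simp
  obtain p q where pq: "quotient_of r0 = (p, q)" by (cases "quotient_of r0") auto
  have rq: "r0 = of_int p / of_int q" and q: "q > 0"
    using quotient_of_div[OF pq] quotient_of_denom_pos[OF pq] by auto
  have "q = 1" "p = - 1 \<or> p = 0 \<or> p = 1" using h q by (auto simp: ht_def pq)
  then have r0: "r0 = - 1 \<or> r0 = 0 \<or> r0 = 1" using rq by auto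
  have w0: "w0 ^ 2 = of_rat r0 ^ 3 + of_rat r0 ^ 2 - of_rat r0" using on P by (simp add: P_def)
  show ?thesis
  proof (cases "r0 = 0")
    case True
    then have "w0 = 0" using w0 by simp
    then show ?thesis unfolding dbl[OF P] by (simp add: P_def True)
  next
    case False
    then have u: "of_rat r0 = (- 1 :: 'k) \<or> of_rat r0 = (1 :: 'k)" using r0 by (auto simp: of_rat_minus)
    then have w1: "w0 ^ 2 = 1" and u2: "(of_rat r0 :: 'k) ^ 2 = 1" unfolding w0 by auto
    then have "w0 \<noteq> 0" by auto
    from E0_double[OF w0 this] obtain w' where w': "ec_add E0 P P = Affine ((1 + 1) ^ 2 / (4 * 1)) w'"
      unfolding w1 u2 P_def by (elim exE)
    then have e: "ec_add E0 P P = Affine 1 w'" by simp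
    have "P [^]\<^bsub>M\<^esub> (2::nat) \<in> carrier M" using P by simp
    then have "w' ^ 2 = 1" unfolding dbl[OF P] e using on[of 1 w'] by simp
    then show ?thesis unfolding dbl[OF P] e by (simp add: power2_eq_1_iff)
  qed
qed

section \<open>Torsion over a multi-quadratic field\<close>

context mq
begin

text \<open>Induction on the set \<open>J\<close> of involutions that may send \<open>P\<close>
  elsewhere than to \<open>P\<close> or its inverse. For \<open>\<tau>\<close> in \<open>J\<close>
  the point \<open>A = P + \<tau> P\<close> is fixed by \<open>\<tau>\<close> and
  \<open>B = P - \<tau> P\<close> is negated. Since the involutions commute, those that were fine
  for \<open>P\<close> remain so for \<open>A\<close> and \<open>B\<close>; and
  \<open>A + B = 2 P\<close>. If \<open>J\<close> is empty, the abscissa is fixed by all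
  involutions, hence rational.\<close>

lemma torsion_power:
  fixes M defines "M \<equiv> mordell_weil (E0 :: 'k weierstrass)"
  assumes J: "finite J" "J \<subseteq> Sg" and P: "P \<in> carrier M" and N: "N > 0" "P [^]\<^bsub>M\<^esub> (N::nat) = \<one>\<^bsub>M\<^esub>"
    and pm: "\<forall>\<sigma>\<in>Sg - J. map_ec_point \<sigma> P = P \<or> map_ec_point \<sigma> P = inv\<^bsub>M\<^esub> P"
  shows "\<exists>k::nat. P [^]\<^bsub>M\<^esub> ((2::nat) ^ k) \<in> C3"
  using J P N(2) pm
proof (induction J arbitrary: P rule: finite_induct)
  interpret M: comm_group M unfolding M_def by (rule elliptic_group[OF E0_elliptic])
  have M1: "\<one>\<^bsub>M\<^esub> = Infinity" and Mm: "monoid.mult M = ec_add E0" and Mc: "carrier M = {P. on_curve E0 P}"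
    unfolding M_def by (simp_all only: mw_sel)
  {
    case empty
    note P = empty(2)
    show ?case
    proof (cases P)
      case Infinity
      have "P [^]\<^bsub>M\<^esub> ((2::nat) ^ 0) = P" using P by simp
      then have "P [^]\<^bsub>M\<^esub> ((2::nat) ^ 0) \<in> C3" unfolding Infinity by simp
      then show ?thesis ..
    next
      case (Affine u w)
      have on: "w ^ 2 = u ^ 3 + u ^ 2 - u" using P unfolding Mc Affine by simp
      have iP: "inv\<^bsub>M\<^esub> P = Affine u (- w)"
        by (rule M.inv_equality[OF _ P]) (use on in \<open>simp_all add: Affine Mm M1 Mc\<close>)
      have "\<forall>\<sigma>\<in>Sg. \<sigma> u = u" using empty(4) unfolding iP unfolding Affine by auto
      then have "u \<in> range of_rat" by (rule fixed)
      then obtain r where u: "u = of_rat r" by (elim rangeE)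
      have "P [^]\<^bsub>M\<^esub> (2::nat) \<in> C3"
        unfolding Affine u M_def
        by (rule rational_torsion[OF _ N(1)]) (use P empty(3) in \<open>simp_all only: M_def Affine u\<close>)
      then have "P [^]\<^bsub>M\<^esub> ((2::nat) ^ 1) \<in> C3" by simp
      then show ?thesis ..
    qed
  next
    case (insert \<tau> J)
    note P = insert(5)
    have \<tau>: "\<tau> \<in> Sg" and J: "J \<subseteq> Sg" using insert(4) by auto
    let ?h = "map_ec_point :: ('k \<Rightarrow> 'k) \<Rightarrow> _"
    have hom: "group_hom M M (?h \<sigma>)" if s: "\<sigma> \<in> Sg" for \<sigma>
    proof -
      interpret field_endo \<sigma> by (rule endo[OF s])
      have f: "map_weierstrass \<sigma> E0 = E0" by (simp add: s_simps)
      have "?h \<sigma> \<in> hom M M"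
        using s_on_curve[of E0, unfolded f] s_ec_add[of E0, unfolded f] by (intro homI) (auto simp: Mc Mm)
      then show ?thesis by (intro group_hom.intro group_hom_axioms.intro M.is_group)
    qed
    interpret t: group_hom M M "?h \<tau>" by (rule hom[OF \<tau>])
    define A B where "A = P \<otimes>\<^bsub>M\<^esub> ?h \<tau> P" and "B = P \<otimes>\<^bsub>M\<^esub> inv\<^bsub>M\<^esub> (?h \<tau> P)"
    have tP: "?h \<tau> P \<in> carrier M" using P by simp
    have tt: "?h \<tau> (?h \<tau> P) = P" by (cases P) (simp_all add: inv2[OF \<tau>])
    have AB: "A \<in> carrier M" "B \<in> carrier M" using P tP by (simp_all add: A_def B_def)
    have PN: "?h \<tau> P [^]\<^bsub>M\<^esub> N = \<one>\<^bsub>M\<^esub>" using t.hom_nat_pow[OF P, of N] insert(6) by simp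
    have tor: "A [^]\<^bsub>M\<^esub> N = \<one>\<^bsub>M\<^esub>" "B [^]\<^bsub>M\<^esub> N = \<one>\<^bsub>M\<^esub>"
      unfolding A_def B_def using P tP by (simp_all add: M.nat_pow_distrib M.nat_pow_inv PN insert(6))
    have pmA: "?h \<sigma> A = A \<or> ?h \<sigma> A = inv\<^bsub>M\<^esub> A" and pmB: "?h \<sigma> B = B \<or> ?h \<sigma> B = inv\<^bsub>M\<^esub> B"
      if s: "\<sigma> \<in> Sg - J" for \<sigma>
    proof -
      interpret s: group_hom M M "?h \<sigma>" by (rule hom) (use s in blast)
      have "(?h \<sigma> A = A \<or> ?h \<sigma> A = inv\<^bsub>M\<^esub> A) \<and> (?h \<sigma> B = B \<or> ?h \<sigma> B = inv\<^bsub>M\<^esub> B)"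
      proof (cases "\<sigma> = \<tau>")
        case True
        have "?h \<sigma> A = A" unfolding True A_def using P tP by (simp add: tt M.m_comm)
        moreover have "?h \<sigma> B = inv\<^bsub>M\<^esub> B" unfolding True B_def using P tP
          by (simp add: tt M.inv_mult)  (simp add: M.m_comm)
        ultimately show ?thesis by blast
      next
        case False
        then have "\<sigma> \<in> Sg - insert \<tau> J" using s by blast
        then have c: "?h \<sigma> P = P \<or> ?h \<sigma> P = inv\<^bsub>M\<^esub> P" using insert(7) by blast
        have "?h \<sigma> (?h \<tau> P) = ?h \<tau> (?h \<sigma> P)" by (cases P) (use s \<tau> in \<open>auto simp: comm\<close>)
        then have ct: "?h \<sigma> P = P \<and> ?h \<sigma> (?h \<tau> P) = ?h \<tau> P \<or> ?h \<sigma> P = inv\<^bsub>M\<^esub> P \<and> ?h \<sigma> (?h \<tau> P) = inv\<^bsub>M\<^esub> (?h \<tau> P)"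
          using c P by auto
        then show ?thesis
        proof
          assume a: "?h \<sigma> P = P \<and> ?h \<sigma> (?h \<tau> P) = ?h \<tau> P"
          then have "?h \<sigma> A = A" "?h \<sigma> B = B" unfolding A_def B_def using P tP by simp_all
          then show ?thesis by blast
        next
          assume a: "?h \<sigma> P = inv\<^bsub>M\<^esub> P \<and> ?h \<sigma> (?h \<tau> P) = inv\<^bsub>M\<^esub> (?h \<tau> P)"
          then have "?h \<sigma> A = inv\<^bsub>M\<^esub> A" "?h \<sigma> B = inv\<^bsub>M\<^esub> B"
            unfolding A_def B_def using P tP by (simp_all add: M.inv_mult)
          then show ?thesis by blast
        qed
      qed
      then show "?h \<sigma> A = A \<or> ?h \<sigma> A = inv\<^bsub>M\<^esub> A" "?h \<sigma> B = B \<or> ?h \<sigma> B = inv\<^bsub>M\<^esub> B" by blast+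
    qed
    obtain a where a: "A [^]\<^bsub>M\<^esub> ((2::nat) ^ a) \<in> C3" using insert(3)[OF J AB(1) tor(1)] pmA by blast
    obtain b where b: "B [^]\<^bsub>M\<^esub> ((2::nat) ^ b) \<in> C3" using insert(3)[OF J AB(2) tor(2)] pmB by blast
    have pw: "Q [^]\<^bsub>M\<^esub> (n::nat) \<in> C3" if "Q \<in> C3" for Q n
    proof (induction n)
      case 0
      then show ?case by (simp add: M1)
    next
      case (Suc n)
      then show ?case unfolding M.nat_pow_Suc Mm using that by (rule C3_closed)
    qed
    have "A [^]\<^bsub>M\<^esub> ((2::nat) ^ (a + b)) \<in> C3" "B [^]\<^bsub>M\<^esub> ((2::nat) ^ (a + b)) \<in> C3"
      using pw[OF a, of "2 ^ b"] pw[OF b, of "2 ^ a"]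
      unfolding M.nat_pow_pow[OF AB(1)] M.nat_pow_pow[OF AB(2)] by (simp_all only: power_add mult.commute)
    then have "A [^]\<^bsub>M\<^esub> ((2::nat) ^ (a + b)) \<otimes>\<^bsub>M\<^esub> B [^]\<^bsub>M\<^esub> ((2::nat) ^ (a + b)) \<in> C3"
      unfolding Mm by (rule C3_closed)
    moreover have "A \<otimes>\<^bsub>M\<^esub> B = P [^]\<^bsub>M\<^esub> (2::nat)"
    proof -
      have "A \<otimes>\<^bsub>M\<^esub> B = (P \<otimes>\<^bsub>M\<^esub> P) \<otimes>\<^bsub>M\<^esub> (?h \<tau> P \<otimes>\<^bsub>M\<^esub> inv\<^bsub>M\<^esub> (?h \<tau> P))"
        unfolding A_def B_def using P tP M.inv_closed[OF tP] by (simp only: M.m_ac M.m_closed)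
      also have "\<dots> = P [^]\<^bsub>M\<^esub> (2::nat)" using P tP by (simp add: numeral_2_eq_2)
      finally show ?thesis .
    qed
    ultimately have "P [^]\<^bsub>M\<^esub> ((2::nat) * 2 ^ (a + b)) \<in> C3"
      unfolding M.nat_pow_distrib[OF AB, symmetric] M.nat_pow_pow[OF P, symmetric] by simp
    then have "P [^]\<^bsub>M\<^esub> ((2::nat) ^ Suc (a + b)) \<in> C3" by simp
    then show ?case ..
  }
qed

text \<open>By \<open>halving\<close> every \<open>2^k P\<close> is an affine non-cusp; for a
  torsion point one of them would lie in \<open>C3\<close>, whose affine points have the cuspidal
  abscissa 1.\<close>

theorem noncusp_infinite_order:
  fixes M defines "M \<equiv> mordell_weil (E0 :: 'k weierstrass)"
  assumes on: "w ^ 2 = u ^ 3 + u ^ 2 - u" and nc: "noncusp u" and n: "Affine u w [^]\<^bsub>M\<^esub> (n::int) = Infinity"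
  shows "n = 0"
proof (rule ccontr)
  assume n0: "n \<noteq> 0"
  interpret M: comm_group M unfolding M_def by (rule elliptic_group[OF E0_elliptic])
  have M1: "\<one>\<^bsub>M\<^esub> = Infinity" and Mm: "monoid.mult M = ec_add E0" and Mc: "carrier M = {P. on_curve E0 P}"
    unfolding M_def by (simp_all only: mw_sel)
  let ?P = "Affine u w"
  have P: "?P \<in> carrier M" unfolding Mc using on by simp
  have "int (M.ord ?P) dvd n" using n M.int_pow_eq_id[OF P, of n] unfolding M1 by blast
  then have o: "M.ord ?P > 0" using n0 by (metis dvd_0_left_iff gr0I of_nat_0)
  have o1: "?P [^]\<^bsub>M\<^esub> M.ord ?P = \<one>\<^bsub>M\<^esub>" by (rule M.pow_ord_eq_1[OF P])
  have "\<exists>k::nat. ?P [^]\<^bsub>M\<^esub> ((2::nat) ^ k) \<in> C3"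
    by (rule torsion_power[OF fin subset_refl, folded M_def, OF P o o1]) simp
  then obtain k :: nat where k: "?P [^]\<^bsub>M\<^esub> ((2::nat) ^ k) \<in> C3" ..
  have dbl: "S [^]\<^bsub>M\<^esub> (2::nat) = ec_add E0 S S" if "S \<in> carrier M" for S
    using that unfolding numeral_2_eq_2 M.nat_pow_Suc M.nat_pow_0 by (simp add: Mm M1)
  have "\<exists>u' w'. ?P [^]\<^bsub>M\<^esub> ((2::nat) ^ k) = Affine u' w' \<and> noncusp u'" for k :: nat
  proof (induction k)
    case 0
    then show ?case using nc P by simp
  next
    case (Suc k)
    then obtain u' w' where q: "?P [^]\<^bsub>M\<^esub> ((2::nat) ^ k) = Affine u' w'" "noncusp u'" by (elim exE conjE)
    have Q: "Affine u' w' \<in> carrier M" unfolding q(1)[symmetric] using P by simp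
    then have on': "w' ^ 2 = u' ^ 3 + u' ^ 2 - u'" unfolding Mc by simp
    have "?P [^]\<^bsub>M\<^esub> ((2::nat) ^ Suc k) = (?P [^]\<^bsub>M\<^esub> ((2::nat) ^ k)) [^]\<^bsub>M\<^esub> (2::nat)"
      unfolding M.nat_pow_pow[OF P] by (simp add: mult.commute)
    also have "\<dots> = ec_add E0 (Affine u' w') (Affine u' w')"
      unfolding q(1) by (rule dbl[OF Q])
    finally show ?case using halving[OF on' q(2)] by simp
  qed
  from this[of k] k show False by (auto simp: noncusp_def)
qed

end

section \<open>The involutions of a multi-quadratic field\<close>

definition gen :: "'k::field_char_0 set \<Rightarrow> 'k set" where
  "gen S = \<Inter>{K. field_set K \<and> S \<subseteq> K}"

lemma gen_field: "field_set (gen S)"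
  unfolding field_set_def gen_def by (auto intro: field_setD)

lemma gen_incl: "S \<subseteq> gen S" and gen_least: "field_set K \<Longrightarrow> S \<subseteq> K \<Longrightarrow> gen S \<subseteq> K"
  and gen_mono: "S \<subseteq> S' \<Longrightarrow> gen S \<subseteq> gen S'"
  unfolding gen_def by blast+

lemma of_rat_in_field_set:
  assumes "field_set K" shows "of_rat r \<in> K"
proof -
  note D = field_setD[OF assms]
  have n: "of_nat m \<in> K" for m by (induction m) (auto intro: D)
  have i: "of_int m \<in> K" for m by (cases m rule: int_cases2) (auto intro: D n)
  obtain a b :: int where "r = Rat.Fract a b" "b > 0" by (cases r rule: Rat_cases) auto
  then show ?thesis by (simp add: of_rat_rat D(8) i)
qed

lemma gen_empty: "gen {} \<subseteq> range (of_rat :: rat \<Rightarrow> 'k::field_char_0)"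
proof (rule gen_least)
  show "field_set (range (of_rat :: rat \<Rightarrow> 'k))"
    unfolding field_set_def
  proof (intro conjI ballI)
    show "1 \<in> range (of_rat :: rat \<Rightarrow> 'k)" by (rule range_eqI[of _ _ 1]) simp
    fix x :: 'k assume "x \<in> range of_rat"
    then obtain a where a: "x = of_rat a" by (elim rangeE)
    show "- x \<in> range of_rat" unfolding a of_rat_minus[symmetric] by (rule rangeI)
    show "inverse x \<in> range of_rat" unfolding a of_rat_inverse[symmetric] by (rule rangeI)
    fix y :: 'k assume "y \<in> range of_rat"
    then obtain b where b: "y = of_rat b" by (elim rangeE)
    show "x + y \<in> range of_rat" unfolding a b of_rat_add[symmetric] by (rule rangeI)
    show "x * y \<in> range of_rat" unfolding a b of_rat_mult[symmetric] by (rule rangeI)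
  qed
qed simp

definition quad_ext :: "'k::field set \<Rightarrow> 'k \<Rightarrow> 'k set" where
  "quad_ext M s = {a + b * s |a b. a \<in> M \<and> b \<in> M}"

lemma quad_ext_unique:
  assumes M: "field_set M" and s: "s \<notin> M" and ab: "a \<in> M" "b \<in> M" "a' \<in> M" "b' \<in> M" and e: "a + b * s = a' + b' * s"
  shows "a = a' \<and> b = b'"
proof -
  note D = field_setD[OF M]
  have "b = b'"
  proof (rule ccontr)
    assume "b \<noteq> b'"
    then have "b - b' \<noteq> 0" by simp
    moreover have "s * (b - b') = a' - a" using e by (simp add: algebra_simps)
    ultimately have "s = (a' - a) / (b - b')" by (simp add: nonzero_eq_divide_eq)
    then have "s \<in> M" using ab by (simp add: D)
    with s show False by contradiction
  qed
  then show ?thesis using e by simp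
qed

lemma quad_ext_field:
  assumes M: "field_set M" and ss: "s * s \<in> M" and s: "s \<notin> M"
  shows "field_set (quad_ext M s)"
proof -
  note D = field_setD[OF M]
  have I: "a + b * s \<in> quad_ext M s" if "a \<in> M" "b \<in> M" for a b using that unfolding quad_ext_def by blast
  show ?thesis
    unfolding field_set_def
  proof (intro conjI ballI)
    show "1 \<in> quad_ext M s" using I[OF D(1,2)] by simp
    fix x assume "x \<in> quad_ext M s"
    then obtain a b where x: "x = a + b * s" "a \<in> M" "b \<in> M" unfolding quad_ext_def by blast
    show "- x \<in> quad_ext M s" using I[OF D(5)[OF x(2)] D(5)[OF x(3)]] x(1) by simp
    show "inverse x \<in> quad_ext M s"
    proof (cases "x = 0")
      case True
      then show ?thesis using I[OF D(2,2)] by simp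
    next
      case False
      define m where "m = a * a - b * b * (s * s)"
      have mM: "m \<in> M" unfolding m_def by (rule D(7)[OF D(4)[OF x(2,2)] D(4)[OF D(4)[OF x(3,3)] ss]])
      have "a - b * s \<noteq> 0"
      proof
        assume "a - b * s = 0"
        then have "a + (- b) * s = 0 + 0 * s" by simp
        from quad_ext_unique[OF M s x(2) D(5)[OF x(3)] D(2) D(2) this] have "a = 0 \<and> b = 0" by simp
        with False x(1) show False by simp
      qed
      moreover have m: "m = x * (a - b * s)" unfolding m_def x(1) by (simp add: algebra_simps)
      ultimately have m0: "m \<noteq> 0" using False by simp
      have "x * (a / m + (- b / m) * s) = (x * (a - b * s)) / m" by (simp add: diff_divide_distrib right_diff_distrib)
      also have "\<dots> = 1" unfolding m[symmetric] using m0 by simp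
      finally have "inverse x = a / m + (- b / m) * s" by (rule inverse_unique)
      then show ?thesis using I[OF D(8)[OF x(2) mM] D(8)[OF D(5)[OF x(3)] mM]] by simp
    qed
    fix y assume "y \<in> quad_ext M s"
    then obtain c d where y: "y = c + d * s" "c \<in> M" "d \<in> M" unfolding quad_ext_def by blast
    have "x + y = (a + c) + (b + d) * s" unfolding x(1) y(1) by (simp add: algebra_simps)
    then show "x + y \<in> quad_ext M s" using I[OF D(3)[OF x(2) y(2)] D(3)[OF x(3) y(3)]] by simp
    have "x * y = (a * c + b * d * (s * s)) + (a * d + b * c) * s" unfolding x(1) y(1) by (simp add: algebra_simps)
    moreover have "a * c + b * d * (s * s) \<in> M" by (rule D(3)[OF D(4)[OF x(2) y(2)] D(4)[OF D(4)[OF x(3) y(3)] ss]])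
    moreover have "a * d + b * c \<in> M" by (rule D(3)[OF D(4)[OF x(2) y(3)] D(4)[OF x(3) y(2)]])
    ultimately show "x * y \<in> quad_ext M s" using I by simp
  qed
qed

lemma gen_insert:
  assumes ss: "s * s \<in> range of_rat" and s: "s \<notin> gen S"
  shows "gen (insert s S) \<subseteq> quad_ext (gen S) s"
proof (rule gen_least)
  have "s * s \<in> gen S" using ss of_rat_in_field_set[OF gen_field] by auto
  then show "field_set (quad_ext (gen S) s)" using gen_field s by (intro quad_ext_field)
  have I: "a + b * s \<in> quad_ext (gen S) s" if "a \<in> gen S" "b \<in> gen S" for a b using that unfolding quad_ext_def by blast
  note D = field_setD[OF gen_field]
  have "x \<in> quad_ext (gen S) s" if "x \<in> S" for x using I[of x 0] gen_incl[of S] that D(2)[of S] by auto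
  moreover have "s \<in> quad_ext (gen S) s" using I[of 0 1] D(1,2)[of S] by simp
  ultimately show "insert s S \<subseteq> quad_ext (gen S) s" by blast
qed

text \<open>In a generating set \<open>S\<close> of square roots of least cardinality, no
  \<open>s\<close> lies in the field \<open>M s\<close> generated by the others. So the whole field
  is a quadratic extension of \<open>M s\<close>, and its conjugation \<open>f s\<close> changes the
  sign of \<open>s\<close> while fixing the other generators.\<close>

theorem mq_exists_gen:
  fixes S :: "'k::field_char_0 set"
  assumes "finite S" "\<forall>s\<in>S. s * s \<in> range of_rat" "gen S = UNIV"
  shows "\<exists>Sg :: ('k \<Rightarrow> 'k) set. mq Sg"
proof -
  let ?A = "\<lambda>S :: 'k set. finite S \<and> (\<forall>s\<in>S. s * s \<in> range of_rat) \<and> gen S = UNIV"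
  have "?A S" using assms by blast
  from ex_has_least_nat[of ?A, OF this, of card] obtain S
    where S: "finite S" "\<forall>s\<in>S. s * s \<in> range of_rat" "gen S = (UNIV :: 'k set)"
      and min: "\<forall>S'. ?A S' \<longrightarrow> card S \<le> card S'" by blast
  define M where "M s = gen (S - {s})" for s
  have Mf: "field_set (M s)" for s unfolding M_def by (rule gen_field)
  have sM: "s \<notin> M s" if s: "s \<in> S" for s
  proof
    assume "s \<in> M s"
    then have "S \<subseteq> gen (S - {s})" using gen_incl[of "S - {s}"] unfolding M_def by blast
    then have "gen (S - {s}) = UNIV" using gen_least[OF gen_field] S(3) by blast
    then have "?A (S - {s})" using S by auto
    then have "card S \<le> card (S - {s})" using min by blast
    then show False using card_Diff1_less[OF S(1) s] by simp
  qed
  have oM: "t \<in> M s" if "t \<in> S" "t \<noteq> s" for s t using gen_incl[of "S - {s}"] that unfolding M_def by blast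
  have rep: "\<exists>a b. x = a + b * s \<and> a \<in> M s \<and> b \<in> M s" if s: "s \<in> S" for s x
  proof -
    have "insert s (S - {s}) = S" using s by blast
    then have "UNIV \<subseteq> quad_ext (M s) s"
      using gen_insert[of s "S - {s}"] S(2,3) sM[OF s] s unfolding M_def by simp
    then show ?thesis unfolding quad_ext_def by blast
  qed
  define f where "f s x = (SOME y. \<exists>a b. x = a + b * s \<and> a \<in> M s \<and> b \<in> M s \<and> y = a - b * s)" for s x
  have f: "f s (a + b * s) = a - b * s" if s: "s \<in> S" and ab: "a \<in> M s" "b \<in> M s" for s a b
  proof -
    have "\<exists>y. \<exists>c d. a + b * s = c + d * s \<and> c \<in> M s \<and> d \<in> M s \<and> y = c - d * s" using ab by blast
    from someI_ex[OF this] obtain c d where cd: "a + b * s = c + d * s" "c \<in> M s" "d \<in> M s" "f s (a + b * s) = c - d * s"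
      unfolding f_def by blast
    have "a = c \<and> b = d" by (rule quad_ext_unique[OF Mf sM[OF s] ab cd(2,3,1)])
    then show ?thesis using cd(4) by simp
  qed
  have ss: "s * s \<in> M s" if "s \<in> S" for s using S(2) that of_rat_in_field_set[OF Mf] by auto
  have endo: "field_endo (f s)" if s: "s \<in> S" for s
  proof
    note D = field_setD[OF Mf[of s]]
    have "f s (1 + 0 * s) = 1 - 0 * s" by (rule f[OF s D(1,2)])
    then show "f s 1 = 1" by simp
    fix x y
    obtain a b where x: "x = a + b * s" "a \<in> M s" "b \<in> M s" using rep[OF s] by blast
    obtain c d where y: "y = c + d * s" "c \<in> M s" "d \<in> M s" using rep[OF s] by blast
    have "x + y = (a + c) + (b + d) * s" unfolding x(1) y(1) by (simp add: algebra_simps)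
    then have "f s (x + y) = (a + c) - (b + d) * s" using f[OF s D(3)[OF x(2) y(2)] D(3)[OF x(3) y(3)]] by simp
    then show "f s (x + y) = f s x + f s y"
      unfolding x(1) y(1) f[OF s x(2,3)] f[OF s y(2,3)] by (simp add: algebra_simps)
    have m: "a * c + b * d * (s * s) \<in> M s" "a * d + b * c \<in> M s"
      by (rule D(3)[OF D(4)[OF x(2) y(2)] D(4)[OF D(4)[OF x(3) y(3)] ss[OF s]]],
          rule D(3)[OF D(4)[OF x(2) y(3)] D(4)[OF x(3) y(2)]])
    have "x * y = (a * c + b * d * (s * s)) + (a * d + b * c) * s" unfolding x(1) y(1) by (simp add: algebra_simps)
    then have "f s (x * y) = (a * c + b * d * (s * s)) - (a * d + b * c) * s" using f[OF s m] by simp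
    then show "f s (x * y) = f s x * f s y"
      unfolding x(1) y(1) f[OF s x(2,3)] f[OF s y(2,3)] by (simp add: algebra_simps)
  qed
  have fM: "f s x = x" if "s \<in> S" "x \<in> M s" for s x
    using f[OF that field_setD(2)[OF Mf]] by simp
  have fs: "f s s = - s" if "s \<in> S" for s
    using f[OF that field_setD(2,1)[OF Mf[of s]]] by simp
  have "mq (f ` S)"
  proof (rule mq.intro)
    show "finite (f ` S)" using S(1) by simp
    show "field_endo \<sigma>" if "\<sigma> \<in> f ` S" for \<sigma> using that endo by blast
    show "\<sigma> (\<sigma> x) = x" if h: "\<sigma> \<in> f ` S" for \<sigma> x
    proof -
      obtain s where s: "s \<in> S" "\<sigma> = f s" using h by blast
      obtain a b where x: "x = a + b * s" "a \<in> M s" "b \<in> M s" using rep[OF s(1)] by blast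
      have "f s (a + (- b) * s) = a - (- b) * s" by (rule f[OF s(1) x(2) field_setD(5)[OF Mf x(3)]])
      then show ?thesis unfolding s(2) x(1) f[OF s(1) x(2,3)] by simp
    qed
    show "\<sigma> (\<tau> x) = \<tau> (\<sigma> x)" if st: "\<sigma> \<in> f ` S" "\<tau> \<in> f ` S" for \<sigma> \<tau> x
    proof -
      obtain s t where s: "s \<in> S" "\<sigma> = f s" and t: "t \<in> S" "\<tau> = f t" using st by blast
      interpret s: field_endo "f s" by (rule endo[OF s(1)])
      interpret t: field_endo "f t" by (rule endo[OF t(1)])
      let ?K = "{x. f s (f t x) = f t (f s x)}"
      have "field_set ?K" unfolding field_set_def by (simp add: s.s_simps t.s_simps)
      moreover have "S \<subseteq> ?K"
      proof
        fix r assume r: "r \<in> S"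
        have v: "f v r = r \<or> f v r = - r" if "v \<in> S" for v
          using fs fM[OF that oM[OF r]] r by (cases "r = v") auto
        have "f s (f t r) = f t (f s r)"
          using v[OF s(1)] v[OF t(1)] by (auto simp: s.s_minus t.s_minus)
        then show "r \<in> ?K" by simp
      qed
      ultimately have "gen S \<subseteq> ?K" by (rule gen_least)
      then show ?thesis unfolding s(2) t(2) S(3) by blast
    qed
    \<comment> \<open>The generators are removed one at a time: in \<open>x = a + b * s\<close>,
      invariance under \<open>f s\<close> forces \<open>b = 0\<close>.\<close>
    have fixed: "x \<in> range of_rat" if "finite S'" "S' \<subseteq> S" "x \<in> gen S'" "\<forall>s\<in>S'. f s x = x" for S' x
      using that
    proof (induction S' rule: finite_induct)
      case empty
      then show ?case using gen_empty by blast
    next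
      case (insert s S')
      have s: "s \<in> S" and S': "S' \<subseteq> S - {s}" using insert by auto
      have le: "gen S' \<subseteq> M s" unfolding M_def by (rule gen_mono[OF S'])
      then have "s \<notin> gen S'" using sM[OF s] by blast
      then have "x \<in> quad_ext (gen S') s" using gen_insert[of s S'] S(2) s insert(5) by blast
      then obtain a b where x: "x = a + b * s" "a \<in> gen S'" "b \<in> gen S'" unfolding quad_ext_def by blast
      have "f s x = a - b * s" unfolding x(1) by (rule f[OF s]) (use x le in auto)
      moreover have "f s x = x" using insert(6) by simp
      ultimately have "a + b * s = a - b * s" using x(1) by simp
      then have "b * s = - (b * s)" by (metis add_left_cancel diff_conv_add_uminus)
      then have "b * s = 0" by simp
      then have "x = a" using x(1) by simp
      then have "x \<in> gen S'" using x(2) by simp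
      then show ?case using insert(3) S' insert(6) by blast
    qed
    show "x \<in> range of_rat" if "\<forall>\<sigma>\<in>f ` S. \<sigma> x = x" for x
      by (rule fixed[OF S(1) subset_refl]) (use that S(3) in auto)
  qed
  then show ?thesis by blast
qed

text \<open>There is a rational basis consisting of 1 and some \<open>s0\<close>; completing the
  square in the quadratic relation for \<open>s0\<close> yields an \<open>s\<close> with rational
  square.\<close>

lemma quadratic_generator:
  fixes L :: "'k::field_char_0 set"
  assumes L: "quadratic_subfield L"
  shows "\<exists>s. s * s \<in> range of_rat \<and> L \<subseteq> gen {s}"
proof -
  interpret V: vector_space "\<lambda>(q::rat) (x::'k). of_rat q * x"
    by unfold_locales (simp_all add: algebra_simps of_rat_add of_rat_mult)
  have sub: "subfield L ring_of_type_algebra" and dim: "V.dim L = 2"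
    using L unfolding quadratic_subfield_def by auto
  have "subring L ring_of_type_algebra" using sub by (rule subfieldE(1))
  then have L1: "1 \<in> L" and Lm: "\<And>x y. x \<in> L \<Longrightarrow> y \<in> L \<Longrightarrow> x * y \<in> L" unfolding subring_type_iff by blast+
  have "V.independent {1}" by (simp add: V.dependent_single)
  then obtain B where B: "{1} \<subseteq> B" "B \<subseteq> L" "V.independent B" "L \<subseteq> V.span B"
    using V.maximal_independent_subset_extend[of "{1}" L] L1 by blast
  have "card B = 2" using V.basis_card_eq_dim[OF B(2,4,3)] dim by simp
  then obtain x y where xy: "B = {x, y}" "x \<noteq> y" by (auto simp: card_2_iff)
  then obtain s0 where B': "B = {s0, 1}" using B(1) by auto
  have sp: "\<exists>a b. x = of_rat a + of_rat b * s0" if x: "x \<in> L" for x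
  proof -
    have "x \<in> V.span {s0, 1}" using x B(4) B' by blast
    then obtain b where "x - of_rat b * s0 \<in> V.span {1}" unfolding V.span_breakdown_eq by blast
    then obtain a where "x - of_rat b * s0 = of_rat a * 1" unfolding V.span_singleton by blast
    then have "x = of_rat a + of_rat b * s0" by (simp add: diff_eq_eq)
    then show ?thesis by blast
  qed
  have "s0 * s0 \<in> L" using Lm B(2) B' by blast
  from sp[OF this] obtain a b where ab: "s0 * s0 = of_rat a + of_rat b * s0" by blast
  define s where "s = s0 - of_rat (b / 2)"
  have b2: "of_rat b = 2 * (of_rat (b / 2) :: 'k)" by (simp add: of_rat_divide)
  have "s * s = of_rat a + of_rat (b / 2) * of_rat (b / 2)"
    using ab unfolding b2 s_def by Groebner_Basis.algebra
  then have ss: "s * s = of_rat (a + b / 2 * (b / 2))" by (simp only: of_rat_add of_rat_mult)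
  note D = field_setD[OF gen_field[of "{s}"]] and q = of_rat_in_field_set[OF gen_field[of "{s}"]]
  have "s \<in> gen {s}" using gen_incl by blast
  then have "s + of_rat (b / 2) \<in> gen {s}" by (intro D q)
  then have s0: "s0 \<in> gen {s}" by (simp add: s_def)
  have "L \<subseteq> gen {s}"
  proof
    fix x assume "x \<in> L"
    from sp[OF this] obtain c d where "x = of_rat c + of_rat d * s0" by blast
    then show "x \<in> gen {s}" using s0 by (simp add: D q)
  qed
  then show ?thesis using ss by blast
qed

lemma generate_field_least:
  fixes K :: "'k::field set"
  assumes K: "field_set K" and H: "H \<subseteq> K"
  shows "generate_field ring_of_type_algebra H \<subseteq> K"
proof
  interpret R: field "ring_of_type_algebra :: 'k ring" by (rule field_from_type_algebra)
  let ?R = "ring_of_type_algebra :: 'k ring"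
  have neg: "\<ominus>\<^bsub>?R\<^esub> x = - x" for x :: 'k
    by (rule R.minus_equality) (simp_all add: ring_of_type_algebra_def)
  have inv: "inv\<^bsub>?R\<^esub> x = inverse x" if "x \<noteq> 0" for x :: 'k
    by (rule R.comm_inv_char) (use that in \<open>simp_all add: ring_of_type_algebra_def\<close>)
  have zero: "\<zero>\<^bsub>?R\<^esub> = 0" and one: "\<one>\<^bsub>?R\<^esub> = 1" and add: "x \<oplus>\<^bsub>?R\<^esub> y = x + y" and mult: "x \<otimes>\<^bsub>?R\<^esub> y = x * y" for x y :: 'k
    by (simp_all add: ring_of_type_algebra_def)
  fix x assume "x \<in> generate_field ?R H"
  then show "x \<in> K"
    by (induction) (use H in \<open>auto simp: neg inv zero one add mult intro: field_setD[OF K]\<close>)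
qed

theorem mq_exists:
  assumes "multi_quadratic_field TYPE('k::field_char_0)"
  shows "\<exists>Sg :: ('k \<Rightarrow> 'k) set. mq Sg"
proof -
  obtain Ls :: "'k set set" where Ls: "finite Ls" "\<forall>L\<in>Ls. quadratic_subfield L"
     "generate_field ring_of_type_algebra (\<Union>Ls) = UNIV"
    using assms unfolding multi_quadratic_field_def by blast
  have "\<forall>L\<in>Ls. \<exists>s. s * s \<in> range of_rat \<and> L \<subseteq> gen {s}" using Ls(2) quadratic_generator by blast
  then obtain c where c: "\<forall>L\<in>Ls. c L * c L \<in> range of_rat \<and> L \<subseteq> gen {c L}" by (rule bchoice[THEN exE])
  have "\<Union>Ls \<subseteq> gen (c ` Ls)"
  proof
    fix x assume "x \<in> \<Union>Ls"
    then obtain L where L: "L \<in> Ls" "x \<in> L" by blast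
    then have "x \<in> gen {c L}" using c by blast
    moreover have "gen {c L} \<subseteq> gen (c ` Ls)" using L by (intro gen_mono) blast
    ultimately show "x \<in> gen (c ` Ls)" by blast
  qed
  then have "gen (c ` Ls) = UNIV" using generate_field_least[OF gen_field] Ls(3) by blast
  then show ?thesis using Ls(1) c by (intro mq_exists_gen[of "c ` Ls"]) auto
qed

section \<open>The equivalences\<close>

theorem theorem5p9:
  fixes F :: "'k::field_char_0 funs set"
  assumes "multi_quadratic_field TYPE('k)"
    and "is_X1_function_field 2 10 F"
  shows "((\<exists>E :: 'k weierstrass. elliptic E \<and> contains_Z2_Z10 E) \<longleftrightarrow>
          infinite ({E :: 'k weierstrass. elliptic E \<and> contains_Z2_Z10 E} //
                    {(E, E'). weierstrass_iso E E'})) \<and>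
         (infinite ({E :: 'k weierstrass. elliptic E \<and> contains_Z2_Z10 E} //
                    {(E, E'). weierstrass_iso E E'}) \<longleftrightarrow>
          abelian_rank (Pic0 F) \<ge> 1)"
proof -
  obtain u w where ell: "ell u w 1 (- 1) (0 :: 'k)" and F: "F = quad.FF u w"
    by (rule X1_2_10[OF assms(2)])
  interpret ell u w 1 "- 1" "0 :: 'k" by (rule ell)
  obtain Sg :: "('k \<Rightarrow> 'k) set" where "mq Sg" using mq_exists[OF assms(1)] by blast
  then interpret mq Sg .
  have 1: "abelian_rank (Pic0 F) \<ge> 1" if h: "\<exists>E :: 'k weierstrass. elliptic E \<and> contains_Z2_Z10 E"
  proof -
    obtain E :: "'k weierstrass" where E: "elliptic E" "contains_Z2_Z10 E" using h by blast
    obtain x y :: 'k where xy: "y ^ 2 = x ^ 3 + x ^ 2 - x" "noncusp x" by (rule contains_point[OF E])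
    show ?thesis unfolding F
    proof (rule nontorsion_imp_rank)
      show "on_curve E0 (Affine x y)" using xy(1) by simp
      show "n = 0" if "Affine x y [^]\<^bsub>mordell_weil E0\<^esub> n = Infinity" for n :: int
        using xy that by (rule noncusp_infinite_order)
    qed
  qed
  have 2: "infinite ({E :: 'k weierstrass. elliptic E \<and> contains_Z2_Z10 E} // {(E, E'). weierstrass_iso E E'})"
    if "abelian_rank (Pic0 F) \<ge> 1"
    by (rule infinite_classes) (rule rank_imp_infinite[OF that[unfolded F]])
  have 3: "\<exists>E :: 'k weierstrass. elliptic E \<and> contains_Z2_Z10 E"
    if "infinite ({E :: 'k weierstrass. elliptic E \<and> contains_Z2_Z10 E} // {(E, E'). weierstrass_iso E E'})"
  proof (rule ccontr)
    assume "\<not> ?thesis"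
    then have e: "{E :: 'k weierstrass. elliptic E \<and> contains_Z2_Z10 E} = {}" by blast
    show False using that unfolding e by simp
  qed
  show ?thesis using 1 2 3 by blast
qed

end
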